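(* Let $\mathbf{k}$ be a commutative ring with $1$, let $\Gamma$ be a finite digraph with vertex set $V$ whose cycles are pairwise disjoint, and let $M$ be a simple (unital right) $L_{\mathbf{k}}(\Gamma)$-module. (i) If there is a sink $w$ in $\Gamma$ with $Mw\neq 0$, then $V_M=V_{\leadsto w}$ and $$M\cong \frac{wL_{\mathbf{k}}(\Gamma)}{\mathfrak{m}\,wL_{\mathbf{k}}(\Gamma)}\cong wL_{\mathbf{k}/\mathfrak{m}}(\Gamma)$$ for a unique maximal ideal $\mathfrak{m}$ of $\mathbf{k}$. Conversely, $wL_{\mathbf{k}/\mathfrak{m}}(\Gamma)$ is a simple $L_{\mathbf{k}}(\Gamma)$-module for each maximal ideal $\mathfrak{m}$ of $\mathbf{k}$ and each sink $w$ of $\Gamma$. This gives a one-to-one correspondence between the isomorphism classes of simple $L_{\mathbf{k}}(\Gamma)$-modules containing a sink in their support and $$\{\mathfrak{m}\mid \mathfrak{m}\text{ a maximal ideal of }\mathbf{k}\}\times\{w\in V\mid w\text{ a sink}\}.$$ (ii) If $Mw=0$ for every sink $w$ in $\Gamma$, then there is a unique cycle $C$ in $\Gamma$ with $\Gamma_M=\Gamma_{\leadsto C}$ and, with $v:=sC$, $$M\cong \frac{\mathbf{k}[x,x^{-1}]}{\mathfrak{m}}\bigotimes_{\mathbf{k}[x,x^{-1}]} vL_{\mathbf{k}}(\Gamma_{\leadsto C})$$ for a unique maximal ideal $\mathfrak{m}$ of $\mathbf{k}[x,x^{-1}]$. Conversely, $(\mathbf{k}[x,x^{-1}]/\mathfrak{m})\bigotimes_{\mathbf{k}[x,x^{-1}]}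 vL_{\mathbf{k}}(\Gamma_{\leadsto C})$ is a simple $L_{\mathbf{k}}(\Gamma)$-module for each maximal ideal $\mathfrak{m}$ of $\mathbf{k}[x,x^{-1}]$ and each cycle $C$ in $\Gamma$ (with $v=sC$). This gives a one-to-one correspondence between the isomorphism classes of simple $L_{\mathbf{k}}(\Gamma)$-modules not containing a sink in their support and $$\{\mathfrak{m}\mid \mathfrak{m}\text{ a maximal ideal of }\mathbf{k}[x,x^{-1}]\}\times\{C\mid C\text{ a cycle in }\Gamma\}.$$
   Context: A digraph $\Gamma=(V,E,s,t)$ has vertex set $V$, arrow set $E$, and source and target maps $s,t:E\to V$ (written $se$, $te$). A vertex $v$ is a sink if $s^{-1}(v)=\emptyset$. A path is either a vertex $v$ (length $0$, $sv=tv=v$) or a sequence $p=e_1\cdots e_n$ of arrows with $te_i=se_{i+1}$, with $sp=se_1$, $tp=te_n$. A cycle is a path $C=e_1\cdots e_n$, $n>0$, with $sC=tC$ and $se_i\ne se_j$ for $i\neq j$; cycles differing by cyclic rotation are identified, and for each cycle a base vertex on it, denoted $sC$, is fixed. Cycles are pairwise disjoint if distinct cycles share no vertex. $u\leadsto v$ means there is a path from $u$ to $v$. Let $E^*=\{e^*\mid e\in E\}$ with $s(e^* )=te$, $t(e^* )=se$. The Leavitt path algebra $L_{\mathbf{k}}(\Gamma)$ is the $\mathbf{k}$-algebra generated by $V\sqcup E\sqcup E^*$ with relations: (V) $vw=\delta_{v,w}v$ for $v,w\in V$; (E) $s(e)e=e=e\,t(e)$ for $e\in E\sqcup E^*$;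 (CK1) $e^*f=\delta_{e,f}\,t(e)$ for $e,f\in E$; (CK2) $v=\sum_{s(e)=v}ee^*$ for every $v$ with $0<|s^{-1}(v)|<\infty$. For a path $p=e_1\cdots e_n$, $p^*:=e_n^*\cdots e_1^*$. All modules are unital right modules. For a vertex $w$, $V_{\leadsto w}:=\{u\in V\mid u\leadsto w\}$; for a cycle $C$, $V_{\leadsto C}:=V_{\leadsto sC}$, and $\Gamma_{\leadsto C}$ is the full subgraph of $\Gamma$ on $V_{\leadsto C}$ (all arrows with source and target in $V_{\leadsto C}$). The support of $M$ is $V_M:=\{u\in V\mid Mu\neq 0\}$, and $\Gamma_M$ is the full subgraph on $V_M$. $wL_{\mathbf{k}/\mathfrak{m}}(\Gamma)$ is an $L_{\mathbf{k}}(\Gamma)$-module via the natural map $L_{\mathbf{k}}(\Gamma)\to L_{\mathbf{k}/\mathfrak{m}}(\Gamma)$. In (ii), with $v=sC$, $vL_{\mathbf{k}}(\Gamma_{\leadsto C})$ is a left $\mathbf{k}[x,x^{-1}]$-module via the isomorphism $\mathbf{k}[x,x^{-1}]\cong vL_{\mathbf{k}}(\Gamma_{\leadsto C})v$, $x\leftrightarrow C^*$ ($C$ has no exit in $\Gamma_{\leadsto C}$), and it is a right $L_{\mathbf{k}}(\Gamma)$-module via $vL_{\mathbf{k}}(\Gamma_{\leadsto C})\cong vL_{\mathbf{k}}(\Gamma)/vI$, where $I$ is the ideal of $L_{\mathbf{k}}(\Gamma)$ generated by $V\setminus V_{\leadsto C}$ and the isomorphism is induced by $L_{\mathbf{k}}(\Gamma)/I\cong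 L_{\mathbf{k}}(\Gamma_{\leadsto C})$. *)

theory Defs
  imports "HOL-Algebra.QuotRing" "HOL-Algebra.Free_Abelian_Groups" "HOL-Algebra.Generated_Groups" "HOL-Algebra.Module"
    "Graph_Theory.Digraph_Component" "Graph_Theory.Arc_Walk"
begin

section \<open>Algebras given by generators and relations\<close>

text \<open>
  Associative, not necessarily unital algebras over \<^term>\<open>R\<close>: the algebra generated by \<^term>\<open>X\<close>
  with relations \<^term>\<open>\<R>\<close> consists of the terms over \<^term>\<open>X\<close> modulo the least congruence
  that contains \<^term>\<open>\<R>\<close> and the axioms of \<^term>\<open>R\<close>-algebras.
\<close>

datatype (gens: 'x, scals: 'k) alg_term =
    Gen 'x
  | Zero
  | Add "('x, 'k) alg_term" "('x, 'k) alg_term"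
  | Neg "('x, 'k) alg_term"
  | Scal 'k "('x, 'k) alg_term"
  | Times "('x, 'k) alg_term" "('x, 'k) alg_term"

definition alg_terms :: "('k, 'z) ring_scheme \<Rightarrow> 'x set \<Rightarrow> ('x, 'k) alg_term set" where
  "alg_terms R X = {t. gens t \<subseteq> X \<and> scals t \<subseteq> carrier R}"

primrec subst_term :: "('x \<Rightarrow> ('y, 'l) alg_term) \<Rightarrow> ('k \<Rightarrow> 'l) \<Rightarrow> ('x, 'k) alg_term \<Rightarrow> ('y, 'l) alg_term" where
  "subst_term g h (Gen x) = g x"
| "subst_term g h Zero = Zero"
| "subst_term g h (Add s t) = Add (subst_term g h s) (subst_term g h t)"
| "subst_term g h (Neg t) = Neg (subst_term g h t)"
| "subst_term g h (Scal a t) = Scal (h a) (subst_term g h t)"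
| "subst_term g h (Times s t) = Times (subst_term g h s) (subst_term g h t)"

definition sum_term :: "('x, 'k) alg_term list \<Rightarrow> ('x, 'k) alg_term" where
  "sum_term ts = foldr Add ts Zero"

inductive alg_eq ::
  "('k, 'z) ring_scheme \<Rightarrow> 'x set \<Rightarrow> (('x, 'k) alg_term \<times> ('x, 'k) alg_term) set \<Rightarrow>
    ('x, 'k) alg_term \<Rightarrow> ('x, 'k) alg_term \<Rightarrow> bool"
  for R :: "('k, 'z) ring_scheme" (structure) and X \<R> where
  rel: "(s, t) \<in> \<R> \<Longrightarrow> alg_eq R X \<R> s t"
| refl: "t \<in> alg_terms R X \<Longrightarrow> alg_eq R X \<R> t t"
| sym: "alg_eq R X \<R> s t \<Longrightarrow> alg_eq R X \<R> t s"
| trans: "\<lbrakk>alg_eq R X \<R> s t; alg_eq R X \<R> t u\<rbrakk> \<Longrightarrow> alg_eq R X \<R> s u"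
| cong_Add: "\<lbrakk>alg_eq R X \<R> s s'; alg_eq R X \<R> t t'\<rbrakk> \<Longrightarrow> alg_eq R X \<R> (Add s t) (Add s' t')"
| cong_Neg: "alg_eq R X \<R> t t' \<Longrightarrow> alg_eq R X \<R> (Neg t) (Neg t')"
| cong_Scal: "\<lbrakk>a \<in> carrier R; alg_eq R X \<R> t t'\<rbrakk> \<Longrightarrow> alg_eq R X \<R> (Scal a t) (Scal a t')"
| cong_Times: "\<lbrakk>alg_eq R X \<R> s s'; alg_eq R X \<R> t t'\<rbrakk> \<Longrightarrow> alg_eq R X \<R> (Times s t) (Times s' t')"
| Add_assoc: "\<lbrakk>s \<in> alg_terms R X; t \<in> alg_terms R X; u \<in> alg_terms R X\<rbrakk> \<Longrightarrow>
    alg_eq R X \<R> (Add (Add s t) u) (Add s (Add t u))"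
| Add_comm: "\<lbrakk>s \<in> alg_terms R X; t \<in> alg_terms R X\<rbrakk> \<Longrightarrow> alg_eq R X \<R> (Add s t) (Add t s)"
| Add_Zero: "t \<in> alg_terms R X \<Longrightarrow> alg_eq R X \<R> (Add t Zero) t"
| Add_Neg: "t \<in> alg_terms R X \<Longrightarrow> alg_eq R X \<R> (Add t (Neg t)) Zero"
| Scal_add: "\<lbrakk>a \<in> carrier R; b \<in> carrier R; t \<in> alg_terms R X\<rbrakk> \<Longrightarrow>
    alg_eq R X \<R> (Scal (a \<oplus> b) t) (Add (Scal a t) (Scal b t))"
| Scal_Add: "\<lbrakk>a \<in> carrier R; s \<in> alg_terms R X; t \<in> alg_terms R X\<rbrakk> \<Longrightarrow>
    alg_eq R X \<R> (Scal a (Add s t)) (Add (Scal a s) (Scal a t))"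
| Scal_mult: "\<lbrakk>a \<in> carrier R; b \<in> carrier R; t \<in> alg_terms R X\<rbrakk> \<Longrightarrow>
    alg_eq R X \<R> (Scal (a \<otimes> b) t) (Scal a (Scal b t))"
| Scal_one: "t \<in> alg_terms R X \<Longrightarrow> alg_eq R X \<R> (Scal \<one> t) t"
| Times_assoc: "\<lbrakk>s \<in> alg_terms R X; t \<in> alg_terms R X; u \<in> alg_terms R X\<rbrakk> \<Longrightarrow>
    alg_eq R X \<R> (Times (Times s t) u) (Times s (Times t u))"
| Times_Add_left: "\<lbrakk>s \<in> alg_terms R X; t \<in> alg_terms R X; u \<in> alg_terms R X\<rbrakk> \<Longrightarrow>
    alg_eq R X \<R> (Times (Add s t) u) (Add (Times s u) (Times t u))"
| Times_Add_right: "\<lbrakk>s \<in> alg_terms R X; t \<in> alg_terms R X; u \<in> alg_terms R X\<rbrakk> \<Longrightarrow>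
    alg_eq R X \<R> (Times s (Add t u)) (Add (Times s t) (Times s u))"
| Scal_Times_left: "\<lbrakk>a \<in> carrier R; s \<in> alg_terms R X; t \<in> alg_terms R X\<rbrakk> \<Longrightarrow>
    alg_eq R X \<R> (Times (Scal a s) t) (Scal a (Times s t))"
| Scal_Times_right: "\<lbrakk>a \<in> carrier R; s \<in> alg_terms R X; t \<in> alg_terms R X\<rbrakk> \<Longrightarrow>
    alg_eq R X \<R> (Times s (Scal a t)) (Scal a (Times s t))"


section \<open>Leavitt path algebras\<close>

datatype ('v, 'e) leavitt_gen = Vertex 'v | Arrow 'e | Ghost 'e

definition leavitt_gens :: "('v, 'e) pre_digraph \<Rightarrow> ('v, 'e) leavitt_gen set" where
  "leavitt_gens G = Vertex ` verts G \<union> Arrow ` arcs G \<union> Ghost ` arcs G"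

inductive_set leavitt_rels ::
  "('v, 'e) pre_digraph \<Rightarrow>
    ((('v, 'e) leavitt_gen, 'k) alg_term \<times> (('v, 'e) leavitt_gen, 'k) alg_term) set"
  for G :: "('v, 'e) pre_digraph" where
  V: "\<lbrakk>v \<in> verts G; w \<in> verts G\<rbrakk> \<Longrightarrow>
    (Times (Gen (Vertex v)) (Gen (Vertex w)), if v = w then Gen (Vertex v) else Zero) \<in> leavitt_rels G"
| E_source: "e \<in> arcs G \<Longrightarrow>
    (Times (Gen (Vertex (tail G e))) (Gen (Arrow e)), Gen (Arrow e)) \<in> leavitt_rels G"
| E_target: "e \<in> arcs G \<Longrightarrow>
    (Times (Gen (Arrow e)) (Gen (Vertex (head G e))), Gen (Arrow e)) \<in> leavitt_rels G"
| E_source_ghost: "e \<in> arcs G \<Longrightarrow>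
    (Times (Gen (Vertex (head G e))) (Gen (Ghost e)), Gen (Ghost e)) \<in> leavitt_rels G"
| E_target_ghost: "e \<in> arcs G \<Longrightarrow>
    (Times (Gen (Ghost e)) (Gen (Vertex (tail G e))), Gen (Ghost e)) \<in> leavitt_rels G"
| CK1: "\<lbrakk>e \<in> arcs G; f \<in> arcs G\<rbrakk> \<Longrightarrow>
    (Times (Gen (Ghost e)) (Gen (Arrow f)), if e = f then Gen (Vertex (head G e)) else Zero) \<in> leavitt_rels G"
| CK2: "\<lbrakk>v \<in> verts G; es \<noteq> []; distinct es; set es = out_arcs G v\<rbrakk> \<Longrightarrow>
    (Gen (Vertex v), sum_term (map (\<lambda>e. Times (Gen (Arrow e)) (Gen (Ghost e))) es)) \<in> leavitt_rels G"

type_synonym ('v, 'e, 'k) leavitt = "(('v, 'e) leavitt_gen, 'k) alg_term set"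

definition leavitt_class ::
  "('k, 'z) ring_scheme \<Rightarrow> ('v, 'e) pre_digraph \<Rightarrow> (('v, 'e) leavitt_gen, 'k) alg_term \<Rightarrow> ('v, 'e, 'k) leavitt" where
  "leavitt_class R G t = {u. alg_eq R (leavitt_gens G) (leavitt_rels G) t u}"

text \<open>
  For a finite vertex set the sum of all vertices is the identity element. The set comprehension
  for \<^const>\<open>one\<close> is its class, written without choosing an enumeration of the vertices.
\<close>

definition leavitt :: "('k, 'z) ring_scheme \<Rightarrow> ('v, 'e) pre_digraph \<Rightarrow> ('k, ('v, 'e, 'k) leavitt) module" where
  "leavitt R G = \<lparr>
     carrier = leavitt_class R G ` alg_terms R (leavitt_gens G),
     monoid.mult = (\<lambda>A B. \<Union>s\<in>A. \<Union>t\<in>B. leavitt_class R G (Times s t)),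
     one = (\<Union>vs\<in>{vs. distinct vs \<and> set vs = verts G}.
       leavitt_class R G (sum_term (map (\<lambda>v. Gen (Vertex v)) vs))),
     ring.zero = leavitt_class R G Zero,
     add = (\<lambda>A B. \<Union>s\<in>A. \<Union>t\<in>B. leavitt_class R G (Add s t)),
     smult = (\<lambda>a A. \<Union>t\<in>A. leavitt_class R G (Scal a t))\<rparr>"

definition lvertex :: "('k, 'z) ring_scheme \<Rightarrow> ('v, 'e) pre_digraph \<Rightarrow> 'v \<Rightarrow> ('v, 'e, 'k) leavitt" where
  "lvertex R G v = leavitt_class R G (Gen (Vertex v))"

definition lpath :: "('k, 'z) ring_scheme \<Rightarrow> ('v, 'e) pre_digraph \<Rightarrow> 'e list \<Rightarrow> ('v, 'e, 'k) leavitt" where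
  "lpath R G p = foldr (monoid.mult (leavitt R G)) (map (\<lambda>e. leavitt_class R G (Gen (Arrow e))) p) \<one>\<^bsub>leavitt R G\<^esub>"

definition lghost_path :: "('k, 'z) ring_scheme \<Rightarrow> ('v, 'e) pre_digraph \<Rightarrow> 'e list \<Rightarrow> ('v, 'e, 'k) leavitt" where
  "lghost_path R G p =
     foldr (monoid.mult (leavitt R G)) (map (\<lambda>e. leavitt_class R G (Gen (Ghost e))) (rev p)) \<one>\<^bsub>leavitt R G\<^esub>"

text \<open>The natural map from the algebra over \<^term>\<open>R\<close> to the one over \<^term>\<open>R Quot \<mm>\<close>.\<close>

definition leavitt_reduce ::
  "('k, 'z) ring_scheme \<Rightarrow> 'k set \<Rightarrow> ('v, 'e) pre_digraph \<Rightarrow> ('v, 'e, 'k) leavitt \<Rightarrow> ('v, 'e, 'k set) leavitt" where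
  "leavitt_reduce R \<mm> G A = (\<Union>t\<in>A. leavitt_class (R Quot \<mm>) G (subst_term Gen (a_r_coset R \<mm>) t))"

text \<open>
  The composite \<open>L(G) \<rightarrow> L(G)/I \<cong> L(G \<restriction> W)\<close>, where \<open>I\<close> is the ideal generated by the vertices
  outside \<^term>\<open>W\<close>: generators of the subgraph are fixed, all others go to zero. It respects
  the relations when \<^term>\<open>W\<close> is closed under predecessors and each vertex of \<^term>\<open>W\<close>
  that emits arrows emits one into \<^term>\<open>W\<close>, as for the predecessors of a vertex on a cycle.
\<close>

definition leavitt_restrict ::
  "('k, 'z) ring_scheme \<Rightarrow> ('v, 'e) pre_digraph \<Rightarrow> 'v set \<Rightarrow> ('v, 'e, 'k) leavitt \<Rightarrow> ('v, 'e, 'k) leavitt" where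
  "leavitt_restrict R G W A =
     (\<Union>t\<in>A. leavitt_class R (G \<restriction> W)
       (subst_term (\<lambda>x. if x \<in> leavitt_gens (G \<restriction> W) then Gen x else Zero) (\<lambda>a. a) t))"


section \<open>Right modules\<close>

text \<open>As in \<^theory>\<open>HOL-Algebra.Module\<close>, the multiplicative part inherited from \<open>ring\<close> is not used.\<close>

record ('a, 'm) rmodule = "'m ring" +
  ract :: "'m \<Rightarrow> 'a \<Rightarrow> 'm"

locale right_module = A?: ring A + M?: abelian_group M
  for A :: "('a, 'y) ring_scheme" (structure) and M :: "('a, 'm, 'z) rmodule_scheme" (structure) +
  assumes ract_closed: "\<lbrakk>x \<in> carrier M; a \<in> carrier A\<rbrakk> \<Longrightarrow> ract M x a \<in> carrier M"
    and ract_l_distr: "\<lbrakk>x \<in> carrier M; y \<in> carrier M; a \<in> carrier A\<rbrakk> \<Longrightarrow>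
      ract M (x \<oplus>\<^bsub>M\<^esub> y) a = ract M x a \<oplus>\<^bsub>M\<^esub> ract M y a"
    and ract_r_distr: "\<lbrakk>x \<in> carrier M; a \<in> carrier A; b \<in> carrier A\<rbrakk> \<Longrightarrow>
      ract M x (a \<oplus>\<^bsub>A\<^esub> b) = ract M x a \<oplus>\<^bsub>M\<^esub> ract M x b"
    and ract_assoc: "\<lbrakk>x \<in> carrier M; a \<in> carrier A; b \<in> carrier A\<rbrakk> \<Longrightarrow>
      ract M x (a \<otimes>\<^bsub>A\<^esub> b) = ract M (ract M x a) b"
    and ract_one: "x \<in> carrier M \<Longrightarrow> ract M x \<one>\<^bsub>A\<^esub> = x"

definition submodule_of :: "('a, 'y) ring_scheme \<Rightarrow> ('a, 'm, 'z) rmodule_scheme \<Rightarrow> 'm set \<Rightarrow> bool" where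
  "submodule_of A M N \<longleftrightarrow> additive_subgroup N M \<and> (\<forall>x\<in>N. \<forall>a\<in>carrier A. ract M x a \<in> N)"

definition simple_right_module :: "('a, 'y) ring_scheme \<Rightarrow> ('a, 'm, 'z) rmodule_scheme \<Rightarrow> bool" where
  "simple_right_module A M \<longleftrightarrow> right_module A M \<and> carrier M \<noteq> {\<zero>\<^bsub>M\<^esub>} \<and>
     (\<forall>N. submodule_of A M N \<longrightarrow> N = {\<zero>\<^bsub>M\<^esub>} \<or> N = carrier M)"

definition rmodule_iso ::
  "('a, 'y) ring_scheme \<Rightarrow> ('a, 'm, 'z) rmodule_scheme \<Rightarrow> ('a, 'n, 'w) rmodule_scheme \<Rightarrow> bool" where
  "rmodule_iso A M N \<longleftrightarrow> (\<exists>f. bij_betw f (carrier M) (carrier N) \<and>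
     (\<forall>x\<in>carrier M. \<forall>y\<in>carrier M. f (x \<oplus>\<^bsub>M\<^esub> y) = f x \<oplus>\<^bsub>N\<^esub> f y) \<and>
     (\<forall>x\<in>carrier M. \<forall>a\<in>carrier A. f (ract M x a) = ract N (f x) a))"

text \<open>The right ideal \<open>wB\<close>, as a right module over a ring acting through a map \<open>h\<close> into \<open>B\<close>.\<close>

definition right_ideal_module ::
  "('b, 'y) ring_scheme \<Rightarrow> ('a \<Rightarrow> 'b) \<Rightarrow> 'b \<Rightarrow> ('a, 'b) rmodule" where
  "right_ideal_module B h w = \<lparr>
     carrier = (\<lambda>x. w \<otimes>\<^bsub>B\<^esub> x) ` carrier B,
     monoid.mult = undefined, one = undefined, ring.zero = \<zero>\<^bsub>B\<^esub>, add = add B,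
     ract = (\<lambda>x a. x \<otimes>\<^bsub>B\<^esub> h a)\<rparr>"

definition quotient_module :: "('a, 'm, 'z) rmodule_scheme \<Rightarrow> 'm set \<Rightarrow> ('a, 'm set) rmodule" where
  "quotient_module M N = \<lparr>
     carrier = a_rcosets\<^bsub>M\<^esub> N,
     monoid.mult = undefined, one = undefined, ring.zero = N, add = set_add M,
     ract = (\<lambda>X a. \<Union>x\<in>X. N +>\<^bsub>M\<^esub> ract M x a)\<rparr>"

record ('s, 'a, 'm) bimodule = "('a, 'm) rmodule" +
  lact :: "'s \<Rightarrow> 'm \<Rightarrow> 'm"

text \<open>
  The balanced tensor product over \<open>S\<close> of a right module with a bimodule whose left scalars
  are \<open>S\<close>: the free abelian group on pairs modulo the usual relations.
\<close>

definition tensor_rels ::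
  "('s, 'y) ring_scheme \<Rightarrow> ('s, 'm, 'z) rmodule_scheme \<Rightarrow> ('s, 'a, 'n, 'w) bimodule_scheme \<Rightarrow>
    ('m \<times> 'n \<Rightarrow>\<^sub>0 int) set" where
  "tensor_rels S M N =
     {frag_of (x \<oplus>\<^bsub>M\<^esub> x', y) - frag_of (x, y) - frag_of (x', y) | x x' y.
        x \<in> carrier M \<and> x' \<in> carrier M \<and> y \<in> carrier N} \<union>
     {frag_of (x, y \<oplus>\<^bsub>N\<^esub> y') - frag_of (x, y) - frag_of (x, y') | x y y'.
        x \<in> carrier M \<and> y \<in> carrier N \<and> y' \<in> carrier N} \<union>
     {frag_of (ract M x s, y) - frag_of (x, lact N s y) | x s y.
        x \<in> carrier M \<and> s \<in> carrier S \<and> y \<in> carrier N}"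

definition tensor_module ::
  "('s, 'y) ring_scheme \<Rightarrow> ('s, 'm, 'z) rmodule_scheme \<Rightarrow> ('s, 'a, 'n, 'w) bimodule_scheme \<Rightarrow>
    ('a, ('m \<times> 'n \<Rightarrow>\<^sub>0 int) set) rmodule" where
  "tensor_module S M N =
     (let F = free_Abelian_group (carrier M \<times> carrier N); K = generate F (tensor_rels S M N)
      in \<lparr>carrier = carrier (F Mod K),
          monoid.mult = undefined, one = undefined, ring.zero = \<one>\<^bsub>F Mod K\<^esub>, add = monoid.mult (F Mod K),
          ract = (\<lambda>X a. \<Union>c\<in>X. K #>\<^bsub>F\<^esub> frag_extend (\<lambda>(x, y). frag_of (x, ract N y a)) c)\<rparr>)"


section \<open>Laurent polynomials\<close>

definition laurent :: "('k, 'z) ring_scheme \<Rightarrow> (int \<Rightarrow> 'k) ring" where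
  "laurent R = \<lparr>
     carrier = {f. (\<forall>i. f i \<in> carrier R) \<and> finite {i. f i \<noteq> \<zero>\<^bsub>R\<^esub>}},
     monoid.mult = (\<lambda>f g n. \<Oplus>\<^bsub>R\<^esub>i\<in>{i. f i \<noteq> \<zero>\<^bsub>R\<^esub>}. f i \<otimes>\<^bsub>R\<^esub> g (n - i)),
     one = (\<lambda>n. if n = 0 then \<one>\<^bsub>R\<^esub> else \<zero>\<^bsub>R\<^esub>),
     ring.zero = (\<lambda>n. \<zero>\<^bsub>R\<^esub>),
     add = (\<lambda>f g n. f n \<oplus>\<^bsub>R\<^esub> g n)\<rparr>"


section \<open>Paths, cycles and supports\<close>

definition is_sink :: "('v, 'e) pre_digraph \<Rightarrow> 'v \<Rightarrow> bool" where
  "is_sink G w \<longleftrightarrow> w \<in> verts G \<and> out_arcs G w = {}"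

definition predecessors :: "('v, 'e) pre_digraph \<Rightarrow> 'v \<Rightarrow> 'v set" where
  "predecessors G w = {u \<in> verts G. \<exists>p. pre_digraph.awalk G u p w}"

text \<open>
  A cycle is a rotation class of arc lists. \<^const>\<open>pre_digraph.cycle\<close> asks for distinct targets
  instead of distinct sources, which for a closed walk is the same.
\<close>

lemma (in pre_digraph) cycle_iff_distinct_sources:
  "cycle p \<longleftrightarrow> p \<noteq> [] \<and> (\<exists>u. awalk u p u) \<and> distinct (map (tail G) p)"
proof -
  have "distinct (tl (awalk_verts u p)) \<longleftrightarrow> distinct (map (tail G) p)"
    if "awalk u p u" "p \<noteq> []" for u
  proof -
    have cas: "cas u p u" using that(1) by (simp add: awalk_def)
    have hd: "tail G (hd p) = u" using cas that(2) by (simp add: cas_simp)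
    have cas_last: "head G (last q) = y" if "cas x q y" "q \<noteq> []" for x q y
      using that by (induction x q y rule: cas.induct) (auto split: if_splits)
    have last: "head G (last p) = u" using cas_last[OF cas that(2)] .
    have 1: "awalk_verts u p = u # map (head G) p"
      using awalk_verts_conv'[OF cas] that(2) hd by simp
    have 2: "awalk_verts u p = map (tail G) p @ [u]"
      using awalk_verts_conv[of u p] that(2) last by simp
    have "mset (tl (awalk_verts u p)) = mset (map (tail G) p)"
      using arg_cong[OF 2, of mset] 1 by simp
    then show ?thesis by (metis mset_eq_imp_distinct_iff)
  qed
  then show ?thesis unfolding cycle_def by auto
qed

definition cycles :: "('v, 'e) pre_digraph \<Rightarrow> 'e list set set" where
  "cycles G = {range (\<lambda>n. rotate n p) | p. pre_digraph.cycle G p}"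

definition cycle_verts :: "('v, 'e) pre_digraph \<Rightarrow> 'e list set \<Rightarrow> 'v set" where
  "cycle_verts G C = {tail G e | e p. p \<in> C \<and> e \<in> set p}"

definition disjoint_cycles :: "('v, 'e) pre_digraph \<Rightarrow> bool" where
  "disjoint_cycles G \<longleftrightarrow> pairwise (\<lambda>C D. disjnt (cycle_verts G C) (cycle_verts G D)) (cycles G)"

text \<open>The closed path obtained by reading a cycle from the base vertex \<^term>\<open>v\<close>.\<close>

definition cycle_at :: "('v, 'e) pre_digraph \<Rightarrow> 'e list set \<Rightarrow> 'v \<Rightarrow> 'e list" where
  "cycle_at G C v = (THE p. p \<in> C \<and> tail G (hd p) = v)"

definition support ::
  "('k, 'z) ring_scheme \<Rightarrow> ('v, 'e) pre_digraph \<Rightarrow> (('v, 'e, 'k) leavitt, 'm, 'w) rmodule_scheme \<Rightarrow> 'v set" where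
  "support R G M = {u \<in> verts G. \<exists>x\<in>carrier M. ract M x (lvertex R G u) \<noteq> \<zero>\<^bsub>M\<^esub>}"


section \<open>The simple modules\<close>

text \<open>\<open>w L(G)\<close>, its submodule \<open>\<mm> w L(G)\<close>, and \<open>w L(G)\<close> over \<open>R/\<mm>\<close>.\<close>

definition sink_module ::
  "('k, 'z) ring_scheme \<Rightarrow> ('v, 'e) pre_digraph \<Rightarrow> 'v \<Rightarrow> (('v, 'e, 'k) leavitt, ('v, 'e, 'k) leavitt) rmodule" where
  "sink_module R G w = right_ideal_module (leavitt R G) (\<lambda>a. a) (lvertex R G w)"

definition ideal_sink_module ::
  "('k, 'z) ring_scheme \<Rightarrow> ('v, 'e) pre_digraph \<Rightarrow> 'k set \<Rightarrow> 'v \<Rightarrow> ('v, 'e, 'k) leavitt set" where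
  "ideal_sink_module R G \<mm> w = generate (add_monoid (sink_module R G w))
     {a \<odot>\<^bsub>leavitt R G\<^esub> x | a x. a \<in> \<mm> \<and> x \<in> carrier (sink_module R G w)}"

definition reduced_sink_module ::
  "('k, 'z) ring_scheme \<Rightarrow> ('v, 'e) pre_digraph \<Rightarrow> 'k set \<Rightarrow> 'v \<Rightarrow>
    (('v, 'e, 'k) leavitt, ('v, 'e, 'k set) leavitt) rmodule" where
  "reduced_sink_module R G \<mm> w =
     right_ideal_module (leavitt (R Quot \<mm>) G) (leavitt_reduce R \<mm> G) (lvertex (R Quot \<mm>) G w)"

text \<open>
  For a cycle \<^term>\<open>C\<close> with base vertex \<^term>\<open>v\<close> and \<open>H\<close> the subgraph of the predecessors
  of \<^term>\<open>v\<close>: the image in \<open>v L(H) v\<close> of the Laurent monomial \<open>x\<^sup>i\<close>, with \<open>x\<close> going to the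
  ghost path of \<^term>\<open>C\<close>, and of a Laurent polynomial.
\<close>

definition cycle_power ::
  "('k, 'z) ring_scheme \<Rightarrow> ('v, 'e) pre_digraph \<Rightarrow> 'e list set \<Rightarrow> 'v \<Rightarrow> int \<Rightarrow> ('v, 'e, 'k) leavitt" where
  "cycle_power R H C v i = lvertex R H v \<otimes>\<^bsub>leavitt R H\<^esub>
     (if 0 \<le> i then lghost_path R H (cycle_at H C v) [^]\<^bsub>leavitt R H\<^esub> nat i
      else lpath R H (cycle_at H C v) [^]\<^bsub>leavitt R H\<^esub> nat (- i))"

definition laurent_eval ::
  "('k, 'z) ring_scheme \<Rightarrow> ('v, 'e) pre_digraph \<Rightarrow> 'e list set \<Rightarrow> 'v \<Rightarrow> (int \<Rightarrow> 'k) \<Rightarrow> ('v, 'e, 'k) leavitt" where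
  "laurent_eval R H C v f =
     (\<Oplus>\<^bsub>leavitt R H\<^esub>i\<in>{i. f i \<noteq> \<zero>\<^bsub>R\<^esub>}. f i \<odot>\<^bsub>leavitt R H\<^esub> cycle_power R H C v i)"

definition cycle_bimodule ::
  "('k, 'z) ring_scheme \<Rightarrow> ('v, 'e) pre_digraph \<Rightarrow> 'e list set \<Rightarrow> 'v \<Rightarrow>
    (int \<Rightarrow> 'k, ('v, 'e, 'k) leavitt, ('v, 'e, 'k) leavitt) bimodule" where
  "cycle_bimodule R G C v =
     (let W = predecessors G v; H = G \<restriction> W
      in rmodule.extend (right_ideal_module (leavitt R H) (leavitt_restrict R G W) (lvertex R H v))
           (bimodule.fields (\<lambda>f x. laurent_eval R H C v f \<otimes>\<^bsub>leavitt R H\<^esub> x)))"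

definition cycle_module ::
  "('k, 'z) ring_scheme \<Rightarrow> ('v, 'e) pre_digraph \<Rightarrow> (int \<Rightarrow> 'k) set \<Rightarrow> 'e list set \<Rightarrow> 'v \<Rightarrow>
    (('v, 'e, 'k) leavitt, ((int \<Rightarrow> 'k) set \<times> ('v, 'e, 'k) leavitt \<Rightarrow>\<^sub>0 int) set) rmodule" where
  "cycle_module R G \<mm> C v =
     tensor_module (laurent R)
       (quotient_module (right_ideal_module (laurent R) (\<lambda>f. f) \<one>\<^bsub>laurent R\<^esub>) \<mm>)
       (cycle_bimodule R G C v)"


section \<open>Isomorphism classes\<close>

text \<open>
  A simple right \<open>A\<close>-module is isomorphic to a quotient of \<open>A\<close> by a right ideal, so all of them
  occur, up to isomorphism, on sets of cosets in \<open>A\<close>.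
\<close>

type_synonym 'a coset_module = "('a, 'a set) rmodule"

definition iso_rel :: "('a, 'y) ring_scheme \<Rightarrow> ('a, 'm) rmodule set \<Rightarrow> (('a, 'm) rmodule \<times> ('a, 'm) rmodule) set" where
  "iso_rel A \<S> = {(M, N) \<in> \<S> \<times> \<S>. rmodule_iso A M N}"

definition simples_with_sink ::
  "('k, 'z) ring_scheme \<Rightarrow> ('v, 'e) pre_digraph \<Rightarrow> ('v, 'e, 'k) leavitt coset_module set" where
  "simples_with_sink R G =
     {N. simple_right_module (leavitt R G) N \<and> (\<exists>w. is_sink G w \<and> w \<in> support R G N)}"

definition simples_without_sink ::
  "('k, 'z) ring_scheme \<Rightarrow> ('v, 'e) pre_digraph \<Rightarrow> ('v, 'e, 'k) leavitt coset_module set" where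
  "simples_without_sink R G =
     {N. simple_right_module (leavitt R G) N \<and> (\<forall>w. is_sink G w \<longrightarrow> w \<notin> support R G N)}"

end

theory Submission
  imports Defs
begin

text \<open>
  Let \<open>v\<close> be a vertex and \<open>M\<close> a right module. Everything rests on the paths that arrive at \<open>v\<close> for
  the first time at their end. No such path is a proper initial segment of another one, so
  for \<open>d \<in> M v\<close> the relation \<open>e\<^sup>* f = \<delta>\<^bsub>e,f\<^esub> t(e)\<close> gives \<open>d q\<^sup>* p = d\<close> if \<open>p = q\<close>, while \<open>d q\<^sup>* p v = 0\<close>
  for any other such path \<open>p\<close> (\<open>coef_gact\<close>). Hence for a subgroup \<open>D\<close> of \<open>M v\<close> the sum of the
  \<open>D q\<^sup>*\<close> is direct, and the coefficients of an element can be read off.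

  A path that leaves \<open>v\<close> and comes back for the first time at its end is a return. A sink has
  no return. A vertex on a cycle \<open>C\<close> has exactly one, namely \<open>C\<close>, because the cycles are disjoint
  (\<open>returns_cycle\<close>). If, moreover, arrows from which there is no way back to \<open>C\<close> act as zero, then
  \<open>C\<close> and \<open>C\<^sup>*\<close> act on \<open>M v\<close> as mutually inverse maps. So a commutative ring \<open>A\<close> acts on \<open>M v\<close>: the
  ring of scalars at a sink, the ring of Laurent polynomials, with \<open>C\<^sup>*\<close> for the variable, at a
  vertex on a cycle. The direct sum above is a submodule of \<open>M\<close> as soon as \<open>D\<close> is stable under \<open>A\<close>
  (\<open>gact_gen_in_span\<close>, \<open>submodule_arrival_span\<close>).

  Simple modules that do not vanish at \<open>v\<close> are therefore governed by simple \<open>A\<close>-modules. The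
  annihilator in \<open>A\<close> of a nonzero element of \<open>M v\<close> is a maximal ideal \<open>\<mm>\<close> if \<open>M\<close> is simple
  (\<open>simple_imp_based\<close>). Conversely, a module generated by a nonzero element of \<open>M v\<close> that \<open>\<mm>\<close>
  annihilates is simple and supported on the predecessors of \<open>v\<close> (\<open>based_simple\<close>, \<open>based_support\<close>),
  is determined by \<open>\<mm>\<close> up to isomorphism (\<open>based_iso\<close>), and determines \<open>\<mm>\<close> (\<open>based_ideal_unique\<close>).

  It remains to see which vertices occur and that the modules named in the theorem are generated
  in this way. If no sink lies in the support of a simple module, a vertex of the support from
  which as few vertices as possible can be reached lies on a cycle that the module does not
  leave (\<open>support_cycle_ex\<close>). Different sinks and cycles have different sets of predecessors. The
  modules of the theorem are visibly generated by the class of \<open>v\<close>, which \<open>\<mm>\<close> annihilates. The only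
  difficulty is that this class is not zero, and for that the algebra is made to act on families
  of coefficients indexed by the paths that arrive at \<open>v\<close> (locale \<open>path_model\<close>).
\<close>

section \<open>Additive maps\<close>

lemma additive_zero:
  assumes "abelian_group M" "abelian_group N" "f \<in> carrier M \<rightarrow> carrier N"
    and "\<And>x y. \<lbrakk>x \<in> carrier M; y \<in> carrier M\<rbrakk> \<Longrightarrow> f (x \<oplus>\<^bsub>M\<^esub> y) = f x \<oplus>\<^bsub>N\<^esub> f y"
  shows "f \<zero>\<^bsub>M\<^esub> = \<zero>\<^bsub>N\<^esub>"
proof -
  interpret M: abelian_group M by fact
  interpret N: abelian_group N by fact
  have "f \<zero>\<^bsub>M\<^esub> \<oplus>\<^bsub>N\<^esub> f \<zero>\<^bsub>M\<^esub> = f \<zero>\<^bsub>M\<^esub>"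
    using assms(4)[of "\<zero>\<^bsub>M\<^esub>" "\<zero>\<^bsub>M\<^esub>"] by simp
  moreover have "f \<zero>\<^bsub>M\<^esub> \<in> carrier N" using assms(3) by auto
  ultimately show ?thesis using N.add.l_cancel_one by metis
qed

lemma additive_neg:
  assumes "abelian_group M" "abelian_group N" "f \<in> carrier M \<rightarrow> carrier N"
    and "\<And>x y. \<lbrakk>x \<in> carrier M; y \<in> carrier M\<rbrakk> \<Longrightarrow> f (x \<oplus>\<^bsub>M\<^esub> y) = f x \<oplus>\<^bsub>N\<^esub> f y"
    and x: "x \<in> carrier M"
  shows "f (\<ominus>\<^bsub>M\<^esub> x) = \<ominus>\<^bsub>N\<^esub> f x"
proof -
  interpret M: abelian_group M by fact
  interpret N: abelian_group N by fact
  have "f (\<ominus>\<^bsub>M\<^esub> x) \<oplus>\<^bsub>N\<^esub> f x = \<zero>\<^bsub>N\<^esub>"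
    using assms(4)[of "\<ominus>\<^bsub>M\<^esub> x" x] x additive_zero[OF assms(1-4)] by (simp add: M.l_neg)
  moreover have "f x \<in> carrier N" "f (\<ominus>\<^bsub>M\<^esub> x) \<in> carrier N" using assms(3) x by auto
  ultimately show ?thesis by (simp add: N.minus_equality)
qed

lemma additive_finsum:
  assumes "abelian_group M" "abelian_group N" "f \<in> carrier M \<rightarrow> carrier N"
    and "\<And>x y. \<lbrakk>x \<in> carrier M; y \<in> carrier M\<rbrakk> \<Longrightarrow> f (x \<oplus>\<^bsub>M\<^esub> y) = f x \<oplus>\<^bsub>N\<^esub> f y"
    and "finite A" "g \<in> A \<rightarrow> carrier M"
  shows "f (finsum M g A) = finsum N (\<lambda>i. f (g i)) A"
proof -
  interpret M: abelian_group M by fact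
  interpret N: abelian_group N by fact
  show ?thesis using assms(5,6)
  proof (induction A rule: finite_induct)
    case empty
    show ?case using additive_zero[OF assms(1-4)] by simp
  next
    case (insert a A)
    have fa: "\<And>i. i \<in> insert a A \<Longrightarrow> f (g i) \<in> carrier N" using assms(3) insert.prems by auto
    have "f (finsum M g (insert a A)) = f (g a \<oplus>\<^bsub>M\<^esub> finsum M g A)"
      using insert by (subst M.finsum_insert) auto
    also have "\<dots> = f (g a) \<oplus>\<^bsub>N\<^esub> f (finsum M g A)" using insert.prems by (intro assms(4)) auto
    also have "\<dots> = finsum N (\<lambda>i. f (g i)) (insert a A)"
      using insert fa by (subst N.finsum_insert) auto
    finally show ?case .
  qed
qed

section \<open>The Leavitt path algebra is an algebra\<close>

locale leavitt_algebra = cring R + G: fin_digraph G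
  for R :: "('k, 'z) ring_scheme" (structure) and G :: "('v, 'e) pre_digraph"
begin

abbreviation "terms \<equiv> alg_terms R (leavitt_gens G)"
abbreviation "teq \<equiv> alg_eq R (leavitt_gens G) (leavitt_rels G)"
abbreviation "cls \<equiv> leavitt_class R G"
abbreviation "L \<equiv> leavitt R G"
abbreviation "gn g \<equiv> leavitt_class R G (Gen g)"

lemma terms_simps [simp]:
  "Gen x \<in> terms \<longleftrightarrow> x \<in> leavitt_gens G"
  "Zero \<in> terms"
  "Add s t \<in> terms \<longleftrightarrow> s \<in> terms \<and> t \<in> terms"
  "Neg t \<in> terms \<longleftrightarrow> t \<in> terms"
  "Scal a t \<in> terms \<longleftrightarrow> a \<in> carrier R \<and> t \<in> terms"
  "Times s t \<in> terms \<longleftrightarrow> s \<in> terms \<and> t \<in> terms"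
  by (auto simp: alg_terms_def)

lemma gens_iff [simp]:
  "Vertex u \<in> leavitt_gens G \<longleftrightarrow> u \<in> verts G"
  "Arrow e \<in> leavitt_gens G \<longleftrightarrow> e \<in> arcs G"
  "Ghost e \<in> leavitt_gens G \<longleftrightarrow> e \<in> arcs G"
  by (auto simp: leavitt_gens_def)

lemma sum_term_simps [simp]: "sum_term [] = Zero" "sum_term (t # ts) = Add t (sum_term ts)"
  by (auto simp: sum_term_def)

lemma sum_term_in_terms: "(\<And>t. t \<in> set ts \<Longrightarrow> t \<in> terms) \<Longrightarrow> sum_term ts \<in> terms"
  by (induction ts) auto

lemma rels_terms: "(s, t) \<in> leavitt_rels G \<Longrightarrow> s \<in> terms \<and> t \<in> terms"
  by (induction rule: leavitt_rels.induct) (auto intro!: sum_term_in_terms)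

lemma teq_terms: "teq s t \<Longrightarrow> s \<in> terms \<and> t \<in> terms"
  by (induction rule: alg_eq.induct) (auto dest: rels_terms)

lemma cls_eq_iff: "s \<in> terms \<Longrightarrow> cls s = cls t \<longleftrightarrow> teq s t"
  unfolding leavitt_class_def by (auto intro: alg_eq.intros dest: alg_eq.sym)

lemma cls_eqI: "teq s t \<Longrightarrow> cls s = cls t"
  using cls_eq_iff teq_terms by blast

lemma mem_cls: "s \<in> terms \<Longrightarrow> s \<in> cls s"
  by (simp add: leavitt_class_def alg_eq.refl)

lemma mem_clsD: "u \<in> cls s \<Longrightarrow> teq s u"
  by (simp add: leavitt_class_def)

lemma UN_cls:
  assumes "s \<in> terms" "\<And>u. teq s u \<Longrightarrow> f u = f s"
  shows "(\<Union>u\<in>cls s. f u) = f s"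
proof -
  have "(\<Union>u\<in>cls s. f u) = (\<Union>u\<in>cls s. f s)"
    by (rule SUP_cong[OF HOL.refl]) (use assms(2) mem_clsD in blast)
  then show ?thesis using mem_cls[OF assms(1)] by auto
qed

lemma UN2_cls:
  assumes "s \<in> terms" "t \<in> terms" "\<And>u w. \<lbrakk>teq s u; teq t w\<rbrakk> \<Longrightarrow> f u w = f s t"
  shows "(\<Union>u\<in>cls s. \<Union>w\<in>cls t. f u w) = f s t"
proof -
  have "(\<Union>w\<in>cls t. f u w) = f s t" if "teq s u" for u
  proof -
    have "f u t = f s t" "\<And>w. teq t w \<Longrightarrow> f u w = f u t"
      using assms that alg_eq.refl by metis+
    then show ?thesis using UN_cls[OF assms(2), of "f u"] by simp
  qed
  moreover have "teq s s" using assms(1) by (rule alg_eq.refl)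
  ultimately show ?thesis using UN_cls[OF assms(1), of "\<lambda>u. \<Union>w\<in>cls t. f u w"] by simp
qed

lemma carrier_L: "carrier L = cls ` terms"
  by (simp add: leavitt_def)

lemma cls_closed [simp]: "t \<in> terms \<Longrightarrow> cls t \<in> carrier L"
  by (simp add: carrier_L)

lemma L_add [simp]: "\<lbrakk>s \<in> terms; t \<in> terms\<rbrakk> \<Longrightarrow> cls s \<oplus>\<^bsub>L\<^esub> cls t = cls (Add s t)"
  using UN2_cls[of s t "\<lambda>u w. cls (Add u w)"]
  by (simp add: leavitt_def cls_eqI alg_eq.cong_Add alg_eq.sym)

lemma L_mult [simp]: "\<lbrakk>s \<in> terms; t \<in> terms\<rbrakk> \<Longrightarrow> cls s \<otimes>\<^bsub>L\<^esub> cls t = cls (Times s t)"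
  using UN2_cls[of s t "\<lambda>u w. cls (Times u w)"]
  by (simp add: leavitt_def cls_eqI alg_eq.cong_Times alg_eq.sym)

lemma L_smult [simp]: "\<lbrakk>a \<in> carrier R; t \<in> terms\<rbrakk> \<Longrightarrow> a \<odot>\<^bsub>L\<^esub> cls t = cls (Scal a t)"
  using UN_cls[of t "\<lambda>u. cls (Scal a u)"]
  by (simp add: leavitt_def cls_eqI alg_eq.cong_Scal alg_eq.sym)

lemma L_zero: "\<zero>\<^bsub>L\<^esub> = cls Zero"
  by (simp add: leavitt_def)

lemma L_cases:
  assumes "x \<in> carrier L"
  obtains t where "t \<in> terms" "x = cls t"
  using assms by (auto simp: carrier_L)

lemma L_abelian_group: "abelian_group L"
proof (rule abelian_groupI)
  fix x y z
  assume x: "x \<in> carrier L"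
  then obtain s where s: "s \<in> terms" "x = cls s" by (rule L_cases)
  show "\<zero>\<^bsub>L\<^esub> \<oplus>\<^bsub>L\<^esub> x = x"
    using s by (auto simp: L_zero intro!: cls_eqI intro: alg_eq.trans[OF alg_eq.Add_comm alg_eq.Add_Zero])
  have "cls (Neg s) \<oplus>\<^bsub>L\<^esub> x = \<zero>\<^bsub>L\<^esub>"
    using s by (auto simp: L_zero intro!: cls_eqI intro: alg_eq.trans[OF alg_eq.Add_comm alg_eq.Add_Neg])
  then show "\<exists>y\<in>carrier L. y \<oplus>\<^bsub>L\<^esub> x = \<zero>\<^bsub>L\<^esub>" using s by (intro bexI[of _ "cls (Neg s)"]) auto
  assume "y \<in> carrier L"
  then obtain t where t: "t \<in> terms" "y = cls t" by (rule L_cases)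
  show "x \<oplus>\<^bsub>L\<^esub> y \<in> carrier L" using s t by auto
  show "x \<oplus>\<^bsub>L\<^esub> y = y \<oplus>\<^bsub>L\<^esub> x"
    using s t by (auto intro!: cls_eqI intro: alg_eq.intros)
  assume "z \<in> carrier L"
  then obtain u where u: "u \<in> terms" "z = cls u" by (rule L_cases)
  show "x \<oplus>\<^bsub>L\<^esub> y \<oplus>\<^bsub>L\<^esub> z = x \<oplus>\<^bsub>L\<^esub> (y \<oplus>\<^bsub>L\<^esub> z)"
    using s t u by (auto intro!: cls_eqI intro: alg_eq.intros)
qed (auto simp: L_zero)

interpretation LA: abelian_group L by (rule L_abelian_group)

lemma mult_closed: "\<lbrakk>x \<in> carrier L; y \<in> carrier L\<rbrakk> \<Longrightarrow> x \<otimes>\<^bsub>L\<^esub> y \<in> carrier L"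
  by (elim L_cases) simp

lemma smult_closed: "\<lbrakk>a \<in> carrier R; y \<in> carrier L\<rbrakk> \<Longrightarrow> a \<odot>\<^bsub>L\<^esub> y \<in> carrier L"
  by (elim L_cases) simp

lemma mult_assoc: "\<lbrakk>x \<in> carrier L; y \<in> carrier L; z \<in> carrier L\<rbrakk> \<Longrightarrow>
    x \<otimes>\<^bsub>L\<^esub> y \<otimes>\<^bsub>L\<^esub> z = x \<otimes>\<^bsub>L\<^esub> (y \<otimes>\<^bsub>L\<^esub> z)"
  by (elim L_cases) (auto intro!: cls_eqI intro: alg_eq.intros)

lemma l_distr: "\<lbrakk>x \<in> carrier L; y \<in> carrier L; z \<in> carrier L\<rbrakk> \<Longrightarrow>
    (x \<oplus>\<^bsub>L\<^esub> y) \<otimes>\<^bsub>L\<^esub> z = x \<otimes>\<^bsub>L\<^esub> z \<oplus>\<^bsub>L\<^esub> y \<otimes>\<^bsub>L\<^esub> z"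
  by (elim L_cases) (auto intro!: cls_eqI intro: alg_eq.intros)

lemma r_distr: "\<lbrakk>x \<in> carrier L; y \<in> carrier L; z \<in> carrier L\<rbrakk> \<Longrightarrow>
    z \<otimes>\<^bsub>L\<^esub> (x \<oplus>\<^bsub>L\<^esub> y) = z \<otimes>\<^bsub>L\<^esub> x \<oplus>\<^bsub>L\<^esub> z \<otimes>\<^bsub>L\<^esub> y"
  by (elim L_cases) (auto intro!: cls_eqI intro: alg_eq.intros)

lemma smult_l_distr: "\<lbrakk>a \<in> carrier R; b \<in> carrier R; x \<in> carrier L\<rbrakk> \<Longrightarrow>
    (a \<oplus> b) \<odot>\<^bsub>L\<^esub> x = a \<odot>\<^bsub>L\<^esub> x \<oplus>\<^bsub>L\<^esub> b \<odot>\<^bsub>L\<^esub> x"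
  by (elim L_cases) (auto intro!: cls_eqI intro: alg_eq.intros)

lemma smult_assoc1: "\<lbrakk>a \<in> carrier R; b \<in> carrier R; x \<in> carrier L\<rbrakk> \<Longrightarrow>
    (a \<otimes> b) \<odot>\<^bsub>L\<^esub> x = a \<odot>\<^bsub>L\<^esub> (b \<odot>\<^bsub>L\<^esub> x)"
  by (elim L_cases) (auto intro!: cls_eqI intro: alg_eq.intros)

lemma smult_one: "x \<in> carrier L \<Longrightarrow> \<one> \<odot>\<^bsub>L\<^esub> x = x"
  by (elim L_cases) (auto intro!: cls_eqI intro: alg_eq.intros)

lemma smult_assoc2: "\<lbrakk>a \<in> carrier R; x \<in> carrier L; y \<in> carrier L\<rbrakk> \<Longrightarrow>
    a \<odot>\<^bsub>L\<^esub> x \<otimes>\<^bsub>L\<^esub> y = a \<odot>\<^bsub>L\<^esub> (x \<otimes>\<^bsub>L\<^esub> y)"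
  by (elim L_cases) (auto intro!: cls_eqI intro: alg_eq.intros)

lemma smult_assoc3: "\<lbrakk>a \<in> carrier R; x \<in> carrier L; y \<in> carrier L\<rbrakk> \<Longrightarrow>
    x \<otimes>\<^bsub>L\<^esub> (a \<odot>\<^bsub>L\<^esub> y) = a \<odot>\<^bsub>L\<^esub> (x \<otimes>\<^bsub>L\<^esub> y)"
  by (elim L_cases) (auto intro!: cls_eqI intro: alg_eq.intros)

lemma mult_zero: "x \<in> carrier L \<Longrightarrow> x \<otimes>\<^bsub>L\<^esub> \<zero>\<^bsub>L\<^esub> = \<zero>\<^bsub>L\<^esub>"
  by (rule additive_zero[of L L "\<lambda>y. x \<otimes>\<^bsub>L\<^esub> y"]) (auto simp: mult_closed r_distr L_abelian_group)

lemma zero_mult: "x \<in> carrier L \<Longrightarrow> \<zero>\<^bsub>L\<^esub> \<otimes>\<^bsub>L\<^esub> x = \<zero>\<^bsub>L\<^esub>"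
  by (rule additive_zero[of L L "\<lambda>y. y \<otimes>\<^bsub>L\<^esub> x"]) (auto simp: mult_closed l_distr L_abelian_group)

lemma smult_zero_left: assumes "x \<in> carrier L" shows "\<zero> \<odot>\<^bsub>L\<^esub> x = \<zero>\<^bsub>L\<^esub>"
  by (rule additive_zero[of R L "\<lambda>a. a \<odot>\<^bsub>L\<^esub> x"])
    (use assms in \<open>auto simp: smult_closed smult_l_distr L_abelian_group abelian_group_axioms\<close>)

lemma smult_neg_one: assumes "x \<in> carrier L" shows "(\<ominus> \<one>) \<odot>\<^bsub>L\<^esub> x = \<ominus>\<^bsub>L\<^esub> x"
proof -
  have "(\<ominus> \<one>) \<odot>\<^bsub>L\<^esub> x \<oplus>\<^bsub>L\<^esub> \<one> \<odot>\<^bsub>L\<^esub> x = \<zero>\<^bsub>L\<^esub>"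
    using assms smult_l_distr[of "\<ominus> \<one>" \<one> x] by (simp add: l_neg smult_zero_left)
  then show ?thesis using assms by (simp add: smult_one smult_closed LA.minus_equality)
qed

lemma cls_Neg: "t \<in> terms \<Longrightarrow> cls (Neg t) = \<ominus>\<^bsub>L\<^esub> cls t"
proof -
  assume t: "t \<in> terms"
  then have "cls (Neg t) \<oplus>\<^bsub>L\<^esub> cls t = \<zero>\<^bsub>L\<^esub>"
    using t by (auto simp: L_zero intro!: cls_eqI intro: alg_eq.trans[OF alg_eq.Add_comm alg_eq.Add_Neg])
  with t show ?thesis by (simp add: LA.minus_equality del: L_add)
qed

text \<open>Zero and negatives are scalar multiples, so generators, sums, multiples and products suffice.\<close>

lemma L_induct [consumes 1, case_names gen zero add smult mult]:
  assumes "x \<in> carrier L"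
    and "\<And>g. g \<in> leavitt_gens G \<Longrightarrow> P (gn g)"
    and "P \<zero>\<^bsub>L\<^esub>"
    and "\<And>x y. \<lbrakk>x \<in> carrier L; y \<in> carrier L; P x; P y\<rbrakk> \<Longrightarrow> P (x \<oplus>\<^bsub>L\<^esub> y)"
    and "\<And>a x. \<lbrakk>a \<in> carrier R; x \<in> carrier L; P x\<rbrakk> \<Longrightarrow> P (a \<odot>\<^bsub>L\<^esub> x)"
    and "\<And>x y. \<lbrakk>x \<in> carrier L; y \<in> carrier L; P x; P y\<rbrakk> \<Longrightarrow> P (x \<otimes>\<^bsub>L\<^esub> y)"
  shows "P x"
proof -
  obtain t where t: "t \<in> terms" "x = cls t" using assms(1) by (rule L_cases)
  have "t \<in> terms \<Longrightarrow> P (cls t)" for t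
  proof (induction t)
    case (Neg t)
    then have "P ((\<ominus> \<one>) \<odot>\<^bsub>L\<^esub> cls t)" by (intro assms(5)) auto
    with Neg show ?case by (simp add: cls_Neg smult_neg_one del: L_smult)
  next
    case (Add s t)
    then show ?case using assms(4)[of "cls s" "cls t"] by simp
  next
    case (Times s t)
    then show ?case using assms(6)[of "cls s" "cls t"] by simp
  next
    case (Scal a t)
    then show ?case using assms(5)[of a "cls t"] by simp
  qed (use assms(2,3) L_zero in auto)
  with t show ?thesis by simp
qed

lemma cls_sum_term:
  assumes "distinct xs" "\<And>x. x \<in> set xs \<Longrightarrow> f x \<in> terms"
  shows "cls (sum_term (map f xs)) = finsum L (\<lambda>x. cls (f x)) (set xs)"
  using assms
proof (induction xs)
  case (Cons x xs)
  have "cls (sum_term (map f (x # xs))) = cls (f x) \<oplus>\<^bsub>L\<^esub> cls (sum_term (map f xs))"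
    using Cons.prems by (subst L_add) (auto intro!: sum_term_in_terms)
  also have "\<dots> = finsum L (\<lambda>x. cls (f x)) (set (x # xs))"
    using Cons by (simp add: LA.finsum_insert)
  finally show ?case .
qed (simp add: L_zero LA.finsum_empty)

lemma L_one: "\<one>\<^bsub>L\<^esub> = finsum L (lvertex R G) (verts G)"
proof -
  have *: "cls (sum_term (map (\<lambda>v. Gen (Vertex v)) vs)) = finsum L (lvertex R G) (verts G)"
    if "vs \<in> {vs. distinct vs \<and> set vs = verts G}" for vs
    using that cls_sum_term[of vs "\<lambda>v. Gen (Vertex v)"] by (simp add: lvertex_def[abs_def])
  obtain vs where "vs \<in> {vs. distinct vs \<and> set vs = verts G}"
    using finite_distinct_list[OF G.finite_verts] by auto
  then have "(\<Union>vs\<in>{vs. distinct vs \<and> set vs = verts G}.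
      cls (sum_term (map (\<lambda>v. Gen (Vertex v)) vs))) = finsum L (lvertex R G) (verts G)"
    by (subst SUP_cong[OF HOL.refl *]) auto
  then show ?thesis by (simp add: leavitt_def)
qed

lemma gn_closed [simp]: "g \<in> leavitt_gens G \<Longrightarrow> gn g \<in> carrier L"
  by simp

lemma lvertex_closed [simp]: "v \<in> verts G \<Longrightarrow> lvertex R G v \<in> carrier L"
  by (simp add: lvertex_def)

lemma vertex_mult:
  "\<lbrakk>v \<in> verts G; w \<in> verts G\<rbrakk> \<Longrightarrow>
    lvertex R G v \<otimes>\<^bsub>L\<^esub> lvertex R G w = (if v = w then lvertex R G v else \<zero>\<^bsub>L\<^esub>)"
  using alg_eq.rel[OF leavitt_rels.V, of v G w R "leavitt_gens G"]
  by (auto simp: lvertex_def L_zero intro!: cls_eqI)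

lemma arrow_source: "e \<in> arcs G \<Longrightarrow> lvertex R G (tail G e) \<otimes>\<^bsub>L\<^esub> gn (Arrow e) = gn (Arrow e)"
  by (auto simp: lvertex_def intro!: cls_eqI alg_eq.rel leavitt_rels.intros)

lemma arrow_target: "e \<in> arcs G \<Longrightarrow> gn (Arrow e) \<otimes>\<^bsub>L\<^esub> lvertex R G (head G e) = gn (Arrow e)"
  by (auto simp: lvertex_def intro!: cls_eqI alg_eq.rel leavitt_rels.intros)

lemma ghost_source: "e \<in> arcs G \<Longrightarrow> lvertex R G (head G e) \<otimes>\<^bsub>L\<^esub> gn (Ghost e) = gn (Ghost e)"
  by (auto simp: lvertex_def intro!: cls_eqI alg_eq.rel leavitt_rels.intros)

lemma ghost_target: "e \<in> arcs G \<Longrightarrow> gn (Ghost e) \<otimes>\<^bsub>L\<^esub> lvertex R G (tail G e) = gn (Ghost e)"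
  by (auto simp: lvertex_def intro!: cls_eqI alg_eq.rel leavitt_rels.intros)

lemma ghost_arrow:
  "\<lbrakk>e \<in> arcs G; f \<in> arcs G\<rbrakk> \<Longrightarrow>
    gn (Ghost e) \<otimes>\<^bsub>L\<^esub> gn (Arrow f) = (if e = f then lvertex R G (head G e) else \<zero>\<^bsub>L\<^esub>)"
  using alg_eq.rel[OF leavitt_rels.CK1, of e G f R "leavitt_gens G"]
  by (auto simp: lvertex_def L_zero intro!: cls_eqI)

lemma vertex_sum:
  assumes "v \<in> verts G" "out_arcs G v \<noteq> {}"
  shows "lvertex R G v = finsum L (\<lambda>e. gn (Arrow e) \<otimes>\<^bsub>L\<^esub> gn (Ghost e)) (out_arcs G v)"
proof -
  have "finite (out_arcs G v)" by (simp add: G.finite_out_arcs)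
  then obtain es where es: "distinct es" "set es = out_arcs G v"
    using finite_distinct_list by blast
  have "lvertex R G v = cls (sum_term (map (\<lambda>e. Times (Gen (Arrow e)) (Gen (Ghost e))) es))"
    using assms es by (auto simp: lvertex_def intro!: cls_eqI alg_eq.rel leavitt_rels.CK2)
  also have "\<dots> = finsum L (\<lambda>e. cls (Times (Gen (Arrow e)) (Gen (Ghost e)))) (out_arcs G v)"
    using es by (subst cls_sum_term) auto
  also have "\<dots> = finsum L (\<lambda>e. gn (Arrow e) \<otimes>\<^bsub>L\<^esub> gn (Ghost e)) (out_arcs G v)"
    by (rule LA.finsum_cong') (auto simp: Pi_iff)
  finally show ?thesis .
qed

fun gsource where
  "gsource (Vertex v) = v" | "gsource (Arrow e) = tail G e" | "gsource (Ghost e) = head G e"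

fun gtarget where
  "gtarget (Vertex v) = v" | "gtarget (Arrow e) = head G e" | "gtarget (Ghost e) = tail G e"

lemma gsource_in_verts: "g \<in> leavitt_gens G \<Longrightarrow> gsource g \<in> verts G"
  and gtarget_in_verts: "g \<in> leavitt_gens G \<Longrightarrow> gtarget g \<in> verts G"
  by (auto simp: leavitt_gens_def)

lemma vertex_gen:
  assumes "u \<in> verts G" "g \<in> leavitt_gens G"
  shows "lvertex R G u \<otimes>\<^bsub>L\<^esub> gn g = (if u = gsource g then gn g else \<zero>\<^bsub>L\<^esub>)"
proof -
  have 1: "lvertex R G (gsource g) \<otimes>\<^bsub>L\<^esub> gn g = gn g"
    using assms(2) vertex_mult arrow_source ghost_source
    by (cases g) (simp_all add: lvertex_def del: L_mult)
  have "lvertex R G u \<otimes>\<^bsub>L\<^esub> gn g = lvertex R G u \<otimes>\<^bsub>L\<^esub> (lvertex R G (gsource g) \<otimes>\<^bsub>L\<^esub> gn g)"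
    by (simp only: 1)
  also have "\<dots> = (if u = gsource g then lvertex R G u else \<zero>\<^bsub>L\<^esub>) \<otimes>\<^bsub>L\<^esub> gn g"
    using assms gsource_in_verts by (simp add: mult_assoc[symmetric] vertex_mult del: L_mult)
  finally show ?thesis using assms 1 by (auto simp: zero_mult simp del: L_mult)
qed

lemma gen_vertex:
  assumes "u \<in> verts G" "g \<in> leavitt_gens G"
  shows "gn g \<otimes>\<^bsub>L\<^esub> lvertex R G u = (if u = gtarget g then gn g else \<zero>\<^bsub>L\<^esub>)"
proof -
  have 1: "gn g \<otimes>\<^bsub>L\<^esub> lvertex R G (gtarget g) = gn g"
    using assms(2) vertex_mult arrow_target ghost_target
    by (cases g) (simp_all add: lvertex_def del: L_mult)
  have "gn g \<otimes>\<^bsub>L\<^esub> lvertex R G u = (gn g \<otimes>\<^bsub>L\<^esub> lvertex R G (gtarget g)) \<otimes>\<^bsub>L\<^esub> lvertex R G u"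
    by (simp only: 1)
  also have "\<dots> = gn g \<otimes>\<^bsub>L\<^esub> (if gtarget g = u then lvertex R G (gtarget g) else \<zero>\<^bsub>L\<^esub>)"
    using assms gtarget_in_verts by (simp add: mult_assoc vertex_mult del: L_mult)
  finally show ?thesis using assms 1 by (auto simp: mult_zero simp del: L_mult)
qed

lemma finsum_mult_right:
  assumes "finite A" "f \<in> A \<rightarrow> carrier L" "x \<in> carrier L"
  shows "finsum L f A \<otimes>\<^bsub>L\<^esub> x = finsum L (\<lambda>i. f i \<otimes>\<^bsub>L\<^esub> x) A"
  using assms by (intro additive_finsum) (auto simp: L_abelian_group mult_closed l_distr)

lemma finsum_mult_left:
  assumes "finite A" "f \<in> A \<rightarrow> carrier L" "x \<in> carrier L"
  shows "x \<otimes>\<^bsub>L\<^esub> finsum L f A = finsum L (\<lambda>i. x \<otimes>\<^bsub>L\<^esub> f i) A"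
  using assms by (intro additive_finsum) (auto simp: L_abelian_group mult_closed r_distr)

lemma sum_vertex_gen:
  assumes "g \<in> leavitt_gens G"
  shows "finsum L (lvertex R G) (verts G) \<otimes>\<^bsub>L\<^esub> gn g = gn g"
    and "gn g \<otimes>\<^bsub>L\<^esub> finsum L (lvertex R G) (verts G) = gn g"
proof -
  have "finsum L (lvertex R G) (verts G) \<otimes>\<^bsub>L\<^esub> gn g =
      finsum L (\<lambda>u. lvertex R G u \<otimes>\<^bsub>L\<^esub> gn g) (verts G)"
    using assms by (intro finsum_mult_right) (auto simp: G.finite_verts)
  also have "\<dots> = finsum L (\<lambda>u. if gsource g = u then gn g else \<zero>\<^bsub>L\<^esub>) (verts G)"
    by (rule LA.finsum_cong') (use assms vertex_gen in simp_all)
  also have "\<dots> = gn g"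
    using assms gsource_in_verts by (subst LA.finsum_singleton) (simp_all add: G.finite_verts)
  finally show "finsum L (lvertex R G) (verts G) \<otimes>\<^bsub>L\<^esub> gn g = gn g" .
  have "gn g \<otimes>\<^bsub>L\<^esub> finsum L (lvertex R G) (verts G) =
      finsum L (\<lambda>u. gn g \<otimes>\<^bsub>L\<^esub> lvertex R G u) (verts G)"
    using assms by (intro finsum_mult_left) (auto simp: G.finite_verts)
  also have "\<dots> = finsum L (\<lambda>u. if gtarget g = u then gn g else \<zero>\<^bsub>L\<^esub>) (verts G)"
    by (rule LA.finsum_cong') (use assms gen_vertex in simp_all)
  also have "\<dots> = gn g"
    using assms gtarget_in_verts by (subst LA.finsum_singleton) (simp_all add: G.finite_verts)
  finally show "gn g \<otimes>\<^bsub>L\<^esub> finsum L (lvertex R G) (verts G) = gn g" .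
qed

lemma L_one_closed: "\<one>\<^bsub>L\<^esub> \<in> carrier L"
  by (auto simp: L_one intro!: LA.finsum_closed)

lemma L_one_mult:
  assumes "x \<in> carrier L"
  shows "\<one>\<^bsub>L\<^esub> \<otimes>\<^bsub>L\<^esub> x = x" "x \<otimes>\<^bsub>L\<^esub> \<one>\<^bsub>L\<^esub> = x"
proof -
  have "\<one>\<^bsub>L\<^esub> \<otimes>\<^bsub>L\<^esub> x = x \<and> x \<otimes>\<^bsub>L\<^esub> \<one>\<^bsub>L\<^esub> = x"
    using assms
  proof (induction x rule: L_induct)
    case (mult x y)
    then show ?case using L_one_closed by (metis mult_assoc)
  qed (use L_one_closed in \<open>simp_all add: L_one sum_vertex_gen mult_zero zero_mult l_distr r_distr
        smult_assoc2 smult_assoc3 del: L_mult\<close>)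
  then show "\<one>\<^bsub>L\<^esub> \<otimes>\<^bsub>L\<^esub> x = x" "x \<otimes>\<^bsub>L\<^esub> \<one>\<^bsub>L\<^esub> = x" by auto
qed

lemma L_ring: "ring L"
proof (rule ringI)
  show "monoid L"
    by (rule monoidI) (simp_all add: mult_closed L_one_closed mult_assoc L_one_mult)
qed (simp_all add: L_abelian_group l_distr r_distr)

lemma smult_as_mult:
  "\<lbrakk>a \<in> carrier R; x \<in> carrier L\<rbrakk> \<Longrightarrow> a \<odot>\<^bsub>L\<^esub> x = x \<otimes>\<^bsub>L\<^esub> (a \<odot>\<^bsub>L\<^esub> \<one>\<^bsub>L\<^esub>)"
  "\<lbrakk>a \<in> carrier R; x \<in> carrier L\<rbrakk> \<Longrightarrow> a \<odot>\<^bsub>L\<^esub> x = (a \<odot>\<^bsub>L\<^esub> \<one>\<^bsub>L\<^esub>) \<otimes>\<^bsub>L\<^esub> x"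
  by (simp_all add: smult_assoc2 smult_assoc3 L_one_closed L_one_mult)

lemma foldr_mult_closed:
  "(\<And>a. a \<in> set as \<Longrightarrow> a \<in> carrier L) \<Longrightarrow> foldr (monoid.mult L) as \<one>\<^bsub>L\<^esub> \<in> carrier L"
  by (induction as) (auto simp: L_one_closed mult_closed)

end

section \<open>Maps between Leavitt path algebras\<close>

text \<open>
  The congruence on terms is generated by the relations, so a substitution respects it as soon
  as it respects the relations. This is the universal property of the presented algebra.
\<close>

lemma alg_eq_subst:
  fixes R :: "('k, 'z) ring_scheme" and S :: "('l, 'y) ring_scheme"
  assumes h: "h \<in> ring_hom R S"
    and g: "\<And>x. x \<in> X \<Longrightarrow> g x \<in> alg_terms S Y"
    and rels: "\<And>s t. (s, t) \<in> \<R> \<Longrightarrow> alg_eq S Y \<S> (subst_term g h s) (subst_term g h t)"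
    and eq: "alg_eq R X \<R> s t"
  shows "alg_eq S Y \<S> (subst_term g h s) (subst_term g h t)"
proof -
  have T: "subst_term g h t \<in> alg_terms S Y" if "t \<in> alg_terms R X" for t
    using that by (induction t) (use g ring_hom_closed[OF h] in \<open>auto simp: alg_terms_def\<close>)
  note simps = ring_hom_add[OF h] ring_hom_mult[OF h] ring_hom_one[OF h] ring_hom_closed[OF h] T
  show ?thesis using eq
  proof (induction rule: alg_eq.induct)
    case (sym s t)
    then show ?case using alg_eq.sym by metis
  next
    case (trans s t u)
    then show ?case by (metis alg_eq.trans)
  qed (simp_all add: simps rels alg_eq.intros(2,5-))
qed

locale leavitt_hom = A: leavitt_algebra R G + B: leavitt_algebra S H
  for R :: "('k, 'z) ring_scheme" and G :: "('v, 'e) pre_digraph"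
    and S :: "('l, 'y) ring_scheme" and H :: "('w, 'f) pre_digraph" +
  fixes g :: "('v, 'e) leavitt_gen \<Rightarrow> (('w, 'f) leavitt_gen, 'l) alg_term" and h :: "'k \<Rightarrow> 'l"
  assumes h_hom: "h \<in> ring_hom R S"
    and g_terms: "\<And>x. x \<in> leavitt_gens G \<Longrightarrow> g x \<in> B.terms"
    and g_rels: "\<And>s t. (s, t) \<in> leavitt_rels G \<Longrightarrow> B.cls (subst_term g h s) = B.cls (subst_term g h t)"
    and g_one: "finsum B.L (\<lambda>v. B.cls (g (Vertex v))) (verts G) = \<one>\<^bsub>B.L\<^esub>"
begin

definition lmap :: "('v, 'e, 'k) leavitt \<Rightarrow> ('w, 'f, 'l) leavitt" where
  "lmap A = (\<Union>t\<in>A. B.cls (subst_term g h t))"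

lemma subst_terms: "t \<in> A.terms \<Longrightarrow> subst_term g h t \<in> B.terms"
  by (induction t) (use g_terms ring_hom_closed[OF h_hom] in auto)

lemma subst_teq: "A.teq s t \<Longrightarrow> B.teq (subst_term g h s) (subst_term g h t)"
  by (rule alg_eq_subst[OF h_hom, where X = "leavitt_gens G" and \<R> = "leavitt_rels G"])
    (use g_terms g_rels B.cls_eq_iff subst_terms A.rels_terms in blast)+

lemma lmap_cls: "t \<in> A.terms \<Longrightarrow> lmap (A.cls t) = B.cls (subst_term g h t)"
  unfolding lmap_def by (rule A.UN_cls) (blast, metis B.cls_eqI subst_teq)

lemma lmap_closed: "x \<in> carrier A.L \<Longrightarrow> lmap x \<in> carrier B.L"
  by (elim A.L_cases) (simp add: lmap_cls subst_terms)

lemma lmap_add: "\<lbrakk>x \<in> carrier A.L; y \<in> carrier A.L\<rbrakk> \<Longrightarrow> lmap (x \<oplus>\<^bsub>A.L\<^esub> y) = lmap x \<oplus>\<^bsub>B.L\<^esub> lmap y"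
  by (elim A.L_cases) (simp add: lmap_cls subst_terms)

lemma lmap_mult: "\<lbrakk>x \<in> carrier A.L; y \<in> carrier A.L\<rbrakk> \<Longrightarrow> lmap (x \<otimes>\<^bsub>A.L\<^esub> y) = lmap x \<otimes>\<^bsub>B.L\<^esub> lmap y"
  by (elim A.L_cases) (simp add: lmap_cls subst_terms)

lemma lmap_smult: "\<lbrakk>a \<in> carrier R; x \<in> carrier A.L\<rbrakk> \<Longrightarrow> lmap (a \<odot>\<^bsub>A.L\<^esub> x) = h a \<odot>\<^bsub>B.L\<^esub> lmap x"
  using ring_hom_closed[OF h_hom] by (elim A.L_cases) (simp add: lmap_cls subst_terms)

lemma lmap_gen: "x \<in> leavitt_gens G \<Longrightarrow> lmap (A.gn x) = B.cls (g x)"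
  by (simp add: lmap_cls)

lemma lmap_one: "lmap \<one>\<^bsub>A.L\<^esub> = \<one>\<^bsub>B.L\<^esub>"
proof -
  interpret BL: ring B.L by (rule B.L_ring)
  have "lmap \<one>\<^bsub>A.L\<^esub> = finsum B.L (\<lambda>v. lmap (lvertex R G v)) (verts G)"
    unfolding A.L_one
    by (rule additive_finsum)
      (auto simp: A.L_abelian_group B.L_abelian_group lmap_closed lmap_add A.G.finite_verts)
  also have "\<dots> = finsum B.L (\<lambda>v. B.cls (g (Vertex v))) (verts G)"
    by (rule BL.finsum_cong') (auto simp: lvertex_def lmap_gen g_terms)
  finally show ?thesis by (simp add: g_one)
qed

lemma lmap_ring_hom: "lmap \<in> ring_hom A.L B.L"
  by (rule ring_hom_memI) (simp_all add: lmap_closed lmap_mult lmap_add lmap_one)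

lemma lmap_surj:
  assumes "h ` carrier R = carrier S"
    and "\<And>y. y \<in> leavitt_gens H \<Longrightarrow> \<exists>x\<in>leavitt_gens G. B.cls (g x) = B.gn y"
    and "y \<in> carrier B.L"
  shows "\<exists>x\<in>carrier A.L. lmap x = y"
  using assms(3)
proof (induction y rule: B.L_induct)
  case (gen y)
  then show ?case using assms(2)[of y] lmap_gen A.gn_closed by metis
next
  case zero
  have "lmap \<zero>\<^bsub>A.L\<^esub> = \<zero>\<^bsub>B.L\<^esub>"
    using additive_zero[OF A.L_abelian_group B.L_abelian_group] lmap_closed lmap_add by blast
  then show ?case by (metis A.cls_closed A.L_zero A.terms_simps(2))
next
  case (add x y)
  then obtain x' y' where "x' \<in> carrier A.L" "lmap x' = x" "y' \<in> carrier A.L" "lmap y' = y" by blast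
  then show ?case using abelian_groupE(1)[OF A.L_abelian_group]
    by (intro bexI[of _ "x' \<oplus>\<^bsub>A.L\<^esub> y'"]) (simp_all add: lmap_add)
next
  case (smult a x)
  obtain x' where x': "x' \<in> carrier A.L" "lmap x' = x" using smult.IH by metis
  have "a \<in> h ` carrier R" using smult.hyps assms(1) by simp
  then obtain a' where "a' \<in> carrier R" "h a' = a" by (metis imageE)
  with x' show ?case by (intro bexI[of _ "a' \<odot>\<^bsub>A.L\<^esub> x'"]) (simp_all add: lmap_smult A.smult_closed)
next
  case (mult x y)
  then obtain x' y' where "x' \<in> carrier A.L" "lmap x' = x" "y' \<in> carrier A.L" "lmap y' = y" by blast
  then show ?case by (intro bexI[of _ "x' \<otimes>\<^bsub>A.L\<^esub> y'"]) (simp_all add: lmap_mult A.mult_closed)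
qed

end

lemma subst_sum_term: "subst_term g h (sum_term ts) = sum_term (map (subst_term g h) ts)"
  by (induction ts) (auto simp: sum_term_def)

text \<open>No scalar occurs in the relations, so they survive a change of coefficients.\<close>

lemma (in leavitt_algebra) leavitt_hom_reduce:
  assumes "ideal \<mm> R"
  shows "leavitt_hom R G (R Quot \<mm>) G Gen (a_r_coset R \<mm>)"
proof -
  interpret \<mm>: ideal \<mm> R by fact
  interpret Q: cring "R Quot \<mm>" by (rule \<mm>.quotient_is_cring) (rule cring_axioms)
  interpret B: leavitt_algebra "R Quot \<mm>" G by unfold_locales
  show ?thesis
  proof
    show "a_r_coset R \<mm> \<in> ring_hom R (R Quot \<mm>)" by (rule \<mm>.rcos_ring_hom)
    have rel_V: "(Times (Gen (Vertex v)) (Gen (Vertex w)), if v = w then Gen (Vertex v) else Zero)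
        \<in> (leavitt_rels G :: ((_, 'k set) alg_term \<times> _) set)"
      if "v \<in> verts G" "w \<in> verts G" for v w
      using that by (rule leavitt_rels.V)
    have rel_CK1: "(Times (Gen (Ghost e)) (Gen (Arrow f)), if e = f then Gen (Vertex (head G e)) else Zero)
        \<in> (leavitt_rels G :: ((_, 'k set) alg_term \<times> _) set)"
      if "e \<in> arcs G" "f \<in> arcs G" for e f
      using that by (rule leavitt_rels.CK1)
    show "B.cls (subst_term Gen (a_r_coset R \<mm>) s) = B.cls (subst_term Gen (a_r_coset R \<mm>) t)"
      if "(s, t) \<in> leavitt_rels G" for s t
    proof -
      have "(subst_term Gen (a_r_coset R \<mm>) s, subst_term Gen (a_r_coset R \<mm>) t) \<in> leavitt_rels G"
        using that
      proof cases
        case (V v w)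
        then show ?thesis using rel_V[of v w] by (cases "v = w") simp_all
      next
        case (CK1 e f)
        then show ?thesis using rel_CK1[of e f] by (cases "e = f") simp_all
      next
        case (CK2 v es)
        then show ?thesis
          by (auto simp: subst_sum_term comp_def intro!: leavitt_rels.CK2)
      qed (auto intro: leavitt_rels.intros)
      then show ?thesis by (intro B.cls_eqI alg_eq.rel)
    qed
    show "finsum B.L (\<lambda>v. B.cls (Gen (Vertex v))) (verts G) = \<one>\<^bsub>B.L\<^esub>"
      by (simp add: B.L_one lvertex_def[abs_def])
  qed auto
qed

text \<open>
  Arrows with an end outside \<open>W\<close> go to zero. As \<open>W\<close> contains all predecessors of its elements,
  these are the arrows whose target is outside \<open>W\<close>. The last assumption keeps every vertex of \<open>W\<close>
  that is not a sink from becoming one; otherwise the sum over its arrows would be sent to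
  zero and the vertex itself would not.
\<close>

lemma (in leavitt_algebra) leavitt_hom_restrict:
  assumes W: "W \<subseteq> verts G"
    and pred: "\<And>e. \<lbrakk>e \<in> arcs G; head G e \<in> W\<rbrakk> \<Longrightarrow> tail G e \<in> W"
    and out: "\<And>v. \<lbrakk>v \<in> W; out_arcs G v \<noteq> {}\<rbrakk> \<Longrightarrow> \<exists>e\<in>out_arcs G v. head G e \<in> W"
  shows "leavitt_hom R G R (G \<restriction> W) (\<lambda>x. if x \<in> leavitt_gens (G \<restriction> W) then Gen x else Zero) (\<lambda>a. a)"
proof -
  have "induced_subgraph (G \<restriction> W) G" using W by (rule G.induced_induce)
  then interpret H: fin_digraph "G \<restriction> W"
    by (intro G.fin_digraph_subgraph) blast
  interpret B: leavitt_algebra R "G \<restriction> W" by unfold_locales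
  interpret BL: ring B.L by (rule B.L_ring)
  let ?g = "\<lambda>x. if x \<in> leavitt_gens (G \<restriction> W) then Gen x else Zero"
  have finW: "finite W" using W G.finite_verts by (rule finite_subset)
  have arcW: "e \<in> arcs (G \<restriction> W) \<longleftrightarrow> e \<in> arcs G \<and> head G e \<in> W" for e
    using pred by auto
  have T: "?g x \<in> B.terms" for x by simp
  show ?thesis
  proof
    show "(\<lambda>a. a) \<in> ring_hom R R" by (rule ring_hom_memI) auto
    have "finsum B.L (\<lambda>v. B.cls (?g (Vertex v))) (verts G) = finsum B.L (lvertex R (G \<restriction> W)) (verts (G \<restriction> W))"
      using W G.finite_verts
      by (intro BL.add.finprod_mono_neutral_cong) (auto simp: lvertex_def B.L_zero finW)
    then show "finsum B.L (\<lambda>v. B.cls (?g (Vertex v))) (verts G) = \<one>\<^bsub>B.L\<^esub>"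
      by (simp add: B.L_one)
    show "B.cls (subst_term ?g (\<lambda>a. a) s) = B.cls (subst_term ?g (\<lambda>a. a) t)"
      if "(s, t) \<in> leavitt_rels G" for s t
      using that
    proof cases
      case (V v w)
      then show ?thesis
        using B.vertex_mult[of v w] B.zero_mult[of "B.gn (Vertex w)"] B.mult_zero[of "B.gn (Vertex v)"]
          B.zero_mult[of "B.cls Zero"]
        by (cases "v \<in> W"; cases "w \<in> W") (auto simp: lvertex_def B.L_zero)
    next
      case (E_source e)
      then show ?thesis
        using B.arrow_source[of e] pred B.mult_zero[of "B.gn (Vertex (tail G e))"] B.zero_mult[of "B.cls Zero"]
        by (auto simp: lvertex_def B.L_zero)
    next
      case (E_target e)
      then show ?thesis
        using B.arrow_target[of e] pred B.zero_mult[of "B.gn (Vertex (head G e))"] B.zero_mult[of "B.cls Zero"]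
        by (auto simp: lvertex_def B.L_zero)
    next
      case (E_source_ghost e)
      then show ?thesis
        using B.ghost_source[of e] pred B.mult_zero[of "B.gn (Vertex (head G e))"] B.zero_mult[of "B.cls Zero"]
        by (auto simp: lvertex_def B.L_zero)
    next
      case (E_target_ghost e)
      then show ?thesis
        using B.ghost_target[of e] pred B.zero_mult[of "B.gn (Vertex (tail G e))"] B.zero_mult[of "B.cls Zero"]
        by (auto simp: lvertex_def B.L_zero)
    next
      case (CK1 e f)
      then show ?thesis
        using B.ghost_arrow[of e f] pred B.zero_mult[of "B.gn (Arrow f)"] B.mult_zero[of "B.gn (Ghost e)"]
          B.zero_mult[of "B.cls Zero"]
        by (auto simp: lvertex_def B.L_zero)
    next
      case (CK2 v es)
      let ?t = "\<lambda>e. Times (?g (Arrow e)) (?g (Ghost e))"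
      have zz: "B.cls (Times Zero Zero) = \<zero>\<^bsub>B.L\<^esub>"
        using B.zero_mult[of "B.cls Zero"] by (simp add: B.L_zero)
      have sum: "B.cls (subst_term ?g (\<lambda>a. a) t) = finsum B.L (\<lambda>e. B.cls (?t e)) (out_arcs G v)"
        using CK2 B.cls_sum_term[of es ?t] by (simp add: subst_sum_term comp_def)
      show ?thesis
      proof (cases "v \<in> W")
        case True
        have sub: "out_arcs (G \<restriction> W) v \<subseteq> out_arcs G v" by auto
        have ne: "out_arcs (G \<restriction> W) v \<noteq> {}"
        proof -
          have "out_arcs G v \<noteq> {}" using CK2 by (metis set_empty)
          then obtain e where "e \<in> out_arcs G v" "head G e \<in> W" using out[OF True] by blast
          then have "e \<in> out_arcs (G \<restriction> W) v" using True by (simp add: out_arcs_def)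
          then show ?thesis by blast
        qed
        have "lvertex R (G \<restriction> W) v =
            finsum B.L (\<lambda>e. B.gn (Arrow e) \<otimes>\<^bsub>B.L\<^esub> B.gn (Ghost e)) (out_arcs (G \<restriction> W) v)"
          using True ne by (intro B.vertex_sum) auto
        also have "\<dots> = finsum B.L (\<lambda>e. B.cls (?t e)) (out_arcs G v)"
          using sub G.finite_out_arcs[of v]
          by (intro BL.add.finprod_mono_neutral_cong) (auto simp: zz finite_subset)
        finally show ?thesis unfolding sum using CK2 True by (simp add: lvertex_def)
      next
        case False
        have "finsum B.L (\<lambda>e. B.cls (?t e)) (out_arcs G v) = finsum B.L (\<lambda>e. \<zero>\<^bsub>B.L\<^esub>) (out_arcs G v)"
          using False by (intro BL.finsum_cong') (auto simp: zz)
        also have "\<dots> = \<zero>\<^bsub>B.L\<^esub>" by simp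
        finally show ?thesis unfolding sum using CK2 False by (simp add: B.L_zero)
      qed
    qed
  qed auto
qed

section \<open>Right modules\<close>

context right_module begin

lemma ract_zero_left: "a \<in> carrier A \<Longrightarrow> ract M \<zero>\<^bsub>M\<^esub> a = \<zero>\<^bsub>M\<^esub>"
  by (rule additive_zero[of M M "\<lambda>x. ract M x a"])
    (auto simp: ract_closed ract_l_distr M.abelian_group_axioms)

lemma ract_zero_right: "x \<in> carrier M \<Longrightarrow> ract M x \<zero>\<^bsub>A\<^esub> = \<zero>\<^bsub>M\<^esub>"
  by (rule additive_zero[of A M "ract M x"])
    (auto simp: ract_closed ract_r_distr M.abelian_group_axioms A.abelian_group_axioms)

lemma ract_neg_left: "\<lbrakk>x \<in> carrier M; a \<in> carrier A\<rbrakk> \<Longrightarrow> ract M (\<ominus>\<^bsub>M\<^esub> x) a = \<ominus>\<^bsub>M\<^esub> ract M x a"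
  by (rule additive_neg[of M M "\<lambda>x. ract M x a"])
    (auto simp: ract_closed ract_l_distr M.abelian_group_axioms)

lemma ract_neg_right: "\<lbrakk>x \<in> carrier M; a \<in> carrier A\<rbrakk> \<Longrightarrow> ract M x (\<ominus>\<^bsub>A\<^esub> a) = \<ominus>\<^bsub>M\<^esub> ract M x a"
  by (rule additive_neg[of A M "ract M x"])
    (auto simp: ract_closed ract_r_distr M.abelian_group_axioms A.abelian_group_axioms)

lemma neg_eq_ract: "x \<in> carrier M \<Longrightarrow> \<ominus>\<^bsub>M\<^esub> x = ract M x (\<ominus>\<^bsub>A\<^esub> \<one>\<^bsub>A\<^esub>)"
  by (simp add: ract_neg_right ract_one)

lemma ract_finsum_right:
  "\<lbrakk>finite I; g \<in> I \<rightarrow> carrier A; x \<in> carrier M\<rbrakk> \<Longrightarrow>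
    ract M x (finsum A g I) = finsum M (\<lambda>i. ract M x (g i)) I"
  by (rule additive_finsum[of A M "ract M x"])
    (auto simp: ract_closed ract_r_distr M.abelian_group_axioms A.abelian_group_axioms)

lemma submodule_ofI:
  assumes "N \<subseteq> carrier M" "\<zero>\<^bsub>M\<^esub> \<in> N" "\<And>x y. \<lbrakk>x \<in> N; y \<in> N\<rbrakk> \<Longrightarrow> x \<oplus>\<^bsub>M\<^esub> y \<in> N"
    and "\<And>x a. \<lbrakk>x \<in> N; a \<in> carrier A\<rbrakk> \<Longrightarrow> ract M x a \<in> N"
  shows "submodule_of A M N"
proof -
  have "\<ominus>\<^bsub>M\<^esub> x \<in> N" if "x \<in> N" for x
    using assms(1,4) that by (subst neg_eq_ract) auto
  then have "subgroup N (add_monoid M)"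
    using assms by (intro M.add.subgroupI) auto
  then show ?thesis
    unfolding submodule_of_def additive_subgroup_def using assms(4) by blast
qed

lemma submodule_ofD:
  assumes "submodule_of A M N"
  shows "N \<subseteq> carrier M" "\<zero>\<^bsub>M\<^esub> \<in> N" "\<And>x y. \<lbrakk>x \<in> N; y \<in> N\<rbrakk> \<Longrightarrow> x \<oplus>\<^bsub>M\<^esub> y \<in> N"
    "\<And>x a. \<lbrakk>x \<in> N; a \<in> carrier A\<rbrakk> \<Longrightarrow> ract M x a \<in> N" "\<And>x. x \<in> N \<Longrightarrow> \<ominus>\<^bsub>M\<^esub> x \<in> N"
proof -
  interpret N: additive_subgroup N M using assms by (simp add: submodule_of_def)
  show "N \<subseteq> carrier M" "\<zero>\<^bsub>M\<^esub> \<in> N" "\<And>x y. \<lbrakk>x \<in> N; y \<in> N\<rbrakk> \<Longrightarrow> x \<oplus>\<^bsub>M\<^esub> y \<in> N"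
    using N.a_subset by auto
  show act: "\<And>x a. \<lbrakk>x \<in> N; a \<in> carrier A\<rbrakk> \<Longrightarrow> ract M x a \<in> N"
    using assms by (simp add: submodule_of_def)
  show "\<ominus>\<^bsub>M\<^esub> x \<in> N" if "x \<in> N" for x
    using act[OF that, of "\<ominus>\<^bsub>A\<^esub> \<one>\<^bsub>A\<^esub>"] neg_eq_ract[of x] that N.a_subset by auto
qed

lemma cyclic_submodule: assumes "x \<in> carrier M" shows "submodule_of A M (ract M x ` carrier A)"
proof (rule submodule_ofI)
  show "ract M x ` carrier A \<subseteq> carrier M" using assms ract_closed by auto
  show "\<zero>\<^bsub>M\<^esub> \<in> ract M x ` carrier A"
    using ract_zero_right[OF assms] by (metis A.zero_closed imageI)
  show "y \<oplus>\<^bsub>M\<^esub> z \<in> ract M x ` carrier A"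
    if "y \<in> ract M x ` carrier A" "z \<in> ract M x ` carrier A" for y z
    using that assms by (auto simp: ract_r_distr[symmetric])
  show "ract M y a \<in> ract M x ` carrier A" if "y \<in> ract M x ` carrier A" "a \<in> carrier A" for y a
    using that assms by (auto simp: ract_assoc[symmetric])
qed

lemma simpleI:
  assumes "x \<in> carrier M" "x \<noteq> \<zero>\<^bsub>M\<^esub>"
    and "\<And>y z. \<lbrakk>y \<in> carrier M; y \<noteq> \<zero>\<^bsub>M\<^esub>; z \<in> carrier M\<rbrakk> \<Longrightarrow> \<exists>a\<in>carrier A. z = ract M y a"
  shows "simple_right_module A M"
proof -
  have "N = {\<zero>\<^bsub>M\<^esub>} \<or> N = carrier M" if N: "submodule_of A M N" for N
  proof (cases "N \<subseteq> {\<zero>\<^bsub>M\<^esub>}")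
    case True then show ?thesis using submodule_ofD(2)[OF N] by blast
  next
    case False
    then obtain y where y: "y \<in> N" "y \<noteq> \<zero>\<^bsub>M\<^esub>" by blast
    have "carrier M \<subseteq> N"
      using assms(3)[of y] y submodule_ofD(1,4)[OF N] by blast
    then show ?thesis using submodule_ofD(1)[OF N] by blast
  qed
  then show ?thesis using assms(1,2) right_module_axioms
    unfolding simple_right_module_def by blast
qed

lemma simpleD:
  assumes "simple_right_module A M" "x \<in> carrier M" "x \<noteq> \<zero>\<^bsub>M\<^esub>" "y \<in> carrier M"
  shows "\<exists>a\<in>carrier A. y = ract M x a"
proof -
  have "x \<in> ract M x ` carrier A"
    using ract_one[OF assms(2)] by (metis A.one_closed imageI)
  then have "ract M x ` carrier A = carrier M"
    using assms cyclic_submodule[OF assms(2)] unfolding simple_right_module_def by blast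
  then show ?thesis using assms(4) by blast
qed

end

lemma simple_imp_right_module: "simple_right_module A M \<Longrightarrow> right_module A M"
  by (simp add: simple_right_module_def)

lemma simple_nonzero:
  assumes "simple_right_module A M" shows "\<exists>x\<in>carrier M. x \<noteq> \<zero>\<^bsub>M\<^esub>"
proof -
  interpret right_module A M using assms by (rule simple_imp_right_module)
  show ?thesis using assms M.zero_closed unfolding simple_right_module_def by blast
qed

subsection \<open>Homomorphisms\<close>

definition rmodule_hom ::
  "('a, 'y) ring_scheme \<Rightarrow> ('a, 'm, 'z) rmodule_scheme \<Rightarrow> ('a, 'n, 'w) rmodule_scheme \<Rightarrow> ('m \<Rightarrow> 'n) \<Rightarrow> bool"
  where "rmodule_hom A M N f \<longleftrightarrow> f \<in> carrier M \<rightarrow> carrier N \<and>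
     (\<forall>x\<in>carrier M. \<forall>y\<in>carrier M. f (x \<oplus>\<^bsub>M\<^esub> y) = f x \<oplus>\<^bsub>N\<^esub> f y) \<and>
     (\<forall>x\<in>carrier M. \<forall>a\<in>carrier A. f (ract M x a) = ract N (f x) a)"

lemma rmodule_iso_iff: "rmodule_iso A M N \<longleftrightarrow> (\<exists>f. rmodule_hom A M N f \<and> bij_betw f (carrier M) (carrier N))"
  unfolding rmodule_iso_def rmodule_hom_def by (auto dest: bij_betw_imp_funcset)

lemma rmodule_iso_trans:
  assumes "rmodule_iso A M N" "rmodule_iso A N P" shows "rmodule_iso A M P"
proof -
  obtain f g where f: "rmodule_hom A M N f" "bij_betw f (carrier M) (carrier N)"
    and g: "rmodule_hom A N P g" "bij_betw g (carrier N) (carrier P)"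
    using assms by (auto simp: rmodule_iso_iff)
  have "rmodule_hom A M P (g \<circ> f)"
    using f(1) g(1) by (auto simp: rmodule_hom_def Pi_iff)
  then show ?thesis using bij_betw_trans[OF f(2) g(2)] unfolding rmodule_iso_iff by blast
qed

lemma rmodule_iso_sym:
  assumes "right_module A M" "rmodule_iso A M N" shows "rmodule_iso A N M"
proof -
  interpret right_module A M by fact
  obtain f where f: "rmodule_hom A M N f" "bij_betw f (carrier M) (carrier N)"
    using assms by (auto simp: rmodule_iso_iff)
  let ?g = "inv_into (carrier M) f"
  have g: "?g y \<in> carrier M" "f (?g y) = y" if "y \<in> carrier N" for y
    using f(2) that bij_betw_inv_into_right bij_betw_imp_surj_on inv_into_into by metis+
  have gf: "?g (f x) = x" if "x \<in> carrier M" for x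
    using f(2) that bij_betw_inv_into_left by metis
  have "rmodule_hom A N M ?g"
    unfolding rmodule_hom_def
  proof (intro conjI ballI)
    fix x y assume xy: "x \<in> carrier N" "y \<in> carrier N"
    have "f (?g x \<oplus>\<^bsub>M\<^esub> ?g y) = x \<oplus>\<^bsub>N\<^esub> y" using f(1) xy by (simp add: rmodule_hom_def g)
    then show "?g (x \<oplus>\<^bsub>N\<^esub> y) = ?g x \<oplus>\<^bsub>M\<^esub> ?g y" using gf[of "?g x \<oplus>\<^bsub>M\<^esub> ?g y"] xy g(1) by simp
  next
    fix x a assume x: "x \<in> carrier N" "a \<in> carrier A"
    have "f (ract M (?g x) a) = ract N x a" using f(1) x by (simp add: rmodule_hom_def g)
    then show "?g (ract N x a) = ract M (?g x) a"
      using gf[of "ract M (?g x) a"] x g(1) ract_closed by simp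
  qed (use g in auto)
  then show ?thesis using bij_betw_inv_into[OF f(2)] unfolding rmodule_iso_iff by blast
qed

lemma rmodule_hom_zero:
  assumes "right_module A M" "right_module A N" "rmodule_hom A M N f"
  shows "f \<zero>\<^bsub>M\<^esub> = \<zero>\<^bsub>N\<^esub>"
  using additive_zero[of M N f] assms by (auto simp: rmodule_hom_def right_module_def)

lemma rmodule_hom_inj:
  assumes M: "right_module A M" and N: "right_module A N" and f: "rmodule_hom A M N f"
    and "\<And>x. \<lbrakk>x \<in> carrier M; f x = \<zero>\<^bsub>N\<^esub>\<rbrakk> \<Longrightarrow> x = \<zero>\<^bsub>M\<^esub>"
  shows "inj_on f (carrier M)"
proof (rule inj_onI)
  interpret M: right_module A M by fact
  interpret N: right_module A N by fact
  fix x y assume xy: "x \<in> carrier M" "y \<in> carrier M" "f x = f y"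
  have "f (x \<oplus>\<^bsub>M\<^esub> \<ominus>\<^bsub>M\<^esub> y) = f x \<oplus>\<^bsub>N\<^esub> \<ominus>\<^bsub>N\<^esub> f y"
    using f xy additive_neg[of M N f y]
    by (auto simp: rmodule_hom_def M.M.abelian_group_axioms N.M.abelian_group_axioms)
  also have "\<dots> = \<zero>\<^bsub>N\<^esub>"
    using f xy N.M.r_neg[of "f y"] by (auto simp: rmodule_hom_def)
  finally have "f (x \<oplus>\<^bsub>M\<^esub> \<ominus>\<^bsub>M\<^esub> y) = \<zero>\<^bsub>N\<^esub>" .
  then have "x \<oplus>\<^bsub>M\<^esub> \<ominus>\<^bsub>M\<^esub> y = \<zero>\<^bsub>M\<^esub>" using assms(4) xy by simp
  then show "x = y" using xy by (metis M.M.minus_equality M.M.minus_minus M.M.a_inv_closed)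
qed

lemma schur:
  assumes M: "simple_right_module A M" and N: "simple_right_module A N" and f: "rmodule_hom A M N f"
    and x: "x \<in> carrier M" "f x \<noteq> \<zero>\<^bsub>N\<^esub>"
  shows "bij_betw f (carrier M) (carrier N)"
proof -
  interpret M: right_module A M using M by (rule simple_imp_right_module)
  interpret N: right_module A N using N by (rule simple_imp_right_module)
  have f0: "f \<zero>\<^bsub>M\<^esub> = \<zero>\<^bsub>N\<^esub>"
    using M.right_module_axioms N.right_module_axioms f by (rule rmodule_hom_zero)
  have inj: "inj_on f (carrier M)"
  proof (rule rmodule_hom_inj[OF M.right_module_axioms N.right_module_axioms f], rule ccontr)
    fix y assume y: "y \<in> carrier M" "f y = \<zero>\<^bsub>N\<^esub>" "y \<noteq> \<zero>\<^bsub>M\<^esub>"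
    then obtain a where a: "a \<in> carrier A" "x = ract M y a" using M.simpleD[OF M _ _ x(1)] by blast
    then have "f x = ract N \<zero>\<^bsub>N\<^esub> a" using f y by (simp add: rmodule_hom_def)
    then show False using x a N.ract_zero_left by simp
  qed
  have "z \<in> f ` carrier M" if z: "z \<in> carrier N" for z
  proof -
    have "f x \<in> carrier N" using f x by (auto simp: rmodule_hom_def)
    then obtain a where a: "a \<in> carrier A" "z = ract N (f x) a" using N.simpleD[OF N _ _ z] x(2) by blast
    then have "z = f (ract M x a)" using f x by (simp add: rmodule_hom_def)
    then show ?thesis using x a M.ract_closed by blast
  qed
  moreover have "f ` carrier M \<subseteq> carrier N" using f by (auto simp: rmodule_hom_def)
  ultimately show ?thesis using inj by (auto simp: bij_betw_def)
qed

lemma simple_if_iso: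
  assumes M: "simple_right_module A M" and N: "right_module A N" and iso: "rmodule_iso A M N"
  shows "simple_right_module A N"
proof -
  interpret M: right_module A M using M by (rule simple_imp_right_module)
  interpret N: right_module A N by (rule N)
  obtain f where f: "rmodule_hom A M N f" "bij_betw f (carrier M) (carrier N)"
    using iso by (auto simp: rmodule_iso_iff)
  have f0: "f \<zero>\<^bsub>M\<^esub> = \<zero>\<^bsub>N\<^esub>"
    using M.right_module_axioms N f(1) by (rule rmodule_hom_zero)
  obtain x where x: "x \<in> carrier M" "x \<noteq> \<zero>\<^bsub>M\<^esub>" using simple_nonzero[OF M] by blast
  show ?thesis
  proof (rule N.simpleI)
    show "f x \<in> carrier N" using f(1) x by (auto simp: rmodule_hom_def)
    show "f x \<noteq> \<zero>\<^bsub>N\<^esub>" using f(2) x f0 M.M.zero_closed by (metis bij_betw_inv_into_left)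
    fix y z assume y: "y \<in> carrier N" "y \<noteq> \<zero>\<^bsub>N\<^esub>" and z: "z \<in> carrier N"
    have N: "carrier N = f ` carrier M" using f(2) by (simp add: bij_betw_def)
    obtain y' z' where yz: "y' \<in> carrier M" "y = f y'" "z' \<in> carrier M" "z = f z'"
      using y(1) z unfolding N by blast
    moreover have "y' \<noteq> \<zero>\<^bsub>M\<^esub>" using y(2) yz(2) f0 by blast
    moreover note yz = calculation
    then obtain a where "a \<in> carrier A" "z' = ract M y' a" using M.simpleD[OF M] by metis
    then show "\<exists>a\<in>carrier A. z = ract N y a" using yz f(1) by (auto simp: rmodule_hom_def)
  qed
qed

subsection \<open>Constructions\<close>

definition sub_module :: "('a, 'm, 'z) rmodule_scheme \<Rightarrow> 'm set \<Rightarrow> ('a, 'm) rmodule" where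
  "sub_module M N = \<lparr>carrier = N, monoid.mult = undefined, one = undefined,
     ring.zero = \<zero>\<^bsub>M\<^esub>, add = add M, ract = ract M\<rparr>"

lemma sub_module_simps [simp]:
  "carrier (sub_module M N) = N" "\<zero>\<^bsub>sub_module M N\<^esub> = \<zero>\<^bsub>M\<^esub>"
  "add (sub_module M N) = add M" "ract (sub_module M N) = ract M"
  by (simp_all add: sub_module_def)

lemma (in right_module) right_module_sub_module:
  assumes "submodule_of A M N" shows "right_module A (sub_module M N)"
proof -
  note D = submodule_ofD[OF assms]
  interpret S: abelian_group "sub_module M N"
  proof (rule abelian_groupI)
    fix x assume "x \<in> carrier (sub_module M N)"
    then show "\<exists>y\<in>carrier (sub_module M N). y \<oplus>\<^bsub>sub_module M N\<^esub> x = \<zero>\<^bsub>sub_module M N\<^esub>"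
      using D(1) D(5)[of x] by (intro bexI[of _ "\<ominus>\<^bsub>M\<^esub> x"]) (auto simp: M.l_neg)
  qed (use D(1) in \<open>auto simp: D subset_iff M.a_ac\<close>)
  show ?thesis
    by unfold_locales
      (use D in \<open>auto simp: subset_iff ract_l_distr ract_r_distr ract_assoc ract_one\<close>)
qed

definition prod_module ::
  "('a, 'm, 'z) rmodule_scheme \<Rightarrow> ('a, 'n, 'w) rmodule_scheme \<Rightarrow> ('a, 'm \<times> 'n) rmodule" where
  "prod_module M N = \<lparr>carrier = carrier M \<times> carrier N, monoid.mult = undefined, one = undefined,
     ring.zero = (\<zero>\<^bsub>M\<^esub>, \<zero>\<^bsub>N\<^esub>), add = (\<lambda>x y. (fst x \<oplus>\<^bsub>M\<^esub> fst y, snd x \<oplus>\<^bsub>N\<^esub> snd y)),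
     ract = (\<lambda>x a. (ract M (fst x) a, ract N (snd x) a))\<rparr>"

lemma prod_module_simps [simp]:
  "carrier (prod_module M N) = carrier M \<times> carrier N"
  "\<zero>\<^bsub>prod_module M N\<^esub> = (\<zero>\<^bsub>M\<^esub>, \<zero>\<^bsub>N\<^esub>)"
  "x \<oplus>\<^bsub>prod_module M N\<^esub> y = (fst x \<oplus>\<^bsub>M\<^esub> fst y, snd x \<oplus>\<^bsub>N\<^esub> snd y)"
  "ract (prod_module M N) x a = (ract M (fst x) a, ract N (snd x) a)"
  by (simp_all add: prod_module_def)

lemma right_module_prod_module:
  assumes "right_module A M" "right_module A N" shows "right_module A (prod_module M N)"
proof -
  interpret M: right_module A M by fact
  interpret N: right_module A N by fact
  interpret S: abelian_group "prod_module M N"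
  proof (rule abelian_groupI)
    fix x assume "x \<in> carrier (prod_module M N)"
    then show "\<exists>y\<in>carrier (prod_module M N). y \<oplus>\<^bsub>prod_module M N\<^esub> x = \<zero>\<^bsub>prod_module M N\<^esub>"
      by (intro bexI[of _ "(\<ominus>\<^bsub>M\<^esub> fst x, \<ominus>\<^bsub>N\<^esub> snd x)"]) (auto simp: M.M.l_neg N.M.l_neg)
  qed (auto simp: M.M.a_ac N.M.a_ac)
  show ?thesis
    by unfold_locales
      (auto simp: M.ract_closed N.ract_closed M.ract_l_distr M.ract_r_distr M.ract_assoc M.ract_one
        N.ract_l_distr N.ract_r_distr N.ract_assoc N.ract_one)
qed

text \<open>Transport of structure along a map that is injective on the carrier.\<close>

definition image_module :: "('a, 'm, 'z) rmodule_scheme \<Rightarrow> ('m \<Rightarrow> 'n) \<Rightarrow> ('a, 'n) rmodule" where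
  "image_module M j = (let i = inv_into (carrier M) j in
    \<lparr>carrier = j ` carrier M, monoid.mult = undefined, one = undefined,
     ring.zero = j \<zero>\<^bsub>M\<^esub>, add = (\<lambda>x y. j (i x \<oplus>\<^bsub>M\<^esub> i y)), ract = (\<lambda>x a. j (ract M (i x) a))\<rparr>)"

lemma (in right_module) image_module:
  assumes j: "inj_on j (carrier M)"
  shows "right_module A (image_module M j)" "rmodule_iso A M (image_module M j)"
proof -
  let ?N = "image_module M j"
  have N: "carrier ?N = j ` carrier M" "\<zero>\<^bsub>?N\<^esub> = j \<zero>\<^bsub>M\<^esub>"
    "\<And>x y. \<lbrakk>x \<in> carrier M; y \<in> carrier M\<rbrakk> \<Longrightarrow> j x \<oplus>\<^bsub>?N\<^esub> j y = j (x \<oplus>\<^bsub>M\<^esub> y)"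
    "\<And>x a. x \<in> carrier M \<Longrightarrow> ract ?N (j x) a = j (ract M x a)"
    using j by (simp_all add: image_module_def Let_def)
  interpret S: abelian_group ?N
  proof (rule abelian_groupI)
    fix x assume "x \<in> carrier ?N"
    then obtain x' where "x' \<in> carrier M" "x = j x'" by (auto simp: N)
    then show "\<exists>y\<in>carrier ?N. y \<oplus>\<^bsub>?N\<^esub> x = \<zero>\<^bsub>?N\<^esub>"
      by (intro bexI[of _ "j (\<ominus>\<^bsub>M\<^esub> x')"]) (auto simp: N M.l_neg)
  qed (auto simp: N M.a_ac)
  show "right_module A ?N"
    by unfold_locales
      (auto simp: N ract_closed ract_l_distr ract_r_distr ract_assoc ract_one)
  show "rmodule_iso A M ?N"
    unfolding rmodule_iso_def using j by (intro exI[of _ j]) (auto simp: N bij_betw_def)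
qed

text \<open>
  A simple module is generated by any nonzero \<open>x\<close>. An element \<open>y\<close> is therefore determined by the
  nonempty set of all \<open>a\<close> with \<open>y = x a\<close>, and these sets carry a copy of the module.
\<close>

lemma simple_coset_copy:
  fixes A :: "('a, 'y) ring_scheme" and M :: "('a, 'm, 'z) rmodule_scheme"
  assumes "simple_right_module A M"
  shows "\<exists>N :: 'a coset_module. simple_right_module A N \<and> rmodule_iso A M N"
proof -
  interpret right_module A M using assms by (rule simple_imp_right_module)
  obtain x where x: "x \<in> carrier M" "x \<noteq> \<zero>\<^bsub>M\<^esub>" using simple_nonzero[OF assms] by blast
  define j where "j y = {a \<in> carrier A. ract M x a = y}" for y
  have "inj_on j (carrier M)"
  proof (rule inj_onI)
    fix y z assume "y \<in> carrier M" "z \<in> carrier M" "j y = j z"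
    moreover then obtain a where "a \<in> carrier A" "y = ract M x a" using simpleD[OF assms x] by metis
    ultimately show "y = z" unfolding j_def by blast
  qed
  from image_module[OF this] show ?thesis using simple_if_iso[OF assms] by blast
qed

lemma right_ideal_module_simps [simp]:
  "carrier (right_ideal_module B h w) = (\<lambda>x. w \<otimes>\<^bsub>B\<^esub> x) ` carrier B"
  "\<zero>\<^bsub>right_ideal_module B h w\<^esub> = \<zero>\<^bsub>B\<^esub>"
  "add (right_ideal_module B h w) = add B"
  "ract (right_ideal_module B h w) x a = x \<otimes>\<^bsub>B\<^esub> h a"
  by (simp_all add: right_ideal_module_def)

lemma right_module_right_ideal_module:
  assumes "ring A" "ring B" "h \<in> ring_hom A B" "w \<in> carrier B"
  shows "right_module A (right_ideal_module B h w)"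
proof -
  interpret A: ring A by fact
  interpret B: ring B by fact
  let ?M = "right_ideal_module B h w"
  have c: "x \<in> carrier ?M \<Longrightarrow> x \<in> carrier B" for x using assms(4) by auto
  interpret M: abelian_group ?M
  proof (rule abelian_groupI)
    fix x y assume "x \<in> carrier ?M" "y \<in> carrier ?M"
    then show "x \<oplus>\<^bsub>?M\<^esub> y \<in> carrier ?M"
      using assms(4) by (auto simp: B.r_distr[symmetric])
  next
    show "\<zero>\<^bsub>?M\<^esub> \<in> carrier ?M" using assms(4) by (auto intro!: image_eqI[of _ _ "\<zero>\<^bsub>B\<^esub>"])
  next
    fix x assume "x \<in> carrier ?M"
    then obtain z where "z \<in> carrier B" "x = w \<otimes>\<^bsub>B\<^esub> z" by auto
    then have "w \<otimes>\<^bsub>B\<^esub> (\<ominus>\<^bsub>B\<^esub> z) \<oplus>\<^bsub>B\<^esub> x = \<zero>\<^bsub>B\<^esub>" "w \<otimes>\<^bsub>B\<^esub> (\<ominus>\<^bsub>B\<^esub> z) \<in> carrier ?M"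
      using assms(4) B.r_distr[of "\<ominus>\<^bsub>B\<^esub> z" z w] by (simp_all add: B.l_neg del: B.r_minus)
    then show "\<exists>y\<in>carrier ?M. y \<oplus>\<^bsub>?M\<^esub> x = \<zero>\<^bsub>?M\<^esub>" by auto
  qed (use assms(4) in \<open>auto simp: B.a_ac\<close>)
  show ?thesis
    by unfold_locales
      (use assms(4) in \<open>auto simp: ring_hom_closed[OF assms(3)] ring_hom_add[OF assms(3)]
        ring_hom_mult[OF assms(3)] ring_hom_one[OF assms(3)] B.m_assoc B.l_distr B.r_distr\<close>)
qed

lemma (in right_module) right_module_quotient_module:
  assumes N: "submodule_of A M N"
  shows "right_module A (quotient_module M N)"
    and "\<And>x a. \<lbrakk>x \<in> carrier M; a \<in> carrier A\<rbrakk> \<Longrightarrow> ract (quotient_module M N) (N +>\<^bsub>M\<^esub> x) a = N +>\<^bsub>M\<^esub> ract M x a"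
    and "\<And>x y. \<lbrakk>x \<in> carrier M; y \<in> carrier M\<rbrakk> \<Longrightarrow>
      (N +>\<^bsub>M\<^esub> x) \<oplus>\<^bsub>quotient_module M N\<^esub> (N +>\<^bsub>M\<^esub> y) = N +>\<^bsub>M\<^esub> (x \<oplus>\<^bsub>M\<^esub> y)"
    and "carrier (quotient_module M N) = (\<lambda>x. N +>\<^bsub>M\<^esub> x) ` carrier M"
    and "\<zero>\<^bsub>quotient_module M N\<^esub> = N"
    and "\<And>x. x \<in> carrier M \<Longrightarrow> N +>\<^bsub>M\<^esub> x = N \<longleftrightarrow> x \<in> N"
proof -
  let ?Q = "quotient_module M N"
  interpret N: additive_subgroup N M using N by (simp add: submodule_of_def)
  interpret N: abelian_subgroup N M
    by (rule abelian_subgroupI3) (rule N.additive_subgroup_axioms M.abelian_group_axioms)+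
  note D = submodule_ofD[OF N]
  show add: "(N +>\<^bsub>M\<^esub> x) \<oplus>\<^bsub>?Q\<^esub> (N +>\<^bsub>M\<^esub> y) = N +>\<^bsub>M\<^esub> (x \<oplus>\<^bsub>M\<^esub> y)"
    if "x \<in> carrier M" "y \<in> carrier M" for x y
    using that by (simp add: quotient_module_def N.a_rcos_sum)
  show car: "carrier ?Q = (\<lambda>x. N +>\<^bsub>M\<^esub> x) ` carrier M"
    by (auto simp: quotient_module_def A_RCOSETS_def')
  show zero: "\<zero>\<^bsub>?Q\<^esub> = N" by (simp add: quotient_module_def)
  show mem: "N +>\<^bsub>M\<^esub> x = N \<longleftrightarrow> x \<in> N" if "x \<in> carrier M" for x
    using that N.a_rcos_const N.a_rcos_self by metis
  show act: "ract ?Q (N +>\<^bsub>M\<^esub> x) a = N +>\<^bsub>M\<^esub> ract M x a" if x: "x \<in> carrier M" "a \<in> carrier A" for x a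
  proof -
    have "N +>\<^bsub>M\<^esub> ract M y a = N +>\<^bsub>M\<^esub> ract M x a" if "y \<in> N +>\<^bsub>M\<^esub> x" for y
    proof -
      obtain n where n: "n \<in> N" "y = n \<oplus>\<^bsub>M\<^esub> x" using \<open>y \<in> N +>\<^bsub>M\<^esub> x\<close> by (auto simp: a_r_coset_def')
      have nM: "n \<in> carrier M" using n D(1) by blast
      have "ract M y a = ract M n a \<oplus>\<^bsub>M\<^esub> ract M x a" using n nM x by (simp add: ract_l_distr)
      then have "ract M y a \<in> N +>\<^bsub>M\<^esub> ract M x a"
        using D(4)[OF n(1) x(2)] by (auto simp: a_r_coset_def')
      then show ?thesis using x ract_closed M.a_repr_independence[OF _ _ N.a_subgroup] by metis
    qed
    then have "(\<Union>y\<in>N +>\<^bsub>M\<^esub> x. N +>\<^bsub>M\<^esub> ract M y a) = (\<Union>y\<in>N +>\<^bsub>M\<^esub> x. N +>\<^bsub>M\<^esub> ract M x a)"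
      by (intro SUP_cong) simp_all
    moreover have "N +>\<^bsub>M\<^esub> x \<noteq> {}" using x N.a_rcos_self by blast
    ultimately show ?thesis by (simp add: quotient_module_def)
  qed
  interpret Q: abelian_group ?Q
  proof (rule abelian_groupI)
    fix X assume "X \<in> carrier ?Q"
    then obtain x where "x \<in> carrier M" "X = N +>\<^bsub>M\<^esub> x" by (auto simp: car)
    then show "\<exists>Y\<in>carrier ?Q. Y \<oplus>\<^bsub>?Q\<^esub> X = \<zero>\<^bsub>?Q\<^esub>"
      using mem[of "\<zero>\<^bsub>M\<^esub>"] D(2) by (intro bexI[of _ "N +>\<^bsub>M\<^esub> (\<ominus>\<^bsub>M\<^esub> x)"]) (simp_all add: car add zero M.l_neg)
  next
    have z: "N = N +>\<^bsub>M\<^esub> \<zero>\<^bsub>M\<^esub>" using mem[of "\<zero>\<^bsub>M\<^esub>"] D(2) by simp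
    show "\<zero>\<^bsub>?Q\<^esub> \<in> carrier ?Q" unfolding car zero using z M.zero_closed by (rule image_eqI)
    show "\<zero>\<^bsub>?Q\<^esub> \<oplus>\<^bsub>?Q\<^esub> X = X" if X: "X \<in> carrier ?Q" for X
    proof -
      obtain x where "x \<in> carrier M" "X = N +>\<^bsub>M\<^esub> x" using X by (auto simp: car)
      then show ?thesis using add[of "\<zero>\<^bsub>M\<^esub>" x] z by (simp add: zero)
    qed
  qed (auto simp: car add M.a_ac)
  show "right_module A ?Q"
    by unfold_locales
      (auto simp: car add act ract_closed ract_l_distr ract_r_distr ract_assoc ract_one)
qed

section \<open>First arrivals and returns\<close>

context pre_digraph begin

text \<open>
  Paths are lists of arrows. The empty list does not tell its vertex; here it stands for the
  path of length \<open>0\<close> at \<open>v\<close>. Arrivals visit \<open>v\<close> only at their end, and returns only at both ends.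
\<close>

definition path_source :: "'a \<Rightarrow> 'b list \<Rightarrow> 'a" where
  "path_source v q = (if q = [] then v else tail G (hd q))"

definition arrivals :: "'a \<Rightarrow> 'b list set" where
  "arrivals v = {q. awalk (path_source v q) q v \<and> v \<notin> tail G ` set q}"

definition returns :: "'a \<Rightarrow> 'b list set" where
  "returns v = {e # q | e q. e \<in> arcs G \<and> tail G e = v \<and> q \<in> arrivals v \<and> path_source v q = head G e}"

end

context wf_digraph begin

lemma path_source_simps [simp]: "path_source v [] = v" "path_source v (e # q) = tail G e"
  by (simp_all add: path_source_def)

lemma path_source_awalk: "awalk u q v \<Longrightarrow> path_source v q = u"
  by (cases q) (auto simp: awalk_Nil_iff awalk_Cons_iff)

lemma Nil_arrivals [simp]: "[] \<in> arrivals v \<longleftrightarrow> v \<in> verts G"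
  by (simp add: arrivals_def awalk_Nil_iff)

lemma Cons_arrivals_iff:
  "e # q \<in> arrivals v \<longleftrightarrow> e \<in> arcs G \<and> tail G e \<noteq> v \<and> q \<in> arrivals v \<and> path_source v q = head G e"
  by (auto simp: arrivals_def awalk_Cons_iff path_source_awalk)

lemma path_source_in_verts: "q \<in> arrivals v \<Longrightarrow> path_source v q \<in> verts G"
  by (auto simp: arrivals_def dest: awalk_hd_in_verts)

lemma arrivals_arcs: "q \<in> arrivals v \<Longrightarrow> set q \<subseteq> arcs G"
  by (auto simp: arrivals_def)

lemma path_source_predecessors: "q \<in> arrivals v \<Longrightarrow> path_source v q \<in> predecessors G v"
  using path_source_in_verts by (auto simp: arrivals_def predecessors_def)

text \<open>A path to \<open>v\<close> is cut at its first visit to \<open>v\<close>.\<close>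

lemma ex_arrival:
  assumes "awalk u p v" shows "\<exists>q\<in>arrivals v. path_source v q = u"
  using assms
proof (induction p arbitrary: u)
  case Nil then show ?case by (auto simp: awalk_Nil_iff intro!: bexI[of _ "[]"])
next
  case (Cons e p)
  then have *: "e \<in> arcs G" "u = tail G e" "awalk (head G e) p v" by (auto simp: awalk_Cons_iff)
  show ?case
  proof (cases "u = v")
    case True
    then show ?thesis using Cons.prems by (intro bexI[of _ "[]"]) (auto dest: awalk_hd_in_verts)
  next
    case False
    obtain q where "q \<in> arrivals v" "path_source v q = head G e"
      using Cons.IH[OF *(3)] by blast
    then show ?thesis using * False by (intro bexI[of _ "e # q"]) (auto simp: Cons_arrivals_iff)
  qed
qed

lemma predecessors_iff: "u \<in> predecessors G v \<longleftrightarrow> (\<exists>q\<in>arrivals v. path_source v q = u)"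
proof
  assume "u \<in> predecessors G v"
  then obtain p where "awalk u p v" by (auto simp: predecessors_def)
  then show "\<exists>q\<in>arrivals v. path_source v q = u" by (rule ex_arrival)
qed (auto dest: path_source_predecessors)

lemma predecessors_self [simp]: "v \<in> predecessors G v \<longleftrightarrow> v \<in> verts G"
  by (auto simp: predecessors_def awalk_Nil_iff intro: exI[of _ "[]"])

lemma predecessors_subset: "predecessors G v \<subseteq> verts G"
  by (auto simp: predecessors_def)

lemma predecessorsI: "awalk u p v \<Longrightarrow> u \<in> predecessors G v"
  unfolding predecessors_def using awalk_hd_in_verts by blast

lemma predecessorsE:
  assumes "u \<in> predecessors G v" obtains p where "awalk u p v"
  using assms unfolding predecessors_def by blast

lemma predecessors_trans:
  assumes "u \<in> predecessors G v" "v \<in> predecessors G w" shows "u \<in> predecessors G w"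
proof -
  obtain p q where "awalk u p v" "awalk v q w" using assms by (metis predecessorsE)
  then have "awalk u (p @ q) w" by (rule awalk_appendI)
  then show ?thesis by (rule predecessorsI)
qed

lemma predecessors_arc:
  assumes "e \<in> arcs G" "head G e \<in> predecessors G v" shows "tail G e \<in> predecessors G v"
proof -
  obtain p where "awalk (head G e) p v" using assms(2) by (rule predecessorsE)
  then have "awalk (tail G e) (e # p) v" using assms(1) by (simp add: awalk_Cons_iff)
  then show ?thesis by (rule predecessorsI)
qed

text \<open>
  If \<open>v\<close> could still be reached after leaving \<open>c\<close> by another arrow \<open>f\<close>, then the initial part of \<open>c\<close>,
  followed by \<open>f\<close> and an arrival, would be a second return.
\<close>

lemma return_deterministic:
  assumes ret: "returns v = {c}" and c: "c = c1 @ e # c2"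
    and f: "f \<in> arcs G" "tail G f = tail G e" "head G f \<in> predecessors G v"
  shows "f = e"
proof -
  obtain q where q: "q \<in> arrivals v" "path_source v q = head G f"
    using f(3) by (auto simp: predecessors_iff)
  have c_ret: "c \<in> returns v" using ret by simp
  show ?thesis
  proof (cases c1)
    case Nil
    then have "tail G f = v" using c_ret c f by (auto simp: returns_def)
    then have "f # q \<in> returns v" using f q by (auto simp: returns_def)
    then show ?thesis using ret c Nil by auto
  next
    case (Cons e1 c1')
    then have arr: "e1 \<in> arcs G" "tail G e1 = v" "c1' @ e # c2 \<in> arrivals v"
        "path_source v (c1' @ e # c2) = head G e1"
      using c_ret c by (auto simp: returns_def)
    have "d @ f # q \<in> arrivals v \<and> path_source v (d @ f # q) = path_source v (d @ e # c2)"
      if "d @ e # c2 \<in> arrivals v" for d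
      using that
    proof (induction d)
      case Nil then show ?case using f q by (simp add: Cons_arrivals_iff)
    next
      case (Cons e' d)
      then show ?case by (simp add: Cons_arrivals_iff)
    qed
    from this[OF arr(3)] arr have "c1 @ f # q \<in> returns v"
      using Cons by (auto simp: returns_def)
    then show ?thesis using ret c by auto
  qed
qed

end

section \<open>Disjoint cycles\<close>

lemma cycles_eqI:
  assumes "C \<in> cycles G" "p \<in> C" shows "C = range (\<lambda>n. rotate n p)"
proof -
  obtain p' where C: "C = range (\<lambda>n. rotate n p')" using assms(1) by (auto simp: cycles_def)
  then obtain n where n: "p = rotate n p'" using assms(2) by auto
  have "rotate m p' \<in> range (\<lambda>n. rotate n p)" for m
  proof -
    let ?l = "length p'"
    have "rotate (m + n * (?l - 1)) p = rotate (m + n * ?l) p'"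
      by (cases ?l) (auto simp: n rotate_rotate algebra_simps)
    also have "\<dots> = rotate m p'"
      by (metis mod_mult_self2 mult.commute rotate_conv_mod)
    finally show ?thesis by (metis rangeI)
  qed
  moreover have "rotate m p \<in> C" for m by (auto simp: C n rotate_rotate)
  ultimately show ?thesis unfolding C by blast
qed

lemma cycle_verts_eq:
  assumes "C \<in> cycles G" "p \<in> C" shows "cycle_verts G C = tail G ` set p"
  unfolding cycle_verts_def cycles_eqI[OF assms] by auto

lemma ex_rotate_to:
  assumes "e \<in> set p" shows "\<exists>n q. rotate n p = e # q"
proof -
  obtain a b where "p = a @ e # b" using assms by (metis split_list)
  then have "rotate (length a) p = e # b @ a" by (simp add: rotate_append)
  then show ?thesis by blast
qed

context wf_digraph begin

lemma closed_awalk_rotate1: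
  assumes "awalk u p u" "p \<noteq> []" shows "\<exists>u. awalk u (rotate1 p) u"
proof -
  obtain e q where p: "p = e # q" using assms(2) by (cases p) auto
  then have "e \<in> arcs G" "u = tail G e" "awalk (head G e) q u" using assms by (auto simp: awalk_Cons_iff)
  then have "awalk (head G e) (q @ [e]) (head G e)"
    by (intro awalk_appendI[of _ q "tail G e"]) (auto simp: arc_implies_awalk)
  then show ?thesis by (auto simp: p)
qed

lemma cycle_rotate: "cycle p \<Longrightarrow> cycle (rotate n p)"
proof (induction n)
  case (Suc n)
  then show ?case
    using closed_awalk_rotate1[of _ "rotate n p"]
    unfolding cycle_iff_distinct_sources by (auto simp: rotate1_map[symmetric])
qed simp

lemma cycles_cycle: assumes "C \<in> cycles G" "p \<in> C" shows "cycle p"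
proof -
  obtain p' where "C = range (\<lambda>n. rotate n p')" "cycle p'" using assms(1) by (auto simp: cycles_def)
  then show ?thesis using assms(2) cycle_rotate by auto
qed

text \<open>
  The sources of the arrows of a cycle are distinct, so exactly one of its rotations begins at
  \<open>v\<close>.
\<close>

lemma cycle_at_spec:
  assumes C: "C \<in> cycles G" and v: "v \<in> cycle_verts G C"
  shows "cycle_at G C v \<in> C \<and> tail G (hd (cycle_at G C v)) = v"
proof -
  obtain p where p: "p \<in> C" using C by (auto simp: cycles_def)
  then obtain e where "e \<in> set p" "tail G e = v" using v cycle_verts_eq[OF C] by auto
  then obtain n q where r: "rotate n p = e # q" using ex_rotate_to by metis
  have rC: "e # q \<in> C" using cycles_eqI[OF C p] r by (metis rangeI)
  have uniq: "p' = e # q" if "p' \<in> C" "tail G (hd p') = v" for p'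
  proof -
    have "p' \<in> range (\<lambda>n. rotate n (e # q))" using that cycles_eqI[OF C rC] by simp
    then obtain m where m: "p' = rotate m (e # q)" by auto
    let ?l = "length (e # q)"
    have "hd p' = (e # q) ! (m mod ?l)" unfolding m by (rule hd_rotate_conv_nth) simp
    moreover have "distinct (map (tail G) (e # q))"
      using cycles_cycle[OF C rC] by (simp add: cycle_iff_distinct_sources)
    moreover have "map (tail G) (e # q) ! (m mod ?l) = map (tail G) (e # q) ! 0"
      using calculation(1) that(2) \<open>tail G e = v\<close> by (subst nth_map) simp_all
    ultimately have "m mod ?l = 0"
      by (subst (asm) nth_eq_iff_index_eq) auto
    then show ?thesis unfolding m by (metis rotate0 id_apply rotate_conv_mod)
  qed
  have "cycle_at G C v = e # q"
    unfolding cycle_at_def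
  proof (rule the_equality)
    show "e # q \<in> C \<and> tail G (hd (e # q)) = v" using rC \<open>tail G e = v\<close> by simp
  qed (rule uniq, simp_all)
  then show ?thesis using rC \<open>tail G e = v\<close> by simp
qed

text \<open>
  Once loops are removed from \<open>w\<close>, no vertex is repeated on it, and \<open>e\<close> closes it to a cycle.
\<close>

lemma ex_cycle_through_arc:
  assumes e: "e \<in> arcs G" "awalk (head G e) w (tail G e)"
  shows "\<exists>q. cycle (e # q)"
proof -
  define q where "q = awalk_to_apath w"
  have q: "apath (head G e) q (tail G e)"
    unfolding q_def using e(2) by (rule apath_awalk_to_apath)
  have aw: "awalk (tail G e) (e # q) (tail G e)"
    using q e(1) by (auto simp: awalk_Cons_iff apath_def)
  have "distinct (map (tail G) (e # q))"
  proof (cases "q = []")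
    case False
    have "distinct (awalk_verts (head G e) q)" "last (awalk_verts (head G e) q) = tail G e"
      using q by (auto simp: apath_def)
    with False show ?thesis by (auto simp: awalk_verts_conv)
  qed simp
  then show ?thesis using aw by (auto simp: cycle_iff_distinct_sources)
qed

text \<open>
  The arrow lies on some cycle, which meets \<open>C\<close> in the source of the arrow and hence is \<open>C\<close>.
\<close>

lemma arc_on_cycle:
  assumes disj: "disjoint_cycles G" and C: "C \<in> cycles G" and p: "p \<in> C"
    and e: "e \<in> arcs G" "tail G e \<in> tail G ` set p" "awalk (head G e) w (tail G e)"
  shows "e \<in> set p"
proof -
  obtain q where cyc: "cycle (e # q)" using ex_cycle_through_arc[OF e(1,3)] by blast
  let ?D = "range (\<lambda>n. rotate n (e # q))"
  have D: "?D \<in> cycles G" using cyc by (auto simp: cycles_def)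
  have mem: "e # q \<in> ?D" by (rule range_eqI[of _ _ 0]) simp
  have "tail G e \<in> cycle_verts G ?D" using cycle_verts_eq[OF D mem] by simp
  moreover have "tail G e \<in> cycle_verts G C" using cycle_verts_eq[OF C p] e(2) by simp
  ultimately have "C = ?D"
    using disj C D unfolding disjoint_cycles_def pairwise_def disjnt_def by (metis disjoint_iff)
  then obtain n where "p = rotate n (e # q)" using p by auto
  then show ?thesis by simp
qed

lemma cycle_awalk: assumes "cycle p" shows "awalk (tail G (hd p)) p (tail G (hd p))"
proof -
  obtain u where u: "awalk u p u" "p \<noteq> []" using assms by (auto simp: cycle_iff_distinct_sources)
  then show ?thesis by (cases p) (auto simp: awalk_Cons_iff)
qed

lemma cycle_reachable:
  assumes "cycle p" "e \<in> set p" shows "\<exists>w. awalk (tail G (hd p)) w (tail G e)" "\<exists>w. awalk (head G e) w (tail G (hd p))"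
proof -
  obtain a b where "p = a @ e # b" using assms(2) by (metis split_list)
  then show "\<exists>w. awalk (tail G (hd p)) w (tail G e)" "\<exists>w. awalk (head G e) w (tail G (hd p))"
    using cycle_awalk[OF assms(1)] by (auto simp: awalk_Cons_iff)
qed

text \<open>
  All arrows of a return lie on \<open>C\<close> by \<open>arc_on_cycle\<close>, and \<open>C\<close> has only one arrow at each of its
  vertices.
\<close>

lemma returns_cycle:
  assumes disj: "disjoint_cycles G" and C: "C \<in> cycles G" and v: "v \<in> cycle_verts G C"
  shows "returns v = {cycle_at G C v}"
proof -
  define c where "c = cycle_at G C v"
  have c: "c \<in> C" "tail G (hd c) = v" using cycle_at_spec[OF C v] by (auto simp: c_def)
  have cyc: "cycle c" using cycles_cycle[OF C c(1)] .
  then obtain e r where er: "c = e # r" by (cases c) (auto simp: cycle_iff_distinct_sources)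
  have dist: "distinct (map (tail G) c)" using cyc by (simp add: cycle_iff_distinct_sources)
  have aw: "awalk v c v" using cycle_awalk[OF cyc] c(2) by simp
  have r: "r \<in> arrivals v" "path_source v r = head G e"
    using aw dist er by (auto simp: arrivals_def awalk_Cons_iff path_source_awalk)
  have "c \<in> returns v" using aw er r by (auto simp: returns_def awalk_Cons_iff)
  moreover have "d = c" if d: "d \<in> returns v" for d
  proof -
    have unique: "q = q'"
      if "q \<in> arrivals v" "q' \<in> arrivals v" "path_source v q = path_source v q'" "set q' \<subseteq> set c" for q q'
      using that
    proof (induction q' arbitrary: q)
      case Nil
      then show ?case by (cases q) (auto simp: Cons_arrivals_iff)
    next
      case (Cons f q')
      then obtain f' q1 where q: "q = f' # q1" by (cases q) (auto simp: Cons_arrivals_iff)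
      have f: "f \<in> set c" "tail G f' = tail G f" "f' \<in> arcs G" using Cons.prems q by (auto simp: Cons_arrivals_iff)
      have w: "awalk (head G f') q1 v"
        using Cons.prems(1) q by (auto simp: arrivals_def awalk_Cons_iff)
      obtain w' where "awalk v w' (tail G f)" using cycle_reachable(1)[OF cyc f(1)] c(2) by auto
      with w have "f' \<in> set c"
      proof -
        have "awalk (head G f') (q1 @ w') (tail G f')"
          using awalk_appendI[OF w \<open>awalk v w' (tail G f)\<close>] f(2) by simp
        moreover have "tail G f' \<in> tail G ` set c" using f(1,2) by simp
        ultimately show ?thesis using arc_on_cycle[OF disj C c(1) f(3)] by metis
      qed
      then have "f' = f" using f(1,2) dist by (metis (no_types, opaque_lifting) distinct_map inj_onD)
      then show ?case using Cons q by (auto simp: Cons_arrivals_iff)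
    qed
    obtain e' q where eq: "d = e' # q" "e' \<in> arcs G" "tail G e' = v" "q \<in> arrivals v" "path_source v q = head G e'"
      using d by (auto simp: returns_def)
    have "awalk (head G e') q v" using eq by (auto simp: arrivals_def)
    then have "e' \<in> set c" using arc_on_cycle[OF disj C c(1) eq(2), of q] eq(3) c(2) er by auto
    then have "e' = e" using eq(3) c(2) er dist by (metis distinct_map inj_onD list.sel(1) list.set_intros(1))
    moreover have "q = r" by (rule unique[OF eq(4) r(1)]) (use eq(5) r(2) er \<open>e' = e\<close> in auto)
    ultimately show ?thesis using er eq(1) by simp
  qed
  ultimately show ?thesis unfolding c_def by blast
qed

text \<open>
  A path from \<open>v\<close> to \<open>w\<close> can be completed to a closed path, so it does not leave \<open>C\<close> by
  \<open>arc_on_cycle\<close>. Thus \<open>w\<close> lies on both cycles.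
\<close>

lemma cycles_eq_if_mutually_reachable:
  assumes disj: "disjoint_cycles G" and C: "C \<in> cycles G" "v \<in> cycle_verts G C"
    and D: "D \<in> cycles G" "w \<in> cycle_verts G D"
    and vw: "v \<in> predecessors G w" "w \<in> predecessors G v"
  shows "C = D"
proof -
  obtain p where p: "awalk v p w" using vw(1) by (auto simp: predecessors_def)
  have on: "w' \<in> cycle_verts G C" if "awalk v p w'" "\<exists>s. awalk w' s v" for p w'
    using that
  proof (induction p arbitrary: w' rule: rev_induct)
    case Nil then show ?case using C by (auto simp: awalk_Nil_iff)
  next
    case (snoc e p)
    then have e: "awalk v p (tail G e)" "e \<in> arcs G" "w' = head G e"
      by (auto simp: awalk_Cons_iff awalk_Nil_iff)
    obtain s where s: "awalk w' s v" using snoc.prems(2) by blast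
    have "awalk (tail G e) (e # s) v" using s e by (simp add: awalk_Cons_iff)
    then have te: "tail G e \<in> cycle_verts G C" using snoc.IH e(1) by blast
    let ?c = "cycle_at G C v"
    have c: "?c \<in> C" "tail G (hd ?c) = v" using cycle_at_spec[OF C] by auto
    have cyc: "cycle ?c" using cycles_cycle[OF C(1) c(1)] .
    have "awalk (head G e) (s @ p) (tail G e)" using awalk_appendI[OF s e(1)] e(3) by simp
    then have "e \<in> set ?c"
      using arc_on_cycle[OF disj C(1) c(1) e(2)] te cycle_verts_eq[OF C(1) c(1)] by metis
    then obtain a b where ab: "?c = a @ e # b" by (metis split_list)
    then have "awalk w' b v" using cycle_awalk[OF cyc] c(2) e(3) by (auto simp: awalk_Cons_iff)
    then have "w' \<in> tail G ` set ?c"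
      using ab c(2) by (cases b; cases a) (auto simp: awalk_Cons_iff awalk_Nil_iff)
    then show ?case using cycle_verts_eq[OF C(1) c(1)] by simp
  qed
  have "w \<in> cycle_verts G C" using on[OF p] vw(2) by (auto simp: predecessors_def)
  then show ?thesis
    using disj C(1) D unfolding disjoint_cycles_def pairwise_def disjnt_def by blast
qed

lemma closed_awalk_cycle:
  assumes "awalk u p u" "p \<noteq> []"
  shows "\<exists>C\<in>cycles G. u \<in> cycle_verts G C"
proof -
  obtain e p' where p: "p = e # p'" using assms(2) by (cases p) auto
  then have e: "e \<in> arcs G" "u = tail G e" "awalk (head G e) p' (tail G e)"
    using assms by (auto simp: awalk_Cons_iff)
  obtain q where cyc: "cycle (e # q)" using ex_cycle_through_arc[OF e(1,3)] by blast
  let ?D = "range (\<lambda>n. rotate n (e # q))"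
  have D: "?D \<in> cycles G" using cyc by (auto simp: cycles_def)
  have mem: "e # q \<in> ?D" by (rule range_eqI[of _ _ 0]) simp
  have "u \<in> cycle_verts G ?D" using cycle_verts_eq[OF D mem] e(2) by simp
  with D show ?thesis by blast
qed

end

section \<open>Modules over a Leavitt path algebra\<close>

text \<open>
  A module over the algebra amounts to an abelian group with operators for generators and scalars
  that satisfy the defining relations. In a product the left factor acts first.
\<close>

locale leavitt_rep = leavitt_algebra R G + M: abelian_group M
  for R :: "('k, 'z) ring_scheme" and G :: "('v, 'e) pre_digraph" and M :: "('m, 'y) ring_scheme" +
  fixes gop :: "('v, 'e) leavitt_gen \<Rightarrow> 'm \<Rightarrow> 'm" and sop :: "'k \<Rightarrow> 'm \<Rightarrow> 'm"
  assumes gop_closed: "\<lbrakk>g \<in> leavitt_gens G; x \<in> carrier M\<rbrakk> \<Longrightarrow> gop g x \<in> carrier M"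
    and gop_add: "\<lbrakk>g \<in> leavitt_gens G; x \<in> carrier M; y \<in> carrier M\<rbrakk> \<Longrightarrow>
      gop g (x \<oplus>\<^bsub>M\<^esub> y) = gop g x \<oplus>\<^bsub>M\<^esub> gop g y"
    and sop_closed: "\<lbrakk>a \<in> carrier R; x \<in> carrier M\<rbrakk> \<Longrightarrow> sop a x \<in> carrier M"
    and sop_add: "\<lbrakk>a \<in> carrier R; x \<in> carrier M; y \<in> carrier M\<rbrakk> \<Longrightarrow>
      sop a (x \<oplus>\<^bsub>M\<^esub> y) = sop a x \<oplus>\<^bsub>M\<^esub> sop a y"
    and sop_add_scalar: "\<lbrakk>a \<in> carrier R; b \<in> carrier R; x \<in> carrier M\<rbrakk> \<Longrightarrow>
      sop (a \<oplus>\<^bsub>R\<^esub> b) x = sop a x \<oplus>\<^bsub>M\<^esub> sop b x"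
    and sop_mult: "\<lbrakk>a \<in> carrier R; b \<in> carrier R; x \<in> carrier M\<rbrakk> \<Longrightarrow> sop (a \<otimes>\<^bsub>R\<^esub> b) x = sop a (sop b x)"
    and sop_one: "x \<in> carrier M \<Longrightarrow> sop \<one>\<^bsub>R\<^esub> x = x"
    and gop_sop: "\<lbrakk>g \<in> leavitt_gens G; a \<in> carrier R; x \<in> carrier M\<rbrakk> \<Longrightarrow> gop g (sop a x) = sop a (gop g x)"
    and gop_vertex: "\<lbrakk>u \<in> verts G; w \<in> verts G; x \<in> carrier M\<rbrakk> \<Longrightarrow>
      gop (Vertex w) (gop (Vertex u) x) = (if u = w then gop (Vertex u) x else \<zero>\<^bsub>M\<^esub>)"
    and gop_arrow_source: "\<lbrakk>e \<in> arcs G; x \<in> carrier M\<rbrakk> \<Longrightarrow>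
      gop (Arrow e) (gop (Vertex (tail G e)) x) = gop (Arrow e) x"
    and gop_arrow_target: "\<lbrakk>e \<in> arcs G; x \<in> carrier M\<rbrakk> \<Longrightarrow>
      gop (Vertex (head G e)) (gop (Arrow e) x) = gop (Arrow e) x"
    and gop_ghost_source: "\<lbrakk>e \<in> arcs G; x \<in> carrier M\<rbrakk> \<Longrightarrow>
      gop (Ghost e) (gop (Vertex (head G e)) x) = gop (Ghost e) x"
    and gop_ghost_target: "\<lbrakk>e \<in> arcs G; x \<in> carrier M\<rbrakk> \<Longrightarrow>
      gop (Vertex (tail G e)) (gop (Ghost e) x) = gop (Ghost e) x"
    and gop_CK1: "\<lbrakk>e \<in> arcs G; f \<in> arcs G; x \<in> carrier M\<rbrakk> \<Longrightarrow>
      gop (Arrow f) (gop (Ghost e) x) = (if e = f then gop (Vertex (head G e)) x else \<zero>\<^bsub>M\<^esub>)"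
    and gop_CK2: "\<lbrakk>u \<in> verts G; out_arcs G u \<noteq> {}; x \<in> carrier M\<rbrakk> \<Longrightarrow>
      gop (Vertex u) x = finsum M (\<lambda>e. gop (Ghost e) (gop (Arrow e) x)) (out_arcs G u)"
    and gop_unit: "x \<in> carrier M \<Longrightarrow> finsum M (\<lambda>u. gop (Vertex u) x) (verts G) = x"
begin

primrec term_act :: "(('v, 'e) leavitt_gen, 'k) alg_term \<Rightarrow> 'm \<Rightarrow> 'm" where
  "term_act (Gen g) x = gop g x"
| "term_act Zero x = \<zero>\<^bsub>M\<^esub>"
| "term_act (Add s t) x = term_act s x \<oplus>\<^bsub>M\<^esub> term_act t x"
| "term_act (Neg t) x = \<ominus>\<^bsub>M\<^esub> term_act t x"
| "term_act (Scal a t) x = sop a (term_act t x)"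
| "term_act (Times s t) x = term_act t (term_act s x)"

lemma term_act_closed: "\<lbrakk>t \<in> terms; x \<in> carrier M\<rbrakk> \<Longrightarrow> term_act t x \<in> carrier M"
  by (induction t arbitrary: x) (auto simp: gop_closed sop_closed)

lemma term_act_add:
  "\<lbrakk>t \<in> terms; x \<in> carrier M; y \<in> carrier M\<rbrakk> \<Longrightarrow> term_act t (x \<oplus>\<^bsub>M\<^esub> y) = term_act t x \<oplus>\<^bsub>M\<^esub> term_act t y"
proof (induction t arbitrary: x y)
  case (Neg t)
  then show ?case by (simp add: term_act_closed M.minus_add M.a_comm)
next
  case (Add s t)
  then show ?case by (simp add: term_act_closed M.a_ac)
qed (auto simp: gop_add sop_add term_act_closed)

lemma sop_zero: "a \<in> carrier R \<Longrightarrow> sop a \<zero>\<^bsub>M\<^esub> = \<zero>\<^bsub>M\<^esub>"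
  by (rule additive_zero[of M M]) (auto simp: sop_closed sop_add M.abelian_group_axioms)

lemma sop_neg: "\<lbrakk>a \<in> carrier R; x \<in> carrier M\<rbrakk> \<Longrightarrow> sop a (\<ominus>\<^bsub>M\<^esub> x) = \<ominus>\<^bsub>M\<^esub> sop a x"
  by (rule additive_neg[of M M]) (auto simp: sop_closed sop_add M.abelian_group_axioms)

lemma term_act_sop:
  "\<lbrakk>t \<in> terms; x \<in> carrier M; a \<in> carrier R\<rbrakk> \<Longrightarrow> term_act t (sop a x) = sop a (term_act t x)"
proof (induction t arbitrary: x)
  case (Scal b t)
  then have "sop (b \<otimes>\<^bsub>R\<^esub> a) (term_act t x) = sop (a \<otimes>\<^bsub>R\<^esub> b) (term_act t x)" by (simp add: m_comm)
  then show ?case using Scal by (simp add: sop_mult term_act_closed)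
qed (auto simp: gop_sop sop_add sop_neg sop_zero term_act_closed sop_closed)

lemma term_act_sum:
  assumes "distinct xs" "\<And>i. i \<in> set xs \<Longrightarrow> f i \<in> terms" "x \<in> carrier M"
  shows "term_act (sum_term (map f xs)) x = finsum M (\<lambda>i. term_act (f i) x) (set xs)"
  using assms
  by (induction xs) (auto simp: M.finsum_insert term_act_closed Pi_iff)

lemma term_act_rel: "\<lbrakk>(s, t) \<in> leavitt_rels G; x \<in> carrier M\<rbrakk> \<Longrightarrow> term_act s x = term_act t x"
proof (induction rule: leavitt_rels.induct)
  case (CK2 u es)
  have "term_act (sum_term (map (\<lambda>e. Times (Gen (Arrow e)) (Gen (Ghost e))) es)) x =
      finsum M (\<lambda>e. term_act (Times (Gen (Arrow e)) (Gen (Ghost e))) x) (set es)"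
    using CK2 by (intro term_act_sum) auto
  then show ?case using CK2 gop_CK2[of u x] by simp (metis set_empty)
qed (auto simp: gop_vertex gop_arrow_source gop_arrow_target gop_ghost_source gop_ghost_target gop_CK1)

lemma term_act_teq: "\<lbrakk>teq s t; x \<in> carrier M\<rbrakk> \<Longrightarrow> term_act s x = term_act t x"
proof (induction arbitrary: x rule: alg_eq.induct)
  case (cong_Times s s' t t')
  then show ?case using teq_terms[OF cong_Times(1)] by (simp add: term_act_closed)
qed (simp_all add: term_act_rel term_act_closed term_act_add term_act_sop M.a_ac M.r_neg sop_add
    sop_add_scalar sop_mult sop_one)

definition rep_module :: "(('v, 'e, 'k) leavitt, 'm) rmodule" where
  "rep_module = \<lparr>carrier = carrier M, monoid.mult = undefined, one = undefined, ring.zero = \<zero>\<^bsub>M\<^esub>,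
     add = add M, ract = (\<lambda>x a. term_act (SOME t. t \<in> terms \<and> a = cls t) x)\<rparr>"

lemma rep_module_simps [simp]:
  "carrier rep_module = carrier M" "\<zero>\<^bsub>rep_module\<^esub> = \<zero>\<^bsub>M\<^esub>" "add rep_module = add M"
  by (simp_all add: rep_module_def)

lemma rep_module_ract:
  assumes "t \<in> terms" "x \<in> carrier M" shows "ract rep_module x (cls t) = term_act t x"
proof -
  define s where "s = (SOME s. s \<in> terms \<and> cls t = cls s)"
  have "s \<in> terms \<and> cls t = cls s" unfolding s_def by (rule someI[of _ t]) (simp add: assms(1))
  then have "teq s t" by (metis cls_eq_iff)
  then show ?thesis using term_act_teq assms(2) by (simp add: rep_module_def s_def)
qed

lemma right_module_rep: "right_module L rep_module"
proof -
  interpret L: ring L by (rule L_ring)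
  interpret S: abelian_group rep_module
    by (rule abelian_groupI) (auto simp: M.a_ac intro: M.l_neg M.a_inv_closed)
  obtain vs where vs: "distinct vs" "set vs = verts G"
    using finite_distinct_list[OF G.finite_verts] by blast
  have one: "\<one>\<^bsub>L\<^esub> = cls (sum_term (map (\<lambda>v. Gen (Vertex v)) vs))"
    using vs by (subst cls_sum_term) (auto simp: L_one lvertex_def[abs_def])
  have T: "sum_term (map (\<lambda>v. Gen (Vertex v)) vs) \<in> terms" using vs by (auto intro!: sum_term_in_terms)
  show ?thesis
  proof unfold_locales
    fix x assume x: "x \<in> carrier rep_module"
    show "ract rep_module x \<one>\<^bsub>L\<^esub> = x"
      unfolding one using x T vs term_act_sum[of vs "\<lambda>v. Gen (Vertex v)" x]
      by (simp add: rep_module_ract gop_unit)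
  qed (elim L_cases, simp add: rep_module_ract term_act_closed term_act_add)+
qed

end

locale leavitt_module = leavitt_algebra R G + M: right_module "leavitt R G" M
  for R :: "('k, 'z) ring_scheme" and G :: "('v, 'e) pre_digraph"
    and M :: "(('v, 'e, 'k) leavitt, 'm, 'y) rmodule_scheme"
begin

abbreviation mact (infixl "\<cdot>" 70) where "x \<cdot> a \<equiv> ract M x a"
abbreviation "vx u \<equiv> lvertex R G u"
abbreviation "ar e \<equiv> gn (Arrow e)"
abbreviation "gh e \<equiv> gn (Ghost e)"
abbreviation "sc r \<equiv> r \<odot>\<^bsub>L\<^esub> \<one>\<^bsub>L\<^esub>"

lemma sc_closed [simp]: "r \<in> carrier R \<Longrightarrow> sc r \<in> carrier L"
  by (simp add: smult_closed)

lemma act_smult: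
  "\<lbrakk>x \<in> carrier M; r \<in> carrier R; a \<in> carrier L\<rbrakk> \<Longrightarrow> x \<cdot> (r \<odot>\<^bsub>L\<^esub> a) = x \<cdot> a \<cdot> sc r"
  by (subst smult_as_mult(1)) (auto simp: M.ract_assoc)

lemma act_sc_comm:
  "\<lbrakk>x \<in> carrier M; r \<in> carrier R; a \<in> carrier L\<rbrakk> \<Longrightarrow> x \<cdot> sc r \<cdot> a = x \<cdot> a \<cdot> sc r"
  by (metis M.ract_assoc sc_closed smult_as_mult)

lemma submodule_if_gens:
  assumes "N \<subseteq> carrier M" "\<zero>\<^bsub>M\<^esub> \<in> N" "\<And>x y. \<lbrakk>x \<in> N; y \<in> N\<rbrakk> \<Longrightarrow> x \<oplus>\<^bsub>M\<^esub> y \<in> N"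
    and "\<And>x g. \<lbrakk>x \<in> N; g \<in> leavitt_gens G\<rbrakk> \<Longrightarrow> x \<cdot> gn g \<in> N"
    and "\<And>x r. \<lbrakk>x \<in> N; r \<in> carrier R\<rbrakk> \<Longrightarrow> x \<cdot> sc r \<in> N"
  shows "submodule_of L M N"
proof (rule M.submodule_ofI[OF assms(1-3)])
  fix x a assume x: "x \<in> N" and a: "a \<in> carrier L"
  have "\<forall>x\<in>N. x \<cdot> a \<in> N" using a
  proof (induction a rule: L_induct)
    case (gen g) then show ?case using assms(4) by blast
  next
    case zero
    show ?case using assms(1,2) by (simp add: M.ract_zero_right subset_iff)
  next
    case (add a b)
    have "x \<cdot> (a \<oplus>\<^bsub>L\<^esub> b) \<in> N" if "x \<in> N" for x
      using add assms(1,3) that by (subst M.ract_r_distr) auto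
    then show ?case by blast
  next
    case (smult r a)
    have "x \<cdot> (r \<odot>\<^bsub>L\<^esub> a) \<in> N" if "x \<in> N" for x
      using smult assms(1,5) that by (subst act_smult) auto
    then show ?case by blast
  next
    case (mult a b)
    have "x \<cdot> (a \<otimes>\<^bsub>L\<^esub> b) \<in> N" if "x \<in> N" for x
      using mult assms(1) that by (subst M.ract_assoc) auto
    then show ?case by blast
  qed
  with x show "x \<cdot> a \<in> N" by blast
qed

lemma act_vertex:
  "\<lbrakk>x \<in> carrier M; u \<in> verts G; w \<in> verts G\<rbrakk> \<Longrightarrow> x \<cdot> vx u \<cdot> vx w = (if u = w then x \<cdot> vx u else \<zero>\<^bsub>M\<^esub>)"
  using vertex_mult[of u w] by (simp add: M.ract_assoc[symmetric] M.ract_zero_right)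

lemma act_vertex_gen:
  "\<lbrakk>x \<in> carrier M; u \<in> verts G; g \<in> leavitt_gens G\<rbrakk> \<Longrightarrow>
    x \<cdot> vx u \<cdot> gn g = (if u = gsource g then x \<cdot> gn g else \<zero>\<^bsub>M\<^esub>)"
  using vertex_gen[of u g] by (simp add: M.ract_assoc[symmetric] M.ract_zero_right del: L_mult)

lemma act_gen_vertex:
  "\<lbrakk>x \<in> carrier M; u \<in> verts G; g \<in> leavitt_gens G\<rbrakk> \<Longrightarrow>
    x \<cdot> gn g \<cdot> vx u = (if u = gtarget g then x \<cdot> gn g else \<zero>\<^bsub>M\<^esub>)"
  using gen_vertex[of u g] by (simp add: M.ract_assoc[symmetric] M.ract_zero_right del: L_mult)

lemma act_ghost_arrow:
  "\<lbrakk>x \<in> carrier M; e \<in> arcs G; f \<in> arcs G\<rbrakk> \<Longrightarrow>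
    x \<cdot> gh e \<cdot> ar f = (if e = f then x \<cdot> vx (head G e) else \<zero>\<^bsub>M\<^esub>)"
  using ghost_arrow[of e f] by (simp add: M.ract_assoc[symmetric] M.ract_zero_right del: L_mult)

lemma act_vertex_sum:
  assumes "x \<in> carrier M" "u \<in> verts G" "out_arcs G u \<noteq> {}"
  shows "x \<cdot> vx u = finsum M (\<lambda>e. x \<cdot> ar e \<cdot> gh e) (out_arcs G u)"
proof -
  have "x \<cdot> vx u = finsum M (\<lambda>e. x \<cdot> (ar e \<otimes>\<^bsub>L\<^esub> gh e)) (out_arcs G u)"
    using assms by (simp add: vertex_sum M.ract_finsum_right G.finite_out_arcs mult_closed Pi_iff del: L_mult)
  also have "\<dots> = finsum M (\<lambda>e. x \<cdot> ar e \<cdot> gh e) (out_arcs G u)"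
    by (rule M.M.finsum_cong') (use assms in \<open>auto simp: M.ract_assoc M.ract_closed simp del: L_mult\<close>)
  finally show ?thesis .
qed

lemma act_unit_sum:
  assumes "x \<in> carrier M" shows "x = finsum M (\<lambda>u. x \<cdot> vx u) (verts G)"
  using assms M.ract_one[OF assms] M.ract_finsum_right[of "verts G" vx x]
  by (simp add: L_one G.finite_verts)

text \<open>
  The action of a path \<open>q\<close> and of \<open>q\<^sup>*\<close>. In \<open>x q\<^sup>*\<close> the ghost of the first arrow of \<open>q\<close> acts last.
\<close>

primrec pact :: "'e list \<Rightarrow> 'm \<Rightarrow> 'm" where
  "pact [] x = x"
| "pact (e # q) x = pact q (x \<cdot> ar e)"

primrec gact :: "'e list \<Rightarrow> 'm \<Rightarrow> 'm" where
  "gact [] x = x"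
| "gact (e # q) x = gact q x \<cdot> gh e"

lemma pact_closed: "\<lbrakk>set q \<subseteq> arcs G; x \<in> carrier M\<rbrakk> \<Longrightarrow> pact q x \<in> carrier M"
  by (induction q arbitrary: x) (auto simp: M.ract_closed)

lemma gact_closed: "\<lbrakk>set q \<subseteq> arcs G; x \<in> carrier M\<rbrakk> \<Longrightarrow> gact q x \<in> carrier M"
  by (induction q) (auto simp: M.ract_closed)

lemma pact_add:
  "\<lbrakk>set q \<subseteq> arcs G; x \<in> carrier M; y \<in> carrier M\<rbrakk> \<Longrightarrow> pact q (x \<oplus>\<^bsub>M\<^esub> y) = pact q x \<oplus>\<^bsub>M\<^esub> pact q y"
  by (induction q arbitrary: x y) (auto simp: M.ract_closed M.ract_l_distr)

lemma gact_add:
  "\<lbrakk>set q \<subseteq> arcs G; x \<in> carrier M; y \<in> carrier M\<rbrakk> \<Longrightarrow> gact q (x \<oplus>\<^bsub>M\<^esub> y) = gact q x \<oplus>\<^bsub>M\<^esub> gact q y"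
  by (induction q) (auto simp: gact_closed M.ract_l_distr)

lemma pact_zero: "set q \<subseteq> arcs G \<Longrightarrow> pact q \<zero>\<^bsub>M\<^esub> = \<zero>\<^bsub>M\<^esub>"
  by (induction q) (auto simp: M.ract_zero_left)

lemma gact_zero: "set q \<subseteq> arcs G \<Longrightarrow> gact q \<zero>\<^bsub>M\<^esub> = \<zero>\<^bsub>M\<^esub>"
  by (induction q) (auto simp: M.ract_zero_left)

lemma gact_sc: "\<lbrakk>set q \<subseteq> arcs G; x \<in> carrier M; r \<in> carrier R\<rbrakk> \<Longrightarrow> gact q (x \<cdot> sc r) = gact q x \<cdot> sc r"
  by (induction q) (auto simp: gact_closed act_sc_comm)

lemma lpath_closed: "set q \<subseteq> arcs G \<Longrightarrow> lpath R G q \<in> carrier L"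
  unfolding lpath_def by (rule foldr_mult_closed) auto

lemma lghost_path_closed: "set q \<subseteq> arcs G \<Longrightarrow> lghost_path R G q \<in> carrier L"
  unfolding lghost_path_def by (rule foldr_mult_closed) auto

lemma act_lpath: "\<lbrakk>set q \<subseteq> arcs G; x \<in> carrier M\<rbrakk> \<Longrightarrow> x \<cdot> lpath R G q = pact q x"
proof (induction q arbitrary: x)
  case (Cons e q)
  then show ?case
    using lpath_closed[of q] by (simp add: lpath_def M.ract_assoc M.ract_closed del: L_mult)
qed (simp add: lpath_def M.ract_one)

lemma act_lghost_path:
  assumes "set q \<subseteq> arcs G" "x \<in> carrier M" shows "x \<cdot> lghost_path R G q = gact q x"
proof -
  have "x \<cdot> foldr (monoid.mult L) as b = x \<cdot> foldr (monoid.mult L) as \<one>\<^bsub>L\<^esub> \<cdot> b"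
    if "set as \<subseteq> carrier L" "b \<in> carrier L" "x \<in> carrier M" for as b x
    using that
  proof (induction as arbitrary: x)
    case (Cons a as)
    have c: "foldr (monoid.mult L) as d \<in> carrier L" if "d \<in> carrier L" for d
      using Cons.prems(1) that by (induction as) (auto simp: mult_closed)
    show ?case using Cons c[of b] c[OF L_one_closed]
      by (simp add: M.ract_assoc M.ract_closed)
  qed (simp add: M.ract_one)
  note * = this
  show ?thesis using assms
  proof (induction q)
    case (Cons e q)
    have "set (map gh (rev q)) \<subseteq> carrier L" using Cons.prems(1) by auto
    from *[OF this _ Cons.prems(2), of "gh e"] Cons show ?case
      by (simp add: lghost_path_def L_one_mult)
  qed (simp add: lghost_path_def M.ract_one)
qed

end

section \<open>Modules generated at a vertex\<close>

lemma (in cring) maximalideal_plus_principal: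
  assumes "maximalideal \<mm> R" "f \<in> carrier R" "f \<notin> \<mm>"
  shows "\<exists>g\<in>carrier R. \<exists>h\<in>\<mm>. \<one> = f \<otimes> g \<oplus> h"
proof -
  interpret \<mm>: maximalideal \<mm> R by fact
  let ?J = "set_add R \<mm> (PIdl f)"
  have mem: "h \<oplus> g \<otimes> f \<in> ?J" if "h \<in> \<mm>" "g \<in> carrier R" for g h
    using that by (auto simp: set_add_def' cgenideal_def)
  have J: "ideal ?J R" using \<mm>.ideal_axioms cgenideal_ideal[OF assms(2)] by (rule add_ideals)
  moreover have "\<mm> \<subseteq> ?J" using mem[of _ \<zero>] assms(2) by (auto simp: \<mm>.Icarr)
  moreover have "f \<in> ?J" using mem[of \<zero> \<one>] assms(2) by simp
  moreover have "?J \<subseteq> carrier R" using ideal.Icarr[OF J] by blast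
  ultimately have "?J = carrier R" using \<mm>.I_maximal[of ?J] assms(3) by blast
  then have "\<one> \<in> ?J" by simp
  then obtain g h where "g \<in> carrier R" "h \<in> \<mm>" "\<one> = h \<oplus> g \<otimes> f"
    by (auto simp: set_add_def' cgenideal_def)
  then show ?thesis using assms(2) by (intro bexI[of _ g] bexI[of _ h]) (simp_all add: a_comm m_comm \<mm>.Icarr)
qed

locale leavitt_corner = leavitt_module R G M
  for R :: "('k, 'z) ring_scheme" and G :: "('v, 'e) pre_digraph"
    and M :: "(('v, 'e, 'k) leavitt, 'm, 'y) rmodule_scheme" +
  fixes v :: 'v
  assumes v: "v \<in> verts G"
begin

abbreviation "arr \<equiv> pre_digraph.arrivals G v"
abbreviation "src \<equiv> pre_digraph.path_source G v"
abbreviation "ret \<equiv> pre_digraph.returns G v"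

definition corner :: "'m set" where
  "corner = {x \<in> carrier M. x \<cdot> vx v = x}"

text \<open>For an element of the form \<open>\<Sum> d q\<^sup>*\<close> this is the coefficient \<open>d\<close> of \<open>q\<^sup>*\<close>; see \<open>coef_gact\<close>.\<close>

definition coef :: "'e list \<Rightarrow> 'm \<Rightarrow> 'm" where
  "coef q x = pact q x \<cdot> vx v"

lemma arr_arcs: "q \<in> arr \<Longrightarrow> set q \<subseteq> arcs G"
  by (rule G.arrivals_arcs)

lemma cornerD: "x \<in> corner \<Longrightarrow> x \<in> carrier M" "x \<in> corner \<Longrightarrow> x \<cdot> vx v = x"
  by (auto simp: corner_def)

lemma act_vertex_in_corner: "x \<in> carrier M \<Longrightarrow> x \<cdot> vx v \<in> corner"
  using v by (simp add: corner_def M.ract_closed act_vertex)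

lemma corner_zero: "\<zero>\<^bsub>M\<^esub> \<in> corner"
  using v by (simp add: corner_def M.ract_zero_left)

lemma coef_closed: "\<lbrakk>q \<in> arr; x \<in> carrier M\<rbrakk> \<Longrightarrow> coef q x \<in> carrier M"
  using v arr_arcs by (simp add: coef_def M.ract_closed pact_closed)

lemma coef_add:
  "\<lbrakk>q \<in> arr; x \<in> carrier M; y \<in> carrier M\<rbrakk> \<Longrightarrow> coef q (x \<oplus>\<^bsub>M\<^esub> y) = coef q x \<oplus>\<^bsub>M\<^esub> coef q y"
  using v arr_arcs by (simp add: coef_def M.ract_closed pact_closed pact_add M.ract_l_distr)

lemma coef_zero: "q \<in> arr \<Longrightarrow> coef q \<zero>\<^bsub>M\<^esub> = \<zero>\<^bsub>M\<^esub>"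
  using v arr_arcs by (simp add: coef_def pact_zero M.ract_zero_left)

lemma coef_Nil: "coef [] x = x \<cdot> vx v"
  by (simp add: coef_def)

lemma gact_source:
  assumes "q \<in> arr" "d \<in> corner" shows "gact q d \<cdot> vx (src q) = gact q d"
proof (cases q)
  case Nil then show ?thesis using assms by (simp add: cornerD)
next
  case (Cons e q')
  then have "e \<in> arcs G" "set q' \<subseteq> arcs G" using assms arr_arcs by fastforce+
  then show ?thesis using Cons assms(2) by (simp add: act_gen_vertex gact_closed cornerD)
qed

text \<open>
  No arrival is a proper initial segment of another one. So in \<open>d q'\<^sup>* q\<close> either all arrows
  cancel or two different arrows meet, unless one of the paths is empty: then the product does
  not start, or does not end, at \<open>v\<close>.
\<close>

lemma coef_gact:
  "\<lbrakk>q \<in> arr; q' \<in> arr; d \<in> corner\<rbrakk> \<Longrightarrow> coef q (gact q' d) = (if q = q' then d else \<zero>\<^bsub>M\<^esub>)"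
proof (induction q' arbitrary: q)
  case Nil
  show ?case
  proof (cases q)
    case Nil then show ?thesis using \<open>d \<in> corner\<close> by (simp add: coef_def cornerD)
  next
    case (Cons e q1)
    then have e: "e \<in> arcs G" "tail G e \<noteq> v" "q1 \<in> arr" using Nil(1) by (auto simp: G.Cons_arrivals_iff)
    have "d \<cdot> ar e = \<zero>\<^bsub>M\<^esub>"
      using e v \<open>d \<in> corner\<close> act_vertex_gen[of d v "Arrow e"] by (simp add: cornerD)
    then show ?thesis using Cons e v arr_arcs by (simp add: coef_def pact_zero M.ract_zero_left)
  qed
next
  case (Cons e' q')
  then have e': "e' \<in> arcs G" "tail G e' \<noteq> v" "q' \<in> arr" "src q' = head G e'" by (auto simp: G.Cons_arrivals_iff)
  have g: "gact q' d \<in> carrier M" using e' Cons.prems(3) arr_arcs by (simp add: gact_closed cornerD)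
  show ?case
  proof (cases q)
    case Nil
    then show ?thesis using e' g v by (simp add: coef_def act_gen_vertex)
  next
    case (Cons e q1)
    then have e: "e \<in> arcs G" "q1 \<in> arr" using Cons.prems(1) by (auto simp: G.Cons_arrivals_iff)
    have *: "gact q' d \<cdot> vx (head G e') = gact q' d"
      using gact_source[OF e'(3) Cons.prems(3)] e'(4) by simp
    show ?thesis
    proof (cases "e = e'")
      case True
      then show ?thesis using Cons.IH[OF e(2) e'(3) Cons.prems(3)] e' g * \<open>q = e # q1\<close>
        by (simp add: coef_def act_ghost_arrow)
    next
      case False
      then show ?thesis using \<open>q = e # q1\<close> e e' g v arr_arcs
        by (simp add: coef_def act_ghost_arrow pact_zero M.ract_zero_left)
    qed
  qed
qed

text \<open>
  These are the conditions under which the sum of the \<open>D q\<^sup>*\<close> is a submodule. An arrow out of \<open>v\<close>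
  either begins a return \<open>c\<close>, and then \<open>d = d c c\<^sup>*\<close> allows it to cancel, or has to act as zero.
\<close>

definition corner_stable :: "'m set \<Rightarrow> bool" where
  "corner_stable D \<longleftrightarrow> D \<subseteq> corner \<and> \<zero>\<^bsub>M\<^esub> \<in> D \<and> (\<forall>x\<in>D. \<forall>y\<in>D. x \<oplus>\<^bsub>M\<^esub> y \<in> D) \<and>
     (\<forall>x\<in>D. \<forall>r\<in>carrier R. x \<cdot> sc r \<in> D) \<and>
     (\<forall>c\<in>ret. \<forall>x\<in>D. pact c x \<in> D \<and> gact c x \<in> D \<and> gact c (pact c x) = x) \<and>
     (\<forall>x\<in>D. \<forall>e\<in>out_arcs G v. x \<cdot> ar e = \<zero>\<^bsub>M\<^esub> \<or> (\<exists>c\<in>ret. hd c = e))"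

inductive_set arrival_span :: "'m set \<Rightarrow> 'm set" for D where
  zero: "\<zero>\<^bsub>M\<^esub> \<in> arrival_span D"
| add: "\<lbrakk>x \<in> arrival_span D; d \<in> D; q \<in> arr\<rbrakk> \<Longrightarrow> x \<oplus>\<^bsub>M\<^esub> gact q d \<in> arrival_span D"

context
  fixes D assumes D: "corner_stable D"
begin

lemma D_corner: "d \<in> D \<Longrightarrow> d \<in> corner" "d \<in> D \<Longrightarrow> d \<in> carrier M" "d \<in> D \<Longrightarrow> d \<cdot> vx v = d"
  using D cornerD by (auto simp: corner_stable_def)

lemma gact_arr_closed: "\<lbrakk>d \<in> D; q \<in> arr\<rbrakk> \<Longrightarrow> gact q d \<in> carrier M"
  using arr_arcs by (simp add: gact_closed D_corner)

lemma arrival_span_closed: "x \<in> arrival_span D \<Longrightarrow> x \<in> carrier M"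
  by (induction rule: arrival_span.induct) (auto simp: gact_arr_closed)

lemma gact_in_span: assumes "d \<in> D" "q \<in> arr" shows "gact q d \<in> arrival_span D"
  using arrival_span.add[OF arrival_span.zero assms] gact_arr_closed[OF assms] by simp

lemma arrival_span_add:
  "\<lbrakk>y \<in> arrival_span D; x \<in> arrival_span D\<rbrakk> \<Longrightarrow> x \<oplus>\<^bsub>M\<^esub> y \<in> arrival_span D"
proof (induction rule: arrival_span.induct)
  case (add y d q)
  then have "(x \<oplus>\<^bsub>M\<^esub> y) \<oplus>\<^bsub>M\<^esub> gact q d \<in> arrival_span D" by (auto intro: arrival_span.add)
  then show ?case using add by (simp add: M.a_assoc arrival_span_closed gact_arr_closed)
qed (simp add: arrival_span_closed)

text \<open>
  An arrow cancels against the last ghost arrow of \<open>q\<^sup>*\<close>, or the two have product zero. If \<open>q\<close> is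
  empty, the arrow starts at \<open>v\<close> and the last condition on \<open>D\<close> applies. A ghost arrow extends \<open>q\<^sup>*\<close>
  to the ghost of a longer arrival or, if it ends at \<open>v\<close>, completes the ghost of a return, which
  maps \<open>D\<close> to itself.
\<close>

lemma gact_gen_in_span:
  assumes d: "d \<in> D" and q: "q \<in> arr" and g: "g \<in> leavitt_gens G"
  shows "gact q d \<cdot> gn g \<in> arrival_span D"
proof -
  note gcl = gact_arr_closed[OF d q]
  have src: "gact q d \<cdot> vx (src q) = gact q d" using gact_source[OF q D_corner(1)[OF d]] .
  have srcv: "src q \<in> verts G" using q by (rule G.path_source_in_verts)
  show ?thesis
  proof (cases "src q = gsource g")
    case False
    then have "gact q d \<cdot> gn g = \<zero>\<^bsub>M\<^esub>" using act_vertex_gen[OF gcl srcv g] src by simp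
    then show ?thesis by (simp add: arrival_span.zero)
  next
    case True
    show ?thesis
    proof (cases g)
      case (Vertex u)
      then show ?thesis using True src gact_in_span[OF d q] by (simp add: lvertex_def)
    next
      case (Arrow e)
      then have e: "e \<in> arcs G" "tail G e = src q" using g True by auto
      show ?thesis
      proof (cases q)
        case Nil
        then have "e \<in> out_arcs G v" using e by simp
        then have "d \<cdot> ar e = \<zero>\<^bsub>M\<^esub> \<or> (\<exists>c\<in>ret. hd c = e)"
          using D d unfolding corner_stable_def by blast
        then show ?thesis
        proof
          assume "d \<cdot> ar e = \<zero>\<^bsub>M\<^esub>"
          then show ?thesis using Nil Arrow by (simp add: arrival_span.zero)
        next
          assume "\<exists>c\<in>ret. hd c = e"
          then obtain r where c: "e # r \<in> ret" "r \<in> arr" "src r = head G e"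
            by (auto simp: pre_digraph.returns_def)
          have dc: "pact (e # r) d \<in> D" "gact (e # r) (pact (e # r) d) = d"
            using D d c(1) unfolding corner_stable_def by blast+
          \<comment> \<open>\<open>d\<close> is rewritten as \<open>d c c\<^sup>*\<close>, so that the arrow meets its own ghost.\<close>
          have "d \<cdot> ar e = gact (e # r) (pact (e # r) d) \<cdot> ar e" by (simp only: dc(2))
          also have "\<dots> = gact r (pact (e # r) d)"
            using e gact_arr_closed[OF dc(1) c(2)] gact_source[OF c(2) D_corner(1)[OF dc(1)]] c(3)
            by (simp add: act_ghost_arrow del: pact.simps)
          finally show ?thesis using gact_in_span[OF dc(1) c(2)] Nil Arrow by simp
        qed
      next
        case (Cons f q')
        then have f: "f \<in> arcs G" "q' \<in> arr" "src q' = head G f" using q by (auto simp: G.Cons_arrivals_iff)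
        then have "gact q d \<cdot> ar e = (if f = e then gact q' d else \<zero>\<^bsub>M\<^esub>)"
          using e gact_arr_closed[OF d f(2)] gact_source[OF f(2) D_corner(1)[OF d]] Cons
          by (cases "f = e") (simp_all add: act_ghost_arrow)
        then show ?thesis using gact_in_span[OF d f(2)] Arrow by (simp add: arrival_span.zero)
      qed
    next
      case (Ghost e)
      then have e: "e \<in> arcs G" "head G e = src q" using g True by auto
      have eq: "gact q d \<cdot> gh e = gact (e # q) d" by simp
      show ?thesis
      proof (cases "tail G e = v")
        case True
        then have "e # q \<in> ret" using e q by (auto simp: pre_digraph.returns_def)
        then have "gact (e # q) d \<in> D" using D d unfolding corner_stable_def by blast
        then show ?thesis using gact_in_span[of _ "[]"] v Ghost by fastforce
      next
        case False
        then have "e # q \<in> arr" using e q by (auto simp: G.Cons_arrivals_iff)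
        then show ?thesis using gact_in_span[OF d] Ghost eq by metis
      qed
    qed
  qed
qed

lemma arrival_span_act:
  assumes a: "a \<in> carrier L" and *: "\<And>d q. \<lbrakk>d \<in> D; q \<in> arr\<rbrakk> \<Longrightarrow> gact q d \<cdot> a \<in> arrival_span D"
    and x: "x \<in> arrival_span D"
  shows "x \<cdot> a \<in> arrival_span D"
  using x
proof (induction rule: arrival_span.induct)
  case zero then show ?case using a by (simp add: M.ract_zero_left arrival_span.zero)
next
  case (add x d q)
  then show ?case
    using a arrival_span_add[OF *[of d q] add.IH]
    by (simp add: M.ract_l_distr arrival_span_closed gact_arr_closed)
qed

lemma submodule_arrival_span: "submodule_of L M (arrival_span D)"
proof (rule submodule_if_gens)
  show "arrival_span D \<subseteq> carrier M" using arrival_span_closed by blast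
  show "x \<cdot> gn g \<in> arrival_span D" if "x \<in> arrival_span D" "g \<in> leavitt_gens G" for x g
    using arrival_span_act[OF _ gact_gen_in_span that(1)] that(2) by simp
  show "x \<cdot> sc r \<in> arrival_span D" if "x \<in> arrival_span D" "r \<in> carrier R" for x r
  proof (rule arrival_span_act[OF _ _ that(1)])
    fix d q assume d: "d \<in> D" "q \<in> arr"
    have "d \<cdot> sc r \<in> D" using D d that(2) unfolding corner_stable_def by blast
    moreover have "gact q d \<cdot> sc r = gact q (d \<cdot> sc r)"
      using d that(2) by (simp add: gact_sc arr_arcs D_corner)
    ultimately show "gact q d \<cdot> sc r \<in> arrival_span D" using gact_in_span d(2) by simp
  qed (simp add: that)
qed (auto intro: arrival_span.zero arrival_span_add)

lemma arrival_span_coef_mem: "\<lbrakk>x \<in> arrival_span D; q \<in> arr\<rbrakk> \<Longrightarrow> coef q x \<in> D"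
proof (induction rule: arrival_span.induct)
  case zero then show ?case using D by (simp add: coef_zero corner_stable_def)
next
  case (add x d q')
  have "(if q = q' then d else \<zero>\<^bsub>M\<^esub>) \<in> D" using D add by (simp add: corner_stable_def)
  moreover have "coef q x \<in> D" using add by simp
  ultimately have "coef q x \<oplus>\<^bsub>M\<^esub> (if q = q' then d else \<zero>\<^bsub>M\<^esub>) \<in> D"
    using D unfolding corner_stable_def by blast
  moreover have "coef q (x \<oplus>\<^bsub>M\<^esub> gact q' d) = coef q x \<oplus>\<^bsub>M\<^esub> (if q = q' then d else \<zero>\<^bsub>M\<^esub>)"
    using add by (simp add: coef_add arrival_span_closed gact_arr_closed coef_gact D_corner)
  ultimately show ?case by (simp only:)
qed

text \<open>An element of the span is the sum of its components, so it is determined by its coefficients.\<close>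

lemma arrival_span_expansion:
  assumes "x \<in> arrival_span D"
  shows "\<exists>F\<subseteq>arr. finite F \<and> (\<forall>q\<in>arr - F. coef q x = \<zero>\<^bsub>M\<^esub>) \<and> x = finsum M (\<lambda>q. gact q (coef q x)) F"
  using assms
proof (induction rule: arrival_span.induct)
  case zero
  show ?case by (rule exI[of _ "{}"]) (simp add: coef_zero)
next
  case (add x d q')
  then obtain F where F: "F \<subseteq> arr" "finite F" "\<And>q. q \<in> arr - F \<Longrightarrow> coef q x = \<zero>\<^bsub>M\<^esub>"
    "x = finsum M (\<lambda>q. gact q (coef q x)) F" by blast
  let ?F = "insert q' F" and ?y = "x \<oplus>\<^bsub>M\<^esub> gact q' d" and ?\<delta> = "\<lambda>q. if q' = q then gact q d else \<zero>\<^bsub>M\<^esub>"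
  have sub: "?F \<subseteq> arr" using F add by simp
  have cl: "gact q (coef q x) \<in> carrier M" if "q \<in> arr" for q
    using that add arrival_span_closed coef_closed arr_arcs by (simp add: gact_closed)
  have y: "coef q ?y = coef q x \<oplus>\<^bsub>M\<^esub> (if q = q' then d else \<zero>\<^bsub>M\<^esub>)" if "q \<in> arr" for q
    using that add by (simp add: coef_add arrival_span_closed gact_arr_closed coef_gact D_corner)
  have gy: "gact q (coef q ?y) = gact q (coef q x) \<oplus>\<^bsub>M\<^esub> ?\<delta> q" if "q \<in> arr" for q
    using that add y[OF that] coef_closed[OF that arrival_span_closed[OF add.hyps(1)]]
    by (auto simp: gact_add gact_zero arr_arcs D_corner cl)
  have "finsum M (\<lambda>q. gact q (coef q ?y)) ?F = finsum M (\<lambda>q. gact q (coef q x) \<oplus>\<^bsub>M\<^esub> ?\<delta> q) ?F"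
    by (rule M.M.finsum_cong') (use sub gy cl add gact_arr_closed in auto)
  also have "\<dots> = finsum M (\<lambda>q. gact q (coef q x)) ?F \<oplus>\<^bsub>M\<^esub> finsum M ?\<delta> ?F"
    by (rule M.M.finsum_addf) (use sub cl add gact_arr_closed in auto)
  also have "finsum M ?\<delta> ?F = gact q' d"
    using sub add F gact_arr_closed by (subst M.finsum_singleton) auto
  also have "finsum M (\<lambda>q. gact q (coef q x)) ?F = finsum M (\<lambda>q. gact q (coef q x)) F"
  proof (rule M.M.add.finprod_mono_neutral_cong_right)
    show "gact i (coef i x) = \<zero>\<^bsub>M\<^esub>" if "i \<in> ?F - F" for i
      using that F(3) add.hyps(3) by (auto simp: gact_zero arr_arcs)
  qed (use F sub cl in auto)
  also have "\<dots> = x" using F(4) by simp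
  finally have "?y = finsum M (\<lambda>q. gact q (coef q ?y)) ?F" by simp
  moreover have "\<forall>q\<in>arr - ?F. coef q ?y = \<zero>\<^bsub>M\<^esub>" using y F(3) by auto
  ultimately show ?case using sub F(2) by (intro exI[of _ ?F]) blast
qed

lemma arrival_span_nonzero_coef:
  assumes "x \<in> arrival_span D" "x \<noteq> \<zero>\<^bsub>M\<^esub>" shows "\<exists>q\<in>arr. coef q x \<noteq> \<zero>\<^bsub>M\<^esub>"
proof (rule ccontr)
  assume *: "\<not> (\<exists>q\<in>arr. coef q x \<noteq> \<zero>\<^bsub>M\<^esub>)"
  obtain F where F: "F \<subseteq> arr" "x = finsum M (\<lambda>q. gact q (coef q x)) F"
    using arrival_span_expansion[OF assms(1)] by blast
  have "finsum M (\<lambda>q. gact q (coef q x)) F = finsum M (\<lambda>q. \<zero>\<^bsub>M\<^esub>) F"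
    by (rule M.M.finsum_cong') (use F(1) * in \<open>simp_all add: gact_zero arr_arcs subsetD[OF F(1)]\<close>)
  then show False using F(2) assms(2) by simp
qed

lemma arrival_span_support:
  assumes "x \<in> arrival_span D" "u \<in> verts G" "u \<notin> predecessors G v" shows "x \<cdot> vx u = \<zero>\<^bsub>M\<^esub>"
  using assms(1)
proof (induction rule: arrival_span.induct)
  case zero then show ?case using assms by (simp add: M.ract_zero_left)
next
  case (add x d q)
  have "src q \<noteq> u" "src q \<in> verts G"
    using G.path_source_predecessors[OF add.hyps(3)] assms(3) G.path_source_in_verts[OF add.hyps(3)] by auto
  then have "gact q d \<cdot> vx u = \<zero>\<^bsub>M\<^esub>"
    using act_vertex[OF gact_arr_closed[OF add.hyps(2,3)], of "src q" u]
      gact_source[OF add.hyps(3) D_corner(1)[OF add.hyps(2)]] assms(2) by simp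
  then show ?case
    using add assms by (simp add: M.ract_l_distr arrival_span_closed gact_arr_closed)
qed

lemma arrival_span_corner: assumes "x \<in> arrival_span D" "x \<cdot> vx v = x" shows "x \<in> D"
  using arrival_span_coef_mem[of x "[]"] assms v by (simp add: coef_Nil)

lemma arrival_span_generated:
  assumes x0: "x0 \<in> D" and gen: "\<And>y. y \<in> carrier M \<Longrightarrow> \<exists>a\<in>carrier L. y = x0 \<cdot> a"
  shows "arrival_span D = carrier M"
proof -
  have "x0 \<in> arrival_span D" using gact_in_span[OF x0, of "[]"] v by simp
  then have "y \<in> arrival_span D" if "y \<in> carrier M" for y
    using gen[OF that] M.submodule_ofD(4)[OF submodule_arrival_span] by blast
  then show ?thesis using arrival_span_closed by blast
qed

end

subsection \<open>A commutative ring that acts on the corner\<close>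

text \<open>
  The last clause is what links \<open>A\<close> to the whole module: subgroups of the corner that are stable
  under \<open>A\<close> span submodules. At a sink, \<open>A\<close> is the ring of scalars; at a vertex on a cycle it is the
  ring of Laurent polynomials.
\<close>

definition corner_action :: "('a, 'w) ring_scheme \<Rightarrow> ('a \<Rightarrow> ('v, 'e, 'k) leavitt) \<Rightarrow> bool" where
  "corner_action A E \<longleftrightarrow> (\<forall>f\<in>carrier A. E f \<in> carrier L) \<and>
     (\<forall>x\<in>corner. \<forall>f\<in>carrier A. x \<cdot> E f \<in> corner) \<and>
     (\<forall>x\<in>corner. \<forall>f\<in>carrier A. \<forall>g\<in>carrier A. x \<cdot> E (f \<oplus>\<^bsub>A\<^esub> g) = x \<cdot> E f \<oplus>\<^bsub>M\<^esub> x \<cdot> E g) \<and>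
     (\<forall>x\<in>corner. \<forall>f\<in>carrier A. \<forall>g\<in>carrier A. x \<cdot> E (f \<otimes>\<^bsub>A\<^esub> g) = x \<cdot> E f \<cdot> E g) \<and>
     (\<forall>x\<in>corner. x \<cdot> E \<one>\<^bsub>A\<^esub> = x) \<and>
     (\<forall>D. D \<subseteq> corner \<and> \<zero>\<^bsub>M\<^esub> \<in> D \<and> (\<forall>x\<in>D. \<forall>y\<in>D. x \<oplus>\<^bsub>M\<^esub> y \<in> D) \<and>
        (\<forall>x\<in>D. \<forall>f\<in>carrier A. x \<cdot> E f \<in> D) \<longrightarrow> corner_stable D)"

text \<open>
  For a maximal ideal \<open>\<mm>\<close> of \<open>A\<close> this describes the simple modules that do not vanish at \<open>v\<close>: the
  element \<open>x\<close> spans a copy of \<open>A/\<mm>\<close> in the corner, and \<open>M\<close> is the sum of the translates of this copy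
  by the ghosts of arrivals.
\<close>

definition based :: "('a \<Rightarrow> ('v, 'e, 'k) leavitt) \<Rightarrow> 'a set \<Rightarrow> 'm \<Rightarrow> bool" where
  "based E \<mm> x \<longleftrightarrow> x \<in> corner \<and> x \<noteq> \<zero>\<^bsub>M\<^esub> \<and> (\<forall>y\<in>carrier M. \<exists>a\<in>carrier L. y = x \<cdot> a) \<and>
     (\<forall>f\<in>\<mm>. x \<cdot> E f = \<zero>\<^bsub>M\<^esub>)"

context
  fixes A :: "('a, 'w) ring_scheme" and E :: "'a \<Rightarrow> ('v, 'e, 'k) leavitt"
  assumes A: "cring A" and E: "corner_action A E"
begin

interpretation A: cring A by (rule A)

lemma E_closed: "f \<in> carrier A \<Longrightarrow> E f \<in> carrier L"
  and act_E_corner: "\<lbrakk>x \<in> corner; f \<in> carrier A\<rbrakk> \<Longrightarrow> x \<cdot> E f \<in> corner"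
  and act_E_add: "\<lbrakk>x \<in> corner; f \<in> carrier A; g \<in> carrier A\<rbrakk> \<Longrightarrow> x \<cdot> E (f \<oplus>\<^bsub>A\<^esub> g) = x \<cdot> E f \<oplus>\<^bsub>M\<^esub> x \<cdot> E g"
  and act_E_mult: "\<lbrakk>x \<in> corner; f \<in> carrier A; g \<in> carrier A\<rbrakk> \<Longrightarrow> x \<cdot> E (f \<otimes>\<^bsub>A\<^esub> g) = x \<cdot> E f \<cdot> E g"
  and act_E_one: "x \<in> corner \<Longrightarrow> x \<cdot> E \<one>\<^bsub>A\<^esub> = x"
  using E by (simp_all only: corner_action_def)

lemma stableI:
  assumes "D \<subseteq> corner" "\<zero>\<^bsub>M\<^esub> \<in> D" "\<And>x y. \<lbrakk>x \<in> D; y \<in> D\<rbrakk> \<Longrightarrow> x \<oplus>\<^bsub>M\<^esub> y \<in> D"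
    and "\<And>x f. \<lbrakk>x \<in> D; f \<in> carrier A\<rbrakk> \<Longrightarrow> x \<cdot> E f \<in> D"
  shows "corner_stable D"
proof -
  have "\<forall>D. D \<subseteq> corner \<and> \<zero>\<^bsub>M\<^esub> \<in> D \<and> (\<forall>x\<in>D. \<forall>y\<in>D. x \<oplus>\<^bsub>M\<^esub> y \<in> D) \<and>
      (\<forall>x\<in>D. \<forall>f\<in>carrier A. x \<cdot> E f \<in> D) \<longrightarrow> corner_stable D"
    using E unfolding corner_action_def by (elim conjE)
  then show ?thesis using assms by simp
qed

lemma act_E_zero: "x \<in> corner \<Longrightarrow> x \<cdot> E \<zero>\<^bsub>A\<^esub> = \<zero>\<^bsub>M\<^esub>"
  by (rule additive_zero[of A M "\<lambda>f. x \<cdot> E f"])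
    (auto simp: A.abelian_group_axioms M.M.abelian_group_axioms act_E_add act_E_corner cornerD)

lemma act_E_comm:
  "\<lbrakk>x \<in> corner; f \<in> carrier A; g \<in> carrier A\<rbrakk> \<Longrightarrow> x \<cdot> E f \<cdot> E g = x \<cdot> E g \<cdot> E f"
  by (simp add: act_E_mult[symmetric] A.m_comm)

lemma cyclic_corner_stable: assumes x: "x \<in> corner" shows "corner_stable ((\<lambda>f. x \<cdot> E f) ` carrier A)"
proof (rule stableI)
  show "(\<lambda>f. x \<cdot> E f) ` carrier A \<subseteq> corner" using act_E_corner[OF x] by blast
  show "\<zero>\<^bsub>M\<^esub> \<in> (\<lambda>f. x \<cdot> E f) ` carrier A" using act_E_zero[OF x] by (metis A.zero_closed imageI)
  show "y \<oplus>\<^bsub>M\<^esub> z \<in> (\<lambda>f. x \<cdot> E f) ` carrier A"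
    if "y \<in> (\<lambda>f. x \<cdot> E f) ` carrier A" "z \<in> (\<lambda>f. x \<cdot> E f) ` carrier A" for y z
    using that x by (auto simp: act_E_add[symmetric])
  show "y \<cdot> E g \<in> (\<lambda>f. x \<cdot> E f) ` carrier A"
    if "y \<in> (\<lambda>f. x \<cdot> E f) ` carrier A" "g \<in> carrier A" for y g
    using that x by (auto simp: act_E_mult[symmetric])
qed

lemma mem_cyclic_corner: "x \<in> corner \<Longrightarrow> x \<in> (\<lambda>f. x \<cdot> E f) ` carrier A"
  using act_E_one by (metis A.one_closed imageI)

context
  fixes \<mm> x assumes \<mm>: "maximalideal \<mm> A" and x: "based E \<mm> x"
begin

interpretation \<mm>: maximalideal \<mm> A by (rule \<mm>)

lemma based_corner: "x \<in> corner" and based_nonzero: "x \<noteq> \<zero>\<^bsub>M\<^esub>"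
  and based_gen: "y \<in> carrier M \<Longrightarrow> \<exists>a\<in>carrier L. y = x \<cdot> a"
  and based_zero: "f \<in> \<mm> \<Longrightarrow> x \<cdot> E f = \<zero>\<^bsub>M\<^esub>"
  using x unfolding based_def by blast+

lemma based_span: "arrival_span ((\<lambda>f. x \<cdot> E f) ` carrier A) = carrier M"
  by (rule arrival_span_generated[OF cyclic_corner_stable mem_cyclic_corner])
    (use based_corner based_gen in auto)

lemma based_corner_eq: assumes "y \<in> corner" shows "\<exists>f\<in>carrier A. y = x \<cdot> E f"
  using arrival_span_corner[OF cyclic_corner_stable[OF based_corner], of y] assms based_span
  by (auto simp: cornerD)

lemma based_act_eq_zero_iff:
  assumes f: "f \<in> carrier A" shows "x \<cdot> E f = \<zero>\<^bsub>M\<^esub> \<longleftrightarrow> f \<in> \<mm>"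
    and based_act_inverse: "f \<notin> \<mm> \<Longrightarrow> \<exists>g\<in>carrier A. x \<cdot> E f \<cdot> E g = x"
proof -
  show inv: "\<exists>g\<in>carrier A. x \<cdot> E f \<cdot> E g = x" if fm: "f \<notin> \<mm>"
  proof -
    obtain g h where gh: "g \<in> carrier A" "h \<in> \<mm>" "\<one>\<^bsub>A\<^esub> = f \<otimes>\<^bsub>A\<^esub> g \<oplus>\<^bsub>A\<^esub> h"
      using A.maximalideal_plus_principal[OF \<mm> f fm] by blast
    have "x = x \<cdot> E (f \<otimes>\<^bsub>A\<^esub> g \<oplus>\<^bsub>A\<^esub> h)" using act_E_one[OF based_corner] gh(3) by simp
    also have "\<dots> = x \<cdot> E f \<cdot> E g"
      using gh(1,2) f based_corner act_E_corner
      by (simp add: act_E_add act_E_mult based_zero \<mm>.Icarr cornerD)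
    finally have "x \<cdot> E f \<cdot> E g = x" by (rule HOL.sym)
    then show ?thesis using gh(1) by (rule bexI)
  qed
  show "x \<cdot> E f = \<zero>\<^bsub>M\<^esub> \<longleftrightarrow> f \<in> \<mm>"
  proof
    assume 0: "x \<cdot> E f = \<zero>\<^bsub>M\<^esub>"
    show "f \<in> \<mm>"
    proof (rule ccontr)
      assume "f \<notin> \<mm>"
      then obtain g where "g \<in> carrier A" "x \<cdot> E f \<cdot> E g = x" using inv by blast
      then show False using 0 based_nonzero M.ract_zero_left[OF E_closed] by simp
    qed
  qed (rule based_zero)
qed

text \<open>
  A nonzero \<open>y\<close> has a nonzero coefficient, which has the form \<open>x f\<close> with \<open>f\<close> outside \<open>\<mm>\<close>. Since \<open>f\<close> is
  invertible modulo \<open>\<mm>\<close>, the generator \<open>x\<close> is recovered from \<open>y\<close>.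
\<close>

lemma based_simple: "simple_right_module L M"
proof (rule M.simpleI[of x])
  show "x \<in> carrier M" "x \<noteq> \<zero>\<^bsub>M\<^esub>" using based_corner based_nonzero cornerD by auto
  fix y z assume y: "y \<in> carrier M" "y \<noteq> \<zero>\<^bsub>M\<^esub>" and z: "z \<in> carrier M"
  have yS: "y \<in> arrival_span ((\<lambda>f. x \<cdot> E f) ` carrier A)" using based_span y(1) by simp
  obtain q where q: "q \<in> arr" "coef q y \<noteq> \<zero>\<^bsub>M\<^esub>"
    using arrival_span_nonzero_coef[OF cyclic_corner_stable[OF based_corner] yS y(2)] by blast
  obtain f where f: "f \<in> carrier A" "coef q y = x \<cdot> E f"
    using arrival_span_coef_mem[OF cyclic_corner_stable[OF based_corner] yS q(1)] by blast
  then obtain g where g: "g \<in> carrier A" "coef q y \<cdot> E g = x"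
    using q(2) based_act_eq_zero_iff(1)[OF f(1)] based_act_inverse[OF f(1)] by metis
  obtain a where a: "a \<in> carrier L" "z = x \<cdot> a" using based_gen[OF z] by blast
  interpret L: ring L by (rule L_ring)
  have qc: "lpath R G q \<in> carrier L" using arr_arcs[OF q(1)] by (rule lpath_closed)
  have "z = y \<cdot> (lpath R G q \<otimes>\<^bsub>L\<^esub> vx v \<otimes>\<^bsub>L\<^esub> E g \<otimes>\<^bsub>L\<^esub> a)"
    using a g v y(1) qc E_closed[OF g(1)] arr_arcs[OF q(1)]
    by (simp add: M.ract_assoc act_lpath coef_def)
  then show "\<exists>a\<in>carrier L. z = y \<cdot> a"
    by (rule bexI) (simp add: a g v qc E_closed)
qed

lemma based_support: "support R G M = predecessors G v"
proof
  show "support R G M \<subseteq> predecessors G v"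
    using arrival_span_support[OF cyclic_corner_stable[OF based_corner]] unfolding based_span support_def by blast
  show "predecessors G v \<subseteq> support R G M"
  proof
    fix u assume "u \<in> predecessors G v"
    then obtain q where q: "q \<in> arr" "src q = u" by (auto simp: G.predecessors_iff)
    let ?y = "gact q x"
    have "?y \<cdot> vx u = ?y" using gact_source[OF q(1) based_corner] q(2) by simp
    moreover have "?y \<noteq> \<zero>\<^bsub>M\<^esub>"
      using coef_gact[OF q(1) q(1) based_corner] coef_zero[OF q(1)] based_nonzero by auto
    moreover have "?y \<in> carrier M" using based_corner cornerD arr_arcs[OF q(1)] by (simp add: gact_closed)
    moreover have "u \<in> verts G" using G.path_source_in_verts[OF q(1)] q(2) by simp
    ultimately show "u \<in> support R G M" unfolding support_def by (metis (mono_tags, lifting) mem_Collect_eq)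
  qed
qed

end

text \<open>
  The ideal is the annihilator of \<open>x\<close>. If \<open>f\<close> does not annihilate \<open>x\<close>, then \<open>y = x f\<close> generates \<open>M\<close> by
  simplicity, so that \<open>M\<close> is spanned by the translates of \<open>y A\<close>. As \<open>x\<close> lies in the corner, this
  puts it into \<open>y A\<close>, say \<open>x = x f g\<close>; and \<open>1 - f g\<close> annihilates \<open>x\<close>.
\<close>

lemma simple_imp_based:
  assumes M: "simple_right_module L M" and x: "x \<in> corner" "x \<noteq> \<zero>\<^bsub>M\<^esub>"
  shows "\<exists>\<mm>. maximalideal \<mm> A \<and> based E \<mm> x"
proof -
  define \<mm> where "\<mm> = {f \<in> carrier A. x \<cdot> E f = \<zero>\<^bsub>M\<^esub>}"
  have mem: "f \<in> \<mm>" if "f \<in> carrier A" "x \<cdot> E f = \<zero>\<^bsub>M\<^esub>" for f using that by (simp add: \<mm>_def)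
  have zero: "x \<cdot> E f = \<zero>\<^bsub>M\<^esub>" if "f \<in> \<mm>" for f using that by (simp add: \<mm>_def)
  have ann: "x \<cdot> E f \<cdot> E g = \<zero>\<^bsub>M\<^esub>" if "f \<in> \<mm>" "g \<in> carrier A" for f g
    using that E_closed by (simp add: \<mm>_def M.ract_zero_left)
  interpret \<mm>: ideal \<mm> A
  proof (rule idealI)
    show "ring A" by (rule A.ring_axioms)
    show "subgroup \<mm> (add_monoid A)"
    proof (rule A.add.subgroupI)
      show "\<mm> \<subseteq> carrier A" by (auto simp: \<mm>_def)
      show "\<mm> \<noteq> {}" using act_E_zero[OF x(1)] by (auto simp: \<mm>_def)
      show "\<ominus>\<^bsub>A\<^esub> f \<in> \<mm>" if "f \<in> \<mm>" for f
        using that additive_neg[of A M "\<lambda>f. x \<cdot> E f" f] x(1) act_E_corner[OF x(1)]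
        by (auto simp: \<mm>_def A.abelian_group_axioms M.M.abelian_group_axioms act_E_add cornerD)
      show "f \<oplus>\<^bsub>A\<^esub> g \<in> \<mm>" if "f \<in> \<mm>" "g \<in> \<mm>" for f g
        using that x(1) by (auto simp: \<mm>_def act_E_add)
    qed
    fix f g assume fg: "f \<in> \<mm>" "g \<in> carrier A"
    then have f: "f \<in> carrier A" by (simp add: \<mm>_def)
    show "f \<otimes>\<^bsub>A\<^esub> g \<in> \<mm>" using ann[OF fg] fg f x(1) by (simp add: \<mm>_def act_E_mult)
    then show "g \<otimes>\<^bsub>A\<^esub> f \<in> \<mm>" using fg f by (simp add: A.m_comm)
  qed
  have gen: "\<exists>a\<in>carrier L. y = x \<cdot> a" if "y \<in> carrier M" for y
    using M.simpleD[OF M _ x(2) that] x(1) cornerD by blast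
  have "maximalideal \<mm> A"
  proof (rule maximalidealI)
    show "ideal \<mm> A" by (rule \<mm>.ideal_axioms)
    show "carrier A \<noteq> \<mm>"
    proof
      assume "carrier A = \<mm>"
      then have "\<one>\<^bsub>A\<^esub> \<in> \<mm>" using A.one_closed by (simp only:)
      then have "x \<cdot> E \<one>\<^bsub>A\<^esub> = \<zero>\<^bsub>M\<^esub>" by (rule zero)
      then show False using act_E_one[OF x(1)] x(2) by (simp only:)
    qed
    fix J assume J: "ideal J A" "\<mm> \<subseteq> J" "J \<subseteq> carrier A"
    interpret J: ideal J A by (rule J)
    show "J = \<mm> \<or> J = carrier A"
    proof (cases "J \<subseteq> \<mm>")
      case False
      then obtain f where f: "f \<in> J" "f \<notin> \<mm>" by blast
      have fA: "f \<in> carrier A" using f(1) J(3) by (rule rev_subsetD)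
      have nz: "x \<cdot> E f \<noteq> \<zero>\<^bsub>M\<^esub>" using f(2) mem[OF fA] by (rule contrapos_nn)
      let ?y = "x \<cdot> E f"
      have y: "?y \<in> corner" using x(1) fA by (rule act_E_corner)
      note st = cyclic_corner_stable[OF y]
      have "\<exists>a\<in>carrier L. z = ?y \<cdot> a" if "z \<in> carrier M" for z
        using M.simpleD[OF M _ nz that] y cornerD by blast
      then have "arrival_span ((\<lambda>g. ?y \<cdot> E g) ` carrier A) = carrier M"
        by (rule arrival_span_generated[OF st mem_cyclic_corner[OF y]])
      then have "x \<in> (\<lambda>g. ?y \<cdot> E g) ` carrier A"
        using arrival_span_corner[OF st, of x] x(1) by (simp add: cornerD)
      then obtain g where g: "g \<in> carrier A" "x = ?y \<cdot> E g" by blast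
      let ?h = "\<one>\<^bsub>A\<^esub> \<oplus>\<^bsub>A\<^esub> \<ominus>\<^bsub>A\<^esub> (f \<otimes>\<^bsub>A\<^esub> g)"
      have xfg: "x \<cdot> E (f \<otimes>\<^bsub>A\<^esub> g) = x" using g x(1) fA by (simp add: act_E_mult)
      have "x \<cdot> E (?h \<oplus>\<^bsub>A\<^esub> f \<otimes>\<^bsub>A\<^esub> g) = x"
        using act_E_one[OF x(1)] fA g(1) by (simp add: A.a_assoc A.l_neg)
      then have "x \<cdot> E ?h \<oplus>\<^bsub>M\<^esub> x = x" using x(1) fA g(1) xfg act_E_add[OF x(1), of ?h "f \<otimes>\<^bsub>A\<^esub> g"] by simp
      moreover have "x \<cdot> E ?h \<in> carrier M" "x \<in> carrier M"
        using act_E_corner[OF x(1), of ?h] x(1) fA g(1) cornerD by auto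
      ultimately have "x \<cdot> E ?h = \<zero>\<^bsub>M\<^esub>" using M.M.add.r_cancel_one by metis
      then have "?h \<in> \<mm>" using fA g(1) by (intro mem) simp_all
      then have "?h \<in> J" using J(2) by (rule rev_subsetD)
      moreover have "f \<otimes>\<^bsub>A\<^esub> g \<in> J" using f(1) g(1) by (rule J.I_r_closed)
      ultimately have "?h \<oplus>\<^bsub>A\<^esub> f \<otimes>\<^bsub>A\<^esub> g \<in> J" by (rule J.a_closed)
      then have "\<one>\<^bsub>A\<^esub> \<in> J" using fA g(1) by (simp add: A.a_assoc A.l_neg)
      then show ?thesis using J.one_imp_carrier by blast
    qed (use J in blast)
  qed
  moreover have "based E \<mm> x" using x gen zero by (simp add: based_def)
  ultimately show ?thesis by blast
qed

end

end

section \<open>Comparing based modules\<close>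

definition (in leavitt_corner) supported :: bool where
  "supported \<longleftrightarrow> (\<forall>x\<in>carrier M. \<forall>u\<in>verts G - predecessors G v. x \<cdot> vx u = \<zero>\<^bsub>M\<^esub>)"

lemma (in leavitt_corner) supported_iff: "supported \<longleftrightarrow> support R G M \<subseteq> predecessors G v"
  unfolding supported_def support_def by blast

lemma leavitt_cornerI:
  assumes "leavitt_algebra R G" "right_module (leavitt R G) M" "v \<in> verts G"
  shows "leavitt_corner R G M v"
  by (intro leavitt_corner.intro leavitt_module.intro leavitt_corner_axioms.intro assms)

text \<open>
  Two modules with generators killed by the same maximal ideal are isomorphic: the submodule of
  the product generated by the pair is again simple, and projects onto both. As this submodule
  only arises in the proof, the action of \<open>A\<close> is demanded of every module with its support.
\<close>

lemma based_iso:
  fixes M :: "(('v, 'e, 'k) leavitt, 'm) rmodule" and M' :: "(('v, 'e, 'k) leavitt, 'n) rmodule"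
  assumes M: "leavitt_corner R G M v" and M': "leavitt_corner R G M' v"
    and A: "cring A" and \<mm>: "maximalideal \<mm> A"
    and E: "leavitt_corner.corner_action R G M v A E" and E': "leavitt_corner.corner_action R G M' v A E"
    and EN: "\<And>N :: (('v, 'e, 'k) leavitt, 'm \<times> 'n) rmodule. \<lbrakk>leavitt_corner R G N v;
        leavitt_corner.supported R G N v\<rbrakk> \<Longrightarrow> leavitt_corner.corner_action R G N v A E"
    and x: "leavitt_corner.based R G M v E \<mm> x" and x': "leavitt_corner.based R G M' v E \<mm> x'"
  shows "rmodule_iso (leavitt R G) M M'"
proof -
  interpret M: leavitt_corner R G M v by (rule M)
  interpret M': leavitt_corner R G M' v by (rule M')
  have mod: "right_module M.L M" "right_module M.L M'"
    by (rule M.M.right_module_axioms, rule M'.M.right_module_axioms)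
  define P where "P = prod_module M M'"
  interpret P: right_module M.L P unfolding P_def using mod by (rule right_module_prod_module)
  note xc = M.based_corner[OF A E \<mm> x] and xc' = M'.based_corner[OF A E' \<mm> x']
  have xP: "(x, x') \<in> carrier P" using M.cornerD(1)[OF xc] M'.cornerD(1)[OF xc'] by (simp add: P_def)
  define N where "N = sub_module P (ract P (x, x') ` carrier M.L)"
  have N: "right_module M.L N"
    unfolding N_def by (rule P.right_module_sub_module[OF P.cyclic_submodule[OF xP]])
  have car: "carrier N = ract P (x, x') ` carrier M.L" by (simp add: N_def)
  have carP: "carrier N \<subseteq> carrier M \<times> carrier M'"
    using P.ract_closed[OF xP] by (auto simp: car P_def)
  have act: "ract N y a = (ract M (fst y) a, ract M' (snd y) a)" for y a
    by (simp add: N_def P_def)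
  have add: "y \<oplus>\<^bsub>N\<^esub> z = (fst y \<oplus>\<^bsub>M\<^esub> fst z, snd y \<oplus>\<^bsub>M'\<^esub> snd z)" for y z
    by (simp add: N_def P_def)
  have zero: "\<zero>\<^bsub>N\<^esub> = (\<zero>\<^bsub>M\<^esub>, \<zero>\<^bsub>M'\<^esub>)" by (simp add: N_def P_def)
  interpret N: leavitt_corner R G N v
    by (rule leavitt_cornerI[OF M.leavitt_algebra_axioms N M.v])
  have xN: "(x, x') \<in> carrier N"
    unfolding car using P.ract_one[OF xP] M.L_one_closed by (metis imageI)
  have "M.supported" "M'.supported"
    using M.based_support[OF A E \<mm> x] M'.based_support[OF A E' \<mm> x']
    by (simp_all add: M.supported_iff M'.supported_iff)
  then have "N.supported"
    unfolding N.supported_def M.supported_def M'.supported_def act zero using carP by auto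
  then have E_N: "N.corner_action A E" using EN N.leavitt_corner_axioms by blast
  have xbN: "N.based E \<mm> (x, x')"
    unfolding N.based_def
  proof (intro conjI ballI)
    show "(x, x') \<in> N.corner"
      using xN M.cornerD(2)[OF xc] M'.cornerD(2)[OF xc'] by (simp add: N.corner_def act)
    show "(x, x') \<noteq> \<zero>\<^bsub>N\<^esub>" using M.based_nonzero[OF A E \<mm> x] by (simp add: zero)
    show "\<exists>a\<in>carrier M.L. y = ract N (x, x') a" if "y \<in> carrier N" for y
      using that by (auto simp: car act P_def)
    show "ract N (x, x') (E f) = \<zero>\<^bsub>N\<^esub>" if "f \<in> \<mm>" for f
      using that M.based_zero[OF A E \<mm> x] M'.based_zero[OF A E' \<mm> x'] by (simp add: act zero)
  qed
  have simp_N: "simple_right_module M.L N" by (rule N.based_simple[OF A E_N \<mm> xbN])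
  have "rmodule_hom M.L N M fst" "rmodule_hom M.L N M' snd"
    using carP by (auto simp: rmodule_hom_def add act)
  moreover have "fst (x, x') \<noteq> \<zero>\<^bsub>M\<^esub>" "snd (x, x') \<noteq> \<zero>\<^bsub>M'\<^esub>"
    using M.based_nonzero[OF A E \<mm> x] M'.based_nonzero[OF A E' \<mm> x'] by simp_all
  ultimately have "rmodule_iso M.L N M" "rmodule_iso M.L N M'"
    using schur[OF simp_N M.based_simple[OF A E \<mm> x] _ xN] schur[OF simp_N M'.based_simple[OF A E' \<mm> x'] _ xN]
    unfolding rmodule_iso_iff by meson+
  then show ?thesis using rmodule_iso_sym[OF N] rmodule_iso_trans by meson
qed

text \<open>
  Every element of the corner of the second module has the form \<open>x' g\<close>, so \<open>\<mm>'\<close> annihilates the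
  whole corner, including the image of \<open>x\<close>.
\<close>

lemma based_ideal_unique:
  fixes M :: "(('v, 'e, 'k) leavitt, 'm) rmodule" and M' :: "(('v, 'e, 'k) leavitt, 'n) rmodule"
  assumes M: "leavitt_corner R G M v" and M': "leavitt_corner R G M' v"
    and A: "cring A" and \<mm>: "maximalideal \<mm> A" and \<mm>': "maximalideal \<mm>' A"
    and E: "leavitt_corner.corner_action R G M v A E" and E': "leavitt_corner.corner_action R G M' v A E"
    and x: "leavitt_corner.based R G M v E \<mm> x" and x': "leavitt_corner.based R G M' v E \<mm>' x'"
    and iso: "rmodule_iso (leavitt R G) M M'"
  shows "\<mm> = \<mm>'"
proof -
  interpret M: leavitt_corner R G M v by (rule M)
  interpret M': leavitt_corner R G M' v by (rule M')
  interpret A: cring A by (rule A)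
  obtain f where f: "rmodule_hom M.L M M' f" "bij_betw f (carrier M) (carrier M')"
    using iso by (auto simp: rmodule_iso_iff)
  note xc = M.based_corner[OF A E \<mm> x] and xc' = M'.based_corner[OF A E' \<mm>' x']
  note xM = M.cornerD(1)[OF xc]
  have f0: "f \<zero>\<^bsub>M\<^esub> = \<zero>\<^bsub>M'\<^esub>"
    using M.M.right_module_axioms M'.M.right_module_axioms f(1) by (rule rmodule_hom_zero)
  have f_act: "f (ract M x a) = ract M' (f x) a" if "a \<in> carrier M.L" for a
    using f(1) xM that by (simp add: rmodule_hom_def)
  have fx: "f x \<in> M'.corner"
  proof -
    have "f x \<in> carrier M'" using f(1) xM by (auto simp: rmodule_hom_def)
    moreover have "ract M' (f x) (M.vx v) = f x"
      using f_act[of "M.vx v"] M.v M.cornerD(2)[OF xc] by simp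
    ultimately show ?thesis by (simp add: M'.corner_def)
  qed
  obtain g where g: "g \<in> carrier A" "f x = ract M' x' (E g)"
    using M'.based_corner_eq[OF A E' \<mm>' x' fx] by blast
  have "\<mm>' \<subseteq> \<mm>"
  proof
    fix h assume h: "h \<in> \<mm>'"
    have hA: "h \<in> carrier A" using \<mm>' h ideal.Icarr maximalideal.axioms(1) by metis
    have "ract M' (f x) (E h) = ract M' (ract M' x' (E h)) (E g)"
      unfolding g(2) by (rule M'.act_E_comm[OF A E' xc' g(1) hA])
    also have "\<dots> = \<zero>\<^bsub>M'\<^esub>"
      using M'.based_zero[OF A E' \<mm>' x' h] M'.M.ract_zero_left[OF M'.E_closed[OF A E' g(1)]] by simp
    finally have "f (ract M x (E h)) = f \<zero>\<^bsub>M\<^esub>"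
      using f_act[OF M.E_closed[OF A E hA]] f0 by simp
    then have "ract M x (E h) = \<zero>\<^bsub>M\<^esub>"
      using f(2) M.M.ract_closed[OF xM M.E_closed[OF A E hA]] M.M.M.zero_closed
      unfolding bij_betw_def by (metis inj_onD)
    then show "h \<in> \<mm>" using M.based_act_eq_zero_iff[OF A E \<mm> x hA] by simp
  qed
  moreover have "ideal \<mm> A" "\<mm> \<subseteq> carrier A" "\<mm> \<noteq> carrier A"
    using \<mm> maximalideal.axioms(1) maximalideal.I_notcarr ideal.Icarr by fast+
  ultimately show ?thesis using maximalideal.I_maximal[OF \<mm>'] by metis
qed

section \<open>The corner at a sink\<close>

text \<open>
  A sink has no returns and no arrows out of it, so only stability under scalars is left.
\<close>

lemma sink_corner_action:
  assumes "leavitt_corner R G M w" and w: "is_sink G w"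
  shows "leavitt_corner.corner_action R G M w R (\<lambda>r. r \<odot>\<^bsub>leavitt R G\<^esub> \<one>\<^bsub>leavitt R G\<^esub>)"
proof -
  interpret leavitt_corner R G M w by fact
  have ret: "ret = {}" using w by (auto simp: pre_digraph.returns_def is_sink_def)
  note act = act_smult[OF _ _ L_one_closed, symmetric]
  have one: "x \<cdot> \<one>\<^bsub>L\<^esub> = x" if "x \<in> corner" for x using that by (simp add: M.ract_one cornerD)
  show ?thesis
    unfolding corner_action_def
  proof (intro conjI ballI allI impI)
    fix x f assume x: "x \<in> corner" and f: "f \<in> carrier R"
    show "x \<cdot> sc f \<in> corner"
      using x f v act_sc_comm[of x f "vx w"] by (simp add: corner_def M.ract_closed)
    fix g assume g: "g \<in> carrier R"
    show "x \<cdot> sc (f \<oplus>\<^bsub>R\<^esub> g) = x \<cdot> sc f \<oplus>\<^bsub>M\<^esub> x \<cdot> sc g"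
      using x f g by (simp add: smult_l_distr L_one_closed M.ract_r_distr cornerD)
    show "x \<cdot> sc (f \<otimes>\<^bsub>R\<^esub> g) = x \<cdot> sc f \<cdot> sc g"
    proof -
      have "x \<cdot> sc (f \<otimes>\<^bsub>R\<^esub> g) = x \<cdot> sc (g \<otimes>\<^bsub>R\<^esub> f)" using f g by (simp add: m_comm)
      also have "\<dots> = x \<cdot> (g \<odot>\<^bsub>L\<^esub> sc f)" using f g by (simp add: smult_assoc1 L_one_closed)
      also have "\<dots> = x \<cdot> sc f \<cdot> sc g" using x f g by (intro act_smult) (simp_all add: cornerD)
      finally show ?thesis .
    qed
  next
    fix x assume "x \<in> corner"
    then show "x \<cdot> sc \<one>\<^bsub>R\<^esub> = x" by (simp add: smult_one L_one_closed one)
  next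
    fix D assume D: "D \<subseteq> corner \<and> \<zero>\<^bsub>M\<^esub> \<in> D \<and> (\<forall>x\<in>D. \<forall>y\<in>D. x \<oplus>\<^bsub>M\<^esub> y \<in> D) \<and>
        (\<forall>x\<in>D. \<forall>f\<in>carrier R. x \<cdot> sc f \<in> D)"
    show "corner_stable D"
      unfolding corner_stable_def using D w by (simp add: ret is_sink_def)
  qed simp
qed

section \<open>Laurent polynomials form a commutative ring\<close>

context cring begin

abbreviation "LP \<equiv> laurent R"

lemma laurent_carrier_iff: "f \<in> carrier LP \<longleftrightarrow> (\<forall>i. f i \<in> carrier R) \<and> finite {i. f i \<noteq> \<zero>}"
  by (simp add: laurent_def)

lemma laurent_simps:
  "\<zero>\<^bsub>LP\<^esub> = (\<lambda>n. \<zero>)" "\<one>\<^bsub>LP\<^esub> = (\<lambda>n. if n = 0 then \<one> else \<zero>)" "f \<oplus>\<^bsub>LP\<^esub> g = (\<lambda>n. f n \<oplus> g n)"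
  by (simp_all add: laurent_def)

lemma laurent_coeff_closed [simp]: "f \<in> carrier LP \<Longrightarrow> f i \<in> carrier R"
  and laurent_finite_supp: "f \<in> carrier LP \<Longrightarrow> finite {i. f i \<noteq> \<zero>}"
  by (simp_all add: laurent_carrier_iff)

text \<open>The monomial \<open>a x\<^sup>k\<close>.\<close>

definition lmono :: "'a \<Rightarrow> int \<Rightarrow> int \<Rightarrow> 'a" where
  "lmono a k = (\<lambda>n. if n = k then a else \<zero>)"

lemma lmono_closed [simp]: "a \<in> carrier R \<Longrightarrow> lmono a k \<in> carrier LP"
  unfolding laurent_carrier_iff lmono_def by simp

lemma laurent_one: "\<one>\<^bsub>LP\<^esub> = lmono \<one> 0"
  by (simp add: laurent_simps lmono_def)

lemma laurent_add_closed:
  assumes "f \<in> carrier LP" "g \<in> carrier LP" shows "f \<oplus>\<^bsub>LP\<^esub> g \<in> carrier LP"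
proof -
  have "{i. f i \<oplus> g i \<noteq> \<zero>} \<subseteq> {i. f i \<noteq> \<zero>} \<union> {i. g i \<noteq> \<zero>}" by auto
  then have "finite {i. f i \<oplus> g i \<noteq> \<zero>}"
    using laurent_finite_supp[OF assms(1)] laurent_finite_supp[OF assms(2)] by (auto intro: finite_subset)
  then show ?thesis
    using laurent_coeff_closed[OF assms(1)] laurent_coeff_closed[OF assms(2)]
    unfolding laurent_carrier_iff laurent_simps by simp
qed

lemma laurent_induct [consumes 1, case_names zero mono add]:
  assumes f: "f \<in> carrier LP" and zero: "P \<zero>\<^bsub>LP\<^esub>"
    and mono: "\<And>a k. a \<in> carrier R \<Longrightarrow> P (lmono a k)"
    and add: "\<And>f g. \<lbrakk>f \<in> carrier LP; g \<in> carrier LP; P f; P g\<rbrakk> \<Longrightarrow> P (f \<oplus>\<^bsub>LP\<^esub> g)"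
  shows "P f"
proof -
  have "\<forall>f\<in>carrier LP. {i. f i \<noteq> \<zero>} \<subseteq> F \<longrightarrow> P f" if "finite F" for F
    using that
  proof (induction F rule: finite_induct)
    case empty
    have "f = \<zero>\<^bsub>LP\<^esub>" if "{i. f i \<noteq> \<zero>} \<subseteq> {}" for f using that by (auto simp: laurent_simps)
    then show ?case using zero by metis
  next
    case (insert k F)
    show ?case
    proof (intro ballI impI)
      fix f assume f: "f \<in> carrier LP" "{i. f i \<noteq> \<zero>} \<subseteq> insert k F"
      let ?g = "f(k := \<zero>)"
      have "{i. ?g i \<noteq> \<zero>} \<subseteq> {i. f i \<noteq> \<zero>}" by auto
      then have "finite {i. ?g i \<noteq> \<zero>}" using laurent_finite_supp[OF f(1)] by (rule finite_subset)
      then have g: "?g \<in> carrier LP"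
        using laurent_coeff_closed[OF f(1)] unfolding laurent_carrier_iff by simp
      moreover have "{i. ?g i \<noteq> \<zero>} \<subseteq> F" using f(2) by auto
      ultimately have "P ?g" using insert.IH by blast
      then have "P (lmono (f k) k \<oplus>\<^bsub>LP\<^esub> ?g)" using f g by (intro add mono) auto
      moreover have "lmono (f k) k \<oplus>\<^bsub>LP\<^esub> ?g = f" using f(1) by (auto simp: laurent_simps lmono_def)
      ultimately show "P f" by simp
    qed
  qed
  then show ?thesis using f laurent_finite_supp[OF f] by blast
qed

lemma laurent_mult_eq:
  assumes "f \<in> carrier LP" "g \<in> carrier LP" "finite F" "{i. f i \<noteq> \<zero>} \<subseteq> F"
  shows "(f \<otimes>\<^bsub>LP\<^esub> g) n = (\<Oplus>i\<in>F. f i \<otimes> g (n - i))"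
proof -
  have "(f \<otimes>\<^bsub>LP\<^esub> g) n = (\<Oplus>i\<in>{i. f i \<noteq> \<zero>}. f i \<otimes> g (n - i))"
    by (simp add: laurent_def del: laurent_coeff_closed)
  also have "\<dots> = (\<Oplus>i\<in>F. f i \<otimes> g (n - i))"
  proof (rule add.finprod_mono_neutral_cong_left)
    show "f i \<otimes> g (n - i) = \<zero>" if "i \<in> F - {i. f i \<noteq> \<zero>}" for i
      using that laurent_coeff_closed[OF assms(2)] by simp
    show "(\<lambda>i. f i \<otimes> g (n - i)) \<in> F \<rightarrow> carrier R"
      using laurent_coeff_closed[OF assms(1)] laurent_coeff_closed[OF assms(2)] by simp
  qed (use assms in simp_all)
  finally show ?thesis .
qed

lemma laurent_mult_closed:
  assumes f: "f \<in> carrier LP" and g: "g \<in> carrier LP" shows "f \<otimes>\<^bsub>LP\<^esub> g \<in> carrier LP"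
proof -
  let ?S = "(\<lambda>(i, j). i + j) ` ({i. f i \<noteq> \<zero>} \<times> {i. g i \<noteq> \<zero>})"
  have fin: "finite {i. f i \<noteq> \<zero>}" "finite ?S" using laurent_finite_supp f g by auto
  note eq = laurent_mult_eq[OF f g fin(1) order.refl]
  have "(f \<otimes>\<^bsub>LP\<^esub> g) n = \<zero>" if n: "n \<notin> ?S" for n
  proof -
    have "f i \<otimes> g (n - i) = \<zero>" if "f i \<noteq> \<zero>" for i
    proof -
      have "g (n - i) = \<zero>"
      proof (rule ccontr)
        assume "g (n - i) \<noteq> \<zero>"
        then have "(\<lambda>(i, j). i + j) (i, n - i) \<in> ?S" using that by (intro imageI) simp
        then show False using n by simp
      qed
      then show ?thesis using f by simp
    qed
    then have "(\<Oplus>i\<in>{i. f i \<noteq> \<zero>}. f i \<otimes> g (n - i)) = (\<Oplus>i\<in>{i. f i \<noteq> \<zero>}. \<zero>)"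
      by (intro finsum_cong') auto
    then show ?thesis by (simp add: eq)
  qed
  then have "{n. (f \<otimes>\<^bsub>LP\<^esub> g) n \<noteq> \<zero>} \<subseteq> ?S" by blast
  then have "finite {n. (f \<otimes>\<^bsub>LP\<^esub> g) n \<noteq> \<zero>}" using fin(2) by (rule finite_subset)
  moreover have "(f \<otimes>\<^bsub>LP\<^esub> g) n \<in> carrier R" for n
    unfolding eq using f g by (intro finsum_closed) auto
  ultimately show ?thesis unfolding laurent_carrier_iff by blast
qed

lemma laurent_l_distr:
  assumes "f \<in> carrier LP" "f' \<in> carrier LP" "g \<in> carrier LP"
  shows "(f \<oplus>\<^bsub>LP\<^esub> f') \<otimes>\<^bsub>LP\<^esub> g = f \<otimes>\<^bsub>LP\<^esub> g \<oplus>\<^bsub>LP\<^esub> f' \<otimes>\<^bsub>LP\<^esub> g"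
proof
  fix n
  let ?F = "{i. f i \<noteq> \<zero>} \<union> {i. f' i \<noteq> \<zero>}"
  have F: "finite ?F" using assms laurent_finite_supp by auto
  have "{i. (f \<oplus>\<^bsub>LP\<^esub> f') i \<noteq> \<zero>} \<subseteq> ?F" by (auto simp: laurent_simps)
  then have "((f \<oplus>\<^bsub>LP\<^esub> f') \<otimes>\<^bsub>LP\<^esub> g) n = (\<Oplus>i\<in>?F. (f i \<oplus> f' i) \<otimes> g (n - i))"
    by (subst laurent_mult_eq[OF laurent_add_closed[OF assms(1,2)] assms(3) F]) (simp_all add: laurent_simps)
  also have "\<dots> = (\<Oplus>i\<in>?F. f i \<otimes> g (n - i) \<oplus> f' i \<otimes> g (n - i))"
    using assms by (intro finsum_cong') (auto simp: l_distr)
  also have "\<dots> = (\<Oplus>i\<in>?F. f i \<otimes> g (n - i)) \<oplus> (\<Oplus>i\<in>?F. f' i \<otimes> g (n - i))"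
    using assms by (intro finsum_addf) auto
  also have "(\<Oplus>i\<in>?F. f i \<otimes> g (n - i)) = (f \<otimes>\<^bsub>LP\<^esub> g) n"
    by (rule laurent_mult_eq[OF assms(1,3) F, symmetric]) simp
  also have "(\<Oplus>i\<in>?F. f' i \<otimes> g (n - i)) = (f' \<otimes>\<^bsub>LP\<^esub> g) n"
    by (rule laurent_mult_eq[OF assms(2,3) F, symmetric]) simp
  finally show "((f \<oplus>\<^bsub>LP\<^esub> f') \<otimes>\<^bsub>LP\<^esub> g) n = (f \<otimes>\<^bsub>LP\<^esub> g \<oplus>\<^bsub>LP\<^esub> f' \<otimes>\<^bsub>LP\<^esub> g) n"
    by (simp add: laurent_simps)
qed

lemma laurent_r_distr:
  assumes "f \<in> carrier LP" "g \<in> carrier LP" "g' \<in> carrier LP"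
  shows "f \<otimes>\<^bsub>LP\<^esub> (g \<oplus>\<^bsub>LP\<^esub> g') = f \<otimes>\<^bsub>LP\<^esub> g \<oplus>\<^bsub>LP\<^esub> f \<otimes>\<^bsub>LP\<^esub> g'"
proof
  fix n
  let ?F = "{i. f i \<noteq> \<zero>}"
  note F = laurent_finite_supp[OF assms(1)] order.refl
  have "(\<Oplus>i\<in>?F. f i \<otimes> (g (n - i) \<oplus> g' (n - i))) = (\<Oplus>i\<in>?F. f i \<otimes> g (n - i) \<oplus> f i \<otimes> g' (n - i))"
    using assms by (intro finsum_cong') (auto simp: r_distr)
  also have "\<dots> = (\<Oplus>i\<in>?F. f i \<otimes> g (n - i)) \<oplus> (\<Oplus>i\<in>?F. f i \<otimes> g' (n - i))"
    using assms by (intro finsum_addf) auto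
  finally show "(f \<otimes>\<^bsub>LP\<^esub> (g \<oplus>\<^bsub>LP\<^esub> g')) n = (f \<otimes>\<^bsub>LP\<^esub> g \<oplus>\<^bsub>LP\<^esub> f \<otimes>\<^bsub>LP\<^esub> g') n"
    using laurent_mult_eq[OF assms(1) laurent_add_closed[OF assms(2,3)] F, of n]
      laurent_mult_eq[OF assms(1,2) F, of n] laurent_mult_eq[OF assms(1,3) F, of n]
    by (simp add: laurent_simps)
qed

lemma lmono_mult:
  assumes "a \<in> carrier R" "g \<in> carrier LP" shows "lmono a k \<otimes>\<^bsub>LP\<^esub> g = (\<lambda>n. a \<otimes> g (n - k))"
proof
  fix n
  have "(lmono a k \<otimes>\<^bsub>LP\<^esub> g) n = (\<Oplus>i\<in>{k}. lmono a k i \<otimes> g (n - i))"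
    using assms by (intro laurent_mult_eq) (simp_all add: subset_iff, simp add: lmono_def)
  also have "\<dots> = a \<otimes> g (n - k)" using assms by (simp add: lmono_def Pi_iff)
  finally show "(lmono a k \<otimes>\<^bsub>LP\<^esub> g) n = a \<otimes> g (n - k)" .
qed

lemma mult_lmono:
  assumes "a \<in> carrier R" "f \<in> carrier LP" shows "f \<otimes>\<^bsub>LP\<^esub> lmono a k = (\<lambda>n. f (n - k) \<otimes> a)"
proof
  fix n
  let ?F = "insert (n - k) {i. f i \<noteq> \<zero>}"
  have F: "finite ?F" using laurent_finite_supp[OF assms(2)] by simp
  have "(f \<otimes>\<^bsub>LP\<^esub> lmono a k) n = (\<Oplus>i\<in>?F. f i \<otimes> lmono a k (n - i))"
    using assms F by (intro laurent_mult_eq) auto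
  also have "\<dots> = (\<Oplus>i\<in>?F. if n - k = i then f i \<otimes> a else \<zero>)"
    using assms by (intro finsum_cong') (auto simp: lmono_def)
  also have "\<dots> = f (n - k) \<otimes> a" using assms F by (subst finsum_singleton) auto
  finally show "(f \<otimes>\<^bsub>LP\<^esub> lmono a k) n = f (n - k) \<otimes> a" .
qed

lemma lmono_lmono:
  "\<lbrakk>a \<in> carrier R; b \<in> carrier R\<rbrakk> \<Longrightarrow> lmono a k \<otimes>\<^bsub>LP\<^esub> lmono b l = lmono (a \<otimes> b) (k + l)"
  by (simp add: lmono_mult) (auto simp: lmono_def)

lemma laurent_abelian_group: "abelian_group LP"
proof (rule abelian_groupI)
  fix f assume f: "f \<in> carrier LP"
  have "{i. \<ominus> f i \<noteq> \<zero>} \<subseteq> {i. f i \<noteq> \<zero>}" by auto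
  then have "(\<lambda>n. \<ominus> f n) \<in> carrier LP"
    using laurent_finite_supp[OF f] laurent_coeff_closed[OF f] unfolding laurent_carrier_iff
    by (auto intro: finite_subset)
  then show "\<exists>g\<in>carrier LP. g \<oplus>\<^bsub>LP\<^esub> f = \<zero>\<^bsub>LP\<^esub>"
    using f by (rule_tac bexI) (simp_all add: laurent_simps l_neg)
next
  show "\<zero>\<^bsub>LP\<^esub> \<in> carrier LP" unfolding laurent_simps laurent_carrier_iff by simp
next
  show "f \<oplus>\<^bsub>LP\<^esub> g \<in> carrier LP" if "f \<in> carrier LP" "g \<in> carrier LP" for f g
    using that by (rule laurent_add_closed)
qed (simp_all add: laurent_simps a_ac)

lemma laurent_zero_mult: "g \<in> carrier LP \<Longrightarrow> \<zero>\<^bsub>LP\<^esub> \<otimes>\<^bsub>LP\<^esub> g = \<zero>\<^bsub>LP\<^esub>"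
  and laurent_mult_zero: "g \<in> carrier LP \<Longrightarrow> g \<otimes>\<^bsub>LP\<^esub> \<zero>\<^bsub>LP\<^esub> = \<zero>\<^bsub>LP\<^esub>"
  using lmono_mult[of \<zero> g 0] mult_lmono[of \<zero> g 0] by (simp_all add: laurent_simps lmono_def)

lemma laurent_assoc:
  assumes "f \<in> carrier LP" "g \<in> carrier LP" "h \<in> carrier LP"
  shows "f \<otimes>\<^bsub>LP\<^esub> g \<otimes>\<^bsub>LP\<^esub> h = f \<otimes>\<^bsub>LP\<^esub> (g \<otimes>\<^bsub>LP\<^esub> h)"
  using assms(1)
proof (induction f rule: laurent_induct)
  case (mono a k)
  show ?case using assms(2)
  proof (induction g rule: laurent_induct)
    case (mono b l)
    have "(lmono a k \<otimes>\<^bsub>LP\<^esub> (lmono b l \<otimes>\<^bsub>LP\<^esub> h)) n = (lmono (a \<otimes> b) (k + l) \<otimes>\<^bsub>LP\<^esub> h) n" for n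
      using \<open>a \<in> carrier R\<close> mono assms(3) laurent_mult_closed[OF lmono_closed[OF mono] assms(3), of l]
      by (simp add: lmono_mult m_assoc algebra_simps)
    then show ?case using \<open>a \<in> carrier R\<close> mono by (auto simp: lmono_lmono)
  qed (use mono assms(3) in \<open>simp_all add: laurent_zero_mult laurent_mult_zero laurent_l_distr
      laurent_r_distr laurent_mult_closed\<close>)
qed (use assms in \<open>simp_all add: laurent_zero_mult laurent_l_distr laurent_mult_closed\<close>)

lemma laurent_comm:
  assumes "f \<in> carrier LP" "g \<in> carrier LP" shows "f \<otimes>\<^bsub>LP\<^esub> g = g \<otimes>\<^bsub>LP\<^esub> f"
  using assms(1)
  by (induction f rule: laurent_induct)
    (use assms(2) in \<open>simp_all add: laurent_zero_mult laurent_mult_zero laurent_l_distr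
      laurent_r_distr lmono_mult mult_lmono m_comm\<close>)

lemma laurent_cring: "cring LP"
proof (rule cringI)
  show "abelian_group LP" by (rule laurent_abelian_group)
  show "comm_monoid LP"
  proof (rule comm_monoidI)
    show "\<one>\<^bsub>LP\<^esub> \<otimes>\<^bsub>LP\<^esub> f = f" if "f \<in> carrier LP" for f
      using that by (simp add: laurent_one lmono_mult)
  next
    show "f \<otimes>\<^bsub>LP\<^esub> g \<otimes>\<^bsub>LP\<^esub> h = f \<otimes>\<^bsub>LP\<^esub> (g \<otimes>\<^bsub>LP\<^esub> h)"
      if "f \<in> carrier LP" "g \<in> carrier LP" "h \<in> carrier LP" for f g h
      using that by (rule laurent_assoc)
    show "f \<otimes>\<^bsub>LP\<^esub> g = g \<otimes>\<^bsub>LP\<^esub> f" if "f \<in> carrier LP" "g \<in> carrier LP" for f g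
      using that by (rule laurent_comm)
  qed (simp_all add: laurent_mult_closed laurent_one)
qed (rule laurent_l_distr)

end

section \<open>The corner at a vertex on a cycle\<close>

context leavitt_algebra begin

context
  fixes C :: "'e list set" and v :: 'v
  assumes v: "v \<in> verts G" and c: "set (cycle_at G C v) \<subseteq> arcs G"
begin

interpretation L: ring L by (rule L_ring)

lemma cycle_power_closed: "cycle_power R G C v i \<in> carrier L"
proof -
  have "lpath R G (cycle_at G C v) \<in> carrier L" "lghost_path R G (cycle_at G C v) \<in> carrier L"
    using c unfolding lpath_def lghost_path_def by (intro foldr_mult_closed; auto)+
  then show ?thesis using v by (simp add: cycle_power_def del: pow_nat)
qed

lemma laurent_eval_eq:
  assumes "f \<in> carrier LP" "finite F" "{i. f i \<noteq> \<zero>} \<subseteq> F"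
  shows "laurent_eval R G C v f = finsum L (\<lambda>i. f i \<odot>\<^bsub>L\<^esub> cycle_power R G C v i) F"
  unfolding laurent_eval_def
proof (rule L.add.finprod_mono_neutral_cong_left)
  show "f i \<odot>\<^bsub>L\<^esub> cycle_power R G C v i = \<zero>\<^bsub>L\<^esub>" if "i \<in> F - {i. f i \<noteq> \<zero>}" for i
    using that cycle_power_closed by (simp add: smult_zero_left)
qed (use assms in \<open>simp_all add: smult_closed cycle_power_closed\<close>)

lemma laurent_eval_closed: "f \<in> carrier LP \<Longrightarrow> laurent_eval R G C v f \<in> carrier L"
  unfolding laurent_eval_def by (intro L.finsum_closed) (simp add: smult_closed cycle_power_closed)

lemma laurent_eval_add:
  assumes f: "f \<in> carrier LP" and g: "g \<in> carrier LP"
  shows "laurent_eval R G C v (f \<oplus>\<^bsub>LP\<^esub> g) = laurent_eval R G C v f \<oplus>\<^bsub>L\<^esub> laurent_eval R G C v g"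
proof -
  let ?F = "{i. f i \<noteq> \<zero>} \<union> {i. g i \<noteq> \<zero>}" and ?c = "cycle_power R G C v"
  have F: "finite ?F" using laurent_finite_supp f g by auto
  have "{i. (f \<oplus>\<^bsub>LP\<^esub> g) i \<noteq> \<zero>} \<subseteq> ?F" by (auto simp: laurent_simps)
  then have "laurent_eval R G C v (f \<oplus>\<^bsub>LP\<^esub> g) = finsum L (\<lambda>i. (f i \<oplus> g i) \<odot>\<^bsub>L\<^esub> ?c i) ?F"
    using laurent_eval_eq[OF laurent_add_closed[OF f g] F] by (simp add: laurent_simps)
  also have "\<dots> = finsum L (\<lambda>i. f i \<odot>\<^bsub>L\<^esub> ?c i \<oplus>\<^bsub>L\<^esub> g i \<odot>\<^bsub>L\<^esub> ?c i) ?F"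
    by (rule L.finsum_cong')
      (use f g in \<open>simp_all add: smult_l_distr smult_closed cycle_power_closed Pi_iff\<close>)
  also have "\<dots> = finsum L (\<lambda>i. f i \<odot>\<^bsub>L\<^esub> ?c i) ?F \<oplus>\<^bsub>L\<^esub> finsum L (\<lambda>i. g i \<odot>\<^bsub>L\<^esub> ?c i) ?F"
    by (rule L.finsum_addf) (use f g in \<open>simp_all add: smult_closed cycle_power_closed Pi_iff\<close>)
  finally show ?thesis
    using laurent_eval_eq[OF f F] laurent_eval_eq[OF g F] by simp
qed

lemma laurent_eval_lmono:
  assumes "a \<in> carrier R" shows "laurent_eval R G C v (lmono a k) = a \<odot>\<^bsub>L\<^esub> cycle_power R G C v k"
proof -
  have "{i. lmono a k i \<noteq> \<zero>} \<subseteq> {k}" by (auto simp: lmono_def)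
  then have "laurent_eval R G C v (lmono a k) = finsum L (\<lambda>i. lmono a k i \<odot>\<^bsub>L\<^esub> cycle_power R G C v i) {k}"
    using assms by (intro laurent_eval_eq) simp_all
  also have "\<dots> = lmono a k k \<odot>\<^bsub>L\<^esub> cycle_power R G C v k"
    using assms by (simp add: smult_closed cycle_power_closed L.finsum_insert lmono_def)
  finally show ?thesis by (simp add: lmono_def)
qed

lemma laurent_eval_zero: "laurent_eval R G C v \<zero>\<^bsub>LP\<^esub> = \<zero>\<^bsub>L\<^esub>"
  by (simp add: laurent_eval_def laurent_simps)

end

end

context leavitt_corner begin

lemma pact_gact: "\<lbrakk>q \<in> arr; y \<in> corner\<rbrakk> \<Longrightarrow> pact q (gact q y) = y"
proof (induction q)
  case (Cons e q)
  then have e: "e \<in> arcs G" "q \<in> arr" "src q = head G e" by (auto simp: G.Cons_arrivals_iff)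
  then show ?case
    using Cons gact_source[OF e(2) Cons.prems(2)] by (simp add: act_ghost_arrow gact_closed arr_arcs cornerD)
qed simp

lemma pact_in_corner:
  "\<lbrakk>q \<in> arr; y \<in> carrier M; y \<cdot> vx (src q) = y\<rbrakk> \<Longrightarrow> pact q y \<in> corner"
proof (induction q arbitrary: y)
  case (Cons e q)
  then have e: "e \<in> arcs G" "q \<in> arr" "src q = head G e" by (auto simp: G.Cons_arrivals_iff)
  then show ?case using Cons by (simp add: M.ract_closed act_gen_vertex)
qed (simp add: corner_def)

lemma ret_cases:
  assumes "c \<in> ret"
  obtains e r where "c = e # r" "e \<in> arcs G" "tail G e = v" "r \<in> arr" "src r = head G e"
  using assms by (auto simp: pre_digraph.returns_def)

lemma ret_arcs: assumes "c \<in> ret" shows "set c \<subseteq> arcs G"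
  using assms by (cases rule: ret_cases) (use arr_arcs in auto)

lemma pact_ret_corner: assumes "c \<in> ret" "y \<in> corner" shows "pact c y \<in> corner"
  using assms(1)
proof (cases rule: ret_cases)
  case (1 e r)
  then show ?thesis using assms(2) by (simp add: pact_in_corner M.ract_closed act_gen_vertex cornerD)
qed

lemma gact_ret_corner: assumes "c \<in> ret" "y \<in> corner" shows "gact c y \<in> corner"
  using assms(1)
proof (cases rule: ret_cases)
  case (1 e r)
  then show ?thesis using assms(2) v
    by (simp add: corner_def M.ract_closed act_gen_vertex gact_closed arr_arcs)
qed

lemma pact_gact_ret: assumes "c \<in> ret" "y \<in> corner" shows "pact c (gact c y) = y"
  using assms(1)
proof (cases rule: ret_cases)
  case (1 e r)
  then show ?thesis using assms(2) gact_source[OF 1(4) assms(2)]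
    by (simp add: act_ghost_arrow gact_closed arr_arcs cornerD pact_gact)
qed

text \<open>
  For \<open>v\<close> on a cycle this says that arrows from which there is no way back to the cycle act as
  zero. It holds if \<open>M\<close> is supported on the predecessors of \<open>v\<close>; for a simple module the cycle has
  to be well chosen, see \<open>support_cycle_ex\<close>.
\<close>

definition tame :: bool where
  "tame \<longleftrightarrow> (\<forall>e\<in>arcs G. v \<in> predecessors G (tail G e) \<longrightarrow> head G e \<notin> predecessors G v \<longrightarrow>
     (\<forall>y\<in>carrier M. y \<cdot> ar e = \<zero>\<^bsub>M\<^esub>))"

lemma exit_zero:
  "\<lbrakk>tame; e \<in> arcs G; v \<in> predecessors G (tail G e); head G e \<notin> predecessors G v; y \<in> carrier M\<rbrakk> \<Longrightarrow>
    y \<cdot> ar e = \<zero>\<^bsub>M\<^esub>"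
  unfolding tame_def by simp

lemma supported_tame: assumes supported shows tame
  unfolding tame_def
proof (intro ballI impI)
  fix e y assume *: "e \<in> arcs G" "head G e \<notin> predecessors G v" "y \<in> carrier M"
  have "y \<cdot> ar e \<cdot> vx (head G e) = \<zero>\<^bsub>M\<^esub>"
    using assms * by (simp add: supported_def M.ract_closed)
  then show "y \<cdot> ar e = \<zero>\<^bsub>M\<^esub>" using * by (simp add: act_gen_vertex)
qed

text \<open>
  An arrow that branches off the return path leads to a vertex that does not precede \<open>v\<close> and
  hence acts as zero. So in the relation that writes a vertex as the sum over its arrows
  only the arrow of the return path survives.
\<close>

lemma gact_pact_suffix:
  assumes tame: tame and ret: "ret = {c}"
  shows "\<lbrakk>c = c1 @ c2; y \<in> carrier M; y \<cdot> vx (src c2) = y\<rbrakk> \<Longrightarrow> gact c2 (pact c2 y) = y"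
proof (induction c2 arbitrary: c1 y)
  case (Cons e c2)
  have cr: "c \<in> ret" using ret by simp
  have arcs: "set (e # c2) \<subseteq> arcs G" using ret_arcs[OF cr] Cons.prems(1) by auto
  have te: "tail G e \<in> verts G" "e \<in> out_arcs G (tail G e)" using arcs by auto
  have walk: "src c2 = head G e"
  proof -
    obtain e' r where r: "c = e' # r" "r \<in> arr" "src r = head G e'" using cr by (rule ret_cases)
    have "d @ e # c2 \<in> arr \<Longrightarrow> src c2 = head G e" for d
      by (induction d) (auto simp: G.Cons_arrivals_iff)
    then show ?thesis using r Cons.prems(1) by (cases c1) auto
  qed
  have reach: "v \<in> predecessors G (tail G e)"
  proof -
    obtain e' r where r: "c = e' # r" "e' \<in> arcs G" "tail G e' = v" "r \<in> arr" "src r = head G e'"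
      using cr by (rule ret_cases)
    then have "G.awalk v c v" by (simp add: G.arrivals_def G.awalk_Cons_iff)
    then have "G.awalk v c1 (tail G e)" using Cons.prems(1) by (auto simp: G.awalk_Cons_iff)
    then show ?thesis by (rule G.predecessorsI)
  qed
  have yar: "y \<cdot> ar e \<in> carrier M" using arcs Cons.prems(2) by (simp add: M.ract_closed)
  have "gact c2 (pact c2 (y \<cdot> ar e)) = y \<cdot> ar e"
  proof (rule Cons.IH[of "c1 @ [e]"])
    show "y \<cdot> ar e \<cdot> vx (src c2) = y \<cdot> ar e"
      using arcs Cons.prems(2) by (simp add: walk act_gen_vertex)
  qed (use Cons.prems(1) yar in simp_all)
  then have "gact (e # c2) (pact (e # c2) y) = y \<cdot> ar e \<cdot> gh e" by simp
  also have "\<dots> = finsum M (\<lambda>f. if e = f then y \<cdot> ar f \<cdot> gh f else \<zero>\<^bsub>M\<^esub>) (out_arcs G (tail G e))"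
    using te Cons.prems(2) by (subst M.M.finsum_singleton) (simp_all add: G.finite_out_arcs M.ract_closed)
  also have "\<dots> = finsum M (\<lambda>f. y \<cdot> ar f \<cdot> gh f) (out_arcs G (tail G e))"
  proof (rule M.M.finsum_cong')
    fix f assume f: "f \<in> out_arcs G (tail G e)"
    show "(if e = f then y \<cdot> ar f \<cdot> gh f else \<zero>\<^bsub>M\<^esub>) = y \<cdot> ar f \<cdot> gh f"
    proof (cases "e = f")
      case False
      have "head G f \<notin> predecessors G v"
        using G.return_deterministic[OF ret Cons.prems(1), of f] f False by auto
      then have "y \<cdot> ar f = \<zero>\<^bsub>M\<^esub>"
        using f reach by (intro exit_zero[OF tame _ _ _ Cons.prems(2)]) simp_all
      then show ?thesis using False f by (simp add: M.ract_zero_left)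
    qed simp
  qed (use Cons.prems(2) in \<open>simp_all add: M.ract_closed\<close>)
  also have "\<dots> = y \<cdot> vx (tail G e)"
    using te Cons.prems(2) by (intro act_vertex_sum[symmetric]) auto
  finally show ?case using Cons.prems(3) by simp
qed simp

end

locale cycle_corner = leavitt_corner R G M v
  for R :: "('k, 'z) ring_scheme" and G :: "('v, 'e) pre_digraph"
    and M :: "(('v, 'e, 'k) leavitt, 'm, 'y) rmodule_scheme" and v :: 'v +
  fixes C :: "'e list set"
  assumes ret: "ret = {cycle_at G C v}" and tame: tame
begin

abbreviation "c \<equiv> cycle_at G C v"
abbreviation "cp \<equiv> cycle_power R G C v"
abbreviation "lev \<equiv> laurent_eval R G C v"

lemma c_ret: "c \<in> ret" using ret by simp

lemmas c_arcs = ret_arcs[OF c_ret]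

lemma gact_pact_c: assumes "y \<in> corner" shows "gact c (pact c y) = y"
proof -
  have "src c = v" using c_ret by (elim ret_cases) simp
  then show ?thesis using gact_pact_suffix[OF tame ret, of "[]" c y] assms by (simp add: cornerD)
qed

lemma act_pow:
  assumes "a \<in> carrier L" "y \<in> carrier M"
  shows "y \<cdot> (a [^]\<^bsub>L\<^esub> (n::nat)) = ((\<lambda>z. z \<cdot> a) ^^ n) y"
proof -
  interpret L: ring L by (rule L_ring)
  show ?thesis by (induction n) (use assms in \<open>simp_all add: M.ract_one M.ract_assoc\<close>)
qed

lemma act_cp:
  assumes y: "y \<in> corner"
  shows "y \<cdot> cp i = (if 0 \<le> i then (gact c ^^ nat i) y else (pact c ^^ nat (- i)) y)"
proof -
  interpret L: ring L by (rule L_ring)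
  have cl: "lpath R G c \<in> carrier L" "lghost_path R G c \<in> carrier L"
    using lpath_closed lghost_path_closed c_arcs by auto
  have "((\<lambda>z. z \<cdot> lghost_path R G c) ^^ n) y = (gact c ^^ n) y \<and> (gact c ^^ n) y \<in> corner" for n
    by (induction n) (use y in \<open>simp_all add: act_lghost_path[OF c_arcs] gact_ret_corner[OF c_ret] cornerD\<close>)
  moreover have "((\<lambda>z. z \<cdot> lpath R G c) ^^ n) y = (pact c ^^ n) y \<and> (pact c ^^ n) y \<in> corner" for n
    by (induction n) (use y in \<open>simp_all add: act_lpath[OF c_arcs] pact_ret_corner[OF c_ret] cornerD\<close>)
  moreover have "y \<cdot> (vx v \<otimes>\<^bsub>L\<^esub> a) = y \<cdot> a" if "a \<in> carrier L" for a
    using that y v by (simp add: M.ract_assoc cornerD)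
  ultimately show ?thesis
    using cl y by (simp add: cycle_power_def act_pow cornerD del: pow_nat)
qed

lemma act_cp_corner: "y \<in> corner \<Longrightarrow> y \<cdot> cp i \<in> corner"
proof -
  assume y: "y \<in> corner"
  have "(gact c ^^ n) y \<in> corner" "(pact c ^^ n) y \<in> corner" for n
    by (induction n) (use y in \<open>simp_all add: gact_ret_corner[OF c_ret] pact_ret_corner[OF c_ret]\<close>)
  then show ?thesis using y by (simp add: act_cp)
qed

lemma act_cp_succ: assumes y: "y \<in> corner" shows "gact c (y \<cdot> cp i) = y \<cdot> cp (i + 1)"
proof (cases "0 \<le> i")
  case True
  then have "nat (i + 1) = Suc (nat i)" by simp
  then show ?thesis using True y by (simp add: act_cp)
next
  case False
  then have n: "nat (- i) = Suc (nat (- (i + 1)))" by simp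
  have "y \<cdot> cp (i + 1) = (pact c ^^ nat (- (i + 1))) y"
    using False y by (cases "i = -1") (simp_all add: act_cp)
  then show ?thesis using False y n gact_pact_c[OF act_cp_corner[OF y, of "i + 1"]] act_cp[OF y, of i] by simp
qed

lemma act_cp_pred: assumes y: "y \<in> corner" shows "pact c (y \<cdot> cp i) = y \<cdot> cp (i - 1)"
  using pact_gact_ret[OF c_ret act_cp_corner[OF y], of "i - 1"] act_cp_succ[OF y, of "i - 1"] by simp

text \<open>
  Exponents of different sign may be added because \<open>c\<close> and \<open>c\<^sup>*\<close> act on the corner as inverses of
  each other.
\<close>

lemma act_cp_add: assumes y: "y \<in> corner" shows "y \<cdot> cp (i + j) = y \<cdot> cp i \<cdot> cp j"
proof (induction j rule: int_induct[where k = 0])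
  case base
  show ?case using act_cp[OF act_cp_corner[OF y], of i 0] by simp
next
  case (step1 j)
  have "y \<cdot> cp (i + (j + 1)) = gact c (y \<cdot> cp (i + j))" using act_cp_succ[OF y, of "i + j"] by (simp add: add.assoc)
  also have "\<dots> = y \<cdot> cp i \<cdot> cp (j + 1)" using step1 act_cp_succ[OF act_cp_corner[OF y], of i j] by simp
  finally show ?case .
next
  case (step2 j)
  have "y \<cdot> cp (i + (j - 1)) = pact c (y \<cdot> cp (i + j))" using act_cp_pred[OF y, of "i + j"] by (simp add: add_diff_eq)
  also have "\<dots> = y \<cdot> cp i \<cdot> cp (j - 1)" using step2 act_cp_pred[OF act_cp_corner[OF y], of i j] by simp
  finally show ?case .
qed

lemmas cp_closed = cycle_power_closed[OF v c_arcs]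
lemmas lev_closed = laurent_eval_closed[OF v c_arcs]

lemma act_lev_add:
  "\<lbrakk>y \<in> corner; f \<in> carrier LP; g \<in> carrier LP\<rbrakk> \<Longrightarrow> y \<cdot> lev (f \<oplus>\<^bsub>LP\<^esub> g) = y \<cdot> lev f \<oplus>\<^bsub>M\<^esub> y \<cdot> lev g"
  by (simp add: laurent_eval_add[OF v c_arcs] lev_closed M.ract_r_distr cornerD)

lemma act_lev_lmono: "\<lbrakk>y \<in> corner; a \<in> carrier R\<rbrakk> \<Longrightarrow> y \<cdot> lev (lmono a k) = y \<cdot> cp k \<cdot> sc a"
  by (simp add: laurent_eval_lmono[OF v c_arcs] act_smult cp_closed cornerD)

lemma corner_add: "\<lbrakk>x \<in> corner; y \<in> corner\<rbrakk> \<Longrightarrow> x \<oplus>\<^bsub>M\<^esub> y \<in> corner"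
  using v by (simp add: corner_def M.ract_l_distr)

lemma corner_sc: "\<lbrakk>x \<in> corner; a \<in> carrier R\<rbrakk> \<Longrightarrow> x \<cdot> sc a \<in> corner"
  using v act_sc_comm[of x a "vx v"] by (simp add: corner_def M.ract_closed)

lemma act_lev_zero: "y \<in> corner \<Longrightarrow> y \<cdot> lev \<zero>\<^bsub>LP\<^esub> = \<zero>\<^bsub>M\<^esub>"
  by (simp add: laurent_eval_zero[OF v c_arcs] M.ract_zero_right cornerD)

lemma act_lev_corner: assumes y: "y \<in> corner" and f: "f \<in> carrier LP" shows "y \<cdot> lev f \<in> corner"
  using f
proof (induction f rule: laurent_induct)
  case (add f g) then show ?case using y by (simp add: act_lev_add corner_add)
qed (use y in \<open>simp_all add: act_lev_zero corner_zero act_lev_lmono act_cp_corner corner_sc\<close>)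

lemma act_sc_sc: "\<lbrakk>y \<in> carrier M; a \<in> carrier R; b \<in> carrier R\<rbrakk> \<Longrightarrow> y \<cdot> sc a \<cdot> sc b = y \<cdot> sc (a \<otimes>\<^bsub>R\<^esub> b)"
proof -
  assume *: "y \<in> carrier M" "a \<in> carrier R" "b \<in> carrier R"
  have "y \<cdot> sc (a \<otimes>\<^bsub>R\<^esub> b) = y \<cdot> (b \<odot>\<^bsub>L\<^esub> sc a)"
    using * by (simp add: m_comm smult_assoc1[symmetric] L_one_closed)
  also have "\<dots> = y \<cdot> sc a \<cdot> sc b" using * by (intro act_smult) simp_all
  finally show ?thesis by simp
qed

lemma act_lev_mult:
  assumes y: "y \<in> corner" and f: "f \<in> carrier LP" and g: "g \<in> carrier LP"
  shows "y \<cdot> lev (f \<otimes>\<^bsub>LP\<^esub> g) = y \<cdot> lev f \<cdot> lev g"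
  using f
proof (induction f rule: laurent_induct)
  case zero
  then show ?case using y g by (simp add: laurent_zero_mult act_lev_zero M.ract_zero_left lev_closed)
next
  case (add f f')
  then show ?case using y g
    by (simp add: laurent_l_distr laurent_mult_closed act_lev_add M.ract_l_distr lev_closed M.ract_closed cornerD)
next
  case (mono a k)
  note a = mono
  have ya: "y \<cdot> lev (lmono a k) \<in> corner" using y a by (simp add: act_lev_corner)
  show ?case using g
  proof (induction g rule: laurent_induct)
    case zero
    then show ?case using y a ya by (simp add: laurent_mult_zero act_lev_zero)
  next
    case (add f f')
    then show ?case using y a ya by (simp add: laurent_r_distr laurent_mult_closed act_lev_add)
  next
    case (mono b l)
    have "y \<cdot> lev (lmono a k) \<cdot> lev (lmono b l) = y \<cdot> cp k \<cdot> sc a \<cdot> cp l \<cdot> sc b"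
      using ya mono by (simp add: act_lev_lmono y a)
    also have "y \<cdot> cp k \<cdot> sc a \<cdot> cp l = y \<cdot> cp k \<cdot> cp l \<cdot> sc a"
      using y a cp_closed by (intro act_sc_comm) (simp_all add: M.ract_closed cornerD)
    also have "\<dots> \<cdot> sc b = y \<cdot> cp (k + l) \<cdot> sc (a \<otimes>\<^bsub>R\<^esub> b)"
      using y a mono cp_closed act_sc_sc[of "y \<cdot> cp (k + l)" a b] act_cp_add[OF y, of k l]
      by (simp add: M.ract_closed cornerD)
    finally show ?case using y a mono by (simp add: lmono_lmono act_lev_lmono)
  qed
qed

text \<open>
  An arrow out of \<open>v\<close> whose target precedes \<open>v\<close> begins a return and thus \<open>c\<close>; any other arrow out of
  \<open>v\<close> acts as zero since the module is tame.
\<close>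

lemma cycle_corner_action: "corner_action LP lev"
  unfolding corner_action_def
proof (intro conjI ballI allI impI)
  show "y \<cdot> lev \<one>\<^bsub>LP\<^esub> = y" if "y \<in> corner" for y
    using that act_cp[OF that, of 0]
    by (simp add: laurent_one act_lev_lmono smult_one L_one_closed M.ract_one cornerD)
next
  fix D assume D: "D \<subseteq> corner \<and> \<zero>\<^bsub>M\<^esub> \<in> D \<and> (\<forall>x\<in>D. \<forall>y\<in>D. x \<oplus>\<^bsub>M\<^esub> y \<in> D) \<and>
      (\<forall>x\<in>D. \<forall>f\<in>carrier LP. x \<cdot> lev f \<in> D)"
  have mono: "x \<cdot> cp k \<cdot> sc a \<in> D" if "x \<in> D" "a \<in> carrier R" for x a k
    using D that act_lev_lmono[of x a k] lmono_closed[of a k] by (metis subsetD)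
  have one: "x \<cdot> sc \<one>\<^bsub>R\<^esub> = x" if "x \<in> carrier M" for x
    using that by (simp add: smult_one L_one_closed M.ract_one)
  have sub: "x \<in> corner" if "x \<in> D" for x using D that by blast
  have "x \<cdot> sc a \<in> D" if "x \<in> D" "a \<in> carrier R" for x a
    using mono[OF that, of 0] act_cp[OF sub[OF that(1)], of 0] by simp
  moreover have "gact c x \<in> D" if "x \<in> D" for x
    using mono[OF that, of "\<one>\<^bsub>R\<^esub>" 1] act_cp[OF sub[OF that], of 1] one[of "gact c x"]
      gact_ret_corner[OF c_ret sub[OF that]] by (simp add: cornerD)
  moreover have "pact c x \<in> D" if "x \<in> D" for x
    using mono[OF that, of "\<one>\<^bsub>R\<^esub>" "-1"] act_cp[OF sub[OF that], of "-1"] one[of "pact c x"]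
      pact_ret_corner[OF c_ret sub[OF that]] by (simp add: cornerD)
  moreover have "x \<cdot> ar e = \<zero>\<^bsub>M\<^esub> \<or> hd c = e" if "x \<in> D" "e \<in> out_arcs G v" for x e
  proof (cases "head G e \<in> predecessors G v")
    case True
    then obtain q where "q \<in> arr" "src q = head G e" by (auto simp: G.predecessors_iff)
    then have "e # q \<in> ret" using that(2) by (auto simp: pre_digraph.returns_def)
    then show ?thesis using ret by (metis list.sel(1) singletonD)
  next
    case False
    have "x \<cdot> ar e = \<zero>\<^bsub>M\<^esub>"
      using that v cornerD(1)[OF sub[OF that(1)]] by (intro exit_zero[OF tame _ _ False]) simp_all
    then show ?thesis ..
  qed
  ultimately show "corner_stable D"
    unfolding corner_stable_def ret using D gact_pact_c sub by simp
qed (simp_all add: lev_closed act_lev_corner act_lev_add act_lev_mult)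

end

section \<open>A module on which a vertex does not vanish\<close>

text \<open>
  The elements are families of coefficients indexed by the paths that arrive at \<open>v\<close>; the value
  at \<open>q\<close> is the coefficient of \<open>q\<^sup>*\<close>. A ghost arrow lengthens the paths and an arrow shortens them.
  Where the longer path would be the return \<open>c\<close>, the empty path takes its place, and the
  coefficient picks up the automorphism \<open>\<tau>\<close>. In the relation that writes \<open>v\<close> as a sum over its
  arrows, the return alone contributes to the coefficient at the empty path; hence there has to
  be one unless \<open>v\<close> is a sink.
\<close>

locale path_model = leavitt_algebra R G + B: abelian_group B
  for R :: "('k, 'z) ring_scheme" and G :: "('v, 'e) pre_digraph" and B :: "('b, 'y) ring_scheme" +
  fixes v :: 'v and c :: "'e list" and sB :: "'k \<Rightarrow> 'b \<Rightarrow> 'b" and \<tau> \<tau>' :: "'b \<Rightarrow> 'b"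
  assumes v: "v \<in> verts G"
    and ret: "pre_digraph.returns G v \<subseteq> {c}"
    and sink_or_ret: "out_arcs G v = {} \<or> c \<in> pre_digraph.returns G v"
    and sB_closed: "\<lbrakk>a \<in> carrier R; b \<in> carrier B\<rbrakk> \<Longrightarrow> sB a b \<in> carrier B"
    and sB_add: "\<lbrakk>a \<in> carrier R; b \<in> carrier B; b' \<in> carrier B\<rbrakk> \<Longrightarrow> sB a (b \<oplus>\<^bsub>B\<^esub> b') = sB a b \<oplus>\<^bsub>B\<^esub> sB a b'"
    and sB_add_scalar: "\<lbrakk>a \<in> carrier R; a' \<in> carrier R; b \<in> carrier B\<rbrakk> \<Longrightarrow>
      sB (a \<oplus>\<^bsub>R\<^esub> a') b = sB a b \<oplus>\<^bsub>B\<^esub> sB a' b"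
    and sB_mult: "\<lbrakk>a \<in> carrier R; a' \<in> carrier R; b \<in> carrier B\<rbrakk> \<Longrightarrow> sB (a \<otimes>\<^bsub>R\<^esub> a') b = sB a (sB a' b)"
    and sB_one: "b \<in> carrier B \<Longrightarrow> sB \<one>\<^bsub>R\<^esub> b = b"
    and \<tau>_closed: "b \<in> carrier B \<Longrightarrow> \<tau> b \<in> carrier B" "b \<in> carrier B \<Longrightarrow> \<tau>' b \<in> carrier B"
    and \<tau>_add: "\<lbrakk>b \<in> carrier B; b' \<in> carrier B\<rbrakk> \<Longrightarrow> \<tau> (b \<oplus>\<^bsub>B\<^esub> b') = \<tau> b \<oplus>\<^bsub>B\<^esub> \<tau> b'"
      "\<lbrakk>b \<in> carrier B; b' \<in> carrier B\<rbrakk> \<Longrightarrow> \<tau>' (b \<oplus>\<^bsub>B\<^esub> b') = \<tau>' b \<oplus>\<^bsub>B\<^esub> \<tau>' b'"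
    and \<tau>_inv: "b \<in> carrier B \<Longrightarrow> \<tau> (\<tau>' b) = b" "b \<in> carrier B \<Longrightarrow> \<tau>' (\<tau> b) = b"
    and \<tau>_sB: "\<lbrakk>a \<in> carrier R; b \<in> carrier B\<rbrakk> \<Longrightarrow> \<tau> (sB a b) = sB a (\<tau> b)"
      "\<lbrakk>a \<in> carrier R; b \<in> carrier B\<rbrakk> \<Longrightarrow> \<tau>' (sB a b) = sB a (\<tau>' b)"
begin

abbreviation "arr \<equiv> pre_digraph.arrivals G v"
abbreviation "src \<equiv> pre_digraph.path_source G v"

definition families :: "('e list \<Rightarrow> 'b) ring" where
  "families = \<lparr>carrier = {\<phi>. (\<forall>q\<in>arr. \<phi> q \<in> carrier B) \<and> (\<forall>q. q \<notin> arr \<longrightarrow> \<phi> q = \<zero>\<^bsub>B\<^esub>)},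
     monoid.mult = undefined, one = undefined, ring.zero = (\<lambda>q. \<zero>\<^bsub>B\<^esub>), add = (\<lambda>\<phi> \<psi> q. \<phi> q \<oplus>\<^bsub>B\<^esub> \<psi> q)\<rparr>"

lemma families_simps:
  "\<zero>\<^bsub>families\<^esub> = (\<lambda>q. \<zero>\<^bsub>B\<^esub>)" "\<phi> \<oplus>\<^bsub>families\<^esub> \<psi> = (\<lambda>q. \<phi> q \<oplus>\<^bsub>B\<^esub> \<psi> q)"
  by (simp_all add: families_def)

lemma familiesI:
  "\<lbrakk>\<And>q. q \<in> arr \<Longrightarrow> \<phi> q \<in> carrier B; \<And>q. q \<notin> arr \<Longrightarrow> \<phi> q = \<zero>\<^bsub>B\<^esub>\<rbrakk> \<Longrightarrow> \<phi> \<in> carrier families"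
  by (simp add: families_def)

lemma families_outside: "\<lbrakk>\<phi> \<in> carrier families; q \<notin> arr\<rbrakk> \<Longrightarrow> \<phi> q = \<zero>\<^bsub>B\<^esub>"
  by (simp add: families_def)

lemma families_closed: "\<phi> \<in> carrier families \<Longrightarrow> \<phi> q \<in> carrier B"
  by (cases "q \<in> arr") (simp_all add: families_def)

lemma abelian_group_families: "abelian_group families"
proof (rule abelian_groupI)
  fix \<phi> assume "\<phi> \<in> carrier families"
  then show "\<exists>\<psi>\<in>carrier families. \<psi> \<oplus>\<^bsub>families\<^esub> \<phi> = \<zero>\<^bsub>families\<^esub>"
    by (intro bexI[of _ "\<lambda>q. \<ominus>\<^bsub>B\<^esub> \<phi> q"] familiesI)
      (simp_all add: families_simps families_closed families_outside B.l_neg)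
next
  show "\<phi> \<oplus>\<^bsub>families\<^esub> \<psi> \<in> carrier families"
    if "\<phi> \<in> carrier families" "\<psi> \<in> carrier families" for \<phi> \<psi>
    using that by (intro familiesI) (simp_all add: families_simps families_closed families_outside)
  show "\<zero>\<^bsub>families\<^esub> \<in> carrier families" by (intro familiesI) (simp_all add: families_simps)
qed (simp_all add: families_simps families_closed B.a_ac)

lemma finsum_families:
  assumes "finite I" "\<And>i. i \<in> I \<Longrightarrow> \<phi> i \<in> carrier families"
  shows "finsum families \<phi> I q = finsum B (\<lambda>i. \<phi> i q) I"
  by (rule additive_finsum[of families B "\<lambda>\<psi>. \<psi> q"])
    (use assms in \<open>simp_all add: abelian_group_families B.abelian_group_axioms families_closed families_simps\<close>)

lemma \<tau>_zero: "\<tau> \<zero>\<^bsub>B\<^esub> = \<zero>\<^bsub>B\<^esub>" "\<tau>' \<zero>\<^bsub>B\<^esub> = \<zero>\<^bsub>B\<^esub>"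
  by (rule additive_zero[of B B]; simp add: B.abelian_group_axioms \<tau>_closed \<tau>_add)+

lemma sB_zero: "a \<in> carrier R \<Longrightarrow> sB a \<zero>\<^bsub>B\<^esub> = \<zero>\<^bsub>B\<^esub>"
  by (rule additive_zero[of B B]) (simp_all add: B.abelian_group_axioms sB_closed sB_add)

fun gop :: "('v, 'e) leavitt_gen \<Rightarrow> ('e list \<Rightarrow> 'b) \<Rightarrow> 'e list \<Rightarrow> 'b" where
  "gop (Vertex u) \<phi> q = (if q \<in> arr \<and> src q = u then \<phi> q else \<zero>\<^bsub>B\<^esub>)"
| "gop (Arrow e) \<phi> q =
     (if q \<in> arr \<and> src q = head G e then if tail G e = v then \<tau>' (\<phi> []) else \<phi> (e # q) else \<zero>\<^bsub>B\<^esub>)"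
| "gop (Ghost e) \<phi> [] = (if e # tl c \<in> pre_digraph.returns G v then \<tau> (\<phi> (tl c)) else \<zero>\<^bsub>B\<^esub>)"
| "gop (Ghost e) \<phi> (f # q) = (if f # q \<in> arr \<and> f = e then \<phi> q else \<zero>\<^bsub>B\<^esub>)"

definition sop :: "'k \<Rightarrow> ('e list \<Rightarrow> 'b) \<Rightarrow> 'e list \<Rightarrow> 'b" where
  "sop a \<phi> q = sB a (\<phi> q)"

lemma ret_iff: "e # q \<in> pre_digraph.returns G v \<longleftrightarrow> e \<in> arcs G \<and> tail G e = v \<and> q \<in> arr \<and> src q = head G e"
  by (auto simp: pre_digraph.returns_def)

lemma ret_eq: "e # q \<in> pre_digraph.returns G v \<Longrightarrow> c = e # q"
  using ret by blast

lemma arr_Cons: "e # q \<in> arr \<longleftrightarrow> e \<in> arcs G \<and> tail G e \<noteq> v \<and> q \<in> arr \<and> src q = head G e"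
  by (rule G.Cons_arrivals_iff)

lemma arr_Nil: "[] \<in> arr" using v by simp

lemma gop_in_families:
  assumes "\<phi> \<in> carrier families" shows "gop g \<phi> \<in> carrier families"
proof (rule familiesI)
  fix q show "gop g \<phi> q \<in> carrier B"
    by (cases "(g, \<phi>, q)" rule: gop.cases) (use assms in \<open>simp_all add: families_closed \<tau>_closed\<close>)
next
  fix q assume "q \<notin> arr"
  then show "gop g \<phi> q = \<zero>\<^bsub>B\<^esub>"
    by (cases "(g, \<phi>, q)" rule: gop.cases) (use arr_Nil in simp_all)
qed

lemma gop_add_at:
  assumes "\<phi> \<in> carrier families" "\<psi> \<in> carrier families"
  shows "gop g (\<phi> \<oplus>\<^bsub>families\<^esub> \<psi>) q = gop g \<phi> q \<oplus>\<^bsub>B\<^esub> gop g \<psi> q"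
  by (cases "(g, \<phi>, q)" rule: gop.cases)
    (use assms in \<open>auto simp: families_simps families_closed \<tau>_add\<close>)

lemma gop_sop_at:
  assumes "\<phi> \<in> carrier families" "a \<in> carrier R" shows "gop g (sop a \<phi>) q = sB a (gop g \<phi> q)"
  by (cases "(g, \<phi>, q)" rule: gop.cases)
    (use assms in \<open>auto simp: sop_def families_closed \<tau>_sB sB_zero\<close>)

lemma sop_in_families: "\<lbrakk>a \<in> carrier R; \<phi> \<in> carrier families\<rbrakk> \<Longrightarrow> sop a \<phi> \<in> carrier families"
  by (intro familiesI) (simp_all add: sop_def sB_closed families_closed families_outside sB_zero)

lemma gop_CK1_at:
  assumes e: "e \<in> arcs G" and f: "f \<in> arcs G" and \<phi>: "\<phi> \<in> carrier families"
  shows "gop (Arrow f) (gop (Ghost e) \<phi>) q = (if e = f then gop (Vertex (head G e)) \<phi> q else \<zero>\<^bsub>B\<^esub>)"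
proof (cases "q \<in> arr \<and> src q = head G f")
  case True
  show ?thesis
  proof (cases "tail G f = v")
    case tf: True
    have "f # q \<in> pre_digraph.returns G v" using True tf f by (simp add: ret_iff)
    then have c: "c = f # q" by (rule ret_eq)
    then have tl: "tl c = q" by simp
    have "e # q \<in> pre_digraph.returns G v \<longleftrightarrow> e = f"
      using \<open>f # q \<in> pre_digraph.returns G v\<close> ret_eq[of e q] c by auto
    then show ?thesis using True tf tl \<phi> by (simp add: families_closed \<tau>_inv \<tau>_zero)
  next
    case False
    then have "f # q \<in> arr" using True f by (simp add: arr_Cons)
    then show ?thesis using True False by simp
  qed
next
  case False
  then show ?thesis by (simp only: gop.simps if_False) auto
qed

lemma gop_CK2_at:
  assumes u: "u \<in> verts G" "out_arcs G u \<noteq> {}" and \<phi>: "\<phi> \<in> carrier families"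
  shows "gop (Vertex u) \<phi> q = finsum B (\<lambda>e. gop (Ghost e) (gop (Arrow e) \<phi>) q) (out_arcs G u)"
proof -
  have sum: "finsum B (\<lambda>e. gop (Ghost e) (gop (Arrow e) \<phi>) q) (out_arcs G u) =
      (if f \<in> out_arcs G u then b else \<zero>\<^bsub>B\<^esub>)"
    if "b \<in> carrier B"
      "\<And>e. e \<in> out_arcs G u \<Longrightarrow> gop (Ghost e) (gop (Arrow e) \<phi>) q = (if f = e then b else \<zero>\<^bsub>B\<^esub>)" for f b
  proof -
    have "finsum B (\<lambda>e. gop (Ghost e) (gop (Arrow e) \<phi>) q) (out_arcs G u) =
        finsum B (\<lambda>e. if f = e then b else \<zero>\<^bsub>B\<^esub>) (out_arcs G u)"
      by (rule B.finsum_cong') (use that in simp_all)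
    also have "\<dots> = (if f \<in> out_arcs G u then b else \<zero>\<^bsub>B\<^esub>)"
    proof (cases "f \<in> out_arcs G u")
      case True
      then show ?thesis using that(1) by (subst B.finsum_singleton) (simp_all add: G.finite_out_arcs)
    next
      case False
      have "finsum B (\<lambda>e. if f = e then b else \<zero>\<^bsub>B\<^esub>) (out_arcs G u) = finsum B (\<lambda>e. \<zero>\<^bsub>B\<^esub>) (out_arcs G u)"
        by (rule B.finsum_cong') (use False in auto)
      then show ?thesis using False by (simp only: B.finsum_zero if_False)
    qed
    finally show ?thesis .
  qed
  have zero: "finsum B (\<lambda>e. gop (Ghost e) (gop (Arrow e) \<phi>) q) (out_arcs G u) = \<zero>\<^bsub>B\<^esub>"
    if "\<And>e. e \<in> out_arcs G u \<Longrightarrow> gop (Ghost e) (gop (Arrow e) \<phi>) q = \<zero>\<^bsub>B\<^esub>"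
    using sum[of "\<zero>\<^bsub>B\<^esub>"] that by simp
  show ?thesis
  proof (cases q)
    case Nil
    show ?thesis
    proof (cases "u = v")
      case True
      then have cr: "c \<in> pre_digraph.returns G v" using u sink_or_ret by auto
      then obtain f r where c: "c = f # r" by (auto simp: pre_digraph.returns_def)
      have fr: "f \<in> arcs G" "tail G f = v" "r \<in> arr" "src r = head G f" using cr c by (simp_all add: ret_iff)
      have "gop (Ghost e) (gop (Arrow e) \<phi>) q = (if f = e then \<phi> [] else \<zero>\<^bsub>B\<^esub>)"
        if "e \<in> out_arcs G u" for e
      proof -
        have "e # r \<in> pre_digraph.returns G v \<longleftrightarrow> f = e" using cr c ret_eq[of e r] by auto
        moreover have "tl c = r" using c by simp
        ultimately show ?thesis using Nil fr \<phi> by (cases "f = e") (simp_all add: families_closed \<tau>_inv)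
      qed
      then have "finsum B (\<lambda>e. gop (Ghost e) (gop (Arrow e) \<phi>) q) (out_arcs G u) =
          (if f \<in> out_arcs G u then \<phi> [] else \<zero>\<^bsub>B\<^esub>)"
        using families_closed[OF \<phi>] by (intro sum) simp_all
      then show ?thesis using fr True Nil v by simp
    next
      case False
      then show ?thesis using Nil by (subst zero) (auto simp: ret_iff)
    qed
  next
    case (Cons f q')
    show ?thesis
    proof (cases "q \<in> arr")
      case True
      then have f: "f \<in> arcs G" "tail G f \<noteq> v" "q' \<in> arr" "src q' = head G f" using Cons by (simp_all add: arr_Cons)
      have "gop (Ghost e) (gop (Arrow e) \<phi>) q = (if f = e then \<phi> q else \<zero>\<^bsub>B\<^esub>)" for e
        using Cons True f by (cases "f = e") simp_all
      then have "finsum B (\<lambda>e. gop (Ghost e) (gop (Arrow e) \<phi>) q) (out_arcs G u) =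
          (if f \<in> out_arcs G u then \<phi> q else \<zero>\<^bsub>B\<^esub>)"
        using families_closed[OF \<phi>] by (intro sum) simp_all
      then show ?thesis using True f Cons by simp
    next
      case False
      then show ?thesis using Cons by (subst zero) simp_all
    qed
  qed
qed

lemma gop_unit_at:
  assumes \<phi>: "\<phi> \<in> carrier families"
  shows "finsum B (\<lambda>u. gop (Vertex u) \<phi> q) (verts G) = \<phi> q"
proof (cases "q \<in> arr")
  case True
  have "finsum B (\<lambda>u. gop (Vertex u) \<phi> q) (verts G) = finsum B (\<lambda>u. if src q = u then \<phi> q else \<zero>\<^bsub>B\<^esub>) (verts G)"
    using families_closed[OF \<phi>] True by (intro B.finsum_cong') simp_all
  also have "\<dots> = \<phi> q"
    using families_closed[OF \<phi>] G.path_source_in_verts[OF True]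
    by (subst B.finsum_singleton) (simp_all add: G.finite_verts)
  finally show ?thesis .
next
  case False
  then show ?thesis using \<phi> by (simp add: families_outside)
qed

sublocale rep: leavitt_rep R G families gop sop
proof -
  interpret F: abelian_group families by (rule abelian_group_families)
  have at: "\<phi> = \<psi>" if "\<And>q. \<phi> q = \<psi> q" for \<phi> \<psi> :: "'e list \<Rightarrow> 'b" using that by (rule ext)
  show "leavitt_rep R G families gop sop"
  proof
    show "gop g (\<phi> \<oplus>\<^bsub>families\<^esub> \<psi>) = gop g \<phi> \<oplus>\<^bsub>families\<^esub> gop g \<psi>"
      if "\<phi> \<in> carrier families" "\<psi> \<in> carrier families" for g \<phi> \<psi>
      by (rule at) (use gop_add_at[OF that] in \<open>simp add: families_simps\<close>)
    show "gop g (sop a \<phi>) = sop a (gop g \<phi>)" if "a \<in> carrier R" "\<phi> \<in> carrier families" for g a \<phi>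
      by (rule at) (use gop_sop_at[OF that(2,1)] in \<open>simp add: sop_def\<close>)
    show "sop a (\<phi> \<oplus>\<^bsub>families\<^esub> \<psi>) = sop a \<phi> \<oplus>\<^bsub>families\<^esub> sop a \<psi>"
      if "a \<in> carrier R" "\<phi> \<in> carrier families" "\<psi> \<in> carrier families" for a \<phi> \<psi>
      by (rule at) (use that in \<open>simp add: sop_def families_simps sB_add families_closed\<close>)
    show "sop (a \<oplus>\<^bsub>R\<^esub> b) \<phi> = sop a \<phi> \<oplus>\<^bsub>families\<^esub> sop b \<phi>"
      if "a \<in> carrier R" "b \<in> carrier R" "\<phi> \<in> carrier families" for a b \<phi>
      by (rule at) (use that in \<open>simp add: sop_def families_simps sB_add_scalar families_closed\<close>)
    show "sop (a \<otimes>\<^bsub>R\<^esub> b) \<phi> = sop a (sop b \<phi>)"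
      if "a \<in> carrier R" "b \<in> carrier R" "\<phi> \<in> carrier families" for a b \<phi>
      by (rule at) (use that in \<open>simp add: sop_def sB_mult families_closed\<close>)
    show "sop \<one>\<^bsub>R\<^esub> \<phi> = \<phi>" if "\<phi> \<in> carrier families" for \<phi>
      by (rule at) (use that in \<open>simp add: sop_def sB_one families_closed\<close>)
    show "gop (Vertex w) (gop (Vertex u) \<phi>) = (if u = w then gop (Vertex u) \<phi> else \<zero>\<^bsub>families\<^esub>)" for u w \<phi>
      by (rule at) (simp add: families_simps)
    show "gop (Arrow e) (gop (Vertex (tail G e)) \<phi>) = gop (Arrow e) \<phi>" if "e \<in> arcs G" for e \<phi>
      by (rule at) (use that arr_Nil in \<open>simp add: arr_Cons\<close>)
    show "gop (Vertex (head G e)) (gop (Arrow e) \<phi>) = gop (Arrow e) \<phi>" for e \<phi>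
      by (rule at) simp
    show "gop (Ghost e) (gop (Vertex (head G e)) \<phi>) = gop (Ghost e) \<phi>" if "\<phi> \<in> carrier families" for e \<phi>
    proof (rule at)
      fix q show "gop (Ghost e) (gop (Vertex (head G e)) \<phi>) q = gop (Ghost e) \<phi> q"
        by (cases q) (auto simp: ret_iff arr_Cons)
    qed
    show "gop (Vertex (tail G e)) (gop (Ghost e) \<phi>) = gop (Ghost e) \<phi>" for e \<phi>
    proof (rule at)
      fix q show "gop (Vertex (tail G e)) (gop (Ghost e) \<phi>) q = gop (Ghost e) \<phi> q"
      proof (cases q)
        case Nil
        have "tail G e = v" if "e # tl c \<in> pre_digraph.returns G v" using that by (simp add: ret_iff)
        moreover have "gop (Ghost e) \<phi> [] = \<zero>\<^bsub>B\<^esub>" if "e # tl c \<notin> pre_digraph.returns G v" using that by simp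
        ultimately have "tail G e = v \<or> gop (Ghost e) \<phi> [] = \<zero>\<^bsub>B\<^esub>" by blast
        then show ?thesis
          using arr_Nil by (elim disjE) (simp_all only: Nil gop.simps(1) G.path_source_simps if_cancel simp_thms if_True)
      next
        case (Cons f q')
        then show ?thesis by (cases "f = e") simp_all
      qed
    qed
    show "gop (Arrow f) (gop (Ghost e) \<phi>) = (if e = f then gop (Vertex (head G e)) \<phi> else \<zero>\<^bsub>families\<^esub>)"
      if "e \<in> arcs G" "f \<in> arcs G" "\<phi> \<in> carrier families" for e f \<phi>
      by (rule at) (use gop_CK1_at[OF that] in \<open>simp add: families_simps del: gop.simps\<close>)
    show "gop (Vertex u) \<phi> = finsum families (\<lambda>e. gop (Ghost e) (gop (Arrow e) \<phi>)) (out_arcs G u)"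
      if "u \<in> verts G" "out_arcs G u \<noteq> {}" "\<phi> \<in> carrier families" for u \<phi>
      by (rule at) (use gop_CK2_at[OF that] that in
        \<open>simp add: finsum_families G.finite_out_arcs gop_in_families del: gop.simps\<close>)
    show "finsum families (\<lambda>u. gop (Vertex u) \<phi>) (verts G) = \<phi>" if "\<phi> \<in> carrier families" for \<phi>
      by (rule at) (use gop_unit_at[OF that] that in
        \<open>simp add: finsum_families G.finite_verts gop_in_families del: gop.simps\<close>)
  qed (simp_all add: gop_in_families sop_in_families)
qed

abbreviation "path_module \<equiv> rep.rep_module"

definition delta :: "'b \<Rightarrow> 'e list \<Rightarrow> 'b" where
  "delta b q = (if q = [] then b else \<zero>\<^bsub>B\<^esub>)"

lemma delta_in_families: "b \<in> carrier B \<Longrightarrow> delta b \<in> carrier families"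
  using arr_Nil by (intro familiesI) (auto simp: delta_def)

sublocale mod: leavitt_corner R G path_module v
  by (rule leavitt_cornerI[OF leavitt_algebra_axioms rep.right_module_rep v])

lemma act_gen: "\<lbrakk>g \<in> leavitt_gens G; \<phi> \<in> carrier families\<rbrakk> \<Longrightarrow> ract path_module \<phi> (gn g) = gop g \<phi>"
  by (simp add: rep.rep_module_ract)

lemma act_sc: "\<lbrakk>a \<in> carrier R; \<phi> \<in> carrier families\<rbrakk> \<Longrightarrow> ract path_module \<phi> (a \<odot>\<^bsub>L\<^esub> \<one>\<^bsub>L\<^esub>) = sop a \<phi>"
proof -
  assume *: "a \<in> carrier R" "\<phi> \<in> carrier families"
  obtain t where t: "t \<in> terms" "\<one>\<^bsub>L\<^esub> = cls t" using L_one_closed by (rule L_cases)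
  have "ract path_module \<phi> (cls t) = \<phi>" using mod.M.ract_one[of \<phi>] * t by simp
  then show ?thesis using * t by (simp add: rep.rep_module_ract)
qed

lemma delta_corner: "b \<in> carrier B \<Longrightarrow> delta b \<in> mod.corner"
proof -
  assume b: "b \<in> carrier B"
  have "gop (Vertex v) (delta b) = delta b" using v by (auto simp: delta_def)
  then show ?thesis using b v by (simp add: mod.corner_def delta_in_families lvertex_def act_gen)
qed

lemma path_module_supported: "mod.supported"
  unfolding mod.supported_def
proof (intro ballI)
  fix \<phi> u assume \<phi>: "\<phi> \<in> carrier path_module" and u: "u \<in> verts G - predecessors G v"
  have "gop (Vertex u) \<phi> q = \<zero>\<^bsub>B\<^esub>" for q
    using u G.path_source_predecessors[of q v] by auto
  then have "gop (Vertex u) \<phi> = \<zero>\<^bsub>families\<^esub>" by (simp add: fun_eq_iff families_simps)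
  then show "ract path_module \<phi> (lvertex R G u) = \<zero>\<^bsub>path_module\<^esub>"
    using \<phi> u by (simp add: lvertex_def act_gen del: gop.simps)
qed

text \<open>
  Since the vertex does not act as zero on the path model, it is not zero in the algebra.
\<close>

lemma lvertex_nonzero:
  assumes "b \<in> carrier B" "b \<noteq> \<zero>\<^bsub>B\<^esub>" shows "lvertex R G v \<noteq> \<zero>\<^bsub>L\<^esub>"
proof
  assume 0: "lvertex R G v = \<zero>\<^bsub>L\<^esub>"
  have d: "delta b \<in> mod.corner" using delta_corner assms(1) .
  have "delta b = \<zero>\<^bsub>families\<^esub>"
    using mod.cornerD[OF d] mod.M.ract_zero_right[of "delta b"] 0 by simp
  then show False using assms(2) by (simp add: delta_def families_simps fun_eq_iff split: if_splits)
qed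

lemma gact_delta:
  assumes "q \<in> arr" "b \<in> carrier B"
  shows "mod.gact q (delta b) = (\<lambda>p. if p = q then b else \<zero>\<^bsub>B\<^esub>)"
  using assms(1)
proof (induction q)
  case Nil
  show ?case by (simp add: delta_def fun_eq_iff)
next
  case (Cons e q)
  then have e: "e \<in> arcs G" "tail G e \<noteq> v" "q \<in> arr" by (simp_all add: arr_Cons)
  let ?\<psi> = "\<lambda>p. if p = q then b else \<zero>\<^bsub>B\<^esub>"
  have "?\<psi> \<in> carrier families" using assms(2) e by (intro familiesI) auto
  then have "mod.gact (e # q) (delta b) = gop (Ghost e) ?\<psi>" using Cons.IH e by (simp add: act_gen del: gop.simps)
  moreover have "gop (Ghost e) ?\<psi> p = (if p = e # q then b else \<zero>\<^bsub>B\<^esub>)" for p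
    using Cons.prems e by (cases p) (auto simp: ret_iff)
  ultimately show ?case by (simp only: fun_eq_iff) simp
qed

lemma gact_return_delta:
  assumes cr: "c \<in> pre_digraph.returns G v" and b: "b \<in> carrier B"
  shows "mod.gact c (delta b) = delta (\<tau> b)"
proof -
  obtain e r where c: "c = e # r" "e \<in> arcs G" "tail G e = v" "r \<in> arr" "src r = head G e"
    using cr by (auto simp: pre_digraph.returns_def)
  let ?\<psi> = "\<lambda>p. if p = r then b else \<zero>\<^bsub>B\<^esub>"
  have "?\<psi> \<in> carrier families" using b c by (intro familiesI) auto
  moreover have "mod.gact c (delta b) = mod.gact (e # r) (delta b)"
    by (rule arg_cong[OF c(1), of "\<lambda>p. mod.gact p (delta b)"])
  ultimately have eq: "mod.gact c (delta b) = gop (Ghost e) ?\<psi>"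
    using gact_delta[OF c(4) b] c(2) by (simp add: act_gen del: gop.simps)
  have "tl c = r" "e # r \<in> pre_digraph.returns G v" using c(1) cr by simp_all
  then have "gop (Ghost e) ?\<psi> p = delta (\<tau> b) p" for p
    using c(3) by (cases p) (auto simp: delta_def arr_Cons)
  then show ?thesis unfolding eq by (rule ext)
qed

lemma pact_return_delta:
  assumes cr: "c \<in> pre_digraph.returns G v" and b: "b \<in> carrier B"
  shows "mod.pact c (delta b) = delta (\<tau>' b)"
  using mod.pact_gact_ret[OF cr delta_corner[OF \<tau>_closed(2)[OF b]]]
    gact_return_delta[OF cr \<tau>_closed(2)[OF b]] b by (simp add: \<tau>_inv)

end

section \<open>The modules attached to a sink\<close>

context leavitt_algebra begin

lemma lvertex_sink_nonzero:
  assumes "is_sink G w" "\<one>\<^bsub>R\<^esub> \<noteq> \<zero>\<^bsub>R\<^esub>"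
  shows "lvertex R G w \<noteq> \<zero>\<^bsub>L\<^esub>"
proof -
  interpret path_model R G R w "[]" "\<lambda>a b. a \<otimes>\<^bsub>R\<^esub> b" "\<lambda>b. b" "\<lambda>b. b"
  proof unfold_locales
    show "pre_digraph.returns G w \<subseteq> {[]}" using assms(1) by (auto simp: pre_digraph.returns_def is_sink_def)
  qed (use assms(1) in \<open>simp_all add: is_sink_def ringE(3,4)[OF ring_axioms] m_assoc\<close>)
  show ?thesis by (rule lvertex_nonzero[of "\<one>\<^bsub>R\<^esub>"]) (use assms in simp_all)
qed

lemma lvertex_idem: "w \<in> verts G \<Longrightarrow> lvertex R G w \<otimes>\<^bsub>L\<^esub> lvertex R G w = lvertex R G w"
  by (simp add: vertex_mult)

context
  fixes \<mm> w assumes \<mm>: "maximalideal \<mm> R" and w: "is_sink G w"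
begin

interpretation \<mm>: maximalideal \<mm> R by (rule \<mm>)
interpretation H: leavitt_hom R G "R Quot \<mm>" G Gen "a_r_coset R \<mm>"
  by (rule leavitt_hom_reduce) (rule \<mm>.ideal_axioms)
interpretation L: ring L by (rule L_ring)
interpretation BL: ring H.B.L by (rule H.B.L_ring)

lemma w_vert: "w \<in> verts G" using w by (simp add: is_sink_def)

lemma lmap_reduce: "H.lmap = leavitt_reduce R \<mm> G"
  by (rule ext) (simp add: H.lmap_def leavitt_reduce_def)

lemma reduce_vertex: "u \<in> verts G \<Longrightarrow> leavitt_reduce R \<mm> G (lvertex R G u) = lvertex (R Quot \<mm>) G u"
  using H.lmap_gen[of "Vertex u"] by (simp add: lmap_reduce lvertex_def)

lemma reduce_smult:
  assumes "a \<in> \<mm>" "x \<in> carrier L" shows "leavitt_reduce R \<mm> G (a \<odot>\<^bsub>L\<^esub> x) = \<zero>\<^bsub>H.B.L\<^esub>"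
proof -
  have "a_r_coset R \<mm> a = \<zero>\<^bsub>R Quot \<mm>\<^esub>"
    using a_coset_join2[OF \<mm>.Icarr[OF assms(1)] \<mm>.a_subgroup assms(1)] by (simp add: FactRing_def)
  then show ?thesis
    using assms H.lmap_smult[of a x] H.lmap_closed[OF assms(2)]
    by (simp add: lmap_reduce \<mm>.Icarr H.B.smult_zero_left)
qed

lemma reduce_surj: "y \<in> carrier H.B.L \<Longrightarrow> \<exists>x\<in>carrier L. leavitt_reduce R \<mm> G x = y"
  unfolding lmap_reduce[symmetric]
proof (rule H.lmap_surj)
  show "a_r_coset R \<mm> ` carrier R = carrier (R Quot \<mm>)"
    by (auto simp: FactRing_def A_RCOSETS_def')
qed auto

lemma reduced_vertex_nonzero: "lvertex (R Quot \<mm>) G w \<noteq> \<zero>\<^bsub>H.B.L\<^esub>"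
proof (rule H.B.lvertex_sink_nonzero[OF w])
  interpret Q: field "R Quot \<mm>" by (rule \<mm>.quotient_is_field) (rule cring_axioms)
  show "\<one>\<^bsub>R Quot \<mm>\<^esub> \<noteq> \<zero>\<^bsub>R Quot \<mm>\<^esub>" by (rule Q.one_not_zero)
qed

lemma reduced_sink_corner: "leavitt_corner R G (reduced_sink_module R G \<mm> w) w"
  unfolding reduced_sink_module_def lmap_reduce[symmetric]
  by (rule leavitt_cornerI[OF leavitt_algebra_axioms right_module_right_ideal_module w_vert])
    (simp_all add: L_ring H.B.L_ring H.lmap_ring_hom w_vert)

lemma reduced_sink_based:
  "leavitt_corner.based R G (reduced_sink_module R G \<mm> w) w (\<lambda>r. r \<odot>\<^bsub>L\<^esub> \<one>\<^bsub>L\<^esub>) \<mm> (lvertex (R Quot \<mm>) G w)"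
proof -
  let ?w = "lvertex (R Quot \<mm>) G w"
  interpret M: leavitt_corner R G "reduced_sink_module R G \<mm> w" w by (rule reduced_sink_corner)
  note simps = reduced_sink_module_def
  have wc: "?w \<in> carrier H.B.L" using w_vert by simp
  show ?thesis
    unfolding M.based_def
  proof (intro conjI ballI)
    have "?w \<in> carrier (reduced_sink_module R G \<mm> w)"
      using wc H.B.lvertex_idem[OF w_vert] by (simp add: simps) (metis imageI)
    moreover have "ract (reduced_sink_module R G \<mm> w) ?w (lvertex R G w) = ?w"
      by (simp add: simps reduce_vertex w_vert H.B.lvertex_idem)
    ultimately show "?w \<in> M.corner" by (simp add: M.corner_def)
    show "?w \<noteq> \<zero>\<^bsub>reduced_sink_module R G \<mm> w\<^esub>" by (simp add: simps reduced_vertex_nonzero)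
    show "\<exists>a\<in>carrier L. y = ract (reduced_sink_module R G \<mm> w) ?w a"
      if y: "y \<in> carrier (reduced_sink_module R G \<mm> w)" for y
    proof -
      obtain z where z: "z \<in> carrier H.B.L" "y = ?w \<otimes>\<^bsub>H.B.L\<^esub> z" using y by (auto simp: simps)
      obtain a where "a \<in> carrier L" "leavitt_reduce R \<mm> G a = z" using reduce_surj[OF z(1)] by blast
      then show ?thesis using z by (intro bexI[of _ a]) (simp_all add: simps)
    qed
    show "ract (reduced_sink_module R G \<mm> w) ?w (f \<odot>\<^bsub>L\<^esub> \<one>\<^bsub>L\<^esub>) = \<zero>\<^bsub>reduced_sink_module R G \<mm> w\<^esub>"
      if "f \<in> \<mm>" for f
      using that wc by (simp add: simps reduce_smult)
  qed
qed

lemma right_module_sink_module: "right_module L (sink_module R G w)"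
  unfolding sink_module_def
  by (rule right_module_right_ideal_module) (simp_all add: L_ring ring_hom_def w_vert)

interpretation S: right_module L "sink_module R G w" by (rule right_module_sink_module)

lemma sink_module_simps:
  "carrier (sink_module R G w) = (\<lambda>x. lvertex R G w \<otimes>\<^bsub>L\<^esub> x) ` carrier L"
  "\<zero>\<^bsub>sink_module R G w\<^esub> = \<zero>\<^bsub>L\<^esub>" "add (sink_module R G w) = add L"
  "ract (sink_module R G w) = (\<lambda>x a. x \<otimes>\<^bsub>L\<^esub> a)"
  by (auto simp: sink_module_def right_ideal_module_def)

lemma sink_module_carrier: "x \<in> carrier (sink_module R G w) \<Longrightarrow> x \<in> carrier L"
  using w_vert by (auto simp: sink_module_simps mult_closed)

lemma sink_module_smult:
  assumes "x \<in> carrier (sink_module R G w)" "a \<in> carrier R"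
  shows "a \<odot>\<^bsub>L\<^esub> x \<in> carrier (sink_module R G w)"
proof -
  have "ract (sink_module R G w) x (a \<odot>\<^bsub>L\<^esub> \<one>\<^bsub>L\<^esub>) \<in> carrier (sink_module R G w)"
    using assms by (intro S.ract_closed) (simp_all add: smult_closed)
  then show ?thesis using assms smult_as_mult(1)[OF assms(2) sink_module_carrier[OF assms(1)]]
    by (simp add: sink_module_simps(4))
qed

lemma ideal_sink_submodule:
  "submodule_of L (sink_module R G w) (ideal_sink_module R G \<mm> w)"
proof (rule S.submodule_ofI)
  let ?M = "sink_module R G w" and ?N = "ideal_sink_module R G \<mm> w"
  let ?X = "{a \<odot>\<^bsub>L\<^esub> x | a x. a \<in> \<mm> \<and> x \<in> carrier ?M}"
  have X: "?X \<subseteq> carrier (add_monoid ?M)" by (auto simp: sink_module_smult \<mm>.Icarr)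
  show sub: "?N \<subseteq> carrier ?M"
    using S.M.add.generate_incl[of ?X] X unfolding ideal_sink_module_def by simp
  show "\<zero>\<^bsub>?M\<^esub> \<in> ?N"
    using generate.one[of "add_monoid ?M" ?X] by (simp add: ideal_sink_module_def)
  show "x \<oplus>\<^bsub>?M\<^esub> y \<in> ?N" if "x \<in> ?N" "y \<in> ?N" for x y
    using that generate.eng[of x "add_monoid ?M" ?X y] by (simp add: ideal_sink_module_def)
  show "ract ?M x b \<in> ?N" if x: "x \<in> ?N" and b: "b \<in> carrier L" for x b
    using x unfolding ideal_sink_module_def
  proof (induction x rule: generate.induct)
    case one
    show ?case using b generate.one[of "add_monoid ?M" ?X] by (simp add: S.ract_zero_left)
  next
    case (incl h)
    then obtain a x where ax: "h = a \<odot>\<^bsub>L\<^esub> x" "a \<in> \<mm>" "x \<in> carrier ?M" by blast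
    have "ract ?M h b = a \<odot>\<^bsub>L\<^esub> ract ?M x b"
      using ax b by (simp add: sink_module_simps(4) smult_assoc2 \<mm>.Icarr sink_module_carrier)
    then show ?case using ax b S.ract_closed by (intro generate.incl) blast
  next
    case (inv h)
    then obtain a x where ax: "h = a \<odot>\<^bsub>L\<^esub> x" "a \<in> \<mm>" "x \<in> carrier ?M" by blast
    have "ract ?M h b = a \<odot>\<^bsub>L\<^esub> ract ?M x b"
      using ax b by (simp add: sink_module_simps(4) smult_assoc2 \<mm>.Icarr sink_module_carrier)
    then have "ract ?M h b \<in> ?X" using ax b S.ract_closed by blast
    then have "inv\<^bsub>add_monoid ?M\<^esub> (ract ?M h b) \<in> generate (add_monoid ?M) ?X" by (rule generate.inv)
    moreover have "ract ?M (inv\<^bsub>add_monoid ?M\<^esub> h) b = inv\<^bsub>add_monoid ?M\<^esub> (ract ?M h b)"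
      using ax b sink_module_smult \<mm>.Icarr by (simp add: a_inv_def[symmetric] S.ract_neg_left)
    ultimately show ?case by simp
  next
    case (eng x y)
    have "x \<in> carrier ?M" "y \<in> carrier ?M"
      using eng.hyps S.M.add.generate_incl[of ?X] X by auto
    then show ?case using eng.IH b generate.eng by (fastforce simp: S.ract_l_distr)
  qed
qed

lemma reduce_ideal_sink:
  assumes "x \<in> ideal_sink_module R G \<mm> w" shows "leavitt_reduce R \<mm> G x = \<zero>\<^bsub>H.B.L\<^esub>"
proof -
  let ?M = "sink_module R G w" and ?r = "leavitt_reduce R \<mm> G"
  let ?X = "{a \<odot>\<^bsub>L\<^esub> x | a x. a \<in> \<mm> \<and> x \<in> carrier ?M}"
  have X: "?X \<subseteq> carrier (add_monoid ?M)" by (auto simp: sink_module_smult \<mm>.Icarr)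
  have Mc: "y \<in> carrier L" if "y \<in> generate (add_monoid ?M) ?X" for y
    using that S.M.add.generate_incl[of ?X] X sink_module_carrier by auto
  have add: "?r (y \<oplus>\<^bsub>?M\<^esub> z) = ?r y \<oplus>\<^bsub>H.B.L\<^esub> ?r z" if "y \<in> carrier L" "z \<in> carrier L" for y z
    using that H.lmap_add by (simp add: lmap_reduce sink_module_simps)
  have zero: "?r \<zero>\<^bsub>?M\<^esub> = \<zero>\<^bsub>H.B.L\<^esub>"
    using additive_zero[OF L_abelian_group H.B.L_abelian_group, of H.lmap] H.lmap_closed H.lmap_add
    by (simp add: lmap_reduce sink_module_simps)
  have X0: "?r y = \<zero>\<^bsub>H.B.L\<^esub>" if "y \<in> ?X" for y
    using that sink_module_carrier by (auto simp: reduce_smult)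
  show ?thesis using assms unfolding ideal_sink_module_def
  proof (induction x rule: generate.induct)
    case (inv h)
    have h: "h \<in> carrier ?M" using inv X by auto
    have "?r (\<ominus>\<^bsub>?M\<^esub> h) = \<ominus>\<^bsub>H.B.L\<^esub> ?r h"
      using S.M.abelian_group_axioms H.B.L_abelian_group _ _ h
    proof (rule additive_neg)
      show "?r \<in> carrier ?M \<rightarrow> carrier H.B.L"
        using H.lmap_closed sink_module_carrier by (simp add: lmap_reduce)
    qed (simp add: add sink_module_carrier)
    then show ?case using X0[OF inv] by (simp add: a_inv_def[symmetric])
  next
    case (eng y z)
    then show ?case using add[of y z] Mc by simp
  qed (simp_all add: zero X0)
qed

lemma sink_quotient_corner:
  "leavitt_corner R G (quotient_module (sink_module R G w) (ideal_sink_module R G \<mm> w)) w"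
  by (rule leavitt_cornerI[OF leavitt_algebra_axioms S.right_module_quotient_module(1)[OF ideal_sink_submodule] w_vert])

lemma sink_quotient_based:
  "leavitt_corner.based R G (quotient_module (sink_module R G w) (ideal_sink_module R G \<mm> w)) w
     (\<lambda>r. r \<odot>\<^bsub>L\<^esub> \<one>\<^bsub>L\<^esub>) \<mm> (ideal_sink_module R G \<mm> w +>\<^bsub>sink_module R G w\<^esub> lvertex R G w)"
proof -
  let ?M = "sink_module R G w" and ?N = "ideal_sink_module R G \<mm> w"
  let ?Q = "quotient_module ?M ?N" and ?w = "lvertex R G w"
  note Q = S.right_module_quotient_module[OF ideal_sink_submodule]
  interpret Q: leavitt_corner R G ?Q w by (rule sink_quotient_corner)
  have wc: "?w \<in> carrier L" using w_vert by simp
  have wM: "?w \<in> carrier ?M"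
    using wc lvertex_idem[OF w_vert] by (simp add: sink_module_simps) (metis imageI)
  show ?thesis
    unfolding Q.based_def
  proof (intro conjI ballI)
    show "?N +>\<^bsub>?M\<^esub> ?w \<in> Q.corner"
      using wM wc Q(2)[OF wM wc] lvertex_idem[OF w_vert] by (simp add: Q.corner_def Q(4) sink_module_simps(4))
    \<comment> \<open>Reduction modulo \<open>\<mm>\<close> kills \<open>?N\<close> but not the vertex.\<close>
    have "?w \<notin> ?N"
      using reduce_ideal_sink[of ?w] reduced_vertex_nonzero reduce_vertex[OF w_vert] by auto
    then show "?N +>\<^bsub>?M\<^esub> ?w \<noteq> \<zero>\<^bsub>?Q\<^esub>" using Q(5) Q(6)[OF wM] by simp
    show "\<exists>a\<in>carrier L. y = ract ?Q (?N +>\<^bsub>?M\<^esub> ?w) a" if y: "y \<in> carrier ?Q" for y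
    proof -
      obtain z where z: "z \<in> carrier ?M" "y = ?N +>\<^bsub>?M\<^esub> z" using y by (auto simp: Q(4))
      then obtain a where "a \<in> carrier L" "z = ?w \<otimes>\<^bsub>L\<^esub> a" by (auto simp: sink_module_simps)
      then show ?thesis using z Q(2)[OF wM] by (intro bexI[of _ a]) (simp_all add: sink_module_simps(4))
    qed
    show "ract ?Q (?N +>\<^bsub>?M\<^esub> ?w) (f \<odot>\<^bsub>L\<^esub> \<one>\<^bsub>L\<^esub>) = \<zero>\<^bsub>?Q\<^esub>" if f: "f \<in> \<mm>" for f
    proof -
      have fR: "f \<in> carrier R" using f by (rule \<mm>.Icarr)
      have "f \<odot>\<^bsub>L\<^esub> ?w \<in> ?N" unfolding ideal_sink_module_def using f wM by (intro generate.incl) blast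
      then have "?N +>\<^bsub>?M\<^esub> (f \<odot>\<^bsub>L\<^esub> ?w) = ?N" using Q(6) sink_module_smult[OF wM fR] by simp
      then show ?thesis
        using Q(2)[OF wM, of "f \<odot>\<^bsub>L\<^esub> \<one>\<^bsub>L\<^esub>"] smult_as_mult(1)[OF fR wc] fR
        by (simp add: Q(5) sink_module_simps(4) smult_closed)
    qed
  qed
qed

end

end

lemma sink_support:
  assumes "leavitt_corner R G M w" "is_sink G w" "maximalideal \<mm> R"
    and "leavitt_corner.based R G M w (\<lambda>r. r \<odot>\<^bsub>leavitt R G\<^esub> \<one>\<^bsub>leavitt R G\<^esub>) \<mm> x"
  shows "support R G M = predecessors G w" "simple_right_module (leavitt R G) M"
proof -
  interpret leavitt_corner R G M w by fact
  note a = cring_axioms sink_corner_action[OF assms(1,2)] assms(3,4)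
  show "support R G M = predecessors G w" by (rule based_support[OF a])
  show "simple_right_module (leavitt R G) M" by (rule based_simple[OF a])
qed

section \<open>Balanced tensor products as modules\<close>

lemma right_module_cong:
  assumes "right_module A M" "carrier N = carrier M" "add N = add M" "\<zero>\<^bsub>N\<^esub> = \<zero>\<^bsub>M\<^esub>" "ract N = ract M"
  shows "right_module A N"
proof -
  interpret M: right_module A M by fact
  interpret N: abelian_group N
  proof (rule abelian_groupI)
    fix x assume "x \<in> carrier N"
    then show "\<exists>y\<in>carrier N. y \<oplus>\<^bsub>N\<^esub> x = \<zero>\<^bsub>N\<^esub>"
      using assms(2-4) by (intro bexI[of _ "\<ominus>\<^bsub>M\<^esub> x"]) (simp_all add: M.M.l_neg)
  qed (simp_all add: assms(2-4) M.M.a_ac)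
  show ?thesis
    by unfold_locales
      (simp_all add: assms(2-5) M.ract_closed M.ract_l_distr M.ract_r_distr M.ract_assoc M.ract_one)
qed

locale tensor_product = Q: right_module S Q + N: right_module L N
  for S :: "('s, 'y) ring_scheme" and Q :: "('s, 'm, 'z) rmodule_scheme"
    and L :: "('a, 'x) ring_scheme" and N :: "('s, 'a, 'n, 'w) bimodule_scheme" +
  assumes lact_closed: "\<lbrakk>s \<in> carrier S; y \<in> carrier N\<rbrakk> \<Longrightarrow> lact N s y \<in> carrier N"
    and lact_ract: "\<lbrakk>s \<in> carrier S; y \<in> carrier N; a \<in> carrier L\<rbrakk> \<Longrightarrow>
      lact N s (ract N y a) = ract N (lact N s y) a"
begin

abbreviation "F \<equiv> free_Abelian_group (carrier Q \<times> carrier N)"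
abbreviation "rels \<equiv> tensor_rels S Q N"
abbreviation "K \<equiv> generate F rels"
abbreviation "T \<equiv> tensor_module S Q N"
abbreviation "act_free a \<equiv> frag_extend (\<lambda>(x, y). frag_of (x, ract N y a))"

definition tens :: "'m \<Rightarrow> 'n \<Rightarrow> ('m \<times> 'n \<Rightarrow>\<^sub>0 int) set" where
  "tens x y = K #>\<^bsub>F\<^esub> frag_of (x, y)"

interpretation F: comm_group F by (rule abelian_free_Abelian_group)

lemma F_closed_diff: "\<lbrakk>c \<in> carrier F; d \<in> carrier F\<rbrakk> \<Longrightarrow> c - d \<in> carrier F"
  using keys_diff[of c d] by auto

lemma F_closed_add: "\<lbrakk>c \<in> carrier F; d \<in> carrier F\<rbrakk> \<Longrightarrow> c + d \<in> carrier F"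
  using keys_add[of c d] by auto

lemma F_induct [consumes 1, case_names zero diff pair]:
  assumes "c \<in> carrier F" "P 0"
    and "\<And>c d. \<lbrakk>c \<in> carrier F; d \<in> carrier F; P c; P d\<rbrakk> \<Longrightarrow> P (c - d)"
    and "\<And>x y. \<lbrakk>x \<in> carrier Q; y \<in> carrier N\<rbrakk> \<Longrightarrow> P (frag_of (x, y))"
  shows "P c"
proof -
  have "Poly_Mapping.keys c \<subseteq> carrier Q \<times> carrier N" using assms(1) by simp
  then show ?thesis
    by (rule free_Abelian_group_induct) (use assms(2-4) in auto)
qed

lemma rels_cases:
  assumes "r \<in> rels"
  obtains
    (left) x x' y where "r = frag_of (x \<oplus>\<^bsub>Q\<^esub> x', y) - frag_of (x, y) - frag_of (x', y)"
      "x \<in> carrier Q" "x' \<in> carrier Q" "y \<in> carrier N"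
  | (right) x y y' where "r = frag_of (x, y \<oplus>\<^bsub>N\<^esub> y') - frag_of (x, y) - frag_of (x, y')"
      "x \<in> carrier Q" "y \<in> carrier N" "y' \<in> carrier N"
  | (balanced) x s y where "r = frag_of (ract Q x s, y) - frag_of (x, lact N s y)"
      "x \<in> carrier Q" "s \<in> carrier S" "y \<in> carrier N"
  using assms unfolding tensor_rels_def by blast

lemma relsI:
  "\<lbrakk>x \<in> carrier Q; x' \<in> carrier Q; y \<in> carrier N\<rbrakk> \<Longrightarrow>
    frag_of (x \<oplus>\<^bsub>Q\<^esub> x', y) - frag_of (x, y) - frag_of (x', y) \<in> rels"
  "\<lbrakk>x \<in> carrier Q; y \<in> carrier N; y' \<in> carrier N\<rbrakk> \<Longrightarrow>
    frag_of (x, y \<oplus>\<^bsub>N\<^esub> y') - frag_of (x, y) - frag_of (x, y') \<in> rels"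
  "\<lbrakk>x \<in> carrier Q; s \<in> carrier S; y \<in> carrier N\<rbrakk> \<Longrightarrow>
    frag_of (ract Q x s, y) - frag_of (x, lact N s y) \<in> rels"
  unfolding tensor_rels_def by blast+

lemma frag_of_F: "\<lbrakk>x \<in> carrier Q; y \<in> carrier N\<rbrakk> \<Longrightarrow> frag_of (x, y) \<in> carrier F"
  by simp

lemma rels_F: "rels \<subseteq> carrier F"
proof
  fix r assume "r \<in> rels"
  then show "r \<in> carrier F"
    by (cases rule: rels_cases)
      (simp_all only: F_closed_diff frag_of_F Q.M.a_closed N.M.a_closed Q.ract_closed lact_closed)
qed

lemma K_subgroup: "subgroup K F"
  using rels_F by (rule F.generate_is_subgroup)

lemma K_normal: "K \<lhd> F"
  using K_subgroup by (simp add: F.normal_iff_subgroup)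

lemma K_F: "K \<subseteq> carrier F"
  using K_subgroup by (rule subgroup.subset)

lemma K_diff: "\<lbrakk>c \<in> K; d \<in> K\<rbrakk> \<Longrightarrow> c - d \<in> K"
proof -
  assume c: "c \<in> K" and d: "d \<in> K"
  then have "c + inv\<^bsub>F\<^esub> d \<in> K"
    using subgroup.m_closed[OF K_subgroup c subgroup.m_inv_closed[OF K_subgroup d]] by simp
  moreover have "d \<in> carrier F" using K_F d by blast
  ultimately show "c - d \<in> K" by simp
qed

lemma K_add: "\<lbrakk>c \<in> K; d \<in> K\<rbrakk> \<Longrightarrow> c + d \<in> K"
  using subgroup.m_closed[OF K_subgroup] by simp

lemma coset_eq_iff:
  assumes "c \<in> carrier F" "d \<in> carrier F" shows "K #>\<^bsub>F\<^esub> c = K #>\<^bsub>F\<^esub> d \<longleftrightarrow> c - d \<in> K"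
proof
  assume "K #>\<^bsub>F\<^esub> c = K #>\<^bsub>F\<^esub> d"
  then have "c \<in> K #>\<^bsub>F\<^esub> d" using F.rcos_self[OF assms(1) K_subgroup] by simp
  then obtain k where "k \<in> K" "c = k + d" by (auto simp: r_coset_def)
  then show "c - d \<in> K" by simp
next
  assume "c - d \<in> K"
  then have "c \<in> K #>\<^bsub>F\<^esub> d" by (auto simp: r_coset_def intro!: bexI[of _ "c - d"])
  then show "K #>\<^bsub>F\<^esub> c = K #>\<^bsub>F\<^esub> d"
    using F.repr_independence[OF _ assms(2) K_subgroup] by simp
qed

lemma T_carrier: "carrier T = (\<lambda>c. K #>\<^bsub>F\<^esub> c) ` carrier F"
  by (auto simp: tensor_module_def Let_def FactGroup_def RCOSETS_def)

lemma T_zero: "\<zero>\<^bsub>T\<^esub> = K" and T_zero_coset: "K = K #>\<^bsub>F\<^esub> 0"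
  using F.coset_join2[OF _ K_subgroup, of 0] subgroup.one_closed[OF K_subgroup]
  by (simp_all add: tensor_module_def Let_def FactGroup_def)

lemma T_add: "\<lbrakk>c \<in> carrier F; d \<in> carrier F\<rbrakk> \<Longrightarrow> (K #>\<^bsub>F\<^esub> c) \<oplus>\<^bsub>T\<^esub> (K #>\<^bsub>F\<^esub> d) = K #>\<^bsub>F\<^esub> (c + d)"
  using normal.rcos_sum[OF K_normal, of c d] by (simp add: tensor_module_def Let_def FactGroup_def)

lemma act_free_closed: assumes c: "c \<in> carrier F" and a: "a \<in> carrier L" shows "act_free a c \<in> carrier F"
  using c
proof (induction c rule: F_induct)
  case (diff c d)
  then show ?case using F_closed_diff by (simp only: frag_extend_diff)
next
  case (pair x y)
  then show ?case using a N.ract_closed by (auto simp: frag_extend_of)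
qed simp

lemma act_free_K: assumes a: "a \<in> carrier L" and c: "c \<in> K" shows "act_free a c \<in> K"
proof -
  have rel: "act_free a r \<in> rels" if "r \<in> rels" for r
    using that
  proof (cases rule: rels_cases)
    case (left x x' y)
    then show ?thesis using relsI(1)[of x x' "ract N y a"] a by (simp add: frag_extend_diff N.ract_closed)
  next
    case (right x y y')
    then show ?thesis using relsI(2)[of x "ract N y a" "ract N y' a"] a
      by (simp add: frag_extend_diff N.ract_closed N.ract_l_distr)
  next
    case (balanced x s y)
    then show ?thesis using relsI(3)[of x s "ract N y a"] a
      by (simp add: frag_extend_diff N.ract_closed lact_ract)
  qed
  show ?thesis using c
  proof (induction c rule: generate.induct)
    case one
    show ?case using generate.one[of F rels] by simp
  next
    case (incl r)
    then show ?case by (intro generate.incl rel)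
  next
    case (inv r)
    then have "act_free a r \<in> K" by (intro generate.incl rel)
    then have "0 - act_free a r \<in> K" using generate.one[of F rels] by (intro K_diff) simp_all
    moreover have "r \<in> carrier F" using inv rels_F by blast
    ultimately show ?case by (simp add: frag_extend_minus)
  next
    case (eng c d)
    then show ?case using K_add by (simp add: frag_extend_add)
  qed
qed

lemma T_ract:
  assumes a: "a \<in> carrier L" and c: "c \<in> carrier F"
  shows "ract T (K #>\<^bsub>F\<^esub> c) a = K #>\<^bsub>F\<^esub> act_free a c"
proof -
  have "K #>\<^bsub>F\<^esub> act_free a d = K #>\<^bsub>F\<^esub> act_free a c" if d: "d \<in> K #>\<^bsub>F\<^esub> c" for d
  proof -
    obtain k where k: "k \<in> K" "d = k + c" using d by (auto simp: r_coset_def)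
    then have dF: "d \<in> carrier F" using F_closed_add K_F c by blast
    have "act_free a d - act_free a c \<in> K"
      using act_free_K[OF a k(1)] k(2) by (simp add: frag_extend_add)
    then show ?thesis using coset_eq_iff[OF act_free_closed[OF dF a] act_free_closed[OF c a]] by simp
  qed
  then have "(\<Union>d\<in>K #>\<^bsub>F\<^esub> c. K #>\<^bsub>F\<^esub> act_free a d) = (\<Union>d\<in>K #>\<^bsub>F\<^esub> c. K #>\<^bsub>F\<^esub> act_free a c)"
    by (intro SUP_cong) simp_all
  moreover have "K #>\<^bsub>F\<^esub> c \<noteq> {}" using F.rcos_self[OF c K_subgroup] by blast
  ultimately show ?thesis by (simp add: tensor_module_def Let_def)
qed

lemma act_free_add:
  assumes a: "a \<in> carrier L" and b: "b \<in> carrier L" and c: "c \<in> carrier F"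
  shows "act_free (a \<oplus>\<^bsub>L\<^esub> b) c - (act_free a c + act_free b c) \<in> K"
  using c
proof (induction c rule: F_induct)
  case zero
  show ?case using generate.one[of F rels] by simp
next
  case (diff c d)
  then show ?case using K_diff[OF diff(3,4)] by (simp add: frag_extend_diff algebra_simps)
next
  case (pair x y)
  then show ?case using generate.incl[OF relsI(2)[of x "ract N y a" "ract N y b"], of F] a b
    by (simp add: N.ract_closed N.ract_r_distr diff_diff_eq)
qed

lemma act_free_mult:
  assumes a: "a \<in> carrier L" and b: "b \<in> carrier L" and c: "c \<in> carrier F"
  shows "act_free (a \<otimes>\<^bsub>L\<^esub> b) c = act_free b (act_free a c)"
  using c by (induction c rule: F_induct) (use a b in \<open>simp_all add: frag_extend_diff N.ract_assoc\<close>)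

lemma act_free_one: "c \<in> carrier F \<Longrightarrow> act_free \<one>\<^bsub>L\<^esub> c = c"
  by (induction c rule: F_induct) (simp_all add: frag_extend_diff N.ract_one)

lemma T_cases:
  assumes "X \<in> carrier T" obtains c where "c \<in> carrier F" "X = K #>\<^bsub>F\<^esub> c"
  using assms unfolding T_carrier by blast

lemma T_coset_closed: "c \<in> carrier F \<Longrightarrow> K #>\<^bsub>F\<^esub> c \<in> carrier T"
  unfolding T_carrier by (rule imageI)

lemma right_module_tensor: "right_module L T"
proof -
  interpret T: abelian_group T
  proof (rule abelian_groupI)
    fix X Y assume X: "X \<in> carrier T" and Y: "Y \<in> carrier T"
    obtain c where c: "c \<in> carrier F" "X = K #>\<^bsub>F\<^esub> c" using X by (rule T_cases)
    obtain d where d: "d \<in> carrier F" "Y = K #>\<^bsub>F\<^esub> d" using Y by (rule T_cases)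
    show "X \<oplus>\<^bsub>T\<^esub> Y \<in> carrier T"
      unfolding c(2) d(2) T_add[OF c(1) d(1)] by (rule T_coset_closed[OF F_closed_add[OF c(1) d(1)]])
    show "X \<oplus>\<^bsub>T\<^esub> Y = Y \<oplus>\<^bsub>T\<^esub> X"
      unfolding c(2) d(2) T_add[OF c(1) d(1)] T_add[OF d(1) c(1)] by (simp only: add.commute)
    fix Z assume Z: "Z \<in> carrier T"
    obtain e where e: "e \<in> carrier F" "Z = K #>\<^bsub>F\<^esub> e" using Z by (rule T_cases)
    show "X \<oplus>\<^bsub>T\<^esub> Y \<oplus>\<^bsub>T\<^esub> Z = X \<oplus>\<^bsub>T\<^esub> (Y \<oplus>\<^bsub>T\<^esub> Z)"
      unfolding c(2) d(2) e(2) T_add[OF c(1) d(1)] T_add[OF d(1) e(1)]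
        T_add[OF F_closed_add[OF c(1) d(1)] e(1)] T_add[OF c(1) F_closed_add[OF d(1) e(1)]]
      by (simp only: add.assoc)
  next
    have z: "0 \<in> carrier F" by simp
    show "\<zero>\<^bsub>T\<^esub> \<in> carrier T" using T_zero T_zero_coset T_coset_closed[OF z] by simp
    fix X assume X: "X \<in> carrier T"
    obtain c where c: "c \<in> carrier F" "X = K #>\<^bsub>F\<^esub> c" using X by (rule T_cases)
    show "\<zero>\<^bsub>T\<^esub> \<oplus>\<^bsub>T\<^esub> X = X" using T_add[OF z c(1)] c(2) T_zero T_zero_coset by simp
    have m: "- c \<in> carrier F" using F_closed_diff[OF z c(1)] by simp
    have "(K #>\<^bsub>F\<^esub> (- c)) \<oplus>\<^bsub>T\<^esub> X = \<zero>\<^bsub>T\<^esub>" using T_add[OF m c(1)] c(2) T_zero T_zero_coset by simp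
    then show "\<exists>Y\<in>carrier T. Y \<oplus>\<^bsub>T\<^esub> X = \<zero>\<^bsub>T\<^esub>" using T_coset_closed[OF m] by blast
  qed
  show ?thesis
  proof unfold_locales
    fix X a assume X: "X \<in> carrier T" and a: "a \<in> carrier L"
    obtain c where c: "c \<in> carrier F" "X = K #>\<^bsub>F\<^esub> c" using X by (rule T_cases)
    show "ract T X a \<in> carrier T"
      unfolding c(2) T_ract[OF a c(1)] by (rule T_coset_closed[OF act_free_closed[OF c(1) a]])
    fix b assume b: "b \<in> carrier L"
    show "ract T X (a \<otimes>\<^bsub>L\<^esub> b) = ract T (ract T X a) b"
      unfolding c(2) T_ract[OF a c(1)] T_ract[OF b act_free_closed[OF c(1) a]]
        T_ract[OF N.A.m_closed[OF a b] c(1)] act_free_mult[OF a b c(1)] ..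
    show "ract T X (a \<oplus>\<^bsub>L\<^esub> b) = ract T X a \<oplus>\<^bsub>T\<^esub> ract T X b"
    proof -
      note ac = act_free_closed[OF c(1) a] and bc = act_free_closed[OF c(1) b]
      have "K #>\<^bsub>F\<^esub> act_free (a \<oplus>\<^bsub>L\<^esub> b) c = K #>\<^bsub>F\<^esub> (act_free a c + act_free b c)"
        using act_free_add[OF a b c(1)]
          coset_eq_iff[OF act_free_closed[OF c(1) N.A.a_closed[OF a b]] F_closed_add[OF ac bc]] by (simp only:)
      then show ?thesis
        unfolding c(2) T_ract[OF a c(1)] T_ract[OF b c(1)] T_add[OF ac bc] T_ract[OF N.A.a_closed[OF a b] c(1)] .
    qed
  next
    fix X Y a assume X: "X \<in> carrier T" and Y: "Y \<in> carrier T" and a: "a \<in> carrier L"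
    obtain c where c: "c \<in> carrier F" "X = K #>\<^bsub>F\<^esub> c" using X by (rule T_cases)
    obtain d where d: "d \<in> carrier F" "Y = K #>\<^bsub>F\<^esub> d" using Y by (rule T_cases)
    show "ract T (X \<oplus>\<^bsub>T\<^esub> Y) a = ract T X a \<oplus>\<^bsub>T\<^esub> ract T Y a"
      unfolding c(2) d(2) T_add[OF c(1) d(1)] T_ract[OF a c(1)] T_ract[OF a d(1)]
        T_ract[OF a F_closed_add[OF c(1) d(1)]] frag_extend_add
        T_add[OF act_free_closed[OF c(1) a] act_free_closed[OF d(1) a]] ..
  next
    fix X assume X: "X \<in> carrier T"
    obtain c where c: "c \<in> carrier F" "X = K #>\<^bsub>F\<^esub> c" using X by (rule T_cases)
    show "ract T X \<one>\<^bsub>L\<^esub> = X" 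
      unfolding c(2) T_ract[OF N.A.one_closed c(1)] act_free_one[OF c(1)] ..
  qed
qed

lemma tens_closed: "\<lbrakk>x \<in> carrier Q; y \<in> carrier N\<rbrakk> \<Longrightarrow> tens x y \<in> carrier T"
  unfolding tens_def by (intro T_coset_closed frag_of_F)

lemma tens_ract:
  "\<lbrakk>x \<in> carrier Q; y \<in> carrier N; a \<in> carrier L\<rbrakk> \<Longrightarrow> ract T (tens x y) a = tens x (ract N y a)"
  unfolding tens_def by (simp add: T_ract frag_of_F del: carrier_free_Abelian_group_iff)

lemma tens_balanced:
  "\<lbrakk>x \<in> carrier Q; s \<in> carrier S; y \<in> carrier N\<rbrakk> \<Longrightarrow> tens (ract Q x s) y = tens x (lact N s y)"
  unfolding tens_def
  by (subst coset_eq_iff) (simp_all only: frag_of_F Q.ract_closed lact_closed generate.incl[OF relsI(3)])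

lemma tens_add_right:
  assumes "x \<in> carrier Q" "y \<in> carrier N" "y' \<in> carrier N"
  shows "tens x (y \<oplus>\<^bsub>N\<^esub> y') = tens x y \<oplus>\<^bsub>T\<^esub> tens x y'"
  unfolding tens_def T_add[OF frag_of_F[OF assms(1,2)] frag_of_F[OF assms(1,3)]]
  using generate.incl[OF relsI(2)[OF assms]] assms F_closed_add
  by (subst coset_eq_iff) (simp_all only: frag_of_F N.M.a_closed diff_diff_eq)

lemma tens_add_left:
  assumes "x \<in> carrier Q" "x' \<in> carrier Q" "y \<in> carrier N"
  shows "tens (x \<oplus>\<^bsub>Q\<^esub> x') y = tens x y \<oplus>\<^bsub>T\<^esub> tens x' y"
  unfolding tens_def T_add[OF frag_of_F[OF assms(1,3)] frag_of_F[OF assms(2,3)]]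
  using generate.incl[OF relsI(1)[OF assms]] assms F_closed_add
  by (subst coset_eq_iff) (simp_all only: frag_of_F Q.M.a_closed diff_diff_eq)

text \<open>
  Pure tensors generate the tensor product already as a group. So a submodule is everything as
  soon as a pure tensor in it yields all the others.
\<close>

lemma submodule_eq_carrier:
  assumes U: "submodule_of L T U" and tens: "\<And>x y. \<lbrakk>x \<in> carrier Q; y \<in> carrier N\<rbrakk> \<Longrightarrow> tens x y \<in> U"
  shows "U = carrier T"
proof -
  interpret T: right_module L T by (rule right_module_tensor)
  note D = T.submodule_ofD[OF U]
  have "K #>\<^bsub>F\<^esub> c \<in> U" if c: "c \<in> carrier F" for c
    using c
  proof (induction c rule: F_induct)
    case zero
    show ?case using D(2) T_zero T_zero_coset by simp
  next
    case (diff c d)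
    note F = diff(1,2) F_closed_diff[OF diff(1,2)]
    have cl: "K #>\<^bsub>F\<^esub> (c - d) \<in> carrier T" "K #>\<^bsub>F\<^esub> d \<in> carrier T" "K #>\<^bsub>F\<^esub> c \<in> carrier T"
      using F T_coset_closed by blast+
    have "(K #>\<^bsub>F\<^esub> (c - d)) \<oplus>\<^bsub>T\<^esub> (K #>\<^bsub>F\<^esub> d) = K #>\<^bsub>F\<^esub> c" using T_add[OF F(3,2)] by simp
    then have "K #>\<^bsub>F\<^esub> (c - d) = (K #>\<^bsub>F\<^esub> c) \<oplus>\<^bsub>T\<^esub> \<ominus>\<^bsub>T\<^esub> (K #>\<^bsub>F\<^esub> d)"
      using cl by (metis T.M.a_assoc T.M.r_neg T.M.r_zero T.M.a_inv_closed)
    then show ?case using diff(3,4) D(3,5) by simp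
  next
    case (pair x y)
    then show ?case using tens unfolding tens_def by blast
  qed
  then have "carrier T \<subseteq> U" unfolding T_carrier by auto
  then show ?thesis using D(1) by blast
qed

text \<open>
  A balanced map extends to the free abelian group on all pairs and vanishes on the relations,
  so a pure tensor on which it does not vanish is not zero.
\<close>

lemma tens_nonzero:
  assumes D: "abelian_group D"
    and f: "\<And>x y. \<lbrakk>x \<in> carrier Q; y \<in> carrier N\<rbrakk> \<Longrightarrow> f x y \<in> carrier D"
    and left: "\<And>x x' y. \<lbrakk>x \<in> carrier Q; x' \<in> carrier Q; y \<in> carrier N\<rbrakk> \<Longrightarrow> f (x \<oplus>\<^bsub>Q\<^esub> x') y = f x y \<oplus>\<^bsub>D\<^esub> f x' y"
    and right: "\<And>x y y'. \<lbrakk>x \<in> carrier Q; y \<in> carrier N; y' \<in> carrier N\<rbrakk> \<Longrightarrow> f x (y \<oplus>\<^bsub>N\<^esub> y') = f x y \<oplus>\<^bsub>D\<^esub> f x y'"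
    and bal: "\<And>x s y. \<lbrakk>x \<in> carrier Q; s \<in> carrier S; y \<in> carrier N\<rbrakk> \<Longrightarrow> f (ract Q x s) y = f x (lact N s y)"
    and xy: "x \<in> carrier Q" "y \<in> carrier N" "f x y \<noteq> \<zero>\<^bsub>D\<^esub>"
  shows "tens x y \<noteq> \<zero>\<^bsub>T\<^esub>"
proof
  assume 0: "tens x y = \<zero>\<^bsub>T\<^esub>"
  interpret D: abelian_group D by (rule D)
  have "(\<lambda>(x, y). f x y) ` (carrier Q \<times> carrier N) \<subseteq> carrier (add_monoid D)" using f by auto
  then obtain h where h: "h \<in> hom F (add_monoid D)"
      and hf: "\<And>xy. xy \<in> carrier Q \<times> carrier N \<Longrightarrow> h (frag_of xy) = (case xy of (x, y) \<Rightarrow> f x y)"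
    by (rule comm_group.free_Abelian_group_universal[OF D.a_comm_group]) blast
  have hof: "h (frag_of (x, y)) = f x y" if "x \<in> carrier Q" "y \<in> carrier N" for x y
    using hf[of "(x, y)"] that by simp
  have hcl: "h c \<in> carrier D" if "c \<in> carrier F" for c
    using funcset_mem[of h "carrier F" "carrier (add_monoid D)"] h that unfolding hom_def by simp
  have hadd: "h (c + d) = h c \<oplus>\<^bsub>D\<^esub> h d" if "c \<in> carrier F" "d \<in> carrier F" for c d
    using hom_mult[OF h that] by simp
  have hdiff: "h (c - d) \<oplus>\<^bsub>D\<^esub> h d = h c" if "c \<in> carrier F" "d \<in> carrier F" for c d
    using hadd[OF F_closed_diff[OF that] that(2)] by simp
  have h0: "h 0 = \<zero>\<^bsub>D\<^esub>"
    using hadd[of 0 0] hcl[of 0] D.add.l_cancel_one[of "h 0" "h 0"] by simp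
  have cancel: "a = \<zero>\<^bsub>D\<^esub>" if "a \<in> carrier D" "b \<in> carrier D" "a \<oplus>\<^bsub>D\<^esub> b = b" for a b
    using that D.add.r_cancel_one by metis
  have hrel: "h r = \<zero>\<^bsub>D\<^esub>" if "r \<in> rels" for r
    using that
  proof (cases rule: rels_cases)
    case (left x x' y)
    let ?a = "frag_of (x \<oplus>\<^bsub>Q\<^esub> x', y)" and ?b = "frag_of (x, y)" and ?c = "frag_of (x', y)"
    have F: "?a \<in> carrier F" "?b \<in> carrier F" "?c \<in> carrier F" using left by simp_all
    have r: "r = ?a - (?b + ?c)" using left(1) by (simp add: diff_diff_eq)
    have "h (?b + ?c) = h ?a"
      using hadd[OF F(2,3)] left by (simp add: hof assms(3))
    then show ?thesis unfolding r
      using hdiff[OF F(1) F_closed_add[OF F(2,3)]] hcl[OF F_closed_diff[OF F(1) F_closed_add[OF F(2,3)]]]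
        hcl[OF F(1)] cancel by metis
  next
    case (right x y y')
    let ?a = "frag_of (x, y \<oplus>\<^bsub>N\<^esub> y')" and ?b = "frag_of (x, y)" and ?c = "frag_of (x, y')"
    have F: "?a \<in> carrier F" "?b \<in> carrier F" "?c \<in> carrier F" using right by simp_all
    have r: "r = ?a - (?b + ?c)" using right(1) by (simp add: diff_diff_eq)
    have "h (?b + ?c) = h ?a"
      using hadd[OF F(2,3)] right by (simp add: hof assms(4))
    then show ?thesis unfolding r
      using hdiff[OF F(1) F_closed_add[OF F(2,3)]] hcl[OF F_closed_diff[OF F(1) F_closed_add[OF F(2,3)]]]
        hcl[OF F(1)] cancel by metis
  next
    case (balanced x s y)
    let ?a = "frag_of (ract Q x s, y)" and ?b = "frag_of (x, lact N s y)"
    have F: "?a \<in> carrier F" "?b \<in> carrier F"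
      using balanced by (simp_all add: Q.ract_closed lact_closed)
    have "h ?b = h ?a" using balanced by (simp add: hof bal Q.ract_closed lact_closed)
    then show ?thesis unfolding balanced(1)
      using hdiff[OF F] hcl[OF F_closed_diff[OF F]] hcl[OF F(1)] cancel by metis
  qed
  have hK: "h c = \<zero>\<^bsub>D\<^esub>" if "c \<in> K" for c
    using that
  proof (induction c rule: generate.induct)
    case one
    show ?case using h0 by simp
  next
    case (incl r)
    then show ?case by (rule hrel)
  next
    case (inv r)
    have rF: "r \<in> carrier F" using inv rels_F by blast
    then have i: "inv\<^bsub>F\<^esub> r = - r" by simp
    have z: "0 \<in> carrier F" by simp
    have "h (0 - r) \<oplus>\<^bsub>D\<^esub> h r = h 0" using hdiff[OF z rF] .
    then show ?case using hrel[OF inv] h0 hcl[OF F_closed_diff[OF z rF]] i by simp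
  next
    case (eng c d)
    have "c \<in> carrier F" "d \<in> carrier F" using eng.hyps K_F by blast+
    then show ?case using hadd[of c d] eng.IH by simp
  qed
  have "K #>\<^bsub>F\<^esub> frag_of (x, y) = K #>\<^bsub>F\<^esub> 0" using 0 unfolding tens_def T_zero using T_zero_coset by simp
  then have "frag_of (x, y) \<in> K" using coset_eq_iff[of "frag_of (x, y)" 0] xy by simp
  then have "h (frag_of (x, y)) = \<zero>\<^bsub>D\<^esub>" by (rule hK)
  then show False using hof xy by simp
qed

end

section \<open>The modules attached to a cycle\<close>

text \<open>All vertices on a path to \<open>v\<close> precede \<open>v\<close>.\<close>

lemma arrivals_restrict:
  assumes "fin_digraph G" "v \<in> verts G"
  shows "pre_digraph.arrivals (G \<restriction> predecessors G v) v = pre_digraph.arrivals G v"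
    and "pre_digraph.returns (G \<restriction> predecessors G v) v = pre_digraph.returns G v"
    and "predecessors (G \<restriction> predecessors G v) v = predecessors G v"
proof -
  interpret G: fin_digraph G by fact
  let ?W = "predecessors G v" and ?H = "G \<restriction> predecessors G v"
  have "induced_subgraph ?H G" using G.predecessors_subset by (rule G.induced_induce)
  then interpret H: fin_digraph ?H by (intro G.fin_digraph_subgraph) blast
  have src: "pre_digraph.path_source ?H v q = pre_digraph.path_source G v q" for q
    by (simp add: pre_digraph.path_source_def)
  have arc: "e \<in> arcs ?H \<longleftrightarrow> e \<in> arcs G" if "head G e \<in> ?W" for e
    using that G.predecessors_arc[of e v] by auto
  have "q \<in> pre_digraph.arrivals ?H v \<longleftrightarrow> q \<in> pre_digraph.arrivals G v" for q
  proof (induction q)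
    case Nil
    show ?case using assms(2) by simp
  next
    case (Cons e q)
    show ?case
      using arc[of e] G.path_source_predecessors[of q v]
      by (auto simp: H.Cons_arrivals_iff G.Cons_arrivals_iff Cons.IH src)
  qed
  then show arr: "pre_digraph.arrivals ?H v = pre_digraph.arrivals G v" by blast
  show "pre_digraph.returns ?H v = pre_digraph.returns G v"
  proof -
    have "e \<in> arcs ?H \<longleftrightarrow> e \<in> arcs G"
      if "q \<in> pre_digraph.arrivals G v" "pre_digraph.path_source G v q = head G e" for e q
      using arc[of e] G.path_source_predecessors[OF that(1)] that(2) by simp
    then show ?thesis
      unfolding pre_digraph.returns_def arr src induce_subgraph_tail induce_subgraph_head by blast
  qed
  show "predecessors ?H v = ?W"
    using G.predecessors_iff[of _ v] H.predecessors_iff[of _ v] unfolding arr src by blast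
qed

lemma cycle_at_restrict: "cycle_at (G \<restriction> W) C v = cycle_at G C v"
  by (simp add: cycle_at_def)

lemma laurent_ideal_submodule:
  assumes "cring S" "ideal \<mm> S"
  shows "right_module S (right_ideal_module S (\<lambda>f. f) \<one>\<^bsub>S\<^esub>)"
    and "carrier (right_ideal_module S (\<lambda>f. f) \<one>\<^bsub>S\<^esub>) = carrier S"
    and "submodule_of S (right_ideal_module S (\<lambda>f. f) \<one>\<^bsub>S\<^esub>) \<mm>"
proof -
  interpret S: cring S by fact
  interpret \<mm>: ideal \<mm> S by fact
  let ?M = "right_ideal_module S (\<lambda>f. f) \<one>\<^bsub>S\<^esub>"
  show mod: "right_module S ?M"
    by (rule right_module_right_ideal_module) (simp_all add: S.ring_axioms ring_hom_def)
  show car: "carrier ?M = carrier S" by (simp add: image_def)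
  interpret M: right_module S ?M by (rule mod)
  show "submodule_of S ?M \<mm>"
  proof (rule M.submodule_ofI)
    show "\<mm> \<subseteq> carrier ?M" unfolding car using \<mm>.Icarr by blast
  qed (simp_all add: \<mm>.I_r_closed)
qed

text \<open>
  On the subgraph \<open>H\<close> of the predecessors of \<open>v\<close> the cycle has no exit. The module is the tensor
  product of \<open>Q = A/\<mm>\<close> with \<open>N = v L(H)\<close>, where \<open>A\<close> is the ring of Laurent polynomials. Its
  generator will be \<open>x0\<close>, the tensor product of the class of \<open>1\<close> with \<open>v\<close>.
\<close>

locale cycle_setting = leavitt_algebra R G
  for R :: "('k, 'z) ring_scheme" and G :: "('v, 'e) pre_digraph" +
  fixes C :: "'e list set" and v :: 'v and \<mm> :: "(int \<Rightarrow> 'k) set"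
  assumes disj: "disjoint_cycles G" and C: "C \<in> cycles G" and vC: "v \<in> cycle_verts G C"
    and \<mm>: "maximalideal \<mm> (laurent R)"
begin

abbreviation "W \<equiv> predecessors G v"
abbreviation "H \<equiv> G \<restriction> W"
abbreviation "c \<equiv> cycle_at G C v"
abbreviation "LH \<equiv> leavitt R H"
abbreviation "vH \<equiv> lvertex R H v"
abbreviation "res \<equiv> leavitt_restrict R G W"
abbreviation "N \<equiv> cycle_bimodule R G C v"
abbreviation "Q \<equiv> quotient_module (right_ideal_module LP (\<lambda>f. f) \<one>\<^bsub>LP\<^esub>) \<mm>"
abbreviation "levH \<equiv> laurent_eval R H C v"

lemma ret_G: "pre_digraph.returns G v = {c}"
  by (rule G.returns_cycle[OF disj C vC])

lemma v_vert: "v \<in> verts G"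
  using ret_G by (auto simp: pre_digraph.returns_def)

lemma v_W: "v \<in> W" using v_vert by simp

lemma fin_H: "fin_digraph H"
proof -
  have "induced_subgraph H G" using G.predecessors_subset by (rule G.induced_induce)
  then show ?thesis by (intro G.fin_digraph_subgraph) blast
qed

interpretation LP: cring LP by (rule laurent_cring)
interpretation \<mm>: maximalideal \<mm> LP by (rule \<mm>)
interpretation H: fin_digraph H by (rule fin_H)
interpretation B: leavitt_algebra R H by unfold_locales

lemmas restrict = arrivals_restrict[OF G.fin_digraph_axioms v_vert]

lemma ret_H: "pre_digraph.returns H v = {cycle_at H C v}"
  unfolding restrict(2) ret_G cycle_at_restrict ..

lemma hom_restrict:
  "leavitt_hom R G R H (\<lambda>x. if x \<in> leavitt_gens H then Gen x else Zero) (\<lambda>a. a)"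
proof (rule leavitt_hom_restrict)
  show "W \<subseteq> verts G" by (rule G.predecessors_subset)
  show "tail G e \<in> W" if "e \<in> arcs G" "head G e \<in> W" for e using that by (rule G.predecessors_arc)
  show "\<exists>e\<in>out_arcs G u. head G e \<in> W" if u: "u \<in> W" for u
  proof -
    obtain q where q: "q \<in> pre_digraph.arrivals G v" "pre_digraph.path_source G v q = u"
      using u by (auto simp: G.predecessors_iff)
    show ?thesis
    proof (cases q)
      case Nil
      obtain e r where "e \<in> arcs G" "tail G e = v" "r \<in> pre_digraph.arrivals G v"
          "pre_digraph.path_source G v r = head G e"
        using ret_G by (auto simp: pre_digraph.returns_def)
      then show ?thesis using q(2) Nil G.path_source_predecessors[of r v] by (intro bexI[of _ e]) auto
    next
      case (Cons e r)
      then have "e \<in> arcs G" "r \<in> pre_digraph.arrivals G v" "pre_digraph.path_source G v r = head G e"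
        using q(1) by (simp_all add: G.Cons_arrivals_iff)
      then show ?thesis using q(2) Cons G.path_source_predecessors[of r v] by (intro bexI[of _ e]) auto
    qed
  qed
qed

interpretation h: leavitt_hom R G R H "\<lambda>x. if x \<in> leavitt_gens H then Gen x else Zero" "\<lambda>a. a"
  by (rule hom_restrict)
interpretation LG: ring L by (rule L_ring)
interpretation LH: ring LH by (rule B.L_ring)

lemma lmap_res: "h.lmap = res"
  by (rule ext) (simp add: h.lmap_def leavitt_restrict_def)

lemmas res_closed = h.lmap_closed[unfolded lmap_res]
  and res_add = h.lmap_add[unfolded lmap_res]
  and res_mult = h.lmap_mult[unfolded lmap_res]
  and res_smult = h.lmap_smult[unfolded lmap_res]
  and res_one = h.lmap_one[unfolded lmap_res]
  and res_hom = h.lmap_ring_hom[unfolded lmap_res]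

lemma res_gen: "x \<in> leavitt_gens G \<Longrightarrow> res (gn x) = (if x \<in> leavitt_gens H then B.gn x else \<zero>\<^bsub>LH\<^esub>)"
  using h.lmap_gen[of x] by (simp add: lmap_res B.L_zero)

lemma res_vertex: "u \<in> verts G \<Longrightarrow> res (lvertex R G u) = (if u \<in> W then lvertex R H u else \<zero>\<^bsub>LH\<^esub>)"
  using res_gen[of "Vertex u"] by (simp add: lvertex_def)

lemma res_surj: "y \<in> carrier LH \<Longrightarrow> \<exists>x\<in>carrier L. res x = y"
  unfolding lmap_res[symmetric]
proof (rule h.lmap_surj)
  fix y assume y: "y \<in> leavitt_gens H"
  then have "y \<in> leavitt_gens G" using G.predecessors_subset[of v] by (cases y) auto
  then show "\<exists>x\<in>leavitt_gens G. B.cls (if x \<in> leavitt_gens H then Gen x else Zero) = B.gn y"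
    using y by (intro bexI[of _ y]) simp_all
qed simp_all

lemma c_arcs: "set c \<subseteq> arcs G" "set c \<subseteq> arcs H"
proof -
  have "c \<in> pre_digraph.returns G v" "c \<in> pre_digraph.returns H v"
    using ret_G ret_H by (simp_all add: cycle_at_restrict)
  then show "set c \<subseteq> arcs G" "set c \<subseteq> arcs H"
    using G.arrivals_arcs[of _ v] H.arrivals_arcs[of _ v] unfolding pre_digraph.returns_def by fastforce+
qed

lemma vH_closed: "vH \<in> carrier LH" using v_W by simp

lemma vH_idem: "vH \<otimes>\<^bsub>LH\<^esub> vH = vH" using B.vertex_mult[of v v] v_W by simp

lemma res_pow: "x \<in> carrier L \<Longrightarrow> res (x [^]\<^bsub>L\<^esub> (n::nat)) = res x [^]\<^bsub>LH\<^esub> n"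
  by (induction n) (simp_all add: res_one res_mult)

lemma res_foldr:
  "set as \<subseteq> carrier L \<Longrightarrow> res (foldr (monoid.mult L) as \<one>\<^bsub>L\<^esub>) = foldr (monoid.mult LH) (map res as) \<one>\<^bsub>LH\<^esub>"
proof (induction as)
  case (Cons a as)
  then have "foldr (monoid.mult L) as \<one>\<^bsub>L\<^esub> \<in> carrier L" by (intro foldr_mult_closed) auto
  then show ?case using Cons by (simp add: res_mult)
qed (simp add: res_one)

lemma res_cycle_power: "res (cycle_power R G C v i) = cycle_power R H C v i"
proof -
  have arcs: "e \<in> arcs G" "e \<in> arcs H" if "e \<in> set c" for e using that c_arcs by blast+
  have p: "res (lpath R G c) = lpath R H c"
  proof -
    have "map res (map (\<lambda>e. gn (Arrow e)) c) = map (\<lambda>e. B.gn (Arrow e)) c"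
      using arcs res_gen B.gens_iff(2) gens_iff(2) by auto
    moreover have "set (map (\<lambda>e. gn (Arrow e)) c) \<subseteq> carrier L" using arcs by auto
    ultimately show ?thesis unfolding lpath_def by (simp only: res_foldr)
  qed
  have g: "res (lghost_path R G c) = lghost_path R H c"
  proof -
    have "map res (map (\<lambda>e. gn (Ghost e)) (rev c)) = map (\<lambda>e. B.gn (Ghost e)) (rev c)"
      using arcs res_gen B.gens_iff(3) gens_iff(3) by auto
    moreover have "set (map (\<lambda>e. gn (Ghost e)) (rev c)) \<subseteq> carrier L" using arcs by auto
    ultimately show ?thesis unfolding lghost_path_def by (simp only: res_foldr)
  qed
  have cl: "lpath R G c \<in> carrier L" "lghost_path R G c \<in> carrier L"
    using arcs unfolding lpath_def lghost_path_def by (intro foldr_mult_closed; auto)+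
  have v': "res (lvertex R G v) = vH" using res_vertex[OF v_vert] v_W by simp
  show ?thesis
    unfolding cycle_power_def cycle_at_restrict
    using cl v_vert by (simp add: res_mult res_pow p g v' del: pow_nat)
qed

lemma cpG_closed: "cycle_power R G C v i \<in> carrier L"
  by (rule cycle_power_closed[OF v_vert c_arcs(1)])

lemma cH_arcs: "set (cycle_at H C v) \<subseteq> arcs H" using c_arcs(2) by (simp only: cycle_at_restrict)

lemma v_H: "v \<in> verts H" using v_W by simp

lemma cpH_closed: "cycle_power R H C v i \<in> carrier LH"
  by (rule B.cycle_power_closed[OF v_H cH_arcs])

lemma levH_closed: "f \<in> carrier LP \<Longrightarrow> levH f \<in> carrier LH"
  by (rule B.laurent_eval_closed[OF v_H cH_arcs])

lemma res_lev:
  assumes f: "f \<in> carrier LP" shows "res (laurent_eval R G C v f) = levH f"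
proof -
  have "res (laurent_eval R G C v f) = finsum LH (\<lambda>i. res (f i \<odot>\<^bsub>L\<^esub> cycle_power R G C v i)) {i. f i \<noteq> \<zero>\<^bsub>R\<^esub>}"
    unfolding laurent_eval_def
    by (rule additive_finsum)
      (use f in \<open>simp_all add: L_abelian_group B.L_abelian_group res_closed res_add laurent_finite_supp
        smult_closed cpG_closed\<close>)
  also have "\<dots> = levH f"
    unfolding laurent_eval_def
    by (rule LH.finsum_cong')
      (use f in \<open>simp_all add: res_smult cpG_closed res_cycle_power B.smult_closed cpH_closed\<close>)
  finally show ?thesis .
qed

lemma vH_lev: "f \<in> carrier LP \<Longrightarrow> vH \<otimes>\<^bsub>LH\<^esub> levH f = levH f"
proof (induction f rule: laurent_induct)
  case zero
  show ?case using vH_closed by (simp add: B.laurent_eval_zero[OF v_H cH_arcs])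
next
  case (mono a k)
  have "vH \<otimes>\<^bsub>LH\<^esub> cycle_power R H C v k = cycle_power R H C v k"
  proof -
    have "cycle_power R H C v k = vH \<otimes>\<^bsub>LH\<^esub> cycle_power R H C v k"
    proof -
      have "lpath R H (cycle_at H C v) \<in> carrier LH" "lghost_path R H (cycle_at H C v) \<in> carrier LH"
        using cH_arcs unfolding lpath_def lghost_path_def by (intro B.foldr_mult_closed; auto)+
      then show ?thesis
        unfolding cycle_power_def using vH_closed
        by (simp add: LH.m_assoc[symmetric] vH_idem del: pow_nat)
    qed
    then show ?thesis by (rule HOL.sym)
  qed
  then show ?case using mono vH_closed cpH_closed
    by (simp add: B.laurent_eval_lmono[OF v_H cH_arcs] B.smult_assoc3)
next
  case (add f g)
  then show ?case using vH_closed levH_closed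
    by (simp add: B.laurent_eval_add[OF v_H cH_arcs] LH.r_distr)
qed

text \<open>
  Unlike \<open>vH_lev\<close> this is not built into the powers of the cycle. It holds because Laurent
  polynomials map the corner of the module \<open>v L(H)\<close> to itself.
\<close>

lemma lev_vH: assumes f: "f \<in> carrier LP" shows "levH f \<otimes>\<^bsub>LH\<^esub> vH = levH f"
proof -
  let ?V = "right_ideal_module LH (\<lambda>a. a) vH"
  have "right_module LH ?V"
    by (rule right_module_right_ideal_module) (simp_all add: B.L_ring ring_hom_def vH_closed)
  then interpret V: leavitt_corner R H ?V v
    by (rule leavitt_cornerI[OF B.leavitt_algebra_axioms _ v_H])
  have "V.supported" using restrict(3) by (simp add: V.supported_def)
  then interpret V: cycle_corner R H ?V v C
    by unfold_locales (rule ret_H, rule V.supported_tame)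
  have "vH \<in> carrier ?V" using vH_idem vH_closed by simp (metis imageI)
  then have "vH \<in> V.corner" using vH_idem by (simp add: V.corner_def)
  from V.act_lev_corner[OF this f] show ?thesis
    using vH_lev[OF f] by (simp add: V.corner_def)
qed

subsection \<open>The tensor product\<close>

lemma N_simps:
  "carrier N = (\<lambda>x. vH \<otimes>\<^bsub>LH\<^esub> x) ` carrier LH" "\<zero>\<^bsub>N\<^esub> = \<zero>\<^bsub>LH\<^esub>" "add N = add LH"
  "ract N = (\<lambda>x a. x \<otimes>\<^bsub>LH\<^esub> res a)" "lact N = (\<lambda>f x. levH f \<otimes>\<^bsub>LH\<^esub> x)"
  by (simp_all add: cycle_bimodule_def Let_def rmodule.extend_def bimodule.fields_def
      right_ideal_module_def)

lemma right_module_N: "right_module L N"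
proof (rule right_module_cong)
  show "right_module L (right_ideal_module LH res vH)"
    by (rule right_module_right_ideal_module) (simp_all add: L_ring B.L_ring res_hom vH_closed)
qed (simp_all add: N_simps right_ideal_module_def)

lemma N_closed: "y \<in> carrier N \<Longrightarrow> y \<in> carrier LH"
  using vH_closed by (auto simp: N_simps(1))

lemma N_I: "\<lbrakk>y \<in> carrier LH; vH \<otimes>\<^bsub>LH\<^esub> y = y\<rbrakk> \<Longrightarrow> y \<in> carrier N"
  unfolding N_simps(1) by (metis imageI)

lemma vH_N: "vH \<in> carrier N" using vH_closed vH_idem by (rule N_I)

lemmas Q_ideal = laurent_ideal_submodule[OF laurent_cring \<mm>.ideal_axioms]
lemmas Q_facts = right_module.right_module_quotient_module[OF Q_ideal(1) Q_ideal(3), unfolded Q_ideal(2)]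

abbreviation "coset f \<equiv> \<mm> +>\<^bsub>right_ideal_module LP (\<lambda>f. f) \<one>\<^bsub>LP\<^esub>\<^esub> f"

lemma coset_ract: "\<lbrakk>f \<in> carrier LP; g \<in> carrier LP\<rbrakk> \<Longrightarrow> ract Q (coset f) g = coset (f \<otimes>\<^bsub>LP\<^esub> g)"
  using Q_facts(2)[of f g] by simp

lemma coset_zero: "f \<in> \<mm> \<Longrightarrow> coset f = \<zero>\<^bsub>Q\<^esub>"
  using Q_facts(5) Q_facts(6)[OF \<mm>.Icarr] by simp

lemma coset_one_nonzero: "coset \<one>\<^bsub>LP\<^esub> \<noteq> \<zero>\<^bsub>Q\<^esub>"
proof -
  have "\<one>\<^bsub>LP\<^esub> \<notin> \<mm>" using \<mm>.one_imp_carrier \<mm>.I_notcarr by metis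
  then show ?thesis using Q_facts(5) Q_facts(6)[OF LP.one_closed] by simp
qed

lemma coset_closed: "f \<in> carrier LP \<Longrightarrow> coset f \<in> carrier Q"
  unfolding Q_facts(4) by (rule imageI)

sublocale tensor_product LP Q L N
proof -
  interpret N: right_module L N by (rule right_module_N)
  interpret Q: right_module LP Q by (rule Q_facts(1))
  show "tensor_product LP Q L N"
  proof
    show "lact N s y \<in> carrier N" if "s \<in> carrier LP" "y \<in> carrier N" for s y
      using that levH_closed[OF that(1)] N_closed[OF that(2)] vH_lev[OF that(1)] vH_closed
      by (intro N_I) (simp_all add: N_simps(5) LH.m_assoc[symmetric])
    show "lact N s (ract N y a) = ract N (lact N s y) a"
      if "s \<in> carrier LP" "y \<in> carrier N" "a \<in> carrier L" for s y a
      using that levH_closed[OF that(1)] N_closed[OF that(2)] res_closed[OF that(3)]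
      by (simp add: N_simps(4,5) LH.m_assoc)
  qed
qed

lemma T_eq: "cycle_module R G \<mm> C v = T"
  by (simp add: cycle_module_def)

abbreviation "x0 \<equiv> tens (coset \<one>\<^bsub>LP\<^esub>) vH"

lemma x0_T: "x0 \<in> carrier T"
  by (rule tens_closed[OF coset_closed[OF LP.one_closed] vH_N])

lemma tens_zero_left: assumes "y \<in> carrier N" shows "tens \<zero>\<^bsub>Q\<^esub> y = \<zero>\<^bsub>T\<^esub>"
proof -
  interpret T: right_module L T by (rule right_module_tensor)
  have "tens \<zero>\<^bsub>Q\<^esub> y = tens \<zero>\<^bsub>Q\<^esub> y \<oplus>\<^bsub>T\<^esub> tens \<zero>\<^bsub>Q\<^esub> y"
    using tens_add_left[of "\<zero>\<^bsub>Q\<^esub>" "\<zero>\<^bsub>Q\<^esub>" y] assms by simp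
  then show ?thesis using tens_closed[of "\<zero>\<^bsub>Q\<^esub>" y] assms T.M.add.l_cancel_one' by simp
qed

lemma tens_zero_right: assumes "x \<in> carrier Q" shows "tens x \<zero>\<^bsub>N\<^esub> = \<zero>\<^bsub>T\<^esub>"
proof -
  interpret T: right_module L T by (rule right_module_tensor)
  have "tens x \<zero>\<^bsub>N\<^esub> = tens x \<zero>\<^bsub>N\<^esub> \<oplus>\<^bsub>T\<^esub> tens x \<zero>\<^bsub>N\<^esub>"
    using tens_add_right[of x "\<zero>\<^bsub>N\<^esub>" "\<zero>\<^bsub>N\<^esub>"] assms by simp
  then show ?thesis using tens_closed[of x "\<zero>\<^bsub>N\<^esub>"] assms T.M.add.l_cancel_one' by simp
qed

lemma x0_ract: "a \<in> carrier L \<Longrightarrow> ract T x0 a = tens (coset \<one>\<^bsub>LP\<^esub>) (vH \<otimes>\<^bsub>LH\<^esub> res a)"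
  using tens_ract[OF coset_closed[OF LP.one_closed] vH_N] by (simp add: N_simps(4))

lemma tens_eq_x0_ract:
  assumes X: "X \<in> carrier Q" and y: "y \<in> carrier N"
  shows "\<exists>a\<in>carrier L. tens X y = ract T x0 a"
proof -
  obtain f where f: "f \<in> carrier LP" "X = coset f" using X unfolding Q_facts(4) by blast
  have "X = ract Q (coset \<one>\<^bsub>LP\<^esub>) f" using f coset_ract[of "\<one>\<^bsub>LP\<^esub>" f] by simp
  then have eq: "tens X y = tens (coset \<one>\<^bsub>LP\<^esub>) (lact N f y)"
    using tens_balanced[OF coset_closed[OF LP.one_closed] f(1) y] by simp
  have "lact N f y \<in> carrier N" using f(1) y by (rule lact_closed)
  then obtain z where z: "z \<in> carrier LH" "lact N f y = vH \<otimes>\<^bsub>LH\<^esub> z" unfolding N_simps(1) by blast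
  obtain a where "a \<in> carrier L" "res a = z" using res_surj[OF z(1)] by blast
  then show ?thesis using eq z x0_ract by (intro bexI[of _ a]) simp_all
qed

lemma T_generated: "y \<in> carrier T \<Longrightarrow> \<exists>a\<in>carrier L. y = ract T x0 a"
proof -
  interpret T: right_module L T by (rule right_module_tensor)
  have "ract T x0 ` carrier L = carrier T"
  proof (rule submodule_eq_carrier[OF T.cyclic_submodule[OF x0_T]])
    show "tens X y \<in> ract T x0 ` carrier L" if "X \<in> carrier Q" "y \<in> carrier N" for X y
      using tens_eq_x0_ract[OF that] by blast
  qed
  then show "y \<in> carrier T \<Longrightarrow> \<exists>a\<in>carrier L. y = ract T x0 a" by blast
qed

lemma T_corner: "leavitt_corner R G T v"
  by (rule leavitt_cornerI[OF leavitt_algebra_axioms right_module_tensor v_vert])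

interpretation T: leavitt_corner R G T v by (rule T_corner)

lemma T_supported: T.supported
  unfolding T.supported_def
proof (intro ballI)
  fix y u assume y: "y \<in> carrier T" and u: "u \<in> verts G - W"
  obtain a where a: "a \<in> carrier L" "y = ract T x0 a" using T_generated[OF y] by blast
  have aN: "vH \<otimes>\<^bsub>LH\<^esub> res a \<in> carrier N" unfolding N_simps(1) using res_closed[OF a(1)] by (rule imageI)
  have "ract T y (lvertex R G u) = tens (coset \<one>\<^bsub>LP\<^esub>) (ract N (vH \<otimes>\<^bsub>LH\<^esub> res a) (lvertex R G u))"
    using a u aN by (simp add: x0_ract tens_ract coset_closed)
  also have "ract N (vH \<otimes>\<^bsub>LH\<^esub> res a) (lvertex R G u) = \<zero>\<^bsub>N\<^esub>"
    using u N_closed[OF aN] by (simp add: N_simps res_vertex)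
  finally show "ract T y (lvertex R G u) = \<zero>\<^bsub>T\<^esub>" by (simp add: tens_zero_right coset_closed)
qed

text \<open>
  A Laurent polynomial that acts on the generator moves across the tensor sign to the class of
  \<open>1\<close>.
\<close>

lemma T_act_ideal: assumes f: "f \<in> \<mm>" shows "ract T x0 (laurent_eval R G C v f) = \<zero>\<^bsub>T\<^esub>"
proof -
  have fL: "f \<in> carrier LP" using f by (rule \<mm>.Icarr)
  have "laurent_eval R G C v f \<in> carrier L" by (rule laurent_eval_closed[OF v_vert c_arcs(1) fL])
  then have "ract T x0 (laurent_eval R G C v f) = tens (coset \<one>\<^bsub>LP\<^esub>) (lact N f vH)"
    by (simp add: x0_ract res_lev[OF fL] vH_lev[OF fL] N_simps(5) lev_vH[OF fL])
  also have "\<dots> = tens (coset f) vH"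
    using tens_balanced[OF coset_closed[OF LP.one_closed] fL vH_N] coset_ract[OF LP.one_closed fL] fL by simp
  finally show ?thesis using coset_zero[OF f] tens_zero_left[OF vH_N] by simp
qed

text \<open>
  By \<open>tens_nonzero\<close> a balanced map is needed. It sends \<open>X\<close> and \<open>y\<close> to \<open>\<delta>\<^sub>X y\<close> in the path model over \<open>H\<close>
  with coefficients in \<open>Q\<close>, where a turn around the cycle multiplies coefficients by the
  variable. Here \<open>\<delta>\<^sub>X\<close> is the family with value \<open>X\<close> at the empty path. The map is balanced because
  \<open>\<delta>\<^sub>X f = \<delta>\<^bsub>X f\<^esub>\<close> for all Laurent polynomials \<open>f\<close>.
\<close>

lemma x0_nonzero: "x0 \<noteq> \<zero>\<^bsub>T\<^esub>"
proof -
  let ?x = "lmono \<one>\<^bsub>R\<^esub> 1" and ?x' = "lmono \<one>\<^bsub>R\<^esub> (- 1)"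
  have xx: "?x \<otimes>\<^bsub>LP\<^esub> ?x' = \<one>\<^bsub>LP\<^esub>" "?x' \<otimes>\<^bsub>LP\<^esub> ?x = \<one>\<^bsub>LP\<^esub>" by (simp_all add: lmono_lmono laurent_one)
  have lmono_add: "lmono (a \<oplus>\<^bsub>R\<^esub> b) k = lmono a k \<oplus>\<^bsub>LP\<^esub> lmono b k" if "a \<in> carrier R" "b \<in> carrier R" for a b k
    using that by (auto simp: lmono_def laurent_simps)
  have comm: "ract Q (ract Q X f) g = ract Q (ract Q X g) f"
    if "X \<in> carrier Q" "f \<in> carrier LP" "g \<in> carrier LP" for X f g
    using that by (simp add: Q.ract_assoc[symmetric] LP.m_comm)
  interpret D: path_model R H Q v "cycle_at H C v" "\<lambda>a X. ract Q X (lmono a 0)"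
    "\<lambda>X. ract Q X ?x" "\<lambda>X. ract Q X ?x'"
  proof unfold_locales
    show "v \<in> verts H" by (rule v_H)
    show "pre_digraph.returns H v \<subseteq> {cycle_at H C v}" using ret_H by simp
    show "out_arcs H v = {} \<or> cycle_at H C v \<in> pre_digraph.returns H v" using ret_H by simp
    show "ract Q X (lmono (a \<otimes>\<^bsub>R\<^esub> a') 0) = ract Q (ract Q X (lmono a' 0)) (lmono a 0)"
      if "a \<in> carrier R" "a' \<in> carrier R" "X \<in> carrier Q" for a a' X
      using that Q.ract_assoc[of X "lmono a' 0" "lmono a 0"] by (simp add: lmono_lmono m_comm)
    show "ract Q X (lmono \<one>\<^bsub>R\<^esub> 0) = X" if "X \<in> carrier Q" for X
      using Q.ract_one[OF that] by (simp add: laurent_one)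
    show "ract Q (ract Q X ?x') ?x = X" "ract Q (ract Q X ?x) ?x' = X" if "X \<in> carrier Q" for X
      using that by (simp_all add: Q.ract_assoc[symmetric] xx Q.ract_one)
  qed (simp_all add: Q.ract_closed Q.ract_l_distr Q.ract_r_distr lmono_add comm)
  interpret Dc: cycle_corner R H D.path_module v C
    by unfold_locales (rule ret_H, rule D.mod.supported_tame[OF D.path_module_supported])
  have cr: "cycle_at H C v \<in> pre_digraph.returns H v" using ret_H by simp
  have cp: "ract D.path_module (D.delta X) (cycle_power R H C v k) = D.delta (ract Q X (lmono \<one>\<^bsub>R\<^esub> k))"
    if X: "X \<in> carrier Q" for X k
  proof -
    note d = D.delta_corner[OF X]
    show ?thesis
    proof (induction k rule: int_induct[where k = 0])
      case base
      show ?case using Dc.act_cp[OF d, of 0] Q.ract_one[OF X] by (simp add: laurent_one)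
    next
      case (step1 k)
      have "ract Q (ract Q X (lmono \<one>\<^bsub>R\<^esub> k)) ?x = ract Q X (lmono \<one>\<^bsub>R\<^esub> (k + 1))"
        using X by (simp add: Q.ract_assoc[symmetric] lmono_lmono)
      then show ?case
        using Dc.act_cp_succ[OF d, of k] step1 D.gact_return_delta[OF cr, of "ract Q X (lmono \<one>\<^bsub>R\<^esub> k)"] X
        by (simp add: Q.ract_closed)
    next
      case (step2 k)
      have "ract Q (ract Q X (lmono \<one>\<^bsub>R\<^esub> k)) ?x' = ract Q X (lmono \<one>\<^bsub>R\<^esub> (k - 1))"
        using X by (simp add: Q.ract_assoc[symmetric] lmono_lmono)
      then show ?case
        using Dc.act_cp_pred[OF d, of k] step2 D.pact_return_delta[OF cr, of "ract Q X (lmono \<one>\<^bsub>R\<^esub> k)"] X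
        by (simp add: Q.ract_closed)
    qed
  qed
  have delta_add: "D.delta (X \<oplus>\<^bsub>Q\<^esub> Y) = D.delta X \<oplus>\<^bsub>D.path_module\<^esub> D.delta Y"
    if "X \<in> carrier Q" "Y \<in> carrier Q" for X Y
    using that by (simp add: D.families_simps D.delta_def fun_eq_iff)
  have lev: "ract D.path_module (D.delta X) (levH f) = D.delta (ract Q X f)"
    if X: "X \<in> carrier Q" and f: "f \<in> carrier LP" for X f
    using f
  proof (induction f rule: laurent_induct)
    case zero
    have "D.delta \<zero>\<^bsub>Q\<^esub> = \<zero>\<^bsub>D.path_module\<^esub>" by (simp add: D.families_simps D.delta_def fun_eq_iff)
    then show ?case
      using Dc.act_lev_zero[OF D.delta_corner[OF X]] Q.ract_zero_right[OF X] by simp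
  next
    case (add f g)
    then show ?case
      using X Dc.act_lev_add[OF D.delta_corner[OF X]] by (simp add: Q.ract_r_distr delta_add Q.ract_closed)
  next
    case (mono a k)
    have "ract D.path_module (D.delta X) (levH (lmono a k)) =
        D.sop a (D.delta (ract Q X (lmono \<one>\<^bsub>R\<^esub> k)))"
      using Dc.act_lev_lmono[OF D.delta_corner[OF X] mono, of k] mono X
      by (simp add: cp D.act_sc D.delta_in_families Q.ract_closed)
    also have "\<dots> = D.delta (ract Q (ract Q X (lmono \<one>\<^bsub>R\<^esub> k)) (lmono a 0))"
      using mono by (simp add: D.sop_def D.delta_def fun_eq_iff D.sB_zero Q.ract_zero_left)
    also have "\<dots> = D.delta (ract Q X (lmono a k))"
      using X mono by (simp add: Q.ract_assoc[symmetric] lmono_lmono)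
    finally show ?case .
  qed
  show ?thesis
  proof (rule tens_nonzero[where D = D.path_module and f = "\<lambda>X y. ract D.path_module (D.delta X) y"])
    show "abelian_group D.path_module" by (rule right_module.axioms(2)[OF D.rep.right_module_rep])
    have dP: "D.delta X \<in> carrier D.path_module" if "X \<in> carrier Q" for X
      using D.delta_in_families[OF that] by simp
    show "ract D.path_module (D.delta X) y \<in> carrier D.path_module" if "X \<in> carrier Q" "y \<in> carrier N" for X y
      using dP[OF that(1)] N_closed[OF that(2)] by (rule D.mod.M.ract_closed)
    show "ract D.path_module (D.delta (X \<oplus>\<^bsub>Q\<^esub> X')) y =
        ract D.path_module (D.delta X) y \<oplus>\<^bsub>D.path_module\<^esub> ract D.path_module (D.delta X') y"
      if "X \<in> carrier Q" "X' \<in> carrier Q" "y \<in> carrier N" for X X' y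
      unfolding delta_add[OF that(1,2)] using dP that N_closed by (intro D.mod.M.ract_l_distr) simp_all
    show "ract D.path_module (D.delta X) (y \<oplus>\<^bsub>N\<^esub> y') =
        ract D.path_module (D.delta X) y \<oplus>\<^bsub>D.path_module\<^esub> ract D.path_module (D.delta X) y'"
      if "X \<in> carrier Q" "y \<in> carrier N" "y' \<in> carrier N" for X y y'
      unfolding N_simps(3) using dP[OF that(1)] N_closed[OF that(2)] N_closed[OF that(3)]
      by (rule D.mod.M.ract_r_distr)
    show "ract D.path_module (D.delta (ract Q X s)) y = ract D.path_module (D.delta X) (lact N s y)"
      if "X \<in> carrier Q" "s \<in> carrier LP" "y \<in> carrier N" for X s y
      using D.mod.M.ract_assoc[OF dP[OF that(1)] levH_closed[OF that(2)] N_closed[OF that(3)]] lev[OF that(1,2)]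
      by (simp add: N_simps(5))
    show "ract D.path_module (D.delta (coset \<one>\<^bsub>LP\<^esub>)) vH \<noteq> \<zero>\<^bsub>D.path_module\<^esub>"
    proof -
      note d = D.delta_corner[OF coset_closed[OF LP.one_closed]]
      have "D.delta (coset \<one>\<^bsub>LP\<^esub>) [] \<noteq> \<zero>\<^bsub>Q\<^esub>" using coset_one_nonzero by (simp add: D.delta_def)
      then have "D.delta (coset \<one>\<^bsub>LP\<^esub>) \<noteq> \<zero>\<^bsub>D.path_module\<^esub>" by (auto simp: D.families_simps)
      then show ?thesis using D.mod.cornerD(2)[OF d] by simp
    qed
  qed (simp_all add: coset_closed vH_N)
qed

lemma cycle_module_corner: "leavitt_corner R G (cycle_module R G \<mm> C v) v"
  unfolding T_eq by (rule T_corner)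

lemma cycle_module_tame: "leavitt_corner.tame R G (cycle_module R G \<mm> C v) v"
  unfolding T_eq by (rule T.supported_tame[OF T_supported])

lemma cycle_module_based:
  "\<exists>x. leavitt_corner.based R G (cycle_module R G \<mm> C v) v (laurent_eval R G C v) \<mm> x"
proof -
  have "T.based (laurent_eval R G C v) \<mm> x0"
    unfolding T.based_def
  proof (intro conjI ballI)
    show "x0 \<in> T.corner"
      using x0_T v_vert v_W by (simp add: T.corner_def x0_ract res_vertex vH_idem)
    show "x0 \<noteq> \<zero>\<^bsub>T\<^esub>" by (rule x0_nonzero)
    show "\<exists>a\<in>carrier L. y = ract T x0 a" if "y \<in> carrier T" for y using that by (rule T_generated)
    show "ract T x0 (laurent_eval R G C v f) = \<zero>\<^bsub>T\<^esub>" if "f \<in> \<mm>" for f using that by (rule T_act_ideal)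
  qed
  then show ?thesis unfolding T_eq by blast
qed

end

section \<open>The correspondences\<close>

text \<open>
  The modules \<open>X i\<close> need not belong to \<open>\<S>\<close>, not even by type; a copy of \<open>X i\<close> in \<open>\<S>\<close> represents its
  class.
\<close>

lemma bij_betw_iso_classes:
  assumes mod: "\<And>N. N \<in> \<S> \<Longrightarrow> right_module A N"
    and X: "\<And>i. i \<in> P \<Longrightarrow> right_module A (X i)"
    and copy: "\<And>i. i \<in> P \<Longrightarrow> \<exists>N\<in>\<S>. rmodule_iso A N (X i)"
    and surj: "\<And>N. N \<in> \<S> \<Longrightarrow> \<exists>i\<in>P. rmodule_iso A N (X i)"
    and inj: "\<And>i j. \<lbrakk>i \<in> P; j \<in> P; rmodule_iso A (X i) (X j)\<rbrakk> \<Longrightarrow> i = j"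
  shows "bij_betw (\<lambda>i. {N \<in> \<S>. rmodule_iso A N (X i)}) P (\<S> // iso_rel A \<S>)"
proof -
  have cls: "iso_rel A \<S> `` {N} = {N' \<in> \<S>. rmodule_iso A N' (X i)}"
    if N: "N \<in> \<S>" "i \<in> P" "rmodule_iso A N (X i)" for N i
  proof -
    have "rmodule_iso A N N' \<longleftrightarrow> rmodule_iso A N' (X i)" if N': "N' \<in> \<S>" for N'
    proof
      assume "rmodule_iso A N N'"
      then show "rmodule_iso A N' (X i)"
        using rmodule_iso_sym[OF mod[OF N(1)]] rmodule_iso_trans N(3) by meson
    next
      assume "rmodule_iso A N' (X i)"
      then show "rmodule_iso A N N'"
        using rmodule_iso_sym[OF mod[OF N']] rmodule_iso_trans N(3) by meson
    qed
    then show ?thesis using N(1) by (auto simp: iso_rel_def)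
  qed
  show ?thesis
    unfolding bij_betw_def
  proof (intro conjI inj_onI)
    fix i j assume ij: "i \<in> P" "j \<in> P" and eq: "{N \<in> \<S>. rmodule_iso A N (X i)} = {N \<in> \<S>. rmodule_iso A N (X j)}"
    obtain N where N: "N \<in> \<S>" "rmodule_iso A N (X i)" using copy[OF ij(1)] by blast
    then have "rmodule_iso A N (X j)" using eq by blast
    then have "rmodule_iso A (X i) (X j)"
      using rmodule_iso_sym[OF mod[OF N(1)] N(2)] rmodule_iso_trans by meson
    then show "i = j" using inj ij by blast
  next
    show "(\<lambda>i. {N \<in> \<S>. rmodule_iso A N (X i)}) ` P = \<S> // iso_rel A \<S>"
    proof (intro subset_antisym subsetI)
      fix Y assume "Y \<in> (\<lambda>i. {N \<in> \<S>. rmodule_iso A N (X i)}) ` P"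
      then obtain i where i: "i \<in> P" "Y = {N \<in> \<S>. rmodule_iso A N (X i)}" by blast
      obtain N where N: "N \<in> \<S>" "rmodule_iso A N (X i)" using copy[OF i(1)] by blast
      show "Y \<in> \<S> // iso_rel A \<S>"
        unfolding i(2) cls[OF N(1) i(1) N(2), symmetric] by (rule quotientI[OF N(1)])
    next
      fix Y assume "Y \<in> \<S> // iso_rel A \<S>"
      then obtain N where N: "N \<in> \<S>" "Y = iso_rel A \<S> `` {N}" by (rule quotientE)
      obtain i where i: "i \<in> P" "rmodule_iso A N (X i)" using surj[OF N(1)] by blast
      show "Y \<in> (\<lambda>i. {N \<in> \<S>. rmodule_iso A N (X i)}) ` P"
        unfolding N(2) cls[OF N(1) i] using i(1) by (rule imageI)
    qed
  qed
qed

lemma support_iso: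
  assumes "leavitt_algebra R G" "right_module (leavitt R G) M" "right_module (leavitt R G) N"
    and iso: "rmodule_iso (leavitt R G) M N"
  shows "support R G M = support R G N"
proof -
  interpret leavitt_algebra R G by fact
  interpret M: right_module L M by fact
  interpret N: right_module L N by fact
  obtain f where f: "rmodule_hom L M N f" "bij_betw f (carrier M) (carrier N)"
    using iso by (auto simp: rmodule_iso_iff)
  have f0: "f \<zero>\<^bsub>M\<^esub> = \<zero>\<^bsub>N\<^esub>" by (rule rmodule_hom_zero[OF assms(2,3) f(1)])
  have car: "carrier N = f ` carrier M" using f(2) by (simp add: bij_betw_def)
  have "ract N (f x) (lvertex R G u) = \<zero>\<^bsub>N\<^esub> \<longleftrightarrow> ract M x (lvertex R G u) = \<zero>\<^bsub>M\<^esub>"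
    if x: "x \<in> carrier M" and u: "u \<in> verts G" for x u
  proof -
    have "ract M x (lvertex R G u) \<in> carrier M" using x u by (simp add: M.ract_closed)
    then have "f (ract M x (lvertex R G u)) = f \<zero>\<^bsub>M\<^esub> \<longleftrightarrow> ract M x (lvertex R G u) = \<zero>\<^bsub>M\<^esub>"
      using f(2) M.M.zero_closed unfolding bij_betw_def by (metis inj_on_eq_iff)
    moreover have "f (ract M x (lvertex R G u)) = ract N (f x) (lvertex R G u)"
      using f(1) x u by (simp add: rmodule_hom_def)
    ultimately show ?thesis using f0 by simp
  qed
  then show ?thesis unfolding support_def car by auto
qed

context leavitt_algebra begin

abbreviation "scE \<equiv> (\<lambda>r. r \<odot>\<^bsub>L\<^esub> \<one>\<^bsub>L\<^esub>)"

lemma simple_corner: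
  assumes "simple_right_module L M" "v \<in> verts G" shows "leavitt_corner R G M v"
  by (rule leavitt_cornerI[OF leavitt_algebra_axioms simple_imp_right_module[OF assms(1)] assms(2)])

lemma support_corner:
  assumes "leavitt_corner R G M v" "v \<in> support R G M"
  shows "\<exists>x\<in>leavitt_corner.corner R G M v. x \<noteq> \<zero>\<^bsub>M\<^esub>"
proof -
  interpret leavitt_corner R G M v by fact
  obtain x where "x \<in> carrier M" "ract M x (lvertex R G v) \<noteq> \<zero>\<^bsub>M\<^esub>"
    using assms(2) by (auto simp: support_def)
  then show ?thesis using act_vertex_in_corner by blast
qed

subsection \<open>Sinks\<close>

lemma sink_based_ex:
  assumes M: "simple_right_module L M" and w: "is_sink G w" "w \<in> support R G M"
  shows "\<exists>\<mm> x. maximalideal \<mm> R \<and> leavitt_corner.based R G M w scE \<mm> x"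
proof -
  interpret leavitt_corner R G M w using M w(1) by (intro simple_corner) (simp_all add: is_sink_def)
  obtain x where "x \<in> corner" "x \<noteq> \<zero>\<^bsub>M\<^esub>"
    using support_corner[OF leavitt_corner_axioms w(2)] by blast
  then show ?thesis
    using simple_imp_based[OF cring_axioms sink_corner_action[OF leavitt_corner_axioms w(1)] M] by blast
qed

lemma sink_based_iso:
  fixes M :: "(('v, 'e, 'k) leavitt, 'm) rmodule" and M' :: "(('v, 'e, 'k) leavitt, 'n) rmodule"
  assumes "is_sink G w" "maximalideal \<mm> R"
    and "leavitt_corner R G M w" "leavitt_corner.based R G M w scE \<mm> x"
    and "leavitt_corner R G M' w" "leavitt_corner.based R G M' w scE \<mm> x'"
  shows "rmodule_iso L M M'"
  by (rule based_iso[OF assms(3,5) cring_axioms assms(2) sink_corner_action[OF assms(3,1)]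
      sink_corner_action[OF assms(5,1)] _ assms(4,6)]) (rule sink_corner_action[OF _ assms(1)])

lemma sink_based_unique:
  fixes M :: "(('v, 'e, 'k) leavitt, 'm) rmodule" and M' :: "(('v, 'e, 'k) leavitt, 'n) rmodule"
  assumes "is_sink G w" "maximalideal \<mm> R" "maximalideal \<mm>' R"
    and "leavitt_corner R G M w" "leavitt_corner.based R G M w scE \<mm> x"
    and "leavitt_corner R G M' w" "leavitt_corner.based R G M' w scE \<mm>' x'"
    and "rmodule_iso L M M'"
  shows "\<mm> = \<mm>'"
  by (rule based_ideal_unique[OF assms(4,6) cring_axioms assms(2,3) sink_corner_action sink_corner_action
      assms(5,7,8)]) (rule assms)+

lemma reduced_sink_simple:
  assumes "maximalideal \<mm> R" "is_sink G w"
  shows "simple_right_module L (reduced_sink_module R G \<mm> w)"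
    and "support R G (reduced_sink_module R G \<mm> w) = predecessors G w"
  using sink_support[OF reduced_sink_corner[OF assms] assms(2,1) reduced_sink_based[OF assms]] by auto

theorem sink_classification:
  fixes M :: "(('v, 'e, 'k) leavitt, 'm) rmodule"
  assumes M: "simple_right_module L M" and w: "is_sink G w" "w \<in> support R G M"
  shows "support R G M = predecessors G w"
    and "\<exists>\<mm>. maximalideal \<mm> R \<and>
      rmodule_iso L M (quotient_module (sink_module R G w) (ideal_sink_module R G \<mm> w)) \<and>
      rmodule_iso L (quotient_module (sink_module R G w) (ideal_sink_module R G \<mm> w))
        (reduced_sink_module R G \<mm> w) \<and>
      (\<forall>\<nn>. maximalideal \<nn> R \<and>
        (rmodule_iso L M (quotient_module (sink_module R G w) (ideal_sink_module R G \<nn> w)) \<or>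
         rmodule_iso L M (reduced_sink_module R G \<nn> w)) \<longrightarrow> \<nn> = \<mm>)"
proof -
  obtain \<mm> x where \<mm>: "maximalideal \<mm> R" and x: "leavitt_corner.based R G M w scE \<mm> x"
    using sink_based_ex[OF assms] by blast
  have Mc: "leavitt_corner R G M w" using M w(1) by (intro simple_corner) (simp_all add: is_sink_def)
  show "support R G M = predecessors G w" by (rule sink_support(1)[OF Mc w(1) \<mm> x])
  note q = sink_quotient_corner[OF _ w(1)] sink_quotient_based[OF _ w(1)]
    and r = reduced_sink_corner[OF _ w(1)] reduced_sink_based[OF _ w(1)]
  show "\<exists>\<mm>. maximalideal \<mm> R \<and>
      rmodule_iso L M (quotient_module (sink_module R G w) (ideal_sink_module R G \<mm> w)) \<and>
      rmodule_iso L (quotient_module (sink_module R G w) (ideal_sink_module R G \<mm> w))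
        (reduced_sink_module R G \<mm> w) \<and>
      (\<forall>\<nn>. maximalideal \<nn> R \<and>
        (rmodule_iso L M (quotient_module (sink_module R G w) (ideal_sink_module R G \<nn> w)) \<or>
         rmodule_iso L M (reduced_sink_module R G \<nn> w)) \<longrightarrow> \<nn> = \<mm>)"
  proof (intro exI[of _ \<mm>] conjI allI impI)
    show "maximalideal \<mm> R" by (rule \<mm>)
    show "rmodule_iso L M (quotient_module (sink_module R G w) (ideal_sink_module R G \<mm> w))"
      by (rule sink_based_iso[OF w(1) \<mm> Mc x q(1)[OF \<mm>] q(2)[OF \<mm>]])
    show "rmodule_iso L (quotient_module (sink_module R G w) (ideal_sink_module R G \<mm> w))
        (reduced_sink_module R G \<mm> w)"
      by (rule sink_based_iso[OF w(1) \<mm> q(1)[OF \<mm>] q(2)[OF \<mm>] r(1)[OF \<mm>] r(2)[OF \<mm>]])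
    fix \<nn> assume *: "maximalideal \<nn> R \<and>
        (rmodule_iso L M (quotient_module (sink_module R G w) (ideal_sink_module R G \<nn> w)) \<or>
         rmodule_iso L M (reduced_sink_module R G \<nn> w))"
    then have \<nn>: "maximalideal \<nn> R" by blast
    have "\<mm> = \<nn>"
      using sink_based_unique[OF w(1) \<mm> \<nn> Mc x q(1)[OF \<nn>] q(2)[OF \<nn>]]
        sink_based_unique[OF w(1) \<mm> \<nn> Mc x r(1)[OF \<nn>] r(2)[OF \<nn>]] * by blast
    then show "\<nn> = \<mm>" by (rule HOL.sym)
  qed
qed

text \<open>A path that starts at a sink is empty.\<close>

lemma sink_eq_if_predecessors:
  assumes "is_sink G w" "is_sink G w'" "predecessors G w = predecessors G w'" shows "w = w'"
proof -
  have "w \<in> predecessors G w'" using assms(1,3) by (simp add: is_sink_def flip: assms(3))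
  then obtain p where "G.awalk w p w'" by (rule G.predecessorsE)
  then show ?thesis
    using assms(1) by (cases p) (auto simp: G.awalk_Nil_iff G.awalk_Cons_iff is_sink_def)
qed

theorem sink_correspondence:
  "bij_betw
     (\<lambda>(\<mm>, w). {N \<in> simples_with_sink R G. rmodule_iso L N (reduced_sink_module R G \<mm> w)})
     ({\<mm>. maximalideal \<mm> R} \<times> {w. is_sink G w})
     (simples_with_sink R G // iso_rel L (simples_with_sink R G))"
proof -
  let ?P = "{\<mm>. maximalideal \<mm> R} \<times> {w. is_sink G w}"
  let ?X = "\<lambda>i. reduced_sink_module R G (fst i) (snd i)"
  have simp: "simple_right_module L (?X i)" and supp: "support R G (?X i) = predecessors G (snd i)"
    if "i \<in> ?P" for i using that reduced_sink_simple by auto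
  have "bij_betw (\<lambda>i. {N \<in> simples_with_sink R G. rmodule_iso L N (?X i)}) ?P
      (simples_with_sink R G // iso_rel L (simples_with_sink R G))"
  proof (rule bij_betw_iso_classes)
    show mod: "right_module L N" if "N \<in> simples_with_sink R G" for N
      using that simple_imp_right_module by (auto simp: simples_with_sink_def)
    show "right_module L (?X i)" if "i \<in> ?P" for i using simp[OF that] by (rule simple_imp_right_module)
    show "\<exists>N\<in>simples_with_sink R G. rmodule_iso L N (?X i)" if i: "i \<in> ?P" for i
    proof -
      obtain N :: "('v, 'e, 'k) leavitt coset_module" where N: "simple_right_module L N" "rmodule_iso L (?X i) N"
        using simple_coset_copy[OF simp[OF i]] by blast
      have "support R G N = predecessors G (snd i)"
        using support_iso[OF leavitt_algebra_axioms simple_imp_right_module[OF simp[OF i]]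
            simple_imp_right_module[OF N(1)] N(2)] supp[OF i] by simp
      then have "snd i \<in> support R G N" using i by (auto simp: is_sink_def)
      then have "N \<in> simples_with_sink R G" using N(1) i by (auto simp: simples_with_sink_def)
      then show ?thesis using rmodule_iso_sym[OF simple_imp_right_module[OF simp[OF i]] N(2)] by blast
    qed
    show "\<exists>i\<in>?P. rmodule_iso L N (?X i)" if N0: "N \<in> simples_with_sink R G" for N
    proof -
      obtain w where N: "simple_right_module L N" and w: "is_sink G w" "w \<in> support R G N"
        using N0 by (auto simp: simples_with_sink_def)
      obtain \<mm> where "maximalideal \<mm> R" "rmodule_iso L N (reduced_sink_module R G \<mm> w)"
        using sink_classification(2)[OF N w] rmodule_iso_trans by blast
      then show ?thesis using w(1) by (intro bexI[of _ "(\<mm>, w)"]) simp_all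
    qed
    show "i = j" if ij: "i \<in> ?P" "j \<in> ?P" and iso: "rmodule_iso L (?X i) (?X j)" for i j
    proof -
      have m: "maximalideal (fst i) R" "maximalideal (fst j) R" and w: "is_sink G (snd i)" "is_sink G (snd j)"
        using ij by auto
      have "predecessors G (snd i) = predecessors G (snd j)"
        using support_iso[OF leavitt_algebra_axioms simple_imp_right_module[OF simp[OF ij(1)]]
            simple_imp_right_module[OF simp[OF ij(2)]] iso] supp ij by simp
      then have eq: "snd i = snd j" using sink_eq_if_predecessors w by blast
      have "fst i = fst j"
        using sink_based_unique[OF w(1) m reduced_sink_corner[OF m(1) w(1)] reduced_sink_based[OF m(1) w(1)]
            reduced_sink_corner[OF m(2) w(1)] reduced_sink_based[OF m(2) w(1)]] iso eq by simp
      then show ?thesis using eq by (rule prod_eqI)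
    qed
  qed
  then show ?thesis by (simp add: case_prod_unfold)
qed

subsection \<open>Cycles\<close>

context
  assumes disj: "disjoint_cycles G"
begin

lemma cycle_vert: "\<lbrakk>C \<in> cycles G; v \<in> cycle_verts G C\<rbrakk> \<Longrightarrow> v \<in> verts G \<and> out_arcs G v \<noteq> {}"
proof -
  assume C: "C \<in> cycles G" "v \<in> cycle_verts G C"
  have "cycle_at G C v \<in> pre_digraph.returns G v" using G.returns_cycle[OF disj C] by simp
  then show ?thesis by (auto simp: pre_digraph.returns_def)
qed

lemma tame_corner_action:
  assumes "leavitt_corner R G M v" "leavitt_corner.tame R G M v" "C \<in> cycles G" "v \<in> cycle_verts G C"
  shows "leavitt_corner.corner_action R G M v LP (laurent_eval R G C v)"
proof -
  interpret leavitt_corner R G M v by fact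
  interpret cycle_corner R G M v C
    by unfold_locales (rule G.returns_cycle[OF disj assms(3,4)], rule assms(2))
  show ?thesis by (rule cycle_corner_action)
qed

lemma cycle_based_iso:
  fixes M :: "(('v, 'e, 'k) leavitt, 'm) rmodule" and M' :: "(('v, 'e, 'k) leavitt, 'n) rmodule"
  assumes C: "C \<in> cycles G" "v \<in> cycle_verts G C" and \<mm>: "maximalideal \<mm> LP"
    and M: "leavitt_corner R G M v" "leavitt_corner.tame R G M v"
      "leavitt_corner.based R G M v (laurent_eval R G C v) \<mm> x"
    and M': "leavitt_corner R G M' v" "leavitt_corner.tame R G M' v"
      "leavitt_corner.based R G M' v (laurent_eval R G C v) \<mm> x'"
  shows "rmodule_iso L M M'"
  by (rule based_iso[OF M(1) M'(1) laurent_cring \<mm> tame_corner_action[OF M(1,2) C]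
      tame_corner_action[OF M'(1,2) C] _ M(3) M'(3)])
    (rule tame_corner_action[OF _ leavitt_corner.supported_tame C])

lemma cycle_based_unique:
  fixes M :: "(('v, 'e, 'k) leavitt, 'm) rmodule" and M' :: "(('v, 'e, 'k) leavitt, 'n) rmodule"
  assumes C: "C \<in> cycles G" "v \<in> cycle_verts G C" and \<mm>: "maximalideal \<mm> LP" "maximalideal \<mm>' LP"
    and M: "leavitt_corner R G M v" "leavitt_corner.tame R G M v"
      "leavitt_corner.based R G M v (laurent_eval R G C v) \<mm> x"
    and M': "leavitt_corner R G M' v" "leavitt_corner.tame R G M' v"
      "leavitt_corner.based R G M' v (laurent_eval R G C v) \<mm>' x'"
    and iso: "rmodule_iso L M M'"
  shows "\<mm> = \<mm>'"
  by (rule based_ideal_unique[OF M(1) M'(1) laurent_cring \<mm> tame_corner_action[OF M(1,2) C]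
      tame_corner_action[OF M'(1,2) C] M(3) M'(3) iso])

lemma cycle_module_facts:
  assumes "C \<in> cycles G" "v \<in> cycle_verts G C" "maximalideal \<mm> LP"
  shows "leavitt_corner R G (cycle_module R G \<mm> C v) v" "leavitt_corner.tame R G (cycle_module R G \<mm> C v) v"
    "\<exists>x. leavitt_corner.based R G (cycle_module R G \<mm> C v) v (laurent_eval R G C v) \<mm> x"
    "simple_right_module L (cycle_module R G \<mm> C v)"
    "support R G (cycle_module R G \<mm> C v) = predecessors G v"
proof -
  interpret cycle_setting R G C v \<mm> by (intro cycle_setting.intro cycle_setting_axioms.intro leavitt_algebra_axioms disj assms)
  show *: "leavitt_corner R G (cycle_module R G \<mm> C v) v" "leavitt_corner.tame R G (cycle_module R G \<mm> C v) v"
    by (rule cycle_module_corner, rule cycle_module_tame)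
  show "\<exists>x. leavitt_corner.based R G (cycle_module R G \<mm> C v) v (laurent_eval R G C v) \<mm> x"
    by (rule cycle_module_based)
  then obtain x where x: "leavitt_corner.based R G (cycle_module R G \<mm> C v) v (laurent_eval R G C v) \<mm> x" by blast
  interpret M: leavitt_corner R G "cycle_module R G \<mm> C v" v by (rule *)
  note a = laurent_cring tame_corner_action[OF * assms(1,2)] assms(3) x
  show "simple_right_module L (cycle_module R G \<mm> C v)" by (rule M.based_simple[OF a])
  show "support R G (cycle_module R G \<mm> C v) = predecessors G v" by (rule M.based_support[OF a])
qed

text \<open>
  Without sinks in the support, every vertex of the support emits an arrow into the support. A vertex
  from which as few vertices as possible can be reached therefore lies on a cycle, and what is
  reached from it within the support leads back to it.
\<close>

lemma support_cycle_ex: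
  assumes M: "simple_right_module L M" and nosink: "\<And>w. is_sink G w \<Longrightarrow> w \<notin> support R G M"
    and base: "\<And>C. C \<in> cycles G \<Longrightarrow> base C \<in> cycle_verts G C"
  shows "\<exists>C\<in>cycles G. base C \<in> support R G M \<and> leavitt_corner.tame R G M (base C)"
proof -
  interpret leavitt_module R G M
    by (intro leavitt_module.intro leavitt_algebra_axioms simple_imp_right_module M)
  let ?U = "support R G M"
  have U_iff: "u \<in> ?U \<longleftrightarrow> u \<in> verts G \<and> (\<exists>x\<in>carrier M. x \<cdot> vx u \<noteq> \<zero>\<^bsub>M\<^esub>)" for u
    by (simp add: support_def)
  have head_U: "head G e \<in> ?U" if e: "e \<in> arcs G" "x \<in> carrier M" "x \<cdot> ar e \<noteq> \<zero>\<^bsub>M\<^esub>" for e x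
    unfolding U_iff using e by (intro conjI bexI[of _ "x \<cdot> ar e"]) (simp_all add: act_gen_vertex M.ract_closed)
  \<comment> \<open>The support is closed under predecessors, as \<open>y e\<^sup>* e = y t(e)\<close> forces \<open>y e\<^sup>*\<close> to be nonzero.\<close>
  have backward: "tail G e \<in> ?U" if e: "e \<in> arcs G" "head G e \<in> ?U" for e
  proof -
    obtain y where y: "y \<in> carrier M" "y \<cdot> vx (head G e) \<noteq> \<zero>\<^bsub>M\<^esub>" using e(2) U_iff by blast
    have "y \<cdot> gh e \<noteq> \<zero>\<^bsub>M\<^esub>"
    proof
      assume "y \<cdot> gh e = \<zero>\<^bsub>M\<^esub>"
      then have "y \<cdot> gh e \<cdot> ar e = \<zero>\<^bsub>M\<^esub>" using e(1) by (simp add: M.ract_zero_left)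
      then show False using y e(1) by (simp add: act_ghost_arrow)
    qed
    then show ?thesis
      unfolding U_iff using e y by (intro conjI bexI[of _ "y \<cdot> gh e"]) (simp_all add: act_gen_vertex M.ract_closed)
  qed
  have pred_U: "u \<in> ?U" if "u \<in> predecessors G z" "z \<in> ?U" for u z
  proof -
    obtain p where "G.awalk u p z" using \<open>u \<in> predecessors G z\<close> by (rule G.predecessorsE)
    then show ?thesis using \<open>z \<in> ?U\<close>
      by (induction p arbitrary: u) (auto simp: G.awalk_Nil_iff G.awalk_Cons_iff backward)
  qed
  have step: "\<exists>e\<in>out_arcs G u. head G e \<in> ?U" if u: "u \<in> ?U" for u
  proof (rule ccontr)
    assume no: "\<not> (\<exists>e\<in>out_arcs G u. head G e \<in> ?U)"
    obtain x where x: "x \<in> carrier M" "x \<cdot> vx u \<noteq> \<zero>\<^bsub>M\<^esub>" and uv: "u \<in> verts G" using u U_iff by blast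
    have ne: "out_arcs G u \<noteq> {}" using nosink[of u] u uv by (auto simp: is_sink_def)
    have "x \<cdot> ar e = \<zero>\<^bsub>M\<^esub>" if "e \<in> out_arcs G u" for e using head_U[of e x] no that x(1) by auto
    then have "finsum M (\<lambda>e. x \<cdot> ar e \<cdot> gh e) (out_arcs G u) = finsum M (\<lambda>e. \<zero>\<^bsub>M\<^esub>) (out_arcs G u)"
      by (intro M.M.finsum_cong') (simp_all add: M.ract_zero_left)
    then show False using act_vertex_sum[OF x(1) uv ne] x(2) by simp
  qed
  obtain u0 where u0: "u0 \<in> ?U"
  proof -
    obtain x where x: "x \<in> carrier M" "x \<noteq> \<zero>\<^bsub>M\<^esub>" using simple_nonzero[OF M] by blast
    have "\<exists>u\<in>verts G. x \<cdot> vx u \<noteq> \<zero>\<^bsub>M\<^esub>"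
    proof (rule ccontr)
      assume "\<not> (\<exists>u\<in>verts G. x \<cdot> vx u \<noteq> \<zero>\<^bsub>M\<^esub>)"
      then have "finsum M (\<lambda>u. x \<cdot> vx u) (verts G) = finsum M (\<lambda>u. \<zero>\<^bsub>M\<^esub>) (verts G)"
        by (intro M.M.finsum_cong') simp_all
      then show False using act_unit_sum[OF x(1)] x(2) by simp
    qed
    then show ?thesis using that x(1) unfolding U_iff by blast
  qed
  define reach where "reach u = {z \<in> verts G. u \<in> predecessors G z}" for u
  have fin: "finite (reach u)" for u by (simp add: reach_def G.finite_verts)
  have mono: "reach z \<subseteq> reach u" if "u \<in> predecessors G z" for u z
    using G.predecessors_trans[OF that] by (auto simp: reach_def)
  obtain u where u: "u \<in> ?U" and min: "\<And>z. z \<in> ?U \<Longrightarrow> card (reach u) \<le> card (reach z)"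
    using ex_has_least_nat[of "\<lambda>u. u \<in> ?U" u0 "\<lambda>u. card (reach u)"] u0 by blast
  have uv: "u \<in> verts G" using u U_iff by blast
  \<comment> \<open>From \<open>z\<close> no more is reached than from \<open>u\<close>, and by minimality just as much, including \<open>u\<close>.\<close>
  have return: "z \<in> predecessors G u" if z: "u \<in> predecessors G z" "z \<in> ?U" for z
  proof -
    have "reach z = reach u" using card_seteq[OF fin mono[OF z(1)] min[OF z(2)]] .
    moreover have "u \<in> reach u" using uv by (simp add: reach_def)
    ultimately have "u \<in> reach z" by blast
    then show ?thesis by (simp add: reach_def)
  qed
  obtain e where e: "e \<in> arcs G" "tail G e = u" "head G e \<in> ?U" using step[OF u] by auto
  have "u \<in> predecessors G (head G e)"
    using G.predecessorsI[OF G.arc_implies_awalk[OF e(1)]] e(2) by simp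
  then obtain p where "G.awalk (head G e) p u" using return[OF _ e(3)] by (metis G.predecessorsE)
  then have "G.awalk u (e # p) u" using e by (simp add: G.awalk_Cons_iff)
  then obtain C where C: "C \<in> cycles G" "u \<in> cycle_verts G C" using G.closed_awalk_cycle by blast
  let ?v = "base C"
  note v = base[OF C(1)]
  obtain p where p: "p \<in> C" "tail G (hd p) = u" using G.cycle_at_spec[OF C] by blast
  have cyc: "G.cycle p" by (rule G.cycles_cycle[OF C(1) p(1)])
  obtain f where f: "f \<in> set p" "?v = tail G f" using v cycle_verts_eq[OF C(1) p(1)] by auto
  obtain w1 w2 where w: "G.awalk u w1 ?v" "G.awalk (head G f) w2 u"
    using G.cycle_reachable[OF cyc f(1)] p(2) f(2) by auto
  have fa: "f \<in> arcs G" using G.cycle_awalk[OF cyc] f(1) by (auto simp: G.awalk_def)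
  have uv': "u \<in> predecessors G ?v" using w(1) by (rule G.predecessorsI)
  have "G.awalk ?v (f # w2) u" using w(2) f(2) fa by (simp add: G.awalk_Cons_iff)
  then have vu: "?v \<in> predecessors G u" by (rule G.predecessorsI)
  have vU: "?v \<in> ?U" by (rule pred_U[OF vu u])
  interpret V: leavitt_corner R G M ?v
    using vU U_iff by (intro simple_corner[OF M]) simp
  have "V.tame"
    unfolding V.tame_def
  proof (intro ballI impI)
    fix g y assume g: "g \<in> arcs G" "?v \<in> predecessors G (tail G g)" "head G g \<notin> predecessors G ?v"
      and y: "y \<in> carrier M"
    show "y \<cdot> ar g = \<zero>\<^bsub>M\<^esub>"
    proof (rule ccontr)
      assume "y \<cdot> ar g \<noteq> \<zero>\<^bsub>M\<^esub>"
      then have hU: "head G g \<in> ?U" using head_U g(1) y by blast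
      have "tail G g \<in> predecessors G (head G g)"
        using G.predecessorsI[OF G.arc_implies_awalk[OF g(1)]] .
      then have "u \<in> predecessors G (head G g)"
        using G.predecessors_trans uv' g(2) by meson
      then have "head G g \<in> predecessors G ?v"
        using G.predecessors_trans[OF return[OF _ hU] uv'] by blast
      then show False using g(3) by simp
    qed
  qed
  then show ?thesis using C(1) vU by blast
qed

context
  fixes base :: "'e list set \<Rightarrow> 'v"
  assumes base: "\<And>C. C \<in> cycles G \<Longrightarrow> base C \<in> cycle_verts G C"
begin

lemma cycle_eq_if_predecessors:
  assumes "C \<in> cycles G" "D \<in> cycles G" "predecessors G (base C) = predecessors G (base D)"
  shows "C = D"
proof (rule G.cycles_eq_if_mutually_reachable[OF disj assms(1) base[OF assms(1)] assms(2) base[OF assms(2)]])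
  have *: "base C \<in> predecessors G (base C)" "base D \<in> predecessors G (base D)"
    using cycle_vert[OF assms(1) base[OF assms(1)]] cycle_vert[OF assms(2) base[OF assms(2)]] by simp_all
  show "base C \<in> predecessors G (base D)" using *(1) unfolding assms(3) .
  show "base D \<in> predecessors G (base C)" unfolding assms(3) by (rule *(2))
qed

lemma cycle_based_ex:
  assumes M: "simple_right_module L M" and nosink: "\<And>w. is_sink G w \<Longrightarrow> w \<notin> support R G M"
  shows "\<exists>C\<in>cycles G. \<exists>\<mm> x. leavitt_corner R G M (base C) \<and> leavitt_corner.tame R G M (base C) \<and>
    maximalideal \<mm> LP \<and> leavitt_corner.based R G M (base C) (laurent_eval R G C (base C)) \<mm> x \<and>
    support R G M = predecessors G (base C)"
proof -
  obtain C where C: "C \<in> cycles G" "base C \<in> support R G M" and tame: "leavitt_corner.tame R G M (base C)"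
    using support_cycle_ex[OF M nosink base] by blast
  interpret leavitt_corner R G M "base C"
    using C(2) by (intro simple_corner[OF M]) (simp add: support_def)
  note act = tame_corner_action[OF leavitt_corner_axioms tame C(1) base[OF C(1)]]
  obtain x where x: "x \<in> corner" "x \<noteq> \<zero>\<^bsub>M\<^esub>" using support_corner[OF leavitt_corner_axioms C(2)] by blast
  obtain \<mm> where \<mm>: "maximalideal \<mm> LP" "based (laurent_eval R G C (base C)) \<mm> x"
    using simple_imp_based[OF laurent_cring act M x] by blast
  have "support R G M = predecessors G (base C)"
    by (rule based_support[OF laurent_cring act \<mm>])
  then show ?thesis using C(1) \<mm> tame leavitt_corner_axioms by blast
qed

lemma cycle_module_no_sink:
  assumes "C \<in> cycles G" "is_sink G w" shows "w \<notin> predecessors G (base C)"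
proof
  assume "w \<in> predecessors G (base C)"
  then obtain p where "G.awalk w p (base C)" by (rule G.predecessorsE)
  then show False
    using assms(2) cycle_vert[OF assms(1) base[OF assms(1)]]
    by (cases p) (auto simp: G.awalk_Nil_iff G.awalk_Cons_iff is_sink_def)
qed

theorem cycle_classification:
  fixes M :: "(('v, 'e, 'k) leavitt, 'm) rmodule"
  assumes M: "simple_right_module L M" and nosink: "\<And>w. is_sink G w \<Longrightarrow> w \<notin> support R G M"
  shows "\<exists>!C. C \<in> cycles G \<and> support R G M = predecessors G (base C)"
    and "\<And>C. \<lbrakk>C \<in> cycles G; support R G M = predecessors G (base C)\<rbrakk> \<Longrightarrow>
      \<exists>!\<mm>. maximalideal \<mm> LP \<and> rmodule_iso L M (cycle_module R G \<mm> C (base C))"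
proof -
  obtain C \<mm> x where C: "C \<in> cycles G" and Mc: "leavitt_corner R G M (base C)" "leavitt_corner.tame R G M (base C)"
    and \<mm>: "maximalideal \<mm> LP" and x: "leavitt_corner.based R G M (base C) (laurent_eval R G C (base C)) \<mm> x"
    and supp: "support R G M = predecessors G (base C)"
    using cycle_based_ex[OF assms] by blast
  have uniq: "D = C" if "D \<in> cycles G" "support R G M = predecessors G (base D)" for D
    using cycle_eq_if_predecessors[OF that(1) C] that(2) supp by simp
  show "\<exists>!C. C \<in> cycles G \<and> support R G M = predecessors G (base C)"
    using C supp uniq by blast
  have "\<exists>!\<mm>. maximalideal \<mm> LP \<and> rmodule_iso L M (cycle_module R G \<mm> C (base C))"
  proof (rule ex1I)
    note f = cycle_module_facts[OF C base[OF C]]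
    obtain y where "leavitt_corner.based R G (cycle_module R G \<mm> C (base C)) (base C) (laurent_eval R G C (base C)) \<mm> y"
      using f(3)[OF \<mm>] by blast
    then show "maximalideal \<mm> LP \<and> rmodule_iso L M (cycle_module R G \<mm> C (base C))"
      using cycle_based_iso[OF C base[OF C] \<mm> Mc x f(1,2)[OF \<mm>]] \<mm> by blast
    fix \<nn> assume \<nn>: "maximalideal \<nn> LP \<and> rmodule_iso L M (cycle_module R G \<nn> C (base C))"
    then obtain y where "leavitt_corner.based R G (cycle_module R G \<nn> C (base C)) (base C) (laurent_eval R G C (base C)) \<nn> y"
      using f(3)[of \<nn>] by blast
    then have "\<mm> = \<nn>"
      using cycle_based_unique[OF C base[OF C] \<mm> _ Mc x f(1,2)[of \<nn>]] \<nn> by blast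
    then show "\<nn> = \<mm>" by (rule HOL.sym)
  qed
  then show "\<exists>!\<mm>. maximalideal \<mm> LP \<and> rmodule_iso L M (cycle_module R G \<mm> D (base D))"
    if "D \<in> cycles G" "support R G M = predecessors G (base D)" for D
    using uniq[OF that] by simp
qed

theorem cycle_correspondence:
  "bij_betw
     (\<lambda>(\<mm>, C). {N \<in> simples_without_sink R G. rmodule_iso L N (cycle_module R G \<mm> C (base C))})
     ({\<mm>. maximalideal \<mm> LP} \<times> cycles G)
     (simples_without_sink R G // iso_rel L (simples_without_sink R G))"
proof -
  let ?P = "{\<mm>. maximalideal \<mm> LP} \<times> cycles G"
  let ?X = "\<lambda>i. cycle_module R G (fst i) (snd i) (base (snd i))"
  have facts: "simple_right_module L (?X i)" "support R G (?X i) = predecessors G (base (snd i))"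
    if "i \<in> ?P" for i
    using that cycle_module_facts(4,5)[of "snd i" "base (snd i)" "fst i"] base by auto
  have mod: "right_module L (?X i)" if "i \<in> ?P" for i using facts(1)[OF that] by (rule simple_imp_right_module)
  have "bij_betw (\<lambda>i. {N \<in> simples_without_sink R G. rmodule_iso L N (?X i)}) ?P
      (simples_without_sink R G // iso_rel L (simples_without_sink R G))"
  proof (rule bij_betw_iso_classes)
    show "right_module L N" if "N \<in> simples_without_sink R G" for N
      using that simple_imp_right_module by (auto simp: simples_without_sink_def)
    show "right_module L (?X i)" if "i \<in> ?P" for i by (rule mod[OF that])
    show "\<exists>N\<in>simples_without_sink R G. rmodule_iso L N (?X i)" if i: "i \<in> ?P" for i
    proof -
      obtain N :: "('v, 'e, 'k) leavitt coset_module" where N: "simple_right_module L N" "rmodule_iso L (?X i) N"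
        using simple_coset_copy[OF facts(1)[OF i]] by blast
      have "support R G N = predecessors G (base (snd i))"
        using support_iso[OF leavitt_algebra_axioms mod[OF i] simple_imp_right_module[OF N(1)] N(2)]
          facts(2)[OF i] by simp
      then have "N \<in> simples_without_sink R G"
        using N(1) i cycle_module_no_sink by (auto simp: simples_without_sink_def)
      then show ?thesis using rmodule_iso_sym[OF mod[OF i] N(2)] by blast
    qed
    show "\<exists>i\<in>?P. rmodule_iso L N (?X i)" if "N \<in> simples_without_sink R G" for N
    proof -
      have N: "simple_right_module L N" "\<And>w. is_sink G w \<Longrightarrow> w \<notin> support R G N"
        using that by (auto simp: simples_without_sink_def)
      obtain C where C: "C \<in> cycles G" "support R G N = predecessors G (base C)"
        using cycle_classification(1)[OF N] by blast
      obtain \<mm> where "maximalideal \<mm> LP" "rmodule_iso L N (cycle_module R G \<mm> C (base C))"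
        using cycle_classification(2)[OF N C] by blast
      then show ?thesis using C(1) by (intro bexI[of _ "(\<mm>, C)"]) simp_all
    qed
    show "i = j" if ij: "i \<in> ?P" "j \<in> ?P" and iso: "rmodule_iso L (?X i) (?X j)" for i j
    proof -
      have m: "maximalideal (fst i) LP" "maximalideal (fst j) LP" and C: "snd i \<in> cycles G" "snd j \<in> cycles G"
        using ij by auto
      have "predecessors G (base (snd i)) = predecessors G (base (snd j))"
        using support_iso[OF leavitt_algebra_axioms mod[OF ij(1)] mod[OF ij(2)] iso] facts(2) ij by simp
      then have eq: "snd i = snd j" using cycle_eq_if_predecessors C by blast
      note f = cycle_module_facts[OF C(1) base[OF C(1)]]
      obtain x y where "leavitt_corner.based R G (?X i) (base (snd i)) (laurent_eval R G (snd i) (base (snd i))) (fst i) x"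
        "leavitt_corner.based R G (cycle_module R G (fst j) (snd i) (base (snd i))) (base (snd i))
          (laurent_eval R G (snd i) (base (snd i))) (fst j) y"
        using f(3)[OF m(1)] f(3)[OF m(2)] by blast
      then have "fst i = fst j"
        using cycle_based_unique[OF C(1) base[OF C(1)] m f(1,2)[OF m(1)] _ f(1,2)[OF m(2)]] iso eq by simp
      then show ?thesis using eq by (rule prod_eqI)
    qed
  qed
  then show ?thesis by (simp add: case_prod_unfold)
qed

end

end

end

theorem theorem32:
  fixes R :: "('k, 'z) ring_scheme"
    and G :: "('v, 'e) pre_digraph"
    and base :: "'e list set \<Rightarrow> 'v"
  assumes "cring R"
    and "fin_digraph G"
    and "disjoint_cycles G"
    and "\<And>C. C \<in> cycles G \<Longrightarrow> base C \<in> cycle_verts G C"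
  shows
    "(\<forall>(M :: (('v, 'e, 'k) leavitt, 'm) rmodule) w.
        simple_right_module (leavitt R G) M \<and> is_sink G w \<and> w \<in> support R G M \<longrightarrow>
        support R G M = predecessors G w \<and>
        (\<exists>\<mm>. maximalideal \<mm> R \<and>
           rmodule_iso (leavitt R G) M
             (quotient_module (sink_module R G w) (ideal_sink_module R G \<mm> w)) \<and>
           rmodule_iso (leavitt R G)
             (quotient_module (sink_module R G w) (ideal_sink_module R G \<mm> w))
             (reduced_sink_module R G \<mm> w) \<and>
           (\<forall>\<nn>. maximalideal \<nn> R \<and>
              (rmodule_iso (leavitt R G) M
                 (quotient_module (sink_module R G w) (ideal_sink_module R G \<nn> w)) \<or>
               rmodule_iso (leavitt R G) M (reduced_sink_module R G \<nn> w)) \<longrightarrow> \<nn> = \<mm>))) \<and>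
     (\<forall>\<mm> w. maximalideal \<mm> R \<and> is_sink G w \<longrightarrow>
        simple_right_module (leavitt R G) (reduced_sink_module R G \<mm> w)) \<and>
     bij_betw
       (\<lambda>(\<mm>, w). {N \<in> simples_with_sink R G. rmodule_iso (leavitt R G) N (reduced_sink_module R G \<mm> w)})
       ({\<mm>. maximalideal \<mm> R} \<times> {w. is_sink G w})
       (simples_with_sink R G // iso_rel (leavitt R G) (simples_with_sink R G)) \<and>
     (\<forall>M :: (('v, 'e, 'k) leavitt, 'm) rmodule.
        simple_right_module (leavitt R G) M \<and> (\<forall>w. is_sink G w \<longrightarrow> w \<notin> support R G M) \<longrightarrow>
        (\<exists>!C. C \<in> cycles G \<and> G \<restriction> support R G M = G \<restriction> predecessors G (base C)) \<and>
        (\<forall>C. C \<in> cycles G \<and> G \<restriction> support R G M = G \<restriction> predecessors G (base C) \<longrightarrow>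
           (\<exists>!\<mm>. maximalideal \<mm> (laurent R) \<and>
              rmodule_iso (leavitt R G) M (cycle_module R G \<mm> C (base C))))) \<and>
     (\<forall>\<mm> C. maximalideal \<mm> (laurent R) \<and> C \<in> cycles G \<longrightarrow>
        simple_right_module (leavitt R G) (cycle_module R G \<mm> C (base C))) \<and>
     bij_betw
       (\<lambda>(\<mm>, C). {N \<in> simples_without_sink R G.
          rmodule_iso (leavitt R G) N (cycle_module R G \<mm> C (base C))})
       ({\<mm>. maximalideal \<mm> (laurent R)} \<times> cycles G)
       (simples_without_sink R G // iso_rel (leavitt R G) (simples_without_sink R G))"
proof -
  interpret leavitt_algebra R G by (intro leavitt_algebra.intro assms(1,2))
  have restr: "G \<restriction> A = G \<restriction> B \<longleftrightarrow> A = B" for A B :: "'v set"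
    by (metis induce_subgraph_verts)
  show ?thesis
    unfolding restr
  proof (intro conjI)
    show "\<forall>(M :: (('v, 'e, 'k) leavitt, 'm) rmodule) w.
        simple_right_module (leavitt R G) M \<and> is_sink G w \<and> w \<in> support R G M \<longrightarrow>
        support R G M = predecessors G w \<and>
        (\<exists>\<mm>. maximalideal \<mm> R \<and>
           rmodule_iso (leavitt R G) M
             (quotient_module (sink_module R G w) (ideal_sink_module R G \<mm> w)) \<and>
           rmodule_iso (leavitt R G)
             (quotient_module (sink_module R G w) (ideal_sink_module R G \<mm> w))
             (reduced_sink_module R G \<mm> w) \<and>
           (\<forall>\<nn>. maximalideal \<nn> R \<and>
              (rmodule_iso (leavitt R G) M
                 (quotient_module (sink_module R G w) (ideal_sink_module R G \<nn> w)) \<or>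
               rmodule_iso (leavitt R G) M (reduced_sink_module R G \<nn> w)) \<longrightarrow> \<nn> = \<mm>))"
      (is "\<forall>M w. ?A M w \<longrightarrow> ?P M w")
    proof (intro allI impI)
      fix M :: "(('v, 'e, 'k) leavitt, 'm) rmodule" and w
      assume "simple_right_module (leavitt R G) M \<and> is_sink G w \<and> w \<in> support R G M"
      then have M: "simple_right_module (leavitt R G) M" "is_sink G w" "w \<in> support R G M" by blast+
      show "?P M w" by (rule conjI[OF sink_classification[OF M]])
    qed
    show "\<forall>\<mm> w. maximalideal \<mm> R \<and> is_sink G w \<longrightarrow>
        simple_right_module (leavitt R G) (reduced_sink_module R G \<mm> w)"
      using reduced_sink_simple(1) by blast
    show "\<forall>M :: (('v, 'e, 'k) leavitt, 'm) rmodule.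
        simple_right_module (leavitt R G) M \<and> (\<forall>w. is_sink G w \<longrightarrow> w \<notin> support R G M) \<longrightarrow>
        (\<exists>!C. C \<in> cycles G \<and> support R G M = predecessors G (base C)) \<and>
        (\<forall>C. C \<in> cycles G \<and> support R G M = predecessors G (base C) \<longrightarrow>
           (\<exists>!\<mm>. maximalideal \<mm> (laurent R) \<and>
              rmodule_iso (leavitt R G) M (cycle_module R G \<mm> C (base C))))"
      (is "\<forall>M. ?A M \<longrightarrow> ?P M")
    proof (intro allI impI)
      fix M :: "(('v, 'e, 'k) leavitt, 'm) rmodule"
      assume "simple_right_module (leavitt R G) M \<and> (\<forall>w. is_sink G w \<longrightarrow> w \<notin> support R G M)"
      then have M: "simple_right_module (leavitt R G) M" "\<And>w. is_sink G w \<Longrightarrow> w \<notin> support R G M" by blast+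
      note c = cycle_classification[OF assms(3,4) M]
      show "?P M"
      proof (rule conjI)
        show "\<exists>!C. C \<in> cycles G \<and> support R G M = predecessors G (base C)" by (rule c(1))
        show "\<forall>C. C \<in> cycles G \<and> support R G M = predecessors G (base C) \<longrightarrow>
            (\<exists>!\<mm>. maximalideal \<mm> (laurent R) \<and> rmodule_iso (leavitt R G) M (cycle_module R G \<mm> C (base C)))"
          by (intro allI impI) (rule c(2), simp_all)
      qed
    qed
    show "\<forall>\<mm> C. maximalideal \<mm> (laurent R) \<and> C \<in> cycles G \<longrightarrow>
        simple_right_module (leavitt R G) (cycle_module R G \<mm> C (base C))"
      using cycle_module_facts(4)[OF assms(3)] assms(4) by blast
  qed (rule sink_correspondence cycle_correspondence[OF assms(3,4)], assumption?)+
qed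

end
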